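(* Let $\mathcal A$ be a bridge-addable class of graphs with a growth constant, and let $\rho=\rho_{\mathcal A}$. Let $\mathcal C$ be a non-empty class of connected graphs such that every $H\in\mathcal C$ is bridge-deletable in $\mathcal A$, weakly attachable to $\mathcal A$, and weakly detachable from $\mathcal A$. Let $C(x)=\sum_{n\ge1}|\mathcal C_n|x^n/n!$. Then $0<C(\rho)\le\tfrac12$, and for $R_n\in_u\mathcal A$, $\operatorname{Frag}(R_n,\mathcal C)$ converges in total variation to $\mathrm{BP}(\mathcal C,\rho)$ as $n\to\infty$.
   Context: A class of graphs is a set of graphs closed under isomorphism; $\mathcal A_n$ is the set of graphs in $\mathcal A$ on vertex set $[n]$; $\rho_{\mathcal A}=\big(\limsup_n(|\mathcal A_n|/n!)^{1/n}\big)^{-1}$; $\mathcal A$ has a growth constant if $(|\mathcal A_n|/n!)^{1/n}\to\gamma\in(0,\infty)$, in which case $\rho_{\mathcal A}=1/\gamma$. $R_n\in_u\mathcal A$ means $R_n$ is uniform on $\mathcal A_n$. $\mathcal A$ is bridge-addable if for every $G\in\mathcal A$ and vertices $u,v$ in distinct components of $G$, $G+uv\in\mathcal A$. A connected graph $H$ is bridge-deletable in $\mathcal A$ if for each $G\in\mathcal A$ with a bridge $e$ such that at least one of the two new components of $G-e$ is isomorphic to $H$, $G-e\in\mathcal A$. Pendant appearances, weak attachability and weak detachability: for $H$ with root $r$ (forming $H^{\bullet}$), $G$ has a pendant appearance of $H^{\bullet}$ on a $v(H)$-set $W$ if exactly one edge $wx$ joins $W$ to $V(G)\setminus W$ ($w\in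 W$) and some isomorphism $\phi:H\to G[W]$ has $\phi(r)=w$. Attaching a pendant copy of $H^{\bullet}$ means adding a disjoint copy of $H$ and an edge from its root to a vertex of $G$; detaching means deleting the vertex set of a pendant appearance. $H$ is weakly attachable to (resp. weakly detachable from) $\mathcal A$ if for every choice of root there exist $\delta>0$ and a set $\mathcal B$ of graphs with $\rho_{\mathcal B}=\rho_{\mathcal A}$ such that for all large $n$ and all $G\in\mathcal A_n$, every graph formed from $G$ by simultaneously attaching (resp. detaching) at most $\delta n$ pendant copies of $H^{\bullet}$ is in $\mathcal B$. The fragment $\operatorname{Frag}(G)$ is the unlabelled graph obtained from $G$ by deleting a largest component (ties broken in some way); $\operatorname{Frag}(G,\mathcal C)$ is the unlabelled graph formed by the components of $\operatorname{Frag}(G)$ that lie in $\mathcal C$. Boltzmann Poisson random graph: let $\mathcal F$ be the class of graphs all of whose components are in $\mathcal C$, $\widetilde{\mathcal F}$ the set of unlabelled graphs in $\mathcal F$ including the empty graph, $\mu(G)=\rho^{v(G)}/\operatorname{aut}G$ (with $\mu(\emptyset)=1$); if $C(\rho)<\infty$, $\mathrm{BP}(\mathcal C,\rho)$ is the random element $R$ of $\widetilde{\mathcal F}$ with $\mathbb P(R=G)=e^{-C(\rho)}\mu(G)$. Random elements $X_n$ of a countable set converge in total variation to $Y$ if $\sup_A|\mathbb P(X_n\in A)-\mathbb P(Y\in A)|\to0$.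
   Formalization: In weak attachability and weak detachability the auxiliary set B of graphs is required to be closed under isomorphism; for arbitrary labelled sets B the claim fails (planar graphs of minimum degree at least 2 with C consisting of the one-vertex graph). *)

theory Defs
  imports "HOL-Analysis.Analysis" "HOL-Library.FuncSet"
begin

type_synonym graph = "nat set \<times> nat set set"

definition verts :: "graph \<Rightarrow> nat set" where "verts G = fst G"
definition edges :: "graph \<Rightarrow> nat set set" where "edges G = snd G"

definition wf_graph :: "graph \<Rightarrow> bool" where
  "wf_graph G \<longleftrightarrow> finite (verts G) \<and>
     (\<forall>e\<in>edges G. \<exists>u v. e = {u, v} \<and> u \<noteq> v \<and> u \<in> verts G \<and> v \<in> verts G)"

definition graph_iso :: "(nat \<Rightarrow> nat) \<Rightarrow> graph \<Rightarrow> graph \<Rightarrow> bool" where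
  "graph_iso f G H \<longleftrightarrow> bij_betw f (verts G) (verts H) \<and>
     (\<forall>u\<in>verts G. \<forall>v\<in>verts G. {u, v} \<in> edges G \<longleftrightarrow> {f u, f v} \<in> edges H)"

definition isomorphic :: "graph \<Rightarrow> graph \<Rightarrow> bool" where
  "isomorphic G H \<longleftrightarrow> (\<exists>f. graph_iso f G H)"

definition graph_class :: "graph set \<Rightarrow> bool" where
  "graph_class \<A> \<longleftrightarrow> (\<forall>G\<in>\<A>. wf_graph G) \<and>
     (\<forall>G H. G \<in> \<A> \<and> wf_graph H \<and> isomorphic G H \<longrightarrow> H \<in> \<A>)"

definition graphs_on :: "graph set \<Rightarrow> nat \<Rightarrow> graph set" where
  "graphs_on \<A> n = {G \<in> \<A>. verts G = {1..n}}"

definition rho_class :: "graph set \<Rightarrow> ereal" where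
  "rho_class \<A> = inverse (limsup (\<lambda>n. ereal (root n (real (card (graphs_on \<A> n)) / fact n))))"

definition has_growth_constant :: "graph set \<Rightarrow> real \<Rightarrow> bool" where
  "has_growth_constant \<A> \<gamma> \<longleftrightarrow> 0 < \<gamma> \<and>
     (\<lambda>n. root n (real (card (graphs_on \<A> n)) / fact n)) \<longlonglongrightarrow> \<gamma>"

definition adjacent :: "graph \<Rightarrow> nat \<Rightarrow> nat \<Rightarrow> bool" where
  "adjacent G u v \<longleftrightarrow> {u, v} \<in> edges G"

definition reach :: "graph \<Rightarrow> nat \<Rightarrow> nat \<Rightarrow> bool" where
  "reach G = (adjacent G)\<^sup>*\<^sup>*"

definition component_of :: "graph \<Rightarrow> nat \<Rightarrow> nat set" where
  "component_of G v = {u \<in> verts G. reach G v u}"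

definition components :: "graph \<Rightarrow> nat set set" where
  "components G = component_of G ` verts G"

definition connected_graph :: "graph \<Rightarrow> bool" where
  "connected_graph G \<longleftrightarrow> verts G \<noteq> {} \<and> (\<forall>u\<in>verts G. \<forall>v\<in>verts G. reach G u v)"

definition induced :: "graph \<Rightarrow> nat set \<Rightarrow> graph" where
  "induced G W = (W, {e \<in> edges G. e \<subseteq> W})"

definition delete_edge :: "graph \<Rightarrow> nat set \<Rightarrow> graph" where
  "delete_edge G e = (verts G, edges G - {e})"

definition bridge_addable :: "graph set \<Rightarrow> bool" where
  "bridge_addable \<A> \<longleftrightarrow> (\<forall>G\<in>\<A>. \<forall>u\<in>verts G. \<forall>v\<in>verts G.
      \<not> reach G u v \<longrightarrow> (verts G, insert {u, v} (edges G)) \<in> \<A>)"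

definition bridge_deletable :: "graph \<Rightarrow> graph set \<Rightarrow> bool" where
  "bridge_deletable H \<A> \<longleftrightarrow> (\<forall>G\<in>\<A>. \<forall>u v.
      (let G' = delete_edge G {u, v} in
        {u, v} \<in> edges G \<and> \<not> reach G' u v \<and>
        (isomorphic (induced G' (component_of G' u)) H \<or>
         isomorphic (induced G' (component_of G' v)) H)
        \<longrightarrow> G' \<in> \<A>))"

definition pendant_appearance :: "graph \<Rightarrow> nat \<Rightarrow> graph \<Rightarrow> nat set \<Rightarrow> bool" where
  "pendant_appearance H r G W \<longleftrightarrow> W \<subseteq> verts G \<and>
     (\<exists>w x. w \<in> W \<and> x \<in> verts G - W \<and>
        {e \<in> edges G. e \<inter> W \<noteq> {} \<and> \<not> e \<subseteq> W} = {{w, x}} \<and>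
        (\<exists>\<phi>. graph_iso \<phi> H (induced G W) \<and> \<phi> r = w))"

definition attach_pendant :: "graph \<Rightarrow> nat \<Rightarrow> graph \<Rightarrow> nat \<Rightarrow> graph \<Rightarrow> bool" where
  "attach_pendant H r G k G' \<longleftrightarrow> (\<exists>Hc \<phi> x.
     (\<forall>i<k. wf_graph (Hc i) \<and> graph_iso (\<phi> i) H (Hc i) \<and> x i \<in> verts G \<and>
            verts (Hc i) \<inter> verts G = {}) \<and>
     (\<forall>i<k. \<forall>j<k. i \<noteq> j \<longrightarrow> verts (Hc i) \<inter> verts (Hc j) = {}) \<and>
     G' = (verts G \<union> (\<Union>i<k. verts (Hc i)),
           edges G \<union> (\<Union>i<k. edges (Hc i)) \<union> {{\<phi> i r, x i} | i. i < k}))"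

definition detach_pendant :: "graph \<Rightarrow> nat \<Rightarrow> graph \<Rightarrow> nat \<Rightarrow> graph \<Rightarrow> bool" where
  "detach_pendant H r G k G' \<longleftrightarrow> (\<exists>W.
     (\<forall>i<k. pendant_appearance H r G (W i)) \<and>
     (\<forall>i<k. \<forall>j<k. i \<noteq> j \<longrightarrow> W i \<inter> W j = {}) \<and>
     G' = induced G (verts G - (\<Union>i<k. W i)))"

definition weakly_attachable :: "graph \<Rightarrow> graph set \<Rightarrow> bool" where
  "weakly_attachable H \<A> \<longleftrightarrow> (\<forall>r\<in>verts H. \<exists>\<delta>::real. \<delta> > 0 \<and> (\<exists>\<B>. graph_class \<B> \<and>
      rho_class \<B> = rho_class \<A> \<and>
      (\<forall>\<^sub>F n in sequentially. \<forall>G\<in>graphs_on \<A> n. \<forall>k G'.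
          real k \<le> \<delta> * real n \<and> attach_pendant H r G k G' \<longrightarrow> G' \<in> \<B>)))"

definition weakly_detachable :: "graph \<Rightarrow> graph set \<Rightarrow> bool" where
  "weakly_detachable H \<A> \<longleftrightarrow> (\<forall>r\<in>verts H. \<exists>\<delta>::real. \<delta> > 0 \<and> (\<exists>\<B>. graph_class \<B> \<and>
      rho_class \<B> = rho_class \<A> \<and>
      (\<forall>\<^sub>F n in sequentially. \<forall>G\<in>graphs_on \<A> n. \<forall>k G'.
          real k \<le> \<delta> * real n \<and> detach_pendant H r G k G' \<longrightarrow> G' \<in> \<B>)))"

text \<open>Unlabelled graphs are represented by isomorphism classes.\<close>
definition iso_class :: "graph \<Rightarrow> graph set" where
  "iso_class G = {H. wf_graph H \<and> isomorphic G H}"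

definition is_largest_component_choice :: "(graph \<Rightarrow> nat set) \<Rightarrow> bool" where
  "is_largest_component_choice lc \<longleftrightarrow> (\<forall>G. wf_graph G \<and> verts G \<noteq> {} \<longrightarrow>
      lc G \<in> components G \<and> (\<forall>K\<in>components G. card K \<le> card (lc G)))"

definition frag_C :: "(graph \<Rightarrow> nat set) \<Rightarrow> graph set \<Rightarrow> graph \<Rightarrow> graph set" where
  "frag_C lc \<C> G = iso_class (induced G
      (\<Union>{K \<in> components G. K \<noteq> lc G \<and> induced G K \<in> \<C>}))"

definition rep :: "graph set \<Rightarrow> graph" where
  "rep U = (SOME G. G \<in> U)"

definition aut_count :: "graph \<Rightarrow> nat" where
  "aut_count G = card {f \<in> verts G \<rightarrow>\<^sub>E verts G. graph_iso f G G}"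

definition mu :: "real \<Rightarrow> graph set \<Rightarrow> real" where
  "mu \<rho> U = \<rho> ^ card (verts (rep U)) / real (aut_count (rep U))"

text \<open>The unlabelled graphs all of whose components are in C (including the empty graph).\<close>
definition unlabelled_F :: "graph set \<Rightarrow> graph set set" where
  "unlabelled_F \<C> = {iso_class G | G. wf_graph G \<and> (\<forall>K\<in>components G. induced G K \<in> \<C>)}"

definition egf :: "graph set \<Rightarrow> real \<Rightarrow> ennreal" where
  "egf \<C> x = (\<Sum>n. ennreal (real (card (graphs_on \<C> (Suc n))) * x ^ Suc n / fact (Suc n)))"

definition bp_prob :: "graph set \<Rightarrow> real \<Rightarrow> graph set set \<Rightarrow> real" where
  "bp_prob \<C> \<rho> S = exp (- enn2real (egf \<C> \<rho>)) * infsum (mu \<rho>) (S \<inter> unlabelled_F \<C>)"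

definition frag_prob :: "graph set \<Rightarrow> (graph \<Rightarrow> nat set) \<Rightarrow> graph set \<Rightarrow> nat \<Rightarrow> graph set set \<Rightarrow> real" where
  "frag_prob \<A> lc \<C> n S =
     real (card {G \<in> graphs_on \<A> n. frag_C lc \<C> G \<in> S}) / real (card (graphs_on \<A> n))"

end

theory Submission
  imports Defs "HOL-Combinatorics.Permutations"
begin

text \<open>Copies of \<open>H\<close> are counted by their embeddings, so that no automorphism counts enter the
estimates.
Attaching or detaching \<open>\<delta>n\<close> pendant copies of a rooted \<open>H\<close> changes the number of graphs by a factor
that is compatible with the growth constant only if the number of pendant embeddings is close to
\<open>\<rho> ^ v(H) n\<close>; all other graphs are exponentially rare. Deleting the bridge of a pendant copy of
\<open>H \<in> \<C>\<close> turns it into a component and adding a bridge reverses this. Weighted by the concentrated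
pendant counts, this switching shows that the expected number of isomorphisms from \<open>F + H\<close> onto the
fragment is asymptotically \<open>\<rho> ^ v(H)\<close> times that from \<open>F\<close>. Hence the probability of each fragment is
asymptotically proportional to \<open>\<mu>\<close>. In a bridge-addable class the expected number of vertices outside
the largest component is at most 2 (a graph on \<open>n\<close> vertices has fewer than \<open>n\<close> bridges), so no mass
escapes, and the exponential formula gives the normalising constant.

For \<open>C(\<rho>) \<le> 1/2\<close>, close \<open>\<C>\<close> under joining two members by a bridge, and let \<open>t\<^sub>n\<close> be the terms of the
generating function of the closure at \<open>\<rho>\<close>. Counting bridges of graphs in the class gives
\<open>S = \<Sum> n t\<^sub>n \<le> 1\<close>, and counting bridges of graphs in the closure gives
\<open>\<Sum>\<^sub>i (i t\<^sub>i) ((n - i) t\<^sub>n\<^sub>-\<^sub>i) \<le> 2 (n - 1) t\<^sub>n\<close>; summing over \<open>n\<close> yields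
\<open>C(\<rho>) \<le> \<Sum> t\<^sub>n \<le> S - S\<^sup>2 / 2 \<le> 1/2\<close>.\<close>

text \<open>The hypotheses compare \<open>\<A>\<close> only with classes of equal radius, so
  counting sees numbers of graphs only up to factors e^(o(n)). The proof wins because linearly many
  copies are moved at once and each contributes a fixed factor below 1. The exceptions become
  exponentially rare, which absorbs the polynomial weights that appear when pendant counts are
  multiplied by numbers of embeddings. There are two switchings. One treats all components alike and
  gives one-sided bounds for expected component counts; the bound 1/2 rests on it. The other moves a
  copy between the fragment and the largest component and is an exact bijection once that component
  has more than half of the vertices, so ties cannot interfere. It leaves one unknown, the
  probability of an empty fragment. Total mass 1 determines it, and here the finiteness of
  C(\<rho>), hence the first claim of the theorem, enters the second.\<close>

section \<open>Reachability and components\<close>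

lemma verts_pair [simp]: "verts (V, E) = V" by (simp add: verts_def)
lemma edges_pair [simp]: "edges (V, E) = E" by (simp add: edges_def)
lemma graph_eqI: "verts G = verts H \<Longrightarrow> edges G = edges H \<Longrightarrow> G = H"
  by (simp add: verts_def edges_def prod_eq_iff)
lemma graph_collapse [simp]: "(verts G, edges G) = G"
  by (simp add: verts_def edges_def)

lemma verts_induced [simp]: "verts (induced G W) = W" by (simp add: induced_def)
lemma edges_induced [simp]: "edges (induced G W) = {e \<in> edges G. e \<subseteq> W}"
  by (simp add: induced_def)
lemma verts_delete_edge [simp]: "verts (delete_edge G e) = verts G" by (simp add: delete_edge_def)
lemma edges_delete_edge [simp]: "edges (delete_edge G e) = edges G - {e}"
  by (simp add: delete_edge_def)

definition add_edge :: "graph \<Rightarrow> nat \<Rightarrow> nat \<Rightarrow> graph" where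
  "add_edge G u v = (verts G, insert {u, v} (edges G))"

lemma verts_add_edge [simp]: "verts (add_edge G u v) = verts G" by (simp add: add_edge_def)
lemma edges_add_edge [simp]: "edges (add_edge G u v) = insert {u, v} (edges G)"
  by (simp add: add_edge_def)

lemma wf_finite: "wf_graph G \<Longrightarrow> finite (verts G)" by (simp add: wf_graph_def)

lemma wf_edgeE:
  assumes "wf_graph G" "e \<in> edges G"
  obtains u v where "e = {u, v}" "u \<noteq> v" "u \<in> verts G" "v \<in> verts G"
  using assms unfolding wf_graph_def by blast

lemma wf_edge_subset: "wf_graph G \<Longrightarrow> e \<in> edges G \<Longrightarrow> e \<subseteq> verts G"
  by (auto elim: wf_edgeE)

lemma wf_edgeD:
  assumes "wf_graph G" "{u, v} \<in> edges G"
  shows "u \<noteq> v" "u \<in> verts G" "v \<in> verts G"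
  using assms unfolding wf_graph_def by (auto simp: doubleton_eq_iff)

lemma wf_finite_edges: "wf_graph G \<Longrightarrow> finite (edges G)"
  by (rule finite_subset[of _ "Pow (verts G)"]) (auto simp: wf_finite dest: wf_edge_subset)

lemma wf_edges_subset_Pow: "wf_graph G \<Longrightarrow> edges G \<subseteq> Pow (verts G)"
  by (auto dest: wf_edge_subset)

lemma wf_graphI:
  assumes "finite (verts G)"
    "\<And>e. e \<in> edges G \<Longrightarrow> \<exists>u v. e = {u, v} \<and> u \<noteq> v \<and> u \<in> verts G \<and> v \<in> verts G"
  shows "wf_graph G"
  using assms by (simp add: wf_graph_def)

lemma wf_induced: "wf_graph G \<Longrightarrow> finite W \<Longrightarrow> wf_graph (induced G W)"
  unfolding wf_graph_def by fastforce

lemma wf_delete_edge: "wf_graph G \<Longrightarrow> wf_graph (delete_edge G e)"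
  unfolding wf_graph_def by auto

lemma wf_add_edge:
  "wf_graph G \<Longrightarrow> u \<in> verts G \<Longrightarrow> v \<in> verts G \<Longrightarrow> u \<noteq> v \<Longrightarrow> wf_graph (add_edge G u v)"
  unfolding wf_graph_def by auto

lemma add_edge_delete_edge: "{u, v} \<in> edges G \<Longrightarrow> add_edge (delete_edge G {u, v}) u v = G"
  by (rule graph_eqI) auto

lemma delete_edge_add_edge: "{u, v} \<notin> edges G \<Longrightarrow> delete_edge (add_edge G u v) {u, v} = G"
  by (rule graph_eqI) auto

lemma reach_refl [simp]: "reach G u u" by (simp add: reach_def)

lemma reach_edge: "{u, v} \<in> edges G \<Longrightarrow> reach G u v"
  by (auto simp: reach_def adjacent_def)

lemma reach_trans: "reach G u v \<Longrightarrow> reach G v w \<Longrightarrow> reach G u w"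
  by (simp add: reach_def)

lemma adjacent_sym: "adjacent G u v \<longleftrightarrow> adjacent G v u"
  by (simp add: adjacent_def insert_commute)

lemma reach_sym: "reach G u v \<Longrightarrow> reach G v u"
  unfolding reach_def
proof (induction rule: rtranclp_induct)
  case (step y z)
  then show ?case by (meson adjacent_sym converse_rtranclp_into_rtranclp)
qed auto

lemma reach_mono:
  assumes "edges G \<subseteq> edges H" "reach G u v" shows "reach H u v"
proof -
  have "adjacent G \<le> adjacent H" using assms(1) by (auto simp: adjacent_def)
  then show ?thesis using assms(2) unfolding reach_def using rtranclp_mono by blast
qed

text \<open>In a well-formed graph these are the unions of components. Images of embeddings and
  fragments are such unions, so closedness is kept apart from connectedness.\<close>

definition closed_set :: "graph \<Rightarrow> nat set \<Rightarrow> bool" where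
  "closed_set G W \<longleftrightarrow> W \<subseteq> verts G \<and> (\<forall>e\<in>edges G. e \<inter> W \<noteq> {} \<longrightarrow> e \<subseteq> W)"

lemma closed_set_reach:
  assumes "closed_set G W" "reach G u v" "u \<in> W" shows "v \<in> W"
  using assms(2,3) unfolding reach_def
proof (induction rule: rtranclp_induct)
  case (step y z)
  then show ?case using assms(1) by (force simp: closed_set_def adjacent_def)
qed auto

lemma closed_set_verts: "wf_graph G \<Longrightarrow> closed_set G (verts G)"
  by (auto simp: closed_set_def dest: wf_edge_subset)

lemma closed_set_Diff: "wf_graph G \<Longrightarrow> closed_set G W \<Longrightarrow> closed_set G (verts G - W)"
  unfolding closed_set_def by (auto dest: wf_edge_subset)

lemma closed_set_Union: "(\<And>W. W \<in> \<W> \<Longrightarrow> closed_set G W) \<Longrightarrow> closed_set G (\<Union>\<W>)"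
  unfolding closed_set_def by blast

lemma component_of_self: "v \<in> verts G \<Longrightarrow> v \<in> component_of G v"
  by (simp add: component_of_def)

lemma component_of_subset: "component_of G v \<subseteq> verts G"
  by (auto simp: component_of_def)

lemma component_of_eq: "reach G u v \<Longrightarrow> component_of G u = component_of G v"
  using reach_trans[of G u v] reach_trans[OF reach_sym[of G u v]] by (auto simp: component_of_def)

lemma closed_component_of: "wf_graph G \<Longrightarrow> closed_set G (component_of G v)"
  unfolding closed_set_def component_of_def
proof (intro conjI ballI impI)
  fix e assume wf: "wf_graph G" and e: "e \<in> edges G" "e \<inter> {u \<in> verts G. reach G v u} \<noteq> {}"
  obtain a b where ab: "e = {a, b}" "a \<in> verts G" "b \<in> verts G" using wf_edgeE[OF wf e(1)] by metis
  have "reach G a b" "reach G b a" using e ab by (auto intro: reach_edge simp: insert_commute)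
  then show "e \<subseteq> {u \<in> verts G. reach G v u}" using e ab by (auto intro: reach_trans)
qed auto

text \<open>Walks may leave \<open>W\<close> here. From a closed \<open>W\<close> they cannot, so
  closed and \<open>conn_set\<close> together mean being a component.\<close>

definition conn_set :: "graph \<Rightarrow> nat set \<Rightarrow> bool" where
  "conn_set G W \<longleftrightarrow> W \<noteq> {} \<and> (\<forall>u\<in>W. \<forall>v\<in>W. reach G u v)"

lemma component_eq_component_of:
  "K \<in> components G \<Longrightarrow> v \<in> K \<Longrightarrow> K = component_of G v"
proof -
  assume "K \<in> components G" "v \<in> K"
  then obtain w where w: "K = component_of G w" "reach G w v"
    by (auto simp: components_def component_of_def)
  then show ?thesis using component_of_eq by blast
qed

lemma components_iff:
  assumes "wf_graph G"
  shows "K \<in> components G \<longleftrightarrow> closed_set G K \<and> conn_set G K"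
proof
  assume "K \<in> components G"
  then obtain v where v: "v \<in> verts G" "K = component_of G v" by (auto simp: components_def)
  have "conn_set G K" unfolding conn_set_def
  proof (intro conjI ballI)
    show "K \<noteq> {}" using v component_of_self by blast
    fix a b assume "a \<in> K" "b \<in> K"
    then have "reach G v a" "reach G v b" using v by (auto simp: component_of_def)
    then show "reach G a b" using reach_sym reach_trans by blast
  qed
  then show "closed_set G K \<and> conn_set G K" using v closed_component_of[OF assms] by simp
next
  assume a: "closed_set G K \<and> conn_set G K"
  then obtain v where v: "v \<in> K" by (auto simp: conn_set_def)
  have "K = component_of G v"
    using closed_set_reach[of G K v] a v unfolding component_of_def conn_set_def closed_set_def by blast
  moreover have "v \<in> verts G" using a v by (auto simp: closed_set_def)
  ultimately show "K \<in> components G" by (auto simp: components_def)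
qed

lemma component_of_in_components: "v \<in> verts G \<Longrightarrow> component_of G v \<in> components G"
  by (simp add: components_def)

lemma components_disjoint:
  "K \<in> components G \<Longrightarrow> L \<in> components G \<Longrightarrow> K \<noteq> L \<Longrightarrow> K \<inter> L = {}"
  using component_eq_component_of by blast

lemma Union_components: "\<Union>(components G) = verts G"
  by (auto simp: components_def component_of_def)

lemma components_subset: "K \<in> components G \<Longrightarrow> K \<subseteq> verts G"
  using Union_components by blast

lemma components_nonempty: "K \<in> components G \<Longrightarrow> K \<noteq> {}"
  by (auto simp: components_def component_of_def)

lemma finite_components: "wf_graph G \<Longrightarrow> finite (components G)"
  by (simp add: components_def wf_finite)

lemma components_reach: "K \<in> components G \<Longrightarrow> u \<in> K \<Longrightarrow> v \<in> K \<Longrightarrow> reach G u v"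
  using component_eq_component_of[of K G u] by (auto simp: component_of_def)

lemma components_not_reach:
  "K \<in> components G \<Longrightarrow> L \<in> components G \<Longrightarrow> K \<noteq> L \<Longrightarrow> u \<in> K \<Longrightarrow> v \<in> L \<Longrightarrow> \<not> reach G u v"
  using component_eq_component_of[of K G u] component_eq_component_of[of L G v] component_of_eq[of G u v]
  by blast

text \<open>Closed connected sets are components already; if they cover the vertices, the
  disjointness of components leaves room for no others.\<close>

lemma components_eqI:
  assumes "wf_graph G" "\<And>K. K \<in> \<M> \<Longrightarrow> closed_set G K \<and> conn_set G K" "verts G \<subseteq> \<Union>\<M>"
  shows "components G = \<M>"
proof
  show M: "\<M> \<subseteq> components G" using assms(2) components_iff[OF assms(1)] by blast
  show "components G \<subseteq> \<M>"
  proof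
    fix K assume K: "K \<in> components G"
    then obtain v where v: "v \<in> K" using components_nonempty by blast
    then obtain L where L: "L \<in> \<M>" "v \<in> L" using assms(3) components_subset[OF K] by blast
    then have "L \<in> components G" using M by blast
    then show "K \<in> \<M>" using components_disjoint[OF K, of L] v L by blast
  qed
qed

lemma reach_induced:
  assumes "closed_set G W" "u \<in> W"
  shows "reach (induced G W) u v \<longleftrightarrow> reach G u v"
proof
  show "reach (induced G W) u v \<Longrightarrow> reach G u v" by (rule reach_mono) auto
  assume "reach G u v"
  then show "reach (induced G W) u v" unfolding reach_def
  proof (induction rule: rtranclp_induct)
    case (step y z)
    have "y \<in> W" using step(1) assms closed_set_reach by (simp add: reach_def)
    then have "adjacent (induced G W) y z" using step(2) assms(1) by (auto simp: adjacent_def closed_set_def)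
    then show ?case using step.IH by simp
  qed auto
qed

lemma components_induced:
  assumes "closed_set G W"
  shows "components (induced G W) = {K \<in> components G. K \<subseteq> W}"
proof -
  have *: "component_of (induced G W) v = component_of G v" if "v \<in> W" for v
    using assms that closed_set_reach[OF assms _ that]
    by (auto simp: component_of_def reach_induced closed_set_def)
  have "component_of G v \<subseteq> W" if "v \<in> W" for v
    using closed_set_reach[OF assms _ that] by (auto simp: component_of_def)
  moreover have "K \<in> component_of G ` W" if K: "K \<subseteq> W" "K \<in> components G" for K
  proof -
    obtain v where v: "v \<in> K" using components_nonempty[OF K(2)] by blast
    then show ?thesis using component_eq_component_of[OF K(2) v] K(1) by blast
  qed
  moreover have "component_of G v \<in> components G" if "v \<in> W" for v
    using assms that by (auto simp: closed_set_def components_def)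
  ultimately have "component_of G ` W = {K \<in> components G. K \<subseteq> W}" by (auto simp del: split_paired_All)
  moreover have "components (induced G W) = component_of G ` W"
    using * by (simp add: components_def)
  ultimately show ?thesis by simp
qed

lemma connected_induced_component: "wf_graph G \<Longrightarrow> K \<in> components G \<Longrightarrow> connected_graph (induced G K)"
  unfolding connected_graph_def verts_induced
  by (metis components_iff components_nonempty components_reach reach_induced)

lemma connected_induced_conn_set: "connected_graph (induced G W) \<Longrightarrow> conn_set G W"
  unfolding connected_graph_def conn_set_def verts_induced
  using reach_mono[of "induced G W" G] by simp

text \<open>Without a crossing edge \<open>A \<inter> W\<close> would be closed in the induced graph
  and trap every walk from \<open>a\<close>.\<close>

lemma connected_crossing_edge:
  assumes "connected_graph (induced G W)" "a \<in> W" "a \<in> A" "b \<in> W" "b \<notin> A"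
  shows "\<exists>e\<in>edges G. e \<subseteq> W \<and> e \<inter> A \<noteq> {} \<and> \<not> e \<subseteq> A"
proof (rule ccontr)
  assume no: "\<not> ?thesis"
  have "closed_set (induced G W) (A \<inter> W)" using no by (auto simp: closed_set_def)
  moreover have "reach (induced G W) a b" using assms by (auto simp: connected_graph_def)
  ultimately show False using closed_set_reach assms by blast
qed

lemma connected_graph_components: "wf_graph G \<Longrightarrow> connected_graph G \<Longrightarrow> components G = {verts G}"
  by (rule components_eqI) (auto simp: closed_set_verts conn_set_def connected_graph_def)

lemma induced_verts: "wf_graph G \<Longrightarrow> induced G (verts G) = G"
  by (rule graph_eqI) (auto dest: wf_edge_subset)

lemma induced_induced: "B \<subseteq> A \<Longrightarrow> induced (induced G A) B = induced G B"
  by (rule graph_eqI) auto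

lemma components_add_edge:
  assumes wf: "wf_graph G" and KL: "K \<in> components G" "L \<in> components G" "K \<noteq> L"
    and u: "u \<in> K" and x: "x \<in> L"
  shows "components (add_edge G u x) = insert (K \<union> L) (components G - {K, L})"
proof (rule components_eqI)
  let ?G = "add_edge G u x"
  have vs: "u \<in> verts G" "x \<in> verts G" "u \<noteq> x"
    using assms components_subset components_disjoint by blast+
  then show "wf_graph ?G" by (rule wf_add_edge[OF wf])
  have mono: "reach G a b \<Longrightarrow> reach ?G a b" for a b by (rule reach_mono) auto
  show "verts ?G \<subseteq> \<Union> (insert (K \<union> L) (components G - {K, L}))"
    using Union_components[of G] by auto
  fix M assume "M \<in> insert (K \<union> L) (components G - {K, L})"
  then consider "M = K \<union> L" | "M \<in> components G" "M \<noteq> K" "M \<noteq> L" by blast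
  then show "closed_set ?G M \<and> conn_set ?G M"
  proof cases
    case 1
    have 2: "closed_set G K" "closed_set G L" using KL components_iff[OF wf] by auto
    then have "closed_set ?G M" using 1 u x by (auto simp: closed_set_def) 
    moreover have r: "reach ?G u x" by (rule reach_edge) auto
    have "reach ?G u a" if "a \<in> M" for a
      using that mono components_reach[OF KL(1) u] components_reach[OF KL(2) x] reach_trans[OF r] 1 by blast
    then have "conn_set ?G M" using 1 u unfolding conn_set_def by (blast intro: reach_trans reach_sym)
    ultimately show ?thesis by simp
  next
    case 2
    have "u \<notin> M" "x \<notin> M" using 2 KL u x components_disjoint by blast+
    then have "closed_set ?G M" using 2 components_iff[OF wf] by (auto simp: closed_set_def)
    then show ?thesis using 2 mono components_iff[OF wf] by (auto simp: conn_set_def)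
  qed
qed

section \<open>Bridges\<close>

definition bridges :: "graph \<Rightarrow> nat set set" where
  "bridges G = {e \<in> edges G. \<exists>u v. e = {u, v} \<and> \<not> reach (delete_edge G e) u v}"

text \<open>Bridges are removed one at a time. A bridge of \<open>G\<close> remains one after other
  edges are gone, because reachability is monotone in the edge set, so each removal splits a
  component.\<close>

lemma card_components_delete_bridges:
  assumes "wf_graph G" "finite D" "D \<subseteq> bridges G"
  shows "card (components G) + card D \<le> card (components (verts G, edges G - D))"
  using assms(2,3)
proof (induction D rule: finite_induct)
  case empty
  then show ?case by simp
next
  case (insert e D)
  let ?G1 = "(verts G, edges G - D)" and ?G2 = "(verts G, edges G - insert e D)"
  have wf1: "wf_graph ?G1" and wf2: "wf_graph ?G2" using assms(1) unfolding wf_graph_def by auto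
  obtain u v where e: "e = {u, v}" "e \<in> edges G" "\<not> reach (delete_edge G e) u v"
    using insert.prems by (auto simp: bridges_def)
  have uv: "u \<in> verts G" "v \<in> verts G" using wf_edgeD assms(1) e by blast+
  have nr: "\<not> reach ?G2 u v"
    using e(3) reach_mono[of ?G2 "delete_edge G e" u v] by auto
  have "add_edge ?G2 u v = ?G1" by (rule graph_eqI) (use e insert.hyps in auto)
  moreover have ne: "component_of ?G2 u \<noteq> component_of ?G2 v"
  proof
    assume "component_of ?G2 u = component_of ?G2 v"
    then have "v \<in> component_of ?G2 u" using component_of_self[of v ?G2] uv by simp
    then show False using nr by (simp add: component_of_def)
  qed
  ultimately have "components ?G1 = insert (component_of ?G2 u \<union> component_of ?G2 v)
      (components ?G2 - {component_of ?G2 u, component_of ?G2 v})"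
    using components_add_edge[OF wf2, of "component_of ?G2 u" "component_of ?G2 v" u v] uv
    by (simp add: component_of_in_components component_of_self)
  then have "card (components ?G1) \<le> Suc (card (components ?G2 - {component_of ?G2 u, component_of ?G2 v}))"
    by (simp add: card_insert_le_m1 card_insert_if wf2 finite_components)
  also have "\<dots> = Suc (card (components ?G2) - 2)"
    using uv ne by (subst card_Diff_subset) (auto simp: component_of_in_components)
  finally have "card (components ?G1) \<le> Suc (card (components ?G2) - 2)" .
  moreover have "card (components ?G2) \<ge> 2"
  proof -
    have "card {component_of ?G2 u, component_of ?G2 v} = 2" using ne by simp
    moreover have "{component_of ?G2 u, component_of ?G2 v} \<subseteq> components ?G2"
      using uv by (auto simp: component_of_in_components)
    ultimately show ?thesis by (metis card_mono finite_components wf2)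
  qed
  ultimately show ?case using insert by auto
qed

text \<open>Take all bridges away: the number of components is then at least 1 plus the number of
  bridges, and at most the number of vertices.\<close>

lemma card_bridges:
  assumes "wf_graph G" "verts G \<noteq> {}"
  shows "card (bridges G) < card (verts G)"
proof -
  have fin: "finite (bridges G)"
    using wf_finite_edges[OF assms(1)] by (auto simp: bridges_def)
  have "card (components G) \<ge> 1"
    using assms finite_components[OF assms(1)] by (simp add: components_def Suc_le_eq card_gt_0_iff)
  moreover have "card (components (verts G, edges G - bridges G)) \<le> card (verts G)"
    unfolding components_def using card_image_le[OF wf_finite[OF assms(1)]] by simp
  ultimately show ?thesis using card_components_delete_bridges[OF assms(1) fin] by simp
qed

section \<open>Isomorphisms\<close>

text \<open>Turns isomorphism of well-formed graphs into an equation \<open>H = relabel f G\<close>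
  with \<open>f\<close> injective, so that invariance arguments become rewriting.\<close>

definition relabel :: "(nat \<Rightarrow> nat) \<Rightarrow> graph \<Rightarrow> graph" where
  "relabel f G = (f ` verts G, (`) f ` edges G)"

lemma verts_relabel [simp]: "verts (relabel f G) = f ` verts G" by (simp add: relabel_def)
lemma edges_relabel [simp]: "edges (relabel f G) = (`) f ` edges G" by (simp add: relabel_def)

lemma wf_relabel:
  assumes "wf_graph G" "inj_on f (verts G)" shows "wf_graph (relabel f G)"
proof (rule wf_graphI)
  show "finite (verts (relabel f G))" using assms wf_finite by simp
  fix e assume "e \<in> edges (relabel f G)"
  then obtain e' where e': "e = f ` e'" "e' \<in> edges G" by auto
  obtain u v where "e' = {u, v}" "u \<noteq> v" "u \<in> verts G" "v \<in> verts G" using wf_edgeE[OF assms(1) e'(2)] .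
  then show "\<exists>u v. e = {u, v} \<and> u \<noteq> v \<and> u \<in> verts (relabel f G) \<and> v \<in> verts (relabel f G)"
    using assms(2) e' by (intro exI[of _ "f u"] exI[of _ "f v"]) (auto simp: inj_on_eq_iff)
qed

lemma inj_on_image_edge:
  assumes "inj_on f V" "E \<subseteq> Pow V" "e \<subseteq> V"
  shows "f ` e \<in> (`) f ` E \<longleftrightarrow> e \<in> E"
  using assms inj_on_image_eq_iff[OF assms(1)] by (auto simp: image_iff) 

lemma graph_iso_relabel:
  assumes "wf_graph G" "inj_on f (verts G)" shows "graph_iso f G (relabel f G)"
  unfolding graph_iso_def
proof (intro conjI ballI)
  show "bij_betw f (verts G) (verts (relabel f G))" using assms by (simp add: bij_betw_def)
  fix u v assume "u \<in> verts G" "v \<in> verts G"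
  then show "{u, v} \<in> edges G \<longleftrightarrow> {f u, f v} \<in> edges (relabel f G)"
    using inj_on_image_edge[OF assms(2) wf_edges_subset_Pow[OF assms(1)], of "{u, v}"] by simp
qed

text \<open>\<open>graph_iso\<close> tests only pairs of vertices. Well-formedness of both graphs
  guarantees that every edge is such a pair, so the edge sets are determined.\<close>

lemma graph_iso_imp_relabel:
  assumes "wf_graph G" "wf_graph H" "graph_iso f G H"
  shows "inj_on f (verts G)" "H = relabel f G"
proof -
  show inj: "inj_on f (verts G)" using assms by (auto simp: graph_iso_def bij_betw_def)
  show "H = relabel f G"
  proof (rule graph_eqI)
    show v: "verts H = verts (relabel f G)" using assms by (auto simp: graph_iso_def bij_betw_def)
    show "edges H = edges (relabel f G)"
    proof (intro equalityI subsetI)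
      fix e assume e: "e \<in> edges H"
      then obtain a b where ab: "e = {a, b}" "a \<in> verts H" "b \<in> verts H" using wf_edgeE[OF assms(2)] by metis
      then obtain u w where "u \<in> verts G" "w \<in> verts G" "a = f u" "b = f w" using v by auto
      then have "{u, w} \<in> edges G" "e = f ` {u, w}" using assms(3) e ab by (auto simp: graph_iso_def)
      then show "e \<in> edges (relabel f G)" by (metis edges_relabel imageI)
    next
      fix e assume "e \<in> edges (relabel f G)"
      then obtain e' where e': "e = f ` e'" "e' \<in> edges G" by auto
      obtain u w where "e' = {u, w}" "u \<in> verts G" "w \<in> verts G" using wf_edgeE[OF assms(1) e'(2)] by metis
      then show "e \<in> edges H" using assms(3) e' by (auto simp: graph_iso_def)
    qed
  qed
qed

lemma graph_iso_iff:
  "wf_graph G \<Longrightarrow> wf_graph H \<Longrightarrow> graph_iso f G H \<longleftrightarrow> inj_on f (verts G) \<and> H = relabel f G"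
  using graph_iso_imp_relabel graph_iso_relabel by blast

lemma relabel_relabel: "relabel g (relabel f G) = relabel (g \<circ> f) G"
  by (rule graph_eqI) (auto simp: image_comp image_image)

lemma relabel_cong:
  assumes "wf_graph G" "\<And>v. v \<in> verts G \<Longrightarrow> f v = g v" shows "relabel f G = relabel g G"
proof (rule graph_eqI)
  show "verts (relabel f G) = verts (relabel g G)" using assms by (auto intro: image_cong)
  have "f ` e = g ` e" if "e \<in> edges G" for e
    using wf_edge_subset[OF assms(1) that] assms(2) by (intro image_cong) auto
  then show "edges (relabel f G) = edges (relabel g G)" by (auto intro: image_cong)
qed

lemma relabel_id: "relabel id G = G" by (rule graph_eqI) auto

lemma relabel_inv:
  assumes "wf_graph G" "inj_on f (verts G)" "\<And>v. v \<in> verts G \<Longrightarrow> g (f v) = v"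
  shows "relabel g (relabel f G) = G"
  using relabel_cong[OF assms(1), of "g \<circ> f" id] assms(3) by (simp add: relabel_relabel relabel_id)

lemma isomorphic_iff:
  "wf_graph G \<Longrightarrow> wf_graph H \<Longrightarrow> isomorphic G H \<longleftrightarrow> (\<exists>f. inj_on f (verts G) \<and> H = relabel f G)"
  by (simp add: isomorphic_def graph_iso_iff)

lemma isomorphic_relabel: "wf_graph G \<Longrightarrow> inj_on f (verts G) \<Longrightarrow> isomorphic G (relabel f G)"
  using graph_iso_relabel isomorphic_def by blast

lemma isomorphic_refl: "isomorphic G G"
  unfolding isomorphic_def graph_iso_def by (intro exI[of _ id]) auto

lemma isomorphic_sym:
  assumes "wf_graph G" "wf_graph H" "isomorphic G H" shows "isomorphic H G"
proof -
  obtain f where f: "inj_on f (verts G)" "H = relabel f G" using assms isomorphic_iff by blast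
  then have "relabel (inv_into (verts G) f) H = G" using relabel_inv[OF assms(1) f(1)] by simp
  moreover have "inj_on (inv_into (verts G) f) (verts H)" using f by (simp add: inj_on_inv_into)
  ultimately show ?thesis using isomorphic_iff[OF assms(2,1)] by metis
qed

lemma isomorphic_trans:
  assumes "wf_graph G" "wf_graph H" "wf_graph K" "isomorphic G H" "isomorphic H K" shows "isomorphic G K"
proof -
  obtain f g where "inj_on f (verts G)" "H = relabel f G" "inj_on g (verts H)" "K = relabel g H"
    using assms isomorphic_iff by metis
  then have "inj_on (g \<circ> f) (verts G)" "K = relabel (g \<circ> f) G" by (auto simp: relabel_relabel comp_inj_on)
  then show ?thesis using isomorphic_iff assms by blast
qed

lemma graph_class_wf: "graph_class X \<Longrightarrow> G \<in> X \<Longrightarrow> wf_graph G"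
  by (simp add: graph_class_def)

lemma graph_class_relabel: "graph_class X \<Longrightarrow> G \<in> X \<Longrightarrow> inj_on f (verts G) \<Longrightarrow> relabel f G \<in> X"
  unfolding graph_class_def using isomorphic_relabel wf_relabel by blast

lemma reach_relabel: "reach G u v \<Longrightarrow> reach (relabel f G) (f u) (f v)"
  unfolding reach_def
proof (induction rule: rtranclp_induct)
  case (step y z)
  have "f ` {y, z} \<in> edges (relabel f G)" using step(2) unfolding adjacent_def edges_relabel by (rule imageI)
  then have "adjacent (relabel f G) (f y) (f z)" by (simp add: adjacent_def)
  then show ?case using step by simp
qed auto

lemma connected_relabel: "connected_graph G \<Longrightarrow> connected_graph (relabel f G)"
  by (auto simp: connected_graph_def reach_relabel)

lemma reach_relabel_iff:
  assumes "wf_graph G" "inj_on f (verts G)" "u \<in> verts G" "v \<in> verts G"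
  shows "reach (relabel f G) (f u) (f v) \<longleftrightarrow> reach G u v"
  using reach_relabel[of G u v f]
    reach_relabel[of "relabel f G" "f u" "f v" "inv_into (verts G) f"] assms
    relabel_inv[OF assms(1,2), of "inv_into (verts G) f"] by auto

lemma induced_relabel:
  assumes "wf_graph G" "inj_on f (verts G)" "W \<subseteq> verts G"
  shows "induced (relabel f G) (f ` W) = relabel f (induced G W)"
proof (rule graph_eqI)
  have "f ` e \<subseteq> f ` W \<longleftrightarrow> e \<subseteq> W" if "e \<in> edges G" for e
    using wf_edge_subset[OF assms(1) that] assms(2,3) by (simp add: inj_on_image_subset_iff)
  then show "edges (induced (relabel f G) (f ` W)) = edges (relabel f (induced G W))" by auto
qed simp

lemma closed_set_relabel:
  assumes "wf_graph G" "inj_on f (verts G)" "closed_set G W"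
  shows "closed_set (relabel f G) (f ` W)"
  unfolding closed_set_def
proof (intro conjI ballI impI)
  show "f ` W \<subseteq> verts (relabel f G)" using assms by (auto simp: closed_set_def)
  fix e assume e: "e \<in> edges (relabel f G)" "e \<inter> f ` W \<noteq> {}"
  then obtain e' where e': "e = f ` e'" "e' \<in> edges G" by auto
  have "e' \<subseteq> verts G" "W \<subseteq> verts G" using wf_edge_subset assms e' by (auto simp: closed_set_def)
  then have "e' \<inter> W \<noteq> {}" using e(2) e'(1) assms(2) inj_on_image_Int[OF assms(2), of e' W] by auto
  then show "e \<subseteq> f ` W" using assms(3) e' by (auto simp: closed_set_def)
qed

lemma components_relabel:
  assumes "wf_graph G" "inj_on f (verts G)"
  shows "components (relabel f G) = (`) f ` components G"
proof (rule components_eqI)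
  show "wf_graph (relabel f G)" using assms wf_relabel by blast
  show "verts (relabel f G) \<subseteq> \<Union> ((`) f ` components G)" using Union_components[of G] by auto
  fix K assume "K \<in> (`) f ` components G"
  then obtain K' where K': "K = f ` K'" "K' \<in> components G" by auto
  then have "closed_set G K'" "conn_set G K'" using components_iff assms by auto
  then show "closed_set (relabel f G) K \<and> conn_set (relabel f G) K"
    using K' closed_set_relabel[OF assms] by (auto simp: conn_set_def reach_relabel)
qed

text \<open>The isomorphisms, normalised outside the vertex set so that they can be counted.\<close>
definition isos :: "graph \<Rightarrow> graph \<Rightarrow> (nat \<Rightarrow> nat) set" where
  "isos F G = {f \<in> verts F \<rightarrow>\<^sub>E verts G. graph_iso f F G}"

lemma finite_isos: "wf_graph F \<Longrightarrow> wf_graph G \<Longrightarrow> finite (isos F G)"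
  unfolding isos_def by (rule finite_subset[of _ "verts F \<rightarrow>\<^sub>E verts G"]) (auto simp: finite_PiE wf_finite)

lemma aut_count_isos: "aut_count G = card (isos G G)"
  by (simp add: aut_count_def isos_def)

lemma isos_iff:
  assumes "wf_graph F" "wf_graph G"
  shows "f \<in> isos F G \<longleftrightarrow> f \<in> extensional (verts F) \<and> inj_on f (verts F) \<and> G = relabel f F"
  unfolding isos_def using graph_iso_iff[OF assms] by (auto simp: PiE_def extensional_def)

lemma isos_compose:
  assumes "wf_graph F" "wf_graph G" "f \<in> isos F F" "g \<in> isos F G"
  shows "restrict (g \<circ> f) (verts F) \<in> isos F G"
proof -
  have f: "inj_on f (verts F)" "F = relabel f F" and g: "inj_on g (verts F)" "G = relabel g F"
    using assms isos_iff by blast+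
  have fv: "f ` verts F = verts F" using f(2) by (metis verts_relabel)
  have "inj_on (g \<circ> f) (verts F)" using f(1) g(1) fv by (auto intro: comp_inj_on)
  moreover have "relabel (restrict (g \<circ> f) (verts F)) F = relabel (g \<circ> f) F"
    by (rule relabel_cong[OF assms(1)]) auto
  moreover have "relabel (g \<circ> f) F = G" using f(2) g(2) by (metis relabel_relabel)
  ultimately show ?thesis using isos_iff[OF assms(1,2)] by (auto simp: inj_on_restrict_eq)
qed

text \<open>Fix one isomorphism \<open>g\<close>. Composition with \<open>g\<close> maps the
  automorphisms of \<open>F\<close> bijectively onto the isomorphisms from \<open>F\<close> to
  \<open>G\<close>; composition with the inverse of \<open>g\<close> undoes it.\<close>

lemma card_isos:
  assumes wf: "wf_graph F" "wf_graph G" and iso: "isomorphic F G"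
  shows "card (isos F G) = aut_count F"
proof -
  obtain g0 where g0: "inj_on g0 (verts F)" "G = relabel g0 F" using iso isomorphic_iff[OF wf] by blast
  define g where "g = restrict g0 (verts F)"
  have g: "g \<in> isos F G" "inj_on g (verts F)" "g ` verts F = verts G"
    using g0 relabel_cong[OF wf(1), of g g0] unfolding isos_iff[OF wf]
    by (auto simp: g_def inj_on_restrict_eq)
  have "bij_betw (\<lambda>f. restrict (g \<circ> f) (verts F)) (isos F F) (isos F G)"
  proof (rule bij_betw_byWitness[where f' = "\<lambda>f. restrict (inv_into (verts F) g \<circ> f) (verts F)"])
    have im: "f ` verts F = verts F" "f \<in> extensional (verts F)" if "f \<in> isos F F" for f
      using that isos_iff[OF wf(1) wf(1)] by (metis verts_relabel)+
    have im2: "f ` verts F = verts G" "f \<in> extensional (verts F)" if "f \<in> isos F G" for f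
      using that isos_iff[OF wf] by (metis verts_relabel)+
    show "\<forall>f\<in>isos F F. restrict (inv_into (verts F) g \<circ> restrict (g \<circ> f) (verts F)) (verts F) = f"
    proof
      fix f assume f: "f \<in> isos F F"
      show "restrict (inv_into (verts F) g \<circ> restrict (g \<circ> f) (verts F)) (verts F) = f"
      proof (rule extensionalityI[where A = "verts F"])
        fix x assume x: "x \<in> verts F"
        then have "f x \<in> verts F" using im(1)[OF f] by blast
        then show "restrict (inv_into (verts F) g \<circ> restrict (g \<circ> f) (verts F)) (verts F) x = f x"
          using x g(2) by simp
      qed (use im[OF f] in auto)
    qed
    show "\<forall>f\<in>isos F G. restrict (g \<circ> restrict (inv_into (verts F) g \<circ> f) (verts F)) (verts F) = f"
    proof
      fix f assume f: "f \<in> isos F G"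
      show "restrict (g \<circ> restrict (inv_into (verts F) g \<circ> f) (verts F)) (verts F) = f"
      proof (rule extensionalityI[where A = "verts F"])
        fix x assume x: "x \<in> verts F"
        then have "f x \<in> g ` verts F" using im2(1)[OF f] g(3) by blast
        then show "restrict (g \<circ> restrict (inv_into (verts F) g \<circ> f) (verts F)) (verts F) x = f x"
          using x by (simp add: f_inv_into_f)
      qed (use im2[OF f] in auto)
    qed
    show "(\<lambda>f. restrict (g \<circ> f) (verts F)) ` isos F F \<subseteq> isos F G"
      using isos_compose[OF wf _ g(1)] by blast
    show "(\<lambda>f. restrict (inv_into (verts F) g \<circ> f) (verts F)) ` isos F G \<subseteq> isos F F"
    proof safe
      fix f assume f: "f \<in> isos F G"
      have 1: "inj_on (inv_into (verts F) g \<circ> f) (verts F)"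
        using f im2[OF f] g(3) isos_iff[OF wf] by (metis comp_inj_on inj_on_inv_into order_refl)
      have "G = relabel g F" using g(1) isos_iff[OF wf] by blast
      then have "relabel (inv_into (verts F) g) G = F" using relabel_inv[OF wf(1) g(2)] g(2) by simp
      then have "relabel (inv_into (verts F) g \<circ> f) F = F"
        using f isos_iff[OF wf] by (metis relabel_relabel)
      then have "relabel (restrict (inv_into (verts F) g \<circ> f) (verts F)) F = F"
        using relabel_cong[OF wf(1), of "restrict (inv_into (verts F) g \<circ> f) (verts F)" "inv_into (verts F) g \<circ> f"]
        by (simp del: comp_apply)
      then show "restrict (inv_into (verts F) g \<circ> f) (verts F) \<in> isos F F"
        using 1 by (auto simp: isos_iff[OF wf(1) wf(1)] inj_on_restrict_eq)
    qed
  qed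
  then show ?thesis by (simp add: bij_betw_same_card aut_count_isos)
qed

lemma isos_empty_iff: "wf_graph F \<Longrightarrow> wf_graph G \<Longrightarrow> isos F G = {} \<longleftrightarrow> \<not> isomorphic F G"
proof -
  assume wf: "wf_graph F" "wf_graph G"
  have "restrict f (verts F) \<in> isos F G" if "inj_on f (verts F)" "G = relabel f F" for f
    using that relabel_cong[OF wf(1), of "restrict f (verts F)" f] unfolding isos_iff[OF wf] by (simp add: inj_on_restrict_eq)
  moreover have "f \<in> isos F G \<Longrightarrow> isomorphic F G" for f by (auto simp: isos_def isomorphic_def)
  ultimately show ?thesis using isomorphic_iff[OF wf] by blast
qed

lemma aut_count_pos: "wf_graph F \<Longrightarrow> aut_count F > 0"
  using isos_empty_iff[of F F] isomorphic_refl finite_isos by (simp add: aut_count_isos card_gt_0_iff)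

lemma iso_class_eq_iff:
  assumes "wf_graph G" "wf_graph H" shows "iso_class G = iso_class H \<longleftrightarrow> isomorphic G H"
  unfolding iso_class_def using assms isomorphic_refl isomorphic_sym isomorphic_trans by blast

lemma rep_iso_class:
  assumes "wf_graph G" shows "wf_graph (rep (iso_class G))" "isomorphic G (rep (iso_class G))"
proof -
  have "G \<in> iso_class G" using assms isomorphic_refl by (simp add: iso_class_def)
  then have "rep (iso_class G) \<in> iso_class G" unfolding rep_def by (rule someI)
  then show "wf_graph (rep (iso_class G))" "isomorphic G (rep (iso_class G))" by (auto simp: iso_class_def)
qed

lemma isomorphic_card: "isomorphic G H \<Longrightarrow> card (verts G) = card (verts H)"
  by (auto simp: isomorphic_def graph_iso_def bij_betw_same_card)

section \<open>Pendant embeddings\<close>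

definition boundary :: "graph \<Rightarrow> nat set \<Rightarrow> nat set set" where
  "boundary G W = {e \<in> edges G. e \<inter> W \<noteq> {} \<and> \<not> e \<subseteq> W}"

text \<open>A pendant appearance on a given vertex set is counted once per root-fixing automorphism
  of \<open>H\<close>. Extensionality makes the set finite.\<close>

definition pend :: "graph \<Rightarrow> nat \<Rightarrow> graph \<Rightarrow> (nat \<Rightarrow> nat) set" where
  "pend H r G = {\<psi> \<in> extensional (verts H). inj_on \<psi> (verts H) \<and> \<psi> ` verts H \<subseteq> verts G \<and>
     induced G (\<psi> ` verts H) = relabel \<psi> H \<and>
     (\<exists>x\<in>verts G - \<psi> ` verts H. boundary G (\<psi> ` verts H) = {{\<psi> r, x}})}"

definition pend_nbr :: "graph \<Rightarrow> nat \<Rightarrow> graph \<Rightarrow> (nat \<Rightarrow> nat) \<Rightarrow> nat" where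
  "pend_nbr H r G \<psi> = (THE x. x \<in> verts G - \<psi> ` verts H \<and> boundary G (\<psi> ` verts H) = {{\<psi> r, x}})"

lemma pendD:
  assumes "\<psi> \<in> pend H r G"
  shows "\<psi> \<in> extensional (verts H)" "inj_on \<psi> (verts H)" "\<psi> ` verts H \<subseteq> verts G"
    "induced G (\<psi> ` verts H) = relabel \<psi> H"
    "\<exists>x\<in>verts G - \<psi> ` verts H. boundary G (\<psi> ` verts H) = {{\<psi> r, x}}"
  using assms by (auto simp: pend_def)

lemma pend_nbr:
  assumes "\<psi> \<in> pend H r G"
  shows "pend_nbr H r G \<psi> \<in> verts G - \<psi> ` verts H"
    "boundary G (\<psi> ` verts H) = {{\<psi> r, pend_nbr H r G \<psi>}}"
proof -
  have "\<exists>!x. x \<in> verts G - \<psi> ` verts H \<and> boundary G (\<psi> ` verts H) = {{\<psi> r, x}}"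
    using pendD(5)[OF assms] by (auto simp: doubleton_eq_iff)
  from theI'[OF this] show "pend_nbr H r G \<psi> \<in> verts G - \<psi> ` verts H"
    "boundary G (\<psi> ` verts H) = {{\<psi> r, pend_nbr H r G \<psi>}}" by (simp_all add: pend_nbr_def)
qed

lemma pend_nbr_eqI:
  assumes "\<psi> \<in> pend H r G" "boundary G (\<psi> ` verts H) = {{\<psi> r, x}}"
  shows "pend_nbr H r G \<psi> = x"
  using pend_nbr[OF assms(1)] assms(2) by (auto simp: doubleton_eq_iff)

lemma finite_pend: "wf_graph H \<Longrightarrow> wf_graph G \<Longrightarrow> finite (pend H r G)"
proof -
  assume wf: "wf_graph H" "wf_graph G"
  have "pend H r G \<subseteq> verts H \<rightarrow>\<^sub>E verts G" by (auto simp: pend_def PiE_def)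
  moreover have "finite (verts H \<rightarrow>\<^sub>E verts G)" using wf by (intro finite_PiE) (auto simp: wf_finite)
  ultimately show ?thesis by (rule finite_subset)
qed

lemma pend_appearance:
  assumes "wf_graph H" "wf_graph G" "r \<in> verts H" "\<psi> \<in> pend H r G"
  shows "pendant_appearance H r G (\<psi> ` verts H)"
  unfolding pendant_appearance_def
proof (intro conjI exI)
  show "\<psi> ` verts H \<subseteq> verts G" using pendD[OF assms(4)] by blast
  show "\<psi> r \<in> \<psi> ` verts H" using assms by blast
  show "pend_nbr H r G \<psi> \<in> verts G - \<psi> ` verts H" using pend_nbr[OF assms(4)] by blast
  show "{e \<in> edges G. e \<inter> \<psi> ` verts H \<noteq> {} \<and> \<not> e \<subseteq> \<psi> ` verts H} = {{\<psi> r, pend_nbr H r G \<psi>}}"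
    using pend_nbr[OF assms(4)] by (simp add: boundary_def)
  show "graph_iso \<psi> H (induced G (\<psi> ` verts H))"
    using pendD[OF assms(4)] graph_iso_relabel[OF assms(1)] by simp
qed simp

text \<open>Two distinct pendant sets of the same size that meet have a union without boundary, so that
  all the pendant sets through a vertex lie in a set of size at most \<^term>\<open>2 * card (verts H)\<close>.\<close>
lemma card_pend_through:
  assumes wf: "wf_graph H" "wf_graph G" and conn: "connected_graph H"
  shows "card {\<psi> \<in> pend H r G. v \<in> \<psi> ` verts H} \<le> (2 * card (verts H)) ^ card (verts H)"
proof -
  let ?S = "{\<psi> \<in> pend H r G. v \<in> \<psi> ` verts H}" and ?h = "card (verts H)"
  have connW: "connected_graph (induced G (\<psi> ` verts H))" if "\<psi> \<in> ?S" for \<psi>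
    using that pendD(4)[of \<psi> H r G] connected_relabel[OF conn] by simp
  have cardW: "card (\<psi> ` verts H) = ?h" if "\<psi> \<in> ?S" for \<psi>
    using that pendD(2)[of \<psi> H r G] by (simp add: card_image)
  have finW: "finite (\<psi> ` verts H)" for \<psi> :: "nat \<Rightarrow> nat" using wf wf_finite by simp
  have "\<exists>X. finite X \<and> card X \<le> 2 * ?h \<and> (\<forall>\<psi>\<in>?S. \<psi> ` verts H \<subseteq> X)"
  proof (cases "\<exists>\<psi>1\<in>?S. \<exists>\<psi>2\<in>?S. \<psi>1 ` verts H \<noteq> \<psi>2 ` verts H")
    case True
    then obtain \<psi>1 \<psi>2 where p: "\<psi>1 \<in> ?S" "\<psi>2 \<in> ?S" "\<psi>1 ` verts H \<noteq> \<psi>2 ` verts H" by blast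
    let ?W1 = "\<psi>1 ` verts H" and ?W2 = "\<psi>2 ` verts H"
    have cross: "\<exists>e. boundary G (\<phi> ` verts H) = {e} \<and> e \<subseteq> \<psi> ` verts H"
      if "\<phi> \<in> ?S" "\<psi> \<in> ?S" "\<phi> ` verts H \<noteq> \<psi> ` verts H" for \<phi> \<psi>
    proof -
      have "\<not> \<psi> ` verts H \<subseteq> \<phi> ` verts H"
        using that cardW[of \<phi>] cardW[of \<psi>] card_subset_eq[OF finW[of \<phi>], of "\<psi> ` verts H"] by auto
      then obtain b where b: "b \<in> \<psi> ` verts H" "b \<notin> \<phi> ` verts H" by blast
      have v: "v \<in> \<psi> ` verts H" "v \<in> \<phi> ` verts H" using that by auto
      note cW = connW[OF that(2)]
      obtain e where e: "e \<in> edges G" "e \<subseteq> \<psi> ` verts H" "e \<inter> \<phi> ` verts H \<noteq> {}" "\<not> e \<subseteq> \<phi> ` verts H"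
        using connected_crossing_edge[OF cW v b] by blast
      then have "e \<in> boundary G (\<phi> ` verts H)" by (simp add: boundary_def)
      moreover have "\<phi> \<in> pend H r G" using that by blast
      ultimately have "boundary G (\<phi> ` verts H) = {e}" using pend_nbr(2) by (metis singletonD)
      then show ?thesis using e by blast
    qed
    obtain e1 where e1: "boundary G ?W1 = {e1}" "e1 \<subseteq> ?W2" using cross[OF p] by blast
    obtain e2 where e2: "boundary G ?W2 = {e2}" "e2 \<subseteq> ?W1"
      using cross[OF p(2,1)] p(3) by metis
    have cl: "closed_set G (?W1 \<union> ?W2)" unfolding closed_set_def
    proof (intro conjI ballI impI)
      show "?W1 \<union> ?W2 \<subseteq> verts G" using p pendD(3)[of \<psi>1 H r G] pendD(3)[of \<psi>2 H r G] by blast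
      fix e assume e: "e \<in> edges G" "e \<inter> (?W1 \<union> ?W2) \<noteq> {}"
      show "e \<subseteq> ?W1 \<union> ?W2"
      proof (cases "e \<inter> ?W1 \<noteq> {}")
        case True
        then have "e \<subseteq> ?W1 \<or> e \<in> boundary G ?W1" using e by (auto simp: boundary_def)
        then show ?thesis using e1 by auto
      next
        case False
        then have "e \<subseteq> ?W2 \<or> e \<in> boundary G ?W2" using e by (auto simp: boundary_def)
        then show ?thesis using e2 by auto
      qed
    qed
    have "\<psi> ` verts H \<subseteq> ?W1 \<union> ?W2" if "\<psi> \<in> ?S" for \<psi>
    proof
      fix u assume "u \<in> \<psi> ` verts H"
      moreover have "v \<in> \<psi> ` verts H" using that by blast
      ultimately have "reach G v u" using connected_induced_conn_set[OF connW[OF that]] unfolding conn_set_def by blast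
      then show "u \<in> ?W1 \<union> ?W2" using closed_set_reach[OF cl, of v u] p(1) by blast
    qed
    moreover have "card (?W1 \<union> ?W2) \<le> 2 * ?h" using card_Un_le[of ?W1 ?W2] cardW[OF p(1)] cardW[OF p(2)] by simp
    ultimately show ?thesis using finW by (intro exI[of _ "?W1 \<union> ?W2"]) simp
  next
    case False
    show ?thesis
    proof (cases "?S = {}")
      case True then show ?thesis unfolding True by (intro exI[of _ "{}"]) simp
    next
      case nonempty: False
      then obtain \<psi>1 where p1: "\<psi>1 \<in> ?S" by blast
      have "\<psi> ` verts H = \<psi>1 ` verts H" if "\<psi> \<in> ?S" for \<psi> using False p1 that by blast
      then show ?thesis using cardW[OF p1] finW[of \<psi>1] by (intro exI[of _ "\<psi>1 ` verts H"]) simp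
    qed
  qed
  then obtain X where X: "finite X" "card X \<le> 2 * ?h" "\<And>\<psi>. \<psi> \<in> ?S \<Longrightarrow> \<psi> ` verts H \<subseteq> X" by blast
  have "?S \<subseteq> verts H \<rightarrow>\<^sub>E X"
  proof
    fix \<psi> assume "\<psi> \<in> ?S"
    then show "\<psi> \<in> verts H \<rightarrow>\<^sub>E X" using X(3)[of \<psi>] pendD(1)[of \<psi> H r G] by (auto simp: PiE_def)
  qed
  then have "card ?S \<le> card (verts H \<rightarrow>\<^sub>E X)" using X(1) wf(1) by (intro card_mono finite_PiE) (auto simp: wf_finite)
  also have "\<dots> = card X ^ ?h" using wf(1) wf_finite by (simp add: card_funcsetE)
  also have "\<dots> \<le> (2 * ?h) ^ ?h" using X(2) by (rule power_mono) simp
  finally show ?thesis .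
qed

text \<open>The number of maps from the h vertices of \<open>H\<close> into the at most 2h vertices
  that embeddings through one vertex can use.\<close>

abbreviation pend_mult :: "graph \<Rightarrow> nat" where
  "pend_mult H \<equiv> (2 * card (verts H)) ^ card (verts H)"

lemma card_pend_meeting:
  assumes "wf_graph H" "wf_graph G" "connected_graph H" "finite S"
  shows "card {\<psi> \<in> pend H r G. \<psi> ` verts H \<inter> S \<noteq> {}} \<le> card S * pend_mult H"
proof -
  have "{\<psi> \<in> pend H r G. \<psi> ` verts H \<inter> S \<noteq> {}} = (\<Union>v\<in>S. {\<psi> \<in> pend H r G. v \<in> \<psi> ` verts H})" by blast
  then have "card {\<psi> \<in> pend H r G. \<psi> ` verts H \<inter> S \<noteq> {}} \<le> (\<Sum>v\<in>S. card {\<psi> \<in> pend H r G. v \<in> \<psi> ` verts H})"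
    using card_UN_le[OF assms(4)] by simp
  also have "\<dots> \<le> (\<Sum>v\<in>S. pend_mult H)" by (intro sum_mono card_pend_through assms)
  finally show ?thesis by simp
qed

lemma card_pend_le:
  assumes "wf_graph H" "wf_graph G" "connected_graph H"
  shows "card (pend H r G) \<le> card (verts G) * pend_mult H"
proof -
  have "verts H \<noteq> {}" using assms by (simp add: connected_graph_def)
  then have "pend H r G = {\<psi> \<in> pend H r G. \<psi> ` verts H \<inter> verts G \<noteq> {}}" using pendD(3) by blast
  then show ?thesis using card_pend_meeting[OF assms wf_finite[OF assms(2)], of r] by simp
qed

lemma boundary_relabel:
  assumes "wf_graph G" "inj_on f (verts G)" "W \<subseteq> verts G"
  shows "boundary (relabel f G) (f ` W) = (`) f ` boundary G W"
proof -
  have "(f ` e \<subseteq> f ` W \<longleftrightarrow> e \<subseteq> W) \<and> (f ` e \<inter> f ` W \<noteq> {} \<longleftrightarrow> e \<inter> W \<noteq> {})" if "e \<in> edges G" for e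
    using wf_edge_subset[OF assms(1) that] assms(2,3) inj_on_image_Int[OF assms(2), of e W]
    by (auto simp: inj_on_image_subset_iff)
  then show ?thesis unfolding boundary_def by auto
qed

lemma pend_relabel:
  assumes wf: "wf_graph H" "wf_graph G" and f: "inj_on f (verts G)" and r: "r \<in> verts H"
    and p: "\<psi> \<in> pend H r G"
  shows "restrict (f \<circ> \<psi>) (verts H) \<in> pend H r (relabel f G)"
proof -
  let ?g = "restrict (f \<circ> \<psi>) (verts H)"
  have im: "?g ` verts H = f ` \<psi> ` verts H" by (auto simp: image_comp)
  note P = pendD[OF p]
  have "inj_on ?g (verts H)" using comp_inj_on[OF P(2)] inj_on_subset[OF f P(3)] by (simp add: inj_on_restrict_eq)
  moreover have "induced (relabel f G) (f ` \<psi> ` verts H) = relabel ?g H"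
  proof -
    have "induced (relabel f G) (f ` \<psi> ` verts H) = relabel (f \<circ> \<psi>) H"
      using induced_relabel[OF wf(2) f P(3)] P(4) by (simp add: relabel_relabel)
    also have "\<dots> = relabel ?g H" by (rule relabel_cong[OF wf(1)]) auto
    finally show ?thesis .
  qed
  moreover have "f (pend_nbr H r G \<psi>) \<in> verts (relabel f G) - f ` \<psi> ` verts H"
    using pend_nbr(1)[OF p] f P(3) by (auto simp: inj_on_def)
  moreover have "boundary (relabel f G) (f ` \<psi> ` verts H) = {{?g r, f (pend_nbr H r G \<psi>)}}"
    using boundary_relabel[OF wf(2) f P(3)] pend_nbr(2)[OF p] r by simp
  moreover have "f ` \<psi> ` verts H \<subseteq> verts (relabel f G)" using P(3) by auto
  ultimately show ?thesis unfolding pend_def mem_Collect_eq im using restrict_extensional by blast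
qed

text \<open>Pulling back along the inverse of \<open>f\<close> is injective on pendant
  embeddings.\<close>

lemma card_pend_relabel_le:
  assumes wf: "wf_graph H" "wf_graph G" and f: "inj_on f (verts G)" and r: "r \<in> verts H"
  shows "card (pend H r (relabel f G)) \<le> card (pend H r G)"
proof (rule card_inj_on_le[of "\<lambda>\<psi>. restrict (inv_into (verts G) f \<circ> \<psi>) (verts H)"])
  let ?g = "inv_into (verts G) f"
  have wfr: "wf_graph (relabel f G)" using wf f wf_relabel by blast
  have inj: "inj_on ?g (verts (relabel f G))" by (simp add: inj_on_inv_into)
  have "relabel ?g (relabel f G) = G" using relabel_inv[OF wf(2) f] f by simp
  then show "(\<lambda>\<psi>. restrict (?g \<circ> \<psi>) (verts H)) ` pend H r (relabel f G) \<subseteq> pend H r G"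
    using pend_relabel[OF wf(1) wfr inj r] by auto
  show "finite (pend H r G)" using finite_pend wf by blast
  show "inj_on (\<lambda>\<psi>. restrict (?g \<circ> \<psi>) (verts H)) (pend H r (relabel f G))"
  proof (rule inj_onI)
    fix \<phi> \<psi> assume a: "\<phi> \<in> pend H r (relabel f G)" "\<psi> \<in> pend H r (relabel f G)"
      "restrict (?g \<circ> \<phi>) (verts H) = restrict (?g \<circ> \<psi>) (verts H)"
    show "\<phi> = \<psi>"
    proof (rule extensionalityI[where A = "verts H"])
      show "\<phi> \<in> extensional (verts H)" "\<psi> \<in> extensional (verts H)" using a pendD(1) by blast+
      fix v assume v: "v \<in> verts H"
      then have "?g (\<phi> v) = ?g (\<psi> v)" using fun_cong[OF a(3), of v] by simp
      moreover have "\<phi> v \<in> verts (relabel f G)" "\<psi> v \<in> verts (relabel f G)" using a pendD(3) v by blast+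
      ultimately show "\<phi> v = \<psi> v" using inj by (meson inj_onD)
    qed
  qed
qed

section \<open>Counting permutations with prescribed blocks\<close>

definition enum_verts :: "graph \<Rightarrow> nat \<Rightarrow> nat" where
  "enum_verts H = (SOME e. bij_betw e (verts H) {..<card (verts H)})"

lemma enum_verts: "wf_graph H \<Longrightarrow> bij_betw (enum_verts H) (verts H) {..<card (verts H)}"
proof -
  assume "wf_graph H"
  then have "\<exists>e. bij_betw e (verts H) {..<card (verts H)}"
    using wf_finite by (metis bij_betw_iff_card card_lessThan finite_lessThan)
  then show ?thesis unfolding enum_verts_def by (rule someI_ex)
qed

text \<open>Block \<open>i\<close> of the vertices beyond \<open>n\<close> carries the \<open>i\<close>-th copy of \<open>H\<close>.\<close>
definition blk :: "graph \<Rightarrow> nat \<Rightarrow> nat \<Rightarrow> nat \<Rightarrow> nat" where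
  "blk H n i v = n + i * card (verts H) + enum_verts H v + 1"

lemma bij_blk:
  assumes "wf_graph H"
  shows "bij_betw (\<lambda>(i, v). blk H n i v) ({..<k} \<times> verts H) {n+1..n + k * card (verts H)}"
proof -
  let ?h = "card (verts H)" and ?f = "\<lambda>(i, v). blk H n i v" and ?S = "{..<k} \<times> verts H"
  have e: "inj_on (enum_verts H) (verts H)" "\<And>v. v \<in> verts H \<Longrightarrow> enum_verts H v < ?h"
    using enum_verts[OF assms] by (auto simp: bij_betw_def)
  have inj: "inj_on ?f ?S"
  proof (rule inj_onI)
    fix x y assume xy: "x \<in> ?S" "y \<in> ?S" "?f x = ?f y"
    obtain i v j w where iv: "x = (i, v)" "y = (j, w)" by (cases x; cases y)
    then have a: "i < k" "v \<in> verts H" "j < k" "w \<in> verts H" "blk H n i v = blk H n j w" using xy by auto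
    have eq: "i * ?h + enum_verts H v = j * ?h + enum_verts H w" using a(5) by (simp add: blk_def)
    \<comment> \<open>Division by the block length recovers the block index.\<close>
    have "(i * ?h + enum_verts H v) div ?h = i" "(j * ?h + enum_verts H w) div ?h = j"
      using e(2)[OF a(2)] e(2)[OF a(4)] by simp_all
    then have ij: "i = j" using eq by simp
    then have "enum_verts H v = enum_verts H w" using eq by simp
    then show "x = y" using ij iv e(1) a by (simp add: inj_on_eq_iff)
  qed
  have sub: "?f ` ?S \<subseteq> {n+1..n + k * ?h}"
  proof clarify
    fix i v assume a: "i < k" "v \<in> verts H"
    have "i * ?h + enum_verts H v < Suc i * ?h" using e(2)[OF a(2)] by simp
    also have "\<dots> \<le> k * ?h" using a(1) by (intro mult_right_mono) auto
    finally show "blk H n i v \<in> {n+1..n + k * ?h}" by (simp add: blk_def)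
  qed
  have "card (?f ` ?S) = k * ?h" using card_image[OF inj] by (simp add: card_cartesian_product)
  then have "?f ` ?S = {n+1..n + k * ?h}" using card_subset_eq[OF _ sub] by simp
  then show ?thesis using inj by (simp add: bij_betw_def)
qed

lemma blk_range: "wf_graph H \<Longrightarrow> i < k \<Longrightarrow> v \<in> verts H \<Longrightarrow> blk H n i v \<in> {n+1..n + k * card (verts H)}"
  using bij_betw_apply[OF bij_blk[of H n k], of "(i, v)"] by simp

lemma blk_eq_iff:
  "wf_graph H \<Longrightarrow> v \<in> verts H \<Longrightarrow> w \<in> verts H \<Longrightarrow> blk H n i v = blk H n j w \<longleftrightarrow> i = j \<and> v = w"
  using bij_blk[of H n "Suc (max i j)"] unfolding bij_betw_def inj_on_def by fastforce

lemma blk_cover: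
  assumes "wf_graph H" "y \<in> {n+1..n + k * card (verts H)}"
  obtains i v where "i < k" "v \<in> verts H" "y = blk H n i v"
proof -
  have "y \<in> (\<lambda>(i, v). blk H n i v) ` ({..<k} \<times> verts H)"
    using bij_blk[OF assms(1), of n k] assms(2) by (simp add: bij_betw_def)
  then show ?thesis using that by auto
qed

text \<open>Counting these trades labelled graphs with k distinguished copies of \<open>H\<close>
  against base graphs on n vertices. Once the blocks are fixed only the n base labels are free,
  hence the factor n! in the bounds that follow.\<close>

definition block_perms :: "graph \<Rightarrow> nat \<Rightarrow> nat \<Rightarrow> (nat \<Rightarrow> nat \<Rightarrow> nat) \<Rightarrow> (nat \<Rightarrow> nat) set" where
  "block_perms H n k \<Phi> = {\<sigma>. \<sigma> permutes {1..n + k * card (verts H)} \<and>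
      (\<forall>i<k. restrict (\<sigma> \<circ> blk H n i) (verts H) = \<Phi> i)}"

lemma block_perms_agree:
  assumes "wf_graph H" "\<sigma> \<in> block_perms H n k \<Phi>" "\<tau> \<in> block_perms H n k \<Phi>"
    "y \<in> {n+1..n + k * card (verts H)}"
  shows "\<sigma> y = \<tau> y"
proof -
  obtain i v where iv: "i < k" "v \<in> verts H" "y = blk H n i v" using blk_cover[OF assms(1,4)] .
  then have "restrict (\<sigma> \<circ> blk H n i) (verts H) v = restrict (\<tau> \<circ> blk H n i) (verts H) v"
    using assms by (simp add: block_perms_def)
  then show ?thesis using iv by simp
qed

lemma finite_block_perms: "finite (block_perms H n k \<Phi>)"
  by (rule finite_subset[of _ "{\<sigma>. \<sigma> permutes {1..n + k * card (verts H)}}"])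
    (auto simp: block_perms_def finite_permutations)

text \<open>Two such permutations agree on all blocks, so they differ by a permutation of the base
  \<open>{1..n}\<close>.\<close>

lemma card_block_perms_le:
  assumes "wf_graph H" shows "card (block_perms H n k \<Phi>) \<le> fact n"
proof (cases "block_perms H n k \<Phi> = {}")
  case False
  let ?N = "n + k * card (verts H)"
  obtain \<tau> where t: "\<tau> \<in> block_perms H n k \<Phi>" using False by blast
  then have tp: "\<tau> permutes {1..?N}" by (simp add: block_perms_def)
  have "(\<lambda>\<sigma>. inv \<tau> \<circ> \<sigma>) ` block_perms H n k \<Phi> \<subseteq> {\<pi>. \<pi> permutes {1..n}}"
  proof clarify
    fix \<sigma> assume s: "\<sigma> \<in> block_perms H n k \<Phi>"
    then have sp: "\<sigma> permutes {1..?N}" by (simp add: block_perms_def)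
    have "inv \<tau> \<circ> \<sigma> permutes {1..?N}" using sp tp by (simp add: permutes_compose permutes_inv)
    moreover have "(inv \<tau> \<circ> \<sigma>) y = y" if "y \<in> {1..?N} - {1..n}" for y
    proof -
      have "y \<in> {n+1..?N}" using that by auto
      then show ?thesis using block_perms_agree[OF assms s t] permutes_inverses(2)[OF tp] by simp
    qed
    ultimately show "inv \<tau> \<circ> \<sigma> permutes {1..n}" using permutes_superset by blast
  qed
  moreover have "inj_on (\<lambda>\<sigma>. inv \<tau> \<circ> \<sigma>) (block_perms H n k \<Phi>)"
  proof (rule inj_onI)
    fix \<sigma> \<sigma>' assume "inv \<tau> \<circ> \<sigma> = inv \<tau> \<circ> \<sigma>'"
    then have "\<tau> \<circ> (inv \<tau> \<circ> \<sigma>) = \<tau> \<circ> (inv \<tau> \<circ> \<sigma>')" by simp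
    then show "\<sigma> = \<sigma>'" by (simp add: o_assoc permutes_inv_o[OF tp])
  qed
  ultimately have "card (block_perms H n k \<Phi>) \<le> card {\<pi>. \<pi> permutes {1..n}}"
    by (intro card_inj_on_le) (auto simp: finite_permutations)
  then show ?thesis by (simp add: card_permutations)
qed simp

text \<open>Disjointness makes the prescribed values an injection on the blocks, and any bijection
  from the base onto the leftover labels completes it to a permutation \<open>\<sigma>\<close>.
  Composing \<open>\<sigma>\<close> with the permutations of the base gives n! different
  ones.\<close>

lemma card_block_perms_ge:
  assumes wf: "wf_graph H"
    and ext: "\<And>i. i < k \<Longrightarrow> \<Phi> i \<in> extensional (verts H)"
    and inj: "\<And>i. i < k \<Longrightarrow> inj_on (\<Phi> i) (verts H)"
    and sub: "\<And>i. i < k \<Longrightarrow> \<Phi> i ` verts H \<subseteq> {1..n + k * card (verts H)}"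
    and disj: "\<And>i j. i < k \<Longrightarrow> j < k \<Longrightarrow> i \<noteq> j \<Longrightarrow> \<Phi> i ` verts H \<inter> \<Phi> j ` verts H = {}"
  shows "fact n \<le> card (block_perms H n k \<Phi>)"
proof -
  let ?N = "n + k * card (verts H)" and ?S = "{..<k} \<times> verts H" and ?b = "\<lambda>(i, v). blk H n i v"
  let ?T = "{n+1..?N}"
  define f where "f = (\<lambda>(i, v). \<Phi> i v) \<circ> inv_into ?S ?b"
  have b: "inj_on ?b ?S" "?b ` ?S = ?T" using bij_blk[OF wf] by (auto simp: bij_betw_def)
  have fb: "f (blk H n i v) = \<Phi> i v" if "i < k" "v \<in> verts H" for i v
    using inv_into_f_f[OF b(1), of "(i, v)"] that by (simp add: f_def)
  have injf: "inj_on f ?T"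
  proof (rule inj_onI)
    fix y z assume a: "y \<in> ?T" "z \<in> ?T" "f y = f z"
    obtain i v where iv: "i < k" "v \<in> verts H" "y = blk H n i v" using blk_cover[OF wf a(1)] .
    obtain j w where jw: "j < k" "w \<in> verts H" "z = blk H n j w" using blk_cover[OF wf a(2)] .
    have eq: "\<Phi> i v = \<Phi> j w" using a fb iv jw by simp
    then have "i = j" using disj[of i j] iv jw by blast
    then show "y = z" using eq inj[of i] iv jw by (auto simp: inj_on_eq_iff)
  qed
  have fT: "f ` ?T \<subseteq> {1..?N}"
  proof (rule image_subsetI)
    fix y assume a: "y \<in> ?T"
    obtain i v where iv: "i < k" "v \<in> verts H" "y = blk H n i v" using blk_cover[OF wf a(1)] .
    then show "f y \<in> {1..?N}" using fb sub[of i] by auto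
  qed
  have "card ({1..?N} - f ` ?T) = card {1..n}"
    using card_Diff_subset[OF _ fT] card_image[OF injf] by simp
  then obtain g where g: "bij_betw g {1..n} ({1..?N} - f ` ?T)"
    using finite_same_card_bij[of "{1..n}" "{1..?N} - f ` ?T"] by auto
  define \<sigma> where "\<sigma> y = (if y \<in> ?T then f y else if y \<in> {1..n} then g y else y)" for y
  have "bij_betw \<sigma> ({1..n} \<union> ?T) (({1..?N} - f ` ?T) \<union> f ` ?T)"
  proof (rule bij_betw_combine)
    show "bij_betw \<sigma> {1..n} ({1..?N} - f ` ?T)"
      using g bij_betw_cong[of "{1..n}" \<sigma> g "{1..?N} - f ` ?T"] by (simp add: \<sigma>_def)
    show "bij_betw \<sigma> ?T (f ` ?T)"
      using inj_on_imp_bij_betw[OF injf] bij_betw_cong[of ?T \<sigma> f "f ` ?T"] by (simp add: \<sigma>_def)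
  qed blast
  moreover have "{1..n} \<union> ?T = {1..?N}" by auto
  moreover have "({1..?N} - f ` ?T) \<union> f ` ?T = {1..?N}" using fT by blast
  ultimately have "bij_betw \<sigma> {1..?N} {1..?N}" by simp
  then have sp: "\<sigma> permutes {1..?N}" by (rule bij_imp_permutes) (auto simp: \<sigma>_def)
  have "(\<lambda>\<pi>. \<sigma> \<circ> \<pi>) ` {\<pi>. \<pi> permutes {1..n}} \<subseteq> block_perms H n k \<Phi>"
  proof clarify
    fix \<pi> assume p: "\<pi> permutes {1..n}"
    have "\<sigma> \<circ> \<pi> permutes {1..?N}" using sp permutes_subset[OF p, of "{1..?N}"] by (simp add: permutes_compose)
    moreover have "restrict (\<sigma> \<circ> \<pi> \<circ> blk H n i) (verts H) = \<Phi> i" if "i < k" for i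
    proof (rule extensionalityI[where A = "verts H"])
      fix v assume v: "v \<in> verts H"
      have "blk H n i v \<in> ?T" using blk_range[OF wf that v] .
      moreover from this have "\<pi> (blk H n i v) = blk H n i v" using p by (auto simp: permutes_def)
      ultimately show "restrict (\<sigma> \<circ> \<pi> \<circ> blk H n i) (verts H) v = \<Phi> i v"
        using v fb[OF that v] by (simp add: \<sigma>_def)
    qed (use ext[OF that] in auto)
    ultimately show "\<sigma> \<circ> \<pi> \<in> block_perms H n k \<Phi>" by (simp add: block_perms_def)
  qed
  moreover have "inj_on (\<lambda>\<pi>. \<sigma> \<circ> \<pi>) {\<pi>. \<pi> permutes {1..n}}"
  proof (rule inj_onI)
    fix \<pi> \<pi>' assume "\<sigma> \<circ> \<pi> = \<sigma> \<circ> \<pi>'"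
    then have "inv \<sigma> \<circ> (\<sigma> \<circ> \<pi>) = inv \<sigma> \<circ> (\<sigma> \<circ> \<pi>')" by simp
    then show "\<pi> = \<pi>'" by (simp add: o_assoc permutes_inv_o[OF sp])
  qed
  ultimately have "card {\<pi>. \<pi> permutes {1..n}} \<le> card (block_perms H n k \<Phi>)"
    using finite_block_perms by (intro card_inj_on_le) auto
  then show ?thesis by (simp add: card_permutations)
qed

definition perms_into :: "graph \<Rightarrow> nat \<Rightarrow> nat \<Rightarrow> (nat \<Rightarrow> nat) set \<Rightarrow> (nat \<Rightarrow> nat) set" where
  "perms_into H n k P = {\<sigma>. \<sigma> permutes {1..n + k * card (verts H)} \<and>
      (\<forall>i<k. restrict (\<sigma> \<circ> blk H n i) (verts H) \<in> P)}"

lemma finite_perms_into: "finite (perms_into H n k P)"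
  by (rule finite_subset[of _ "{\<sigma>. \<sigma> permutes {1..n + k * card (verts H)}}"])
    (auto simp: perms_into_def finite_permutations)

text \<open>A choice of k members of \<open>P\<close> fixes the blocks, and at most n! permutations
  remain.\<close>

lemma card_perms_into_le:
  assumes "wf_graph H" "finite P" shows "card (perms_into H n k P) \<le> card P ^ k * fact n"
proof -
  have "perms_into H n k P \<subseteq> (\<Union>\<Phi>\<in>{..<k} \<rightarrow>\<^sub>E P. block_perms H n k \<Phi>)"
  proof
    fix \<sigma> assume s: "\<sigma> \<in> perms_into H n k P"
    then have "(\<lambda>i\<in>{..<k}. restrict (\<sigma> \<circ> blk H n i) (verts H)) \<in> {..<k} \<rightarrow>\<^sub>E P"
      by (auto simp: perms_into_def)
    moreover have "\<sigma> \<in> block_perms H n k (\<lambda>i\<in>{..<k}. restrict (\<sigma> \<circ> blk H n i) (verts H))"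
      using s by (auto simp: perms_into_def block_perms_def)
    ultimately show "\<sigma> \<in> (\<Union>\<Phi>\<in>{..<k} \<rightarrow>\<^sub>E P. block_perms H n k \<Phi>)" by blast
  qed
  moreover have fin: "finite ({..<k} \<rightarrow>\<^sub>E P)" using assms by (intro finite_PiE) auto
  ultimately have "card (perms_into H n k P) \<le> card (\<Union>\<Phi>\<in>{..<k} \<rightarrow>\<^sub>E P. block_perms H n k \<Phi>)"
    by (intro card_mono) (auto simp: finite_block_perms)
  also have "\<dots> \<le> (\<Sum>\<Phi>\<in>{..<k} \<rightarrow>\<^sub>E P. card (block_perms H n k \<Phi>))" by (rule card_UN_le[OF fin])
  also have "\<dots> \<le> (\<Sum>\<Phi>\<in>{..<k} \<rightarrow>\<^sub>E P. fact n)" by (intro sum_mono card_block_perms_le assms)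
  also have "\<dots> = card P ^ k * fact n" by (simp add: card_funcsetE)
  finally show ?thesis .
qed

section \<open>Sequences of embeddings with disjoint images\<close>

definition disj_seqs :: "'a set \<Rightarrow> nat \<Rightarrow> ('a \<Rightarrow> nat) set \<Rightarrow> (nat \<Rightarrow> 'a \<Rightarrow> nat) set" where
  "disj_seqs V k P = {\<Phi> \<in> {..<k} \<rightarrow>\<^sub>E P. \<forall>i<k. \<forall>j<k. i \<noteq> j \<longrightarrow> \<Phi> i ` V \<inter> \<Phi> j ` V = {}}"

text \<open>Greedy choice: the earlier images occupy at most k |V| vertices, and each vertex
  excludes at most \<open>D\<close> members of \<open>P\<close>. The subtraction is truncated, so
  the bound degenerates harmlessly when \<open>P\<close> is small.\<close>

lemma card_disj_seqs_ge:
  assumes fin: "finite V" "finite P"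
    and D: "\<And>v. card {\<phi> \<in> P. v \<in> \<phi> ` V} \<le> D" and jk: "j \<le> k"
  shows "(card P - k * card V * D) ^ j \<le> card (disj_seqs V j P)"
  using jk
proof (induction j)
  case 0
  \<comment> \<open>The only extensional function on the empty index set is the empty
    sequence.\<close>
  have "disj_seqs V 0 P = {\<lambda>_. undefined}" by (auto simp: disj_seqs_def)
  then show ?case by simp
next
  case (Suc j)
  let ?R = "\<lambda>\<Phi>. {\<phi> \<in> P. \<phi> ` V \<inter> (\<Union>i<j. \<Phi> i ` V) = {}}"
  have finS: "finite (disj_seqs V l P)" for l
    by (rule finite_subset[of _ "{..<l} \<rightarrow>\<^sub>E P"]) (auto simp: disj_seqs_def intro!: finite_PiE fin)
  have R: "card P - k * card V * D \<le> card (?R \<Phi>)" for \<Phi>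
  proof -
    let ?U = "\<Union>i<j. \<Phi> i ` V"
    have U: "finite ?U" "card ?U \<le> j * card V"
    proof -
      have "card ?U \<le> (\<Sum>i<j. card (\<Phi> i ` V))" by (rule card_UN_le) simp
      also have "\<dots> \<le> (\<Sum>i<j. card V)" by (intro sum_mono card_image_le fin)
      finally show "card ?U \<le> j * card V" by simp
    qed (use fin in auto)
    have "card {\<phi> \<in> P. \<phi> ` V \<inter> ?U \<noteq> {}} \<le> card (\<Union>v\<in>?U. {\<phi> \<in> P. v \<in> \<phi> ` V})"
    proof (rule card_mono)
      show "finite (\<Union>v\<in>?U. {\<phi> \<in> P. v \<in> \<phi> ` V})" using U(1) fin by auto
    qed blast
    also have "\<dots> \<le> (\<Sum>v\<in>?U. card {\<phi> \<in> P. v \<in> \<phi> ` V})" by (rule card_UN_le[OF U(1)])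
    also have "\<dots> \<le> (\<Sum>v\<in>?U. D)" by (intro sum_mono D)
    also have "\<dots> \<le> j * card V * D" using U(2) by simp
    also have "\<dots> \<le> k * card V * D" using Suc.prems by simp
    finally have *: "card {\<phi> \<in> P. \<phi> ` V \<inter> ?U \<noteq> {}} \<le> k * card V * D" .
    have "?R \<Phi> = P - {\<phi> \<in> P. \<phi> ` V \<inter> ?U \<noteq> {}}" by blast
    then have "card (?R \<Phi>) = card P - card {\<phi> \<in> P. \<phi> ` V \<inter> ?U \<noteq> {}}"
      using fin by (simp add: card_Diff_subset)
    then show ?thesis using * by simp
  qed
  have "(card P - k * card V * D) ^ Suc j \<le> card (disj_seqs V j P) * (card P - k * card V * D)"
    using Suc by (simp add: mult.commute mult_right_mono)
  also have "\<dots> = (\<Sum>\<Phi>\<in>disj_seqs V j P. card P - k * card V * D)" by simp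
  also have "\<dots> \<le> (\<Sum>\<Phi>\<in>disj_seqs V j P. card (?R \<Phi>))" by (intro sum_mono R)
  also have "\<dots> = card (Sigma (disj_seqs V j P) ?R)" using finS fin by simp
  also have "\<dots> \<le> card (disj_seqs V (Suc j) P)"
  proof (rule card_inj_on_le[of "\<lambda>(\<Phi>, \<phi>). \<Phi>(j := \<phi>)"])
    show "inj_on (\<lambda>(\<Phi>, \<phi>). \<Phi>(j := \<phi>)) (Sigma (disj_seqs V j P) ?R)"
    proof (rule inj_onI, clarify)
      fix \<Phi> \<phi> \<Phi>' \<phi>' assume a: "\<Phi> \<in> disj_seqs V j P" "\<Phi>' \<in> disj_seqs V j P" "\<Phi>(j := \<phi>) = \<Phi>'(j := \<phi>')"
      have "\<Phi> i = \<Phi>' i" for i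
      proof (cases "i = j")
        case True then show ?thesis using a by (auto simp: disj_seqs_def PiE_def extensional_def)
      next
        case False then show ?thesis using fun_cong[OF a(3), of i] by simp
      qed
      then show "\<Phi> = \<Phi>' \<and> \<phi> = \<phi>'" using fun_cong[OF a(3), of j] by auto
    qed
    show "(\<lambda>(\<Phi>, \<phi>). \<Phi>(j := \<phi>)) ` Sigma (disj_seqs V j P) ?R \<subseteq> disj_seqs V (Suc j) P"
    proof clarify
      fix \<Phi> \<phi> assume a: "\<Phi> \<in> disj_seqs V j P" "\<phi> \<in> P" "\<phi> ` V \<inter> (\<Union>i<j. \<Phi> i ` V) = {}"
      have "\<Phi>(j := \<phi>) \<in> {..<Suc j} \<rightarrow>\<^sub>E P"
        using a(1,2) by (auto simp: disj_seqs_def PiE_iff extensional_def less_Suc_eq)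
      moreover have "(\<Phi>(j := \<phi>)) i ` V \<inter> (\<Phi>(j := \<phi>)) l ` V = {}" if "i < Suc j" "l < Suc j" "i \<noteq> l" for i l
      proof -
        have *: "\<phi> ` V \<inter> \<Phi> m ` V = {}" if "m < j" for m using that a(3) by blast
        have "\<Phi> i ` V \<inter> \<Phi> l ` V = {}" if "i < j" "l < j" using that \<open>i \<noteq> l\<close> a(1) by (auto simp: disj_seqs_def)
        then show ?thesis using that *[of i] *[of l] by (cases "i = j"; cases "l = j") (simp_all add: less_Suc_eq Int_commute)
      qed
      ultimately show "\<Phi>(j := \<phi>) \<in> disj_seqs V (Suc j) P" by (auto simp: disj_seqs_def)
    qed
  qed (rule finS)
  finally show ?case .
qed

text \<open>A permutation determines its sequence of embeddings, so the families belonging to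
  different disjoint sequences do not overlap and their sizes add up.\<close>

lemma card_perms_into_ge:
  assumes wf: "wf_graph H" and fin: "finite P"
    and D: "\<And>v. card {\<phi> \<in> P. v \<in> \<phi> ` verts H} \<le> D"
    and P: "\<And>\<phi>. \<phi> \<in> P \<Longrightarrow> \<phi> \<in> extensional (verts H) \<and> inj_on \<phi> (verts H) \<and> \<phi> ` verts H \<subseteq> {1..n + k * card (verts H)}"
  shows "(card P - k * card (verts H) * D) ^ k * fact n \<le> card (perms_into H n k P)"
proof -
  let ?S = "disj_seqs (verts H) k P"
  have finS: "finite ?S"
    by (rule finite_subset[of _ "{..<k} \<rightarrow>\<^sub>E P"]) (auto simp: disj_seqs_def intro!: finite_PiE fin)
  have "(card P - k * card (verts H) * D) ^ k * fact n \<le> card ?S * fact n"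
    using card_disj_seqs_ge[OF wf_finite[OF wf] fin D order_refl] by (rule mult_right_mono) simp
  also have "\<dots> = (\<Sum>\<Phi>\<in>?S. fact n)" by simp
  also have "\<dots> \<le> (\<Sum>\<Phi>\<in>?S. card (block_perms H n k \<Phi>))"
  proof (rule sum_mono)
    fix \<Phi> assume "\<Phi> \<in> ?S"
    then show "fact n \<le> card (block_perms H n k \<Phi>)"
      using P by (intro card_block_perms_ge[OF wf]) (auto simp: disj_seqs_def PiE_iff)
  qed
  also have "\<dots> = card (\<Union>\<Phi>\<in>?S. block_perms H n k \<Phi>)"
  proof (rule card_UN_disjoint[symmetric])
    show "\<forall>\<Phi>\<in>?S. \<forall>\<Phi>'\<in>?S. \<Phi> \<noteq> \<Phi>' \<longrightarrow> block_perms H n k \<Phi> \<inter> block_perms H n k \<Phi>' = {}"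
    proof (intro ballI impI, rule ccontr)
      fix \<Phi> \<Phi>' assume a: "\<Phi> \<in> ?S" "\<Phi>' \<in> ?S" "\<Phi> \<noteq> \<Phi>'" "block_perms H n k \<Phi> \<inter> block_perms H n k \<Phi>' \<noteq> {}"
      then have "\<Phi> i = \<Phi>' i" if "i < k" for i using that by (auto simp: block_perms_def)
      then have "\<Phi> = \<Phi>'" using a(1,2) by (intro PiE_ext[of \<Phi> "{..<k}" "\<lambda>_. P"]) (auto simp: disj_seqs_def)
      then show False using a(3) by blast
    qed
  qed (auto simp: finS finite_block_perms)
  also have "\<dots> \<le> card (perms_into H n k P)"
    by (intro card_mono finite_perms_into) (auto simp: block_perms_def perms_into_def disj_seqs_def PiE_iff)
  finally show ?thesis .
qed

section \<open>Attaching and detaching many pendant copies\<close>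

lemma finite_graphs_with_verts:
  assumes "finite V" shows "finite {G. wf_graph G \<and> verts G = V}"
proof (rule finite_subset)
  show "{G. wf_graph G \<and> verts G = V} \<subseteq> {V} \<times> Pow (Pow V)"
  proof
    fix G assume G: "G \<in> {G. wf_graph G \<and> verts G = V}"
    then have "edges G \<in> Pow (Pow V)" using wf_edges_subset_Pow by blast
    then show "G \<in> {V} \<times> Pow (Pow V)" using G by (cases G) simp
  qed
  show "finite ({V} \<times> Pow (Pow V))" using assms by simp
qed

lemma finite_graphs_on: "graph_class X \<Longrightarrow> finite (graphs_on X n)"
  by (rule finite_subset[OF _ finite_graphs_with_verts[of "{1..n}"]])
    (auto simp: graphs_on_def graph_class_def)

lemma wf_edge_nonempty: "wf_graph G \<Longrightarrow> e \<in> edges G \<Longrightarrow> e \<noteq> {}"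
  by (auto elim: wf_edgeE)

text \<open>The normal form of an attachment; other labellings of the result are reached by
  permuting the labels.\<close>

definition glue :: "graph \<Rightarrow> nat \<Rightarrow> nat \<Rightarrow> nat \<Rightarrow> graph \<Rightarrow> (nat \<Rightarrow> nat) \<Rightarrow> graph" where
  "glue H r n k G xs = ({1..n + k * card (verts H)},
     edges G \<union> (\<Union>i<k. edges (relabel (blk H n i) H)) \<union> {{blk H n i r, xs i} | i. i < k})"

context
  fixes H :: graph and r n k :: nat
  assumes wfH: "wf_graph H" and r: "r \<in> verts H"
begin

abbreviation "bl \<equiv> blk H n"
abbreviation "NN \<equiv> n + k * card (verts H)"

lemma bl_inj: "inj_on (bl i) (verts H)"
  using blk_eq_iff[OF wfH] by (auto simp: inj_on_def)

lemma bl_gt: "v \<in> verts H \<Longrightarrow> bl i v > n" by (simp add: blk_def)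

lemma bl_base: "bl i ` verts H \<inter> {1..n} = {}" by (auto simp: blk_def)

lemma bl_disjoint: "i \<noteq> j \<Longrightarrow> bl i ` verts H \<inter> bl j ` verts H = {}"
  using blk_eq_iff[OF wfH] by blast

lemma Un_blocks: "{1..n} \<union> (\<Union>i<k. bl i ` verts H) = {1..NN}"
proof -
  have "(\<Union>i<k. bl i ` verts H) = (\<lambda>(i, v). bl i v) ` ({..<k} \<times> verts H)" by force
  also have "\<dots> = {n+1..NN}" using bij_blk[OF wfH, of n k] by (simp add: bij_betw_def)
  finally show ?thesis by auto
qed

context
  fixes G :: graph and xs :: "nat \<Rightarrow> nat"
  assumes wfG: "wf_graph G" and vG: "verts G = {1..n}" and xs: "xs \<in> {..<k} \<rightarrow> {1..n}"
begin

abbreviation "GG \<equiv> glue H r n k G xs"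

lemma verts_glue: "verts GG = {1..NN}" by (simp add: glue_def)

lemma glue_edge_cases:
  assumes "e \<in> edges GG"
  obtains "e \<in> edges G" "e \<subseteq> {1..n}" | i where "i < k" "e \<in> edges (relabel (bl i) H)" "e \<subseteq> bl i ` verts H"
    | i where "i < k" "e = {bl i r, xs i}"
proof -
  have 1: "e \<in> edges G \<Longrightarrow> e \<subseteq> {1..n}" using wf_edge_subset[OF wfG] vG by simp
  have 2: "e \<in> edges (relabel (bl i) H) \<Longrightarrow> e \<subseteq> bl i ` verts H" for i
    using wf_edge_subset[OF wf_relabel[OF wfH bl_inj]] by simp
  have "e \<in> edges G \<or> (\<exists>i<k. e \<in> edges (relabel (bl i) H)) \<or> (\<exists>i<k. e = {bl i r, xs i})"
    using assms unfolding glue_def by auto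
  then show ?thesis using that 1 2 by blast
qed

lemma wf_glue: "wf_graph GG"
proof (rule wf_graphI)
  show "finite (verts GG)" by (simp add: verts_glue)
  fix e assume "e \<in> edges GG"
  then show "\<exists>u v. e = {u, v} \<and> u \<noteq> v \<and> u \<in> verts GG \<and> v \<in> verts GG"
  proof (cases rule: glue_edge_cases)
    case 1
    then show ?thesis using wf_edgeE[OF wfG 1(1)] vG unfolding verts_glue by (metis Un_blocks Un_iff)
  next
    case (2 i)
    then obtain u v where "e = {u, v}" "u \<noteq> v" using wf_edgeE[OF wf_relabel[OF wfH bl_inj]] by metis
    moreover have "e \<subseteq> {1..NN}" using 2 Un_blocks by blast
    ultimately show ?thesis unfolding verts_glue by blast
  next
    case (3 i)
    have "xs i \<in> {1..n}" using xs 3 by auto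
    moreover have "bl i r > n" using bl_gt r by simp
    moreover have "bl i r \<in> {1..NN}" using Un_blocks 3 r by blast
    ultimately show ?thesis unfolding verts_glue using 3 by (intro exI[of _ "bl i r"] exI[of _ "xs i"]) auto
  qed
qed

lemma attach_glue: "attach_pendant H r G k GG"
  unfolding attach_pendant_def
proof (intro exI[of _ "\<lambda>i. relabel (bl i) H"] exI[of _ bl] exI[of _ xs] conjI allI impI)
  fix i assume i: "i < k"
  show "wf_graph (relabel (bl i) H)" "graph_iso (bl i) H (relabel (bl i) H)"
    using wf_relabel graph_iso_relabel wfH bl_inj by blast+
  show "xs i \<in> verts G" using xs i vG by auto
  show "verts (relabel (bl i) H) \<inter> verts G = {}" using vG bl_base by simp
next
  fix i j assume "i < k" "j < k" "i \<noteq> j"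
  then show "verts (relabel (bl i) H) \<inter> verts (relabel (bl j) H) = {}" using bl_disjoint by simp
next
  have "verts G \<union> (\<Union>i<k. verts (relabel (bl i) H)) = {1..NN}" using Un_blocks vG by simp
  then show "GG = (verts G \<union> (\<Union>i<k. verts (relabel (bl i) H)),
      edges G \<union> (\<Union>i<k. edges (relabel (bl i) H)) \<union> {{bl i r, xs i} | i. i < k})"
    unfolding glue_def by simp
qed

lemma glue_edge_block:
  assumes e: "e \<in> edges GG" and i: "i < k" and m: "e \<inter> bl i ` verts H \<noteq> {}"
  shows "e \<in> edges (relabel (bl i) H) \<and> e \<subseteq> bl i ` verts H \<or> e = {bl i r, xs i}"
  using e
proof (cases rule: glue_edge_cases)
  case 1
  then show ?thesis using m bl_base by blast
next
  case (2 j)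
  then show ?thesis using m bl_disjoint[of i j] by blast
next
  case (3 j)
  have "xs j \<in> {1..n}" using xs 3 by auto
  then have "xs j \<notin> bl i ` verts H" using bl_base by blast
  then have "bl j r \<in> bl i ` verts H" using m 3 by auto
  then have "i = j" using bl_disjoint[of i j] r by blast
  then show ?thesis using 3 by simp
qed

lemma glue_induced_base: "induced GG {1..n} = G"
proof (rule graph_eqI)
  show "edges (induced GG {1..n}) = edges G"
  proof (intro equalityI subsetI)
    fix e assume "e \<in> edges (induced GG {1..n})"
    then have e: "e \<in> edges GG" "e \<subseteq> {1..n}" by auto
    then show "e \<in> edges G"
    proof (cases rule: glue_edge_cases)
      case (2 i)
      have "e \<noteq> {}" using 2 wf_edgeE[OF wf_relabel[OF wfH bl_inj] 2(2)] by blast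
      then show ?thesis using 2 e(2) bl_base[of i] by blast
    next
      case (3 i)
      then show ?thesis using e(2) bl_gt[OF r, of i] by auto
    qed
  next
    fix e assume "e \<in> edges G"
    moreover have "e \<subseteq> {1..n}" using calculation wf_edge_subset[OF wfG] vG by simp
    ultimately show "e \<in> edges (induced GG {1..n})" by (simp add: glue_def)
  qed
qed (simp add: vG)

lemma glue_boundary:
  assumes i: "i < k" shows "boundary GG (bl i ` verts H) = {{bl i r, xs i}}"
proof -
  have "xs i \<in> {1..n}" using xs i by auto
  then have "xs i \<notin> bl i ` verts H" using bl_base by blast
  moreover have "{bl i r, xs i} \<in> edges GG" using i by (auto simp: glue_def)
  ultimately have "{bl i r, xs i} \<in> boundary GG (bl i ` verts H)" using r by (auto simp: boundary_def)
  moreover have "e = {bl i r, xs i}" if "e \<in> boundary GG (bl i ` verts H)" for e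
    using glue_edge_block[OF _ i, of e] that by (auto simp: boundary_def)
  ultimately show ?thesis by blast
qed

lemma pend_glue_block:
  assumes i: "i < k" shows "restrict (bl i) (verts H) \<in> pend H r GG"
proof -
  let ?g = "restrict (bl i) (verts H)"
  have im: "?g ` verts H = bl i ` verts H" by auto
  have x: "xs i \<in> {1..n}" using xs i by auto
  have "induced GG (bl i ` verts H) = relabel (bl i) H"
  proof (rule graph_eqI)
    show "edges (induced GG (bl i ` verts H)) = edges (relabel (bl i) H)"
    proof (intro equalityI subsetI)
      fix e assume "e \<in> edges (induced GG (bl i ` verts H))"
      then have e: "e \<in> edges GG" "e \<subseteq> bl i ` verts H" by auto
      then have "e \<inter> bl i ` verts H \<noteq> {}" using wf_edge_nonempty[OF wf_glue e(1)] by blast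
      moreover have "e \<noteq> {bl i r, xs i}"
        using e(2) bl_base[of i] x by blast
      ultimately show "e \<in> edges (relabel (bl i) H)" using glue_edge_block[OF e(1) i] by blast
    next
      fix e assume "e \<in> edges (relabel (bl i) H)"
      moreover have "e \<subseteq> bl i ` verts H"
        using calculation wf_edge_subset[OF wf_relabel[OF wfH bl_inj]] by simp
      ultimately show "e \<in> edges (induced GG (bl i ` verts H))" using i unfolding glue_def by auto
    qed
  qed simp
  moreover have "relabel ?g H = relabel (bl i) H" by (rule relabel_cong[OF wfH]) simp
  moreover have "xs i \<in> verts GG - bl i ` verts H" "bl i ` verts H \<subseteq> verts GG"
    using x i bl_base[of i] Un_blocks unfolding verts_glue by blast+
  moreover have "boundary GG (bl i ` verts H) = {{?g r, xs i}}" using glue_boundary[OF i] r by simp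
  moreover have "inj_on ?g (verts H)" using bl_inj by (simp add: inj_on_restrict_eq)
  ultimately show ?thesis unfolding pend_def mem_Collect_eq im using restrict_extensional by metis
qed

text \<open>An embedding that avoids the new vertices and all attachment points sees the same
  incident edges in \<open>G\<close>, hence is pendant there. The others meet a set of at most k (h
  + 1) vertices, each of which lies on few embeddings.\<close>

lemma card_pend_glue:
  assumes conn: "connected_graph H"
  shows "card (pend H r GG) \<le> card (pend H r G) + k * (card (verts H) + 1) * pend_mult H"
proof -
  let ?S = "(\<Union>i<k. bl i ` verts H) \<union> xs ` {..<k}"
  have finS: "finite ?S" using wf_finite[OF wfH] by auto
  have "card ?S \<le> card (\<Union>i<k. bl i ` verts H) + card (xs ` {..<k})" by (rule card_Un_le)
  also have "card (\<Union>i<k. bl i ` verts H) \<le> (\<Sum>i<k. card (bl i ` verts H))" by (rule card_UN_le) simp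
  also have "\<dots> \<le> (\<Sum>i<k. card (verts H))" by (intro sum_mono card_image_le wf_finite wfH)
  also have "card (xs ` {..<k}) \<le> k" using card_image_le[of "{..<k}" xs] by simp
  finally have cardS: "card ?S \<le> k * (card (verts H) + 1)" by simp
  have "pend H r GG \<subseteq> pend H r G \<union> {\<psi> \<in> pend H r GG. \<psi> ` verts H \<inter> ?S \<noteq> {}}"
  proof
    fix \<psi> assume p: "\<psi> \<in> pend H r GG"
    let ?W = "\<psi> ` verts H"
    note P = pendD[OF p]
    show "\<psi> \<in> pend H r G \<union> {\<psi> \<in> pend H r GG. \<psi> ` verts H \<inter> ?S \<noteq> {}}"
    proof (cases "?W \<inter> ?S = {}")
      case True
      have "?W \<subseteq> {1..n} \<union> (\<Union>i<k. bl i ` verts H)" using P(3) by (simp only: verts_glue Un_blocks)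
      then have W: "?W \<subseteq> {1..n}" using True by blast
      have eW: "e \<in> edges GG \<longleftrightarrow> e \<in> edges G" if "e \<inter> ?W \<noteq> {}" for e
      proof
        assume "e \<in> edges GG"
        then show "e \<in> edges G"
        proof (cases rule: glue_edge_cases)
          case (2 i) then show ?thesis using that True by blast
        next
          case (3 i) then show ?thesis using that True r by blast
        qed
      qed (simp add: glue_def)
      have "induced G ?W = induced GG ?W"
      proof (rule graph_eqI)
        have "e \<in> edges GG \<Longrightarrow> e \<subseteq> ?W \<Longrightarrow> e \<inter> ?W \<noteq> {}" for e using wf_edge_nonempty[OF wf_glue, of e] by blast
        moreover have "e \<in> edges G \<Longrightarrow> e \<subseteq> ?W \<Longrightarrow> e \<inter> ?W \<noteq> {}" for e using wf_edge_nonempty[OF wfG, of e] by blast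
        ultimately show "edges (induced G ?W) = edges (induced GG ?W)" unfolding edges_induced using eW by blast
      qed simp
      moreover have b: "boundary G ?W = boundary GG ?W" using eW by (auto simp: boundary_def)
      moreover have "pend_nbr H r GG \<psi> \<in> verts G - ?W"
      proof -
        have "{\<psi> r, pend_nbr H r GG \<psi>} \<in> boundary G ?W" using pend_nbr(2)[OF p] b by simp
        then have "{\<psi> r, pend_nbr H r GG \<psi>} \<in> edges G" by (simp add: boundary_def)
        then show ?thesis using wf_edgeD[OF wfG] pend_nbr(1)[OF p] by blast
      qed
      ultimately have "\<psi> \<in> pend H r G"
        unfolding pend_def mem_Collect_eq using P pend_nbr(2)[OF p] W vG by auto
      then show ?thesis by blast
    next
      case False
      then show ?thesis using p by blast
    qed
  qed
  then have "card (pend H r GG) \<le> card (pend H r G \<union> {\<psi> \<in> pend H r GG. \<psi> ` verts H \<inter> ?S \<noteq> {}})"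
    using finite_pend[OF wfH wfG] finite_pend[OF wfH wf_glue] by (intro card_mono) auto
  also have "\<dots> \<le> card (pend H r G) + card {\<psi> \<in> pend H r GG. \<psi> ` verts H \<inter> ?S \<noteq> {}}" by (rule card_Un_le)
  also have "card {\<psi> \<in> pend H r GG. \<psi> ` verts H \<inter> ?S \<noteq> {}} \<le> card ?S * pend_mult H"
    by (rule card_pend_meeting[OF wfH wf_glue conn finS])
  also have "\<dots> \<le> k * (card (verts H) + 1) * pend_mult H" using cardS by (rule mult_right_mono) simp
  finally show ?thesis by simp
qed

lemma relabel_glue:
  assumes B: "graph_class B" "GG \<in> B" and conn: "connected_graph H" and \<sigma>: "\<sigma> permutes {1..NN}"
    and m: "card (pend H r G) + k * (card (verts H) + 1) * pend_mult H \<le> m"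
  shows "relabel \<sigma> GG \<in> {G' \<in> graphs_on B NN. card (pend H r G') \<le> m}"
    "\<sigma> \<in> perms_into H n k (pend H r (relabel \<sigma> GG))"
proof -
  have inj: "inj_on \<sigma> A" for A using permutes_inj[OF \<sigma>] by (rule inj_on_subset) simp
  have "relabel \<sigma> GG \<in> B" using graph_class_relabel[OF B inj] .
  moreover have "verts (relabel \<sigma> GG) = {1..NN}" using permutes_image[OF \<sigma>] by (simp add: verts_glue)
  moreover have "card (pend H r (relabel \<sigma> GG)) \<le> m"
    using card_pend_relabel_le[OF wfH wf_glue inj r] card_pend_glue[OF conn] m by linarith
  ultimately show "relabel \<sigma> GG \<in> {G' \<in> graphs_on B NN. card (pend H r G') \<le> m}"
    by (simp add: graphs_on_def)
  have "restrict (\<sigma> \<circ> bl i) (verts H) \<in> pend H r (relabel \<sigma> GG)" if "i < k" for i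
  proof -
    have "restrict (\<sigma> \<circ> restrict (bl i) (verts H)) (verts H) \<in> pend H r (relabel \<sigma> GG)"
      by (rule pend_relabel[OF wfH wf_glue inj r pend_glue_block[OF that]])
    moreover have "restrict (\<sigma> \<circ> restrict (bl i) (verts H)) (verts H) = restrict (\<sigma> \<circ> bl i) (verts H)" by auto
    ultimately show ?thesis by simp
  qed
  then show "\<sigma> \<in> perms_into H n k (pend H r (relabel \<sigma> GG))" using \<sigma> by (simp add: perms_into_def)
qed

end

text \<open>The base is the graph induced on \<open>{1..n}\<close>, and the single boundary edge of
  block \<open>i\<close> reveals \<open>xs i\<close>.\<close>

lemma glue_inj:
  assumes "wf_graph G" "verts G = {1..n}" "xs \<in> {..<k} \<rightarrow>\<^sub>E {1..n}"
    "wf_graph G'" "verts G' = {1..n}" "ys \<in> {..<k} \<rightarrow>\<^sub>E {1..n}"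
    "glue H r n k G xs = glue H r n k G' ys"
  shows "G = G' \<and> xs = ys"
proof
  have xs: "xs \<in> {..<k} \<rightarrow> {1..n}" "ys \<in> {..<k} \<rightarrow> {1..n}" using assms by auto
  show "G = G'" using glue_induced_base[OF assms(1,2) xs(1)] glue_induced_base[OF assms(4,5) xs(2)] assms(7) by simp
  show "xs = ys"
  proof (rule PiE_ext[OF assms(3,6)])
    fix i assume "i \<in> {..<k}"
    then have i: "i < k" by simp
    have "{{bl i r, xs i}} = {{bl i r, ys i}}"
      using glue_boundary[OF assms(1,2) xs(1) i] glue_boundary[OF assms(4,5) xs(2) i] assms(7) by simp
    then show "xs i = ys i" by (auto simp: doubleton_eq_iff)
  qed
qed

text \<open>Double counting of triples: a permutation, a graph in \<open>X\<close> and a choice of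
  attachment points. Keeping the permutation next to the relabelled result makes the map injective.
  A graph with at most \<open>m\<close> pendant embeddings arises with at most m^k n! permutations,
  since these carry the blocks to pendant embeddings.\<close>

lemma attach_count:
  assumes B: "graph_class B" and conn: "connected_graph H"
    and X: "finite X" "\<And>G. G \<in> X \<Longrightarrow> wf_graph G \<and> verts G = {1..n}"
    and att: "\<And>G G'. G \<in> X \<Longrightarrow> attach_pendant H r G k G' \<Longrightarrow> G' \<in> B"
    and m: "\<And>G. G \<in> X \<Longrightarrow> card (pend H r G) + k * (card (verts H) + 1) * pend_mult H \<le> m"
  shows "card X * n ^ k * fact NN \<le> card (graphs_on B NN) * (m ^ k * fact n)"
proof -
  let ?xs = "{..<k} \<rightarrow>\<^sub>E {1..n}" and ?\<sigma> = "{\<sigma>. \<sigma> permutes {1..NN}}"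
  let ?Y = "{G \<in> graphs_on B NN. card (pend H r G) \<le> m}"
  have finY: "finite ?Y" using finite_graphs_on[OF B] by simp
  have wfY: "wf_graph G" if "G \<in> ?Y" for G using that graph_class_wf[OF B] by (auto simp: graphs_on_def)
  have "card X * n ^ k * fact NN = card (?\<sigma> \<times> X \<times> ?xs)"
    by (simp add: card_cartesian_product card_funcsetE card_permutations)
  also have "\<dots> \<le> card (Sigma ?Y (\<lambda>G'. perms_into H n k (pend H r G')))"
  proof (rule card_inj_on_le[of "\<lambda>(\<sigma>, G, xs). (relabel \<sigma> (glue H r n k G xs), \<sigma>)"])
    show "inj_on (\<lambda>(\<sigma>, G, xs). (relabel \<sigma> (glue H r n k G xs), \<sigma>)) (?\<sigma> \<times> X \<times> ?xs)"
    proof (rule inj_onI)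
      fix a b assume a: "a \<in> ?\<sigma> \<times> X \<times> ?xs" and b: "b \<in> ?\<sigma> \<times> X \<times> ?xs"
        and eq: "(\<lambda>(\<sigma>, G, xs). (relabel \<sigma> (glue H r n k G xs), \<sigma>)) a = (\<lambda>(\<sigma>, G, xs). (relabel \<sigma> (glue H r n k G xs), \<sigma>)) b"
      obtain \<sigma> G xs \<sigma>' G' ys where ab: "a = (\<sigma>, G, xs)" "b = (\<sigma>', G', ys)" by (cases a, cases b) blast
      have s: "\<sigma>' = \<sigma>" "relabel \<sigma> (glue H r n k G xs) = relabel \<sigma> (glue H r n k G' ys)" using eq ab by auto
      have i: "inv \<sigma> (\<sigma> y) = y" for y using a ab permutes_inverses(2) by auto
      have in1: "G \<in> X" "xs \<in> ?xs" "G' \<in> X" "ys \<in> ?xs" using a b ab by auto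
      have p: "xs \<in> {..<k} \<rightarrow> {1..n}" "ys \<in> {..<k} \<rightarrow> {1..n}" using in1 by auto
      have w: "wf_graph (glue H r n k G xs)" "wf_graph (glue H r n k G' ys)"
        using wf_glue X(2) in1 p by blast+
      have inj: "inj_on \<sigma> A" for A using i by (metis inj_on_def)
      have "glue H r n k G xs = glue H r n k G' ys"
        using relabel_inv[OF w(1) inj, of "inv \<sigma>"] relabel_inv[OF w(2) inj, of "inv \<sigma>"] i s(2) by metis
      then show "a = b" using glue_inj X(2) in1 ab s(1) by metis
    qed
    show "(\<lambda>(\<sigma>, G, xs). (relabel \<sigma> (glue H r n k G xs), \<sigma>)) ` (?\<sigma> \<times> X \<times> ?xs) \<subseteq> Sigma ?Y (\<lambda>G'. perms_into H n k (pend H r G'))"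
    proof (rule image_subsetI)
      fix a assume "a \<in> ?\<sigma> \<times> X \<times> ?xs"
      then obtain \<sigma> G xs where a: "a = (\<sigma>, G, xs)" "\<sigma> permutes {1..NN}" "G \<in> X" "xs \<in> ?xs" by blast
      have G: "wf_graph G" "verts G = {1..n}" and xs: "xs \<in> {..<k} \<rightarrow> {1..n}" using X(2)[OF a(3)] a(4) by auto
      have "glue H r n k G xs \<in> B" using att[OF a(3) attach_glue[OF G xs]] .
      from relabel_glue[OF G xs B this conn a(2) m[OF a(3)]]
      show "(\<lambda>(\<sigma>, G, xs). (relabel \<sigma> (glue H r n k G xs), \<sigma>)) a \<in> Sigma ?Y (\<lambda>G'. perms_into H n k (pend H r G'))"
        unfolding a(1) by simp
    qed
    show "finite (Sigma ?Y (\<lambda>G'. perms_into H n k (pend H r G')))"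
      using finY finite_perms_into by (intro finite_SigmaI)
  qed
  also have "\<dots> = (\<Sum>G'\<in>?Y. card (perms_into H n k (pend H r G')))"
    using finY finite_perms_into by simp
  also have "\<dots> \<le> (\<Sum>G'\<in>?Y. m ^ k * fact n)"
  proof (rule sum_mono)
    fix G' assume G': "G' \<in> ?Y"
    have "card (perms_into H n k (pend H r G')) \<le> card (pend H r G') ^ k * fact n"
      using card_perms_into_le[OF wfH finite_pend[OF wfH wfY[OF G']]] .
    also have "\<dots> \<le> m ^ k * fact n" using G' by (intro mult_right_mono power_mono) auto
    finally show "card (perms_into H n k (pend H r G')) \<le> m ^ k * fact n" .
  qed
  also have "\<dots> \<le> card (graphs_on B NN) * (m ^ k * fact n)"
    using card_mono[OF finite_graphs_on[OF B], of ?Y NN] by (simp add: mult_right_mono)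
  finally show ?thesis .
qed

section \<open>Detaching the copies selected by a permutation\<close>

context
  fixes G :: graph and \<sigma> :: "nat \<Rightarrow> nat"
  assumes wfG: "wf_graph G" and vG: "verts G = {1..NN}" and s: "\<sigma> \<in> perms_into H n k (pend H r G)"
begin

abbreviation "ph i \<equiv> restrict (\<sigma> \<circ> bl i) (verts H)"

lemma ph_pend: "i < k \<Longrightarrow> ph i \<in> pend H r G" using s by (simp add: perms_into_def)

lemma ph_image: "ph i ` verts H = \<sigma> ` bl i ` verts H" by (auto simp: image_comp)

lemma s_permutes: "\<sigma> permutes {1..NN}" using s by (simp add: perms_into_def)

lemma s_inj: "inj \<sigma>" using permutes_inj[OF s_permutes] .

lemma ph_disjoint: "i \<noteq> j \<Longrightarrow> ph i ` verts H \<inter> ph j ` verts H = {}"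
  using bl_disjoint[of i j] unfolding ph_image by (simp add: image_Int[OF s_inj, symmetric])

lemma ph_complement: "verts G - (\<Union>i<k. ph i ` verts H) = \<sigma> ` {1..n}"
proof -
  have "{1..n} \<inter> (\<Union>i<k. bl i ` verts H) = {}" using bl_base by blast
  then have "\<sigma> ` {1..n} \<inter> \<sigma> ` (\<Union>i<k. bl i ` verts H) = {}" by (simp add: image_Int[OF s_inj, symmetric])
  moreover have "\<sigma> ` {1..n} \<union> \<sigma> ` (\<Union>i<k. bl i ` verts H) = verts G"
    using permutes_image[OF s_permutes] Un_blocks vG by (metis image_Un)
  moreover have "(\<Union>i<k. ph i ` verts H) = \<sigma> ` (\<Union>i<k. bl i ` verts H)" unfolding ph_image by blast
  moreover have "A \<inter> B = {} \<Longrightarrow> A \<union> B = V \<Longrightarrow> V - B = A" for A B V :: "nat set" by blast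
  ultimately show ?thesis by metis
qed

lemma detach_ph: "detach_pendant H r G k (induced G (\<sigma> ` {1..n}))"
  unfolding detach_pendant_def
proof (intro exI[of _ "\<lambda>i. ph i ` verts H"] conjI allI impI)
  show "pendant_appearance H r G (ph i ` verts H)" if "i < k" for i
    using pend_appearance[OF wfH wfG r ph_pend[OF that]] .
  show "ph i ` verts H \<inter> ph j ` verts H = {}" if "i \<noteq> j" for i j using ph_disjoint[OF that] .
  show "induced G (\<sigma> ` {1..n}) = induced G (verts G - (\<Union>i<k. ph i ` verts H))" by (simp only: ph_complement)
qed

text \<open>Remainder, embeddings and neighbours determine the graph; this makes the detaching map
  in \<open>detach_count\<close> injective.\<close>

lemma edges_detached:
  "edges G = edges (induced G (\<sigma> ` {1..n})) \<union> (\<Union>i<k. edges (relabel (ph i) H)) \<union>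
     {{\<sigma> (bl i r), pend_nbr H r G (ph i)} | i. i < k}" (is "_ = ?R")
proof (intro equalityI subsetI)
  fix e assume e: "e \<in> edges G"
  show "e \<in> ?R"
  proof (cases "\<exists>i<k. e \<inter> ph i ` verts H \<noteq> {}")
    case True
    then obtain i where i: "i < k" "e \<inter> ph i ` verts H \<noteq> {}" by blast
    note p = ph_pend[OF i(1)]
    show ?thesis
    proof (cases "e \<subseteq> ph i ` verts H")
      case True
      then have "e \<in> edges (induced G (ph i ` verts H))" using e by (simp only: edges_induced) simp
      then have "e \<in> edges (relabel (ph i) H)" by (simp only: pendD(4)[OF p])
      then show ?thesis using i(1) by blast
    next
      case False
      then have "e \<in> boundary G (ph i ` verts H)" using e i(2) unfolding boundary_def by blast
      then have "e = {ph i r, pend_nbr H r G (ph i)}" unfolding pend_nbr(2)[OF p] by blast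
      then have "e = {\<sigma> (bl i r), pend_nbr H r G (ph i)}" using r by simp
      then show ?thesis using i(1) by (intro UnI2 CollectI exI[of _ i] conjI)
    qed
  next
    case False
    have "e \<subseteq> verts G" using wf_edge_subset[OF wfG e] .
    then have "e \<subseteq> verts G - (\<Union>i<k. ph i ` verts H)" using False by blast
    then have "e \<subseteq> \<sigma> ` {1..n}" by (simp only: ph_complement)
    then show ?thesis using e by simp
  qed
next
  fix e assume "e \<in> ?R"
  then consider "e \<in> edges (induced G (\<sigma> ` {1..n}))" | i where "i < k" "e \<in> edges (relabel (ph i) H)"
    | i where "i < k" "e = {\<sigma> (bl i r), pend_nbr H r G (ph i)}" by blast
  then show "e \<in> edges G"
  proof cases
    case 1 then show ?thesis by simp
  next
    case (2 i)
    then have "e \<in> edges (induced G (ph i ` verts H))" by (simp only: pendD(4)[OF ph_pend[OF 2(1)]])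
    then show ?thesis by simp
  next
    case (3 i)
    have "e = {ph i r, pend_nbr H r G (ph i)}" using 3 r by simp
    then have "e \<in> boundary G (ph i ` verts H)" using pend_nbr(2)[OF ph_pend[OF 3(1)]] by blast
    then show ?thesis by (simp add: boundary_def)
  qed
qed

end

text \<open>The reverse of \<open>attach_count\<close>. By the greedy bound, a graph with at least
  \<open>m\<close> pendant embeddings admits many permutations that carry the blocks to disjoint
  pendant copies. The permutation is remembered together with the remainder, moved back to
  \<open>{1..n}\<close>, and the neighbours of the copies.\<close>

lemma detach_count:
  assumes B: "graph_class B" and conn: "connected_graph H"
    and X: "finite X" "\<And>G. G \<in> X \<Longrightarrow> wf_graph G \<and> verts G = {1..NN}"
    and det: "\<And>G G'. G \<in> X \<Longrightarrow> detach_pendant H r G k G' \<Longrightarrow> G' \<in> B"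
    and m: "\<And>G. G \<in> X \<Longrightarrow> m \<le> card (pend H r G)"
  shows "card X * ((m - k * card (verts H) * pend_mult H) ^ k * fact n)
     \<le> fact NN * card (graphs_on B n) * NN ^ k"
proof -
  \<comment> \<open>The neighbour of one copy may lie in another detached copy, so the values range
    over all NN labels and not only over those of the remainder.\<close>
  let ?xs = "{..<k} \<rightarrow>\<^sub>E {1..NN}" and ?\<sigma> = "{\<sigma>. \<sigma> permutes {1..NN}}"
  let ?f = "\<lambda>(G, \<sigma>). (\<sigma>, relabel (inv \<sigma>) (induced G (\<sigma> ` {1..n})),
      \<lambda>i\<in>{..<k}. pend_nbr H r G (restrict (\<sigma> \<circ> bl i) (verts H)))"
  let ?S = "Sigma X (\<lambda>G. perms_into H n k (pend H r G))"
  have "card X * ((m - k * card (verts H) * pend_mult H) ^ k * fact n)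
      = (\<Sum>G\<in>X. (m - k * card (verts H) * pend_mult H) ^ k * fact n)" by simp
  also have "\<dots> \<le> (\<Sum>G\<in>X. card (perms_into H n k (pend H r G)))"
  proof (rule sum_mono)
    fix G assume G: "G \<in> X"
    have wfG: "wf_graph G" "verts G = {1..NN}" using X(2)[OF G] by auto
    have "(m - k * card (verts H) * pend_mult H) ^ k * fact n
        \<le> (card (pend H r G) - k * card (verts H) * pend_mult H) ^ k * fact n"
      using m[OF G] by (intro mult_right_mono power_mono) auto
    also have "\<dots> \<le> card (perms_into H n k (pend H r G))"
    proof (rule card_perms_into_ge[OF wfH finite_pend[OF wfH wfG(1)] card_pend_through[OF wfH wfG(1) conn]])
      fix \<phi> assume "\<phi> \<in> pend H r G"
      then show "\<phi> \<in> extensional (verts H) \<and> inj_on \<phi> (verts H) \<and> \<phi> ` verts H \<subseteq> {1..n + k * card (verts H)}"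
        using pendD[of \<phi> H r G] wfG(2) by simp
    qed
    finally show "(m - k * card (verts H) * pend_mult H) ^ k * fact n \<le> card (perms_into H n k (pend H r G))" .
  qed
  also have "\<dots> = card ?S" using X(1) finite_perms_into by simp
  also have "\<dots> \<le> card (?\<sigma> \<times> graphs_on B n \<times> ?xs)"
  proof (rule card_inj_on_le[of ?f])
    show "finite (?\<sigma> \<times> graphs_on B n \<times> ?xs)"
      by (intro finite_cartesian_product finite_PiE finite_graphs_on B finite_permutations) auto
    show "inj_on ?f ?S"
    proof (rule inj_onI)
      fix a b assume a: "a \<in> ?S" and b: "b \<in> ?S" and eq: "?f a = ?f b"
      obtain G \<sigma> G' \<sigma>' where ab: "a = (G, \<sigma>)" "b = (G', \<sigma>')" by (cases a, cases b) blast
      have s: "\<sigma>' = \<sigma>" using eq ab by simp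
      have G: "wf_graph G" "verts G = {1..NN}" "\<sigma> \<in> perms_into H n k (pend H r G)"
        and G': "wf_graph G'" "verts G' = {1..NN}" "\<sigma> \<in> perms_into H n k (pend H r G')"
        using a b ab s X(2) by auto
      have i: "\<sigma> (inv \<sigma> y) = y" for y using permutes_inverses(1)[OF s_permutes[OF G]] .
      have inj: "inj_on (inv \<sigma>) A" for A using i by (metis inj_on_def)
      have "relabel (inv \<sigma>) (induced G (\<sigma> ` {1..n})) = relabel (inv \<sigma>) (induced G' (\<sigma> ` {1..n}))"
        using eq ab s by simp
      moreover have "wf_graph (induced G (\<sigma> ` {1..n}))" "wf_graph (induced G' (\<sigma> ` {1..n}))"
        using wf_induced G G' by auto
      ultimately have base: "induced G (\<sigma> ` {1..n}) = induced G' (\<sigma> ` {1..n})"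
        using relabel_inv[OF _ inj, of _ \<sigma>] i by metis
      have nb: "pend_nbr H r G (restrict (\<sigma> \<circ> bl i) (verts H)) = pend_nbr H r G' (restrict (\<sigma> \<circ> bl i) (verts H))"
        if "i < k" for i
      proof -
        have "(\<lambda>i\<in>{..<k}. pend_nbr H r G (restrict (\<sigma> \<circ> bl i) (verts H))) =
          (\<lambda>i\<in>{..<k}. pend_nbr H r G' (restrict (\<sigma> \<circ> bl i) (verts H)))" using eq ab s by simp
        from fun_cong[OF this, of i] show ?thesis using that by simp
      qed
      have ne: "{{\<sigma> (bl i r), pend_nbr H r G (restrict (\<sigma> \<circ> bl i) (verts H))} | i. i < k} =
          {{\<sigma> (bl i r), pend_nbr H r G' (restrict (\<sigma> \<circ> bl i) (verts H))} | i. i < k}"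
        by (rule Collect_cong) (metis nb)
      have "edges G = edges G'"
        by (subst edges_detached[OF G], subst edges_detached[OF G']) (simp only: base ne)
      then have "G = G'" using G G' by (intro graph_eqI) auto
      then show "a = b" using ab s by simp
    qed
    show "?f ` ?S \<subseteq> ?\<sigma> \<times> graphs_on B n \<times> ?xs"
    proof (rule image_subsetI)
      fix a assume a: "a \<in> ?S"
      then obtain G \<sigma> where ab: "a = (G, \<sigma>)" "G \<in> X" "\<sigma> \<in> perms_into H n k (pend H r G)" by blast
      have G: "wf_graph G" "verts G = {1..NN}" using X(2)[OF ab(2)] by auto
      note sp = s_permutes[OF G ab(3)]
      have i: "\<sigma> (inv \<sigma> y) = y" "inv \<sigma> (\<sigma> y) = y" for y using permutes_inverses[OF sp] by auto
      have inj: "inj_on (inv \<sigma>) A" for A using i by (metis inj_on_def)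
      have "induced G (\<sigma> ` {1..n}) \<in> B" using det[OF ab(2) detach_ph[OF G ab(3)]] .
      then have "relabel (inv \<sigma>) (induced G (\<sigma> ` {1..n})) \<in> B" using graph_class_relabel[OF B _ inj] by blast
      then have "relabel (inv \<sigma>) (induced G (\<sigma> ` {1..n})) \<in> graphs_on B n"
        using i by (simp add: graphs_on_def image_image)
      moreover have "pend_nbr H r G (restrict (\<sigma> \<circ> bl i) (verts H)) \<in> {1..NN}" if "i < k" for i
        using pend_nbr(1)[OF ph_pend[OF G ab(3) that]] G by blast
      ultimately show "?f a \<in> ?\<sigma> \<times> graphs_on B n \<times> ?xs" unfolding ab(1) using sp by simp
    qed
  qed
  also have "\<dots> = fact NN * card (graphs_on B n) * NN ^ k"
    by (simp add: card_cartesian_product card_funcsetE card_permutations)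
  finally show ?thesis .
qed

end

section \<open>Concentration of the number of pendant embeddings\<close>

text \<open>The factor (1 + \<eta>) / (1 - \<eta>) is the uncertainty of the growth rate per vertex.
  By continuity at 0 it can be made so close to 1 that even \<open>L\<close> such factors do not
  cancel the gain \<open>q\<close> of one copy.\<close>

lemma exists_ratio_power_less_one:
  fixes q :: real assumes "q < 1"
  shows "\<exists>\<eta>. 0 < \<eta> \<and> \<eta> < 1 \<and> ((1 + \<eta>) / (1 - \<eta>)) ^ L * q < 1"
proof -
  have "((\<lambda>\<eta>::real. ((1 + \<eta>) / (1 - \<eta>)) ^ L * q) \<longlongrightarrow> ((1 + 0) / (1 - 0)) ^ L * q) (at_right 0)"
    by (intro tendsto_intros) auto
  then have "((\<lambda>\<eta>::real. ((1 + \<eta>) / (1 - \<eta>)) ^ L * q) \<longlongrightarrow> q) (at_right 0)" by simp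
  then have "\<forall>\<^sub>F \<eta> in at_right 0. ((1 + \<eta>) / (1 - \<eta>)) ^ L * q < 1"
    using assms by (rule order_tendstoD)
  moreover have "\<forall>\<^sub>F \<eta> in at_right (0::real). \<eta> \<in> {0<..<1}" by (rule eventually_at_right_real) simp
  ultimately have "\<forall>\<^sub>F \<eta> in at_right 0. 0 < \<eta> \<and> \<eta> < 1 \<and> ((1 + \<eta>) / (1 - \<eta>)) ^ L * q < 1"
    by eventually_elim auto
  then show ?thesis using eventually_happens' trivial_limit_at_right_real by blast
qed

text \<open>Rare graphs will be weighted by quantities that grow polynomially in n; this keeps their
  contribution negligible.\<close>

lemma exponential_beats_power:
  fixes f :: "nat \<Rightarrow> real"
  assumes f: "\<forall>\<^sub>F n in sequentially. 0 \<le> f n \<and> f n \<le> K * \<theta> ^ (n div L)"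
    and \<theta>: "0 < \<theta>" "\<theta> < 1" and L: "L > 0" and K: "K \<ge> 0"
  shows "(\<lambda>n. f n * real n ^ p) \<longlonglongrightarrow> 0"
proof -
  have 1: "(\<lambda>k. real (Suc k) ^ p * \<theta> ^ k) \<longlonglongrightarrow> 0"
  proof -
    have "(\<lambda>k. real k ^ p * \<theta> ^ k) \<longlonglongrightarrow> 0"
    proof (cases "p = 0")
      case True
      then show ?thesis using \<theta> by (simp add: LIMSEQ_realpow_zero)
    next
      case False
      \<comment> \<open>Write k^p \<theta>^k as the p-th power of k times the k-th power of the p-th
        root of \<theta>, which reduces the claim to the linear case.\<close>
      have "norm (root p \<theta>) < 1" using \<theta> False by simp
      then have "(\<lambda>k. of_nat k * root p \<theta> ^ k) \<longlonglongrightarrow> 0" by (rule powser_times_n_limit_0)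
      then have "(\<lambda>k. (of_nat k * root p \<theta> ^ k) ^ p) \<longlonglongrightarrow> 0 ^ p" by (intro tendsto_intros)
      moreover have "(of_nat k * root p \<theta> ^ k) ^ p = real k ^ p * \<theta> ^ k" for k
      proof -
        have "(root p \<theta> ^ k) ^ p = (root p \<theta> ^ p) ^ k" by (simp add: power_mult[symmetric] mult.commute)
        then show ?thesis using False \<theta> by (simp add: power_mult_distrib)
      qed
      ultimately show ?thesis using False by (simp add: zero_power)
    qed
    then have "(\<lambda>k. real (Suc k) ^ p * \<theta> ^ Suc k) \<longlonglongrightarrow> 0" by (rule LIMSEQ_Suc)
    then have "(\<lambda>k. (1 / \<theta>) * (real (Suc k) ^ p * \<theta> ^ Suc k)) \<longlonglongrightarrow> (1 / \<theta>) * 0" by (intro tendsto_intros)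
    then show ?thesis using \<theta> by (simp add: field_simps)
  qed
  have "filterlim (\<lambda>n. n div L) at_top sequentially"
    unfolding filterlim_at_top
  proof
    fix Z :: nat
    have "Z \<le> n div L" if "n \<ge> Z * L" for n using that L by (simp add: less_eq_div_iff_mult_less_eq)
    then show "\<forall>\<^sub>F n in sequentially. Z \<le> n div L" unfolding eventually_sequentially by blast
  qed
  from filterlim_compose[OF 1 this]
  have "(\<lambda>n. real (Suc (n div L)) ^ p * \<theta> ^ (n div L)) \<longlonglongrightarrow> 0" .
  then have "(\<lambda>n. K * real L ^ p * (real (Suc (n div L)) ^ p * \<theta> ^ (n div L))) \<longlonglongrightarrow> K * real L ^ p * 0"
    by (intro tendsto_intros)
  then have lim: "(\<lambda>n. K * real L ^ p * (real (Suc (n div L)) ^ p * \<theta> ^ (n div L))) \<longlonglongrightarrow> 0" by simp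
  show ?thesis
  proof (rule tendsto_sandwich[OF _ _ tendsto_const lim])
    show "\<forall>\<^sub>F n in sequentially. 0 \<le> f n * real n ^ p" using f by eventually_elim simp
    show "\<forall>\<^sub>F n in sequentially. f n * real n ^ p \<le> K * real L ^ p * (real (Suc (n div L)) ^ p * \<theta> ^ (n div L))"
      using f
    proof eventually_elim
      case (elim n)
      have "n \<le> L * Suc (n div L)" using dividend_less_times_div[OF L, of n] by simp
      then have "real n \<le> real (L * Suc (n div L))" by (rule of_nat_mono)
      then have "real n ^ p \<le> (real L * real (Suc (n div L))) ^ p"
        by (intro power_mono) (auto simp: algebra_simps)
      then have "f n * real n ^ p \<le> (K * \<theta> ^ (n div L)) * (real L * real (Suc (n div L))) ^ p"
        using elim K \<theta> by (intro mult_mono) auto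
      then show ?case by (simp add: power_mult_distrib mult_ac)
    qed
  qed
qed

locale growth_class =
  fixes \<A> :: "graph set" and \<gamma> :: real
  assumes A: "graph_class \<A>" and growth: "has_growth_constant \<A> \<gamma>"
begin

definition "\<rho> = 1 / \<gamma>"

abbreviation an :: "nat \<Rightarrow> real" where "an n \<equiv> real (card (graphs_on \<A> n))"

lemma gamma_pos: "\<gamma> > 0" using growth by (simp add: has_growth_constant_def)

lemma rho_pos: "\<rho> > 0" using gamma_pos by (simp add: \<rho>_def)

lemma growth_lower:
  assumes "0 < \<eta>" "\<eta> < 1"
  shows "\<forall>\<^sub>F n in sequentially. (\<gamma> * (1 - \<eta>)) ^ n \<le> an n / fact n"
proof -
  have "(\<lambda>n. root n (an n / fact n)) \<longlonglongrightarrow> \<gamma>" using growth by (simp add: has_growth_constant_def)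
  moreover have "\<gamma> * (1 - \<eta>) < \<gamma>" using gamma_pos assms by (simp add: algebra_simps)
  ultimately have "\<forall>\<^sub>F n in sequentially. \<gamma> * (1 - \<eta>) < root n (an n / fact n)" by (rule order_tendstoD)
  moreover have "\<forall>\<^sub>F n in sequentially. n > 0" by (rule eventually_gt_at_top)
  ultimately show ?thesis
  proof eventually_elim
    case (elim n)
    have "(\<gamma> * (1 - \<eta>)) ^ n \<le> root n (an n / fact n) ^ n"
      using elim gamma_pos assms by (intro power_mono) auto
    then show ?case using elim by simp
  qed
qed

lemma an_pos: "\<forall>\<^sub>F n in sequentially. an n > 0"
proof -
  have "\<forall>\<^sub>F n in sequentially. (\<gamma> * (1 - 1 / 2)) ^ n \<le> an n / fact n" by (rule growth_lower) auto
  then show ?thesis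
  proof eventually_elim
    case (elim n)
    have "(\<gamma> * (1 - 1 / 2)) ^ n > 0" using gamma_pos by simp
    then have "0 < an n / fact n" using elim by linarith
    then show ?case by (simp add: zero_less_divide_iff)
  qed
qed

text \<open>Equal radii control only the upper limit for \<open>\<B>\<close>, so only upper bounds
  are available there; the true limit for \<open>\<A>\<close> supplies the lower bounds in
  \<open>growth_lower\<close>.\<close>

lemma growth_upper:
  assumes B: "graph_class \<B>" and rho: "rho_class \<B> = rho_class \<A>" and "0 < \<eta>"
  shows "\<forall>\<^sub>F n in sequentially. real (card (graphs_on \<B> n)) / fact n \<le> (\<gamma> * (1 + \<eta>)) ^ n"
proof -
  let ?b = "\<lambda>n. root n (real (card (graphs_on \<B> n)) / fact n)"
  have "(\<lambda>n. ereal (root n (an n / fact n))) \<longlonglongrightarrow> ereal \<gamma>"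
    using growth by (simp add: has_growth_constant_def)
  then have "limsup (\<lambda>n. ereal (root n (an n / fact n))) = ereal \<gamma>"
    using lim_imp_Limsup trivial_limit_sequentially by blast
  then have "inverse (limsup (\<lambda>n. ereal (?b n))) = inverse (ereal \<gamma>)"
    using rho by (simp add: rho_class_def)
  then have "limsup (\<lambda>n. ereal (?b n)) = ereal \<gamma>"
  proof -
    assume a: "inverse (limsup (\<lambda>n. ereal (?b n))) = inverse (ereal \<gamma>)"
    have nn: "limsup (\<lambda>n. ereal (?b n)) \<ge> 0" by (intro le_Limsup always_eventually) (auto simp: trivial_limit_sequentially real_root_ge_zero)
    show ?thesis
    proof (cases "limsup (\<lambda>n. ereal (?b n))")
      case (real x)
      then show ?thesis using a gamma_pos by (auto split: if_splits)
    qed (use a nn gamma_pos in auto)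
  qed
  moreover have "ereal \<gamma> < ereal (\<gamma> * (1 + \<eta>))" using gamma_pos assms by (simp add: algebra_simps)
  ultimately have "limsup (\<lambda>n. ereal (?b n)) < ereal (\<gamma> * (1 + \<eta>))" by simp
  then have "\<forall>\<^sub>F n in sequentially. ereal (?b n) < ereal (\<gamma> * (1 + \<eta>))" by (rule Limsup_lessD)
  moreover have "\<forall>\<^sub>F n in sequentially. n > 0" by (rule eventually_gt_at_top)
  ultimately show ?thesis
  proof eventually_elim
    case (elim n)
    then have "?b n ^ n \<le> (\<gamma> * (1 + \<eta>)) ^ n" by (intro power_mono) auto
    then show ?case using elim by simp
  qed
qed

context
  fixes H :: graph and r :: nat
  assumes wfH: "wf_graph H" and r: "r \<in> verts H" and conn: "connected_graph H"
begin

abbreviation "hh \<equiv> card (verts H)"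

text \<open>Attaching about n/L copies to a graph with few pendant embeddings gives a graph in
  \<open>\<B>\<close> that still has at most \<open>m\<close> of them, roughly (\<rho>^h -
  \<epsilon>/2) n. Each copy offers n attachment points but is recovered in at most \<open>m\<close>
  ways, so against the growth of \<open>\<B>\<close> each copy costs the set a factor 1 - \<gamma>^h
  \<epsilon>/2.\<close>

lemma lower_tail:
  assumes \<delta>: "\<delta> > 0" and B: "graph_class \<B>" "rho_class \<B> = rho_class \<A>"
    and att: "\<forall>\<^sub>F n in sequentially. \<forall>G\<in>graphs_on \<A> n. \<forall>k G'.
          real k \<le> \<delta> * real n \<and> attach_pendant H r G k G' \<longrightarrow> G' \<in> \<B>"
    and \<epsilon>: "\<epsilon> > 0"
  shows "(\<lambda>n. real (card {G \<in> graphs_on \<A> n. real (card (pend H r G)) < (\<rho> ^ hh - \<epsilon>) * n}) / an n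
      * real n ^ p) \<longlonglongrightarrow> 0"
proof -
  let ?X = "\<lambda>n. {G \<in> graphs_on \<A> n. real (card (pend H r G)) < (\<rho> ^ hh - \<epsilon>) * n}"
  define D where "D = (hh + 1) * pend_mult H"
  \<comment> \<open>The bound 1/\<delta> keeps n div L within the allowed \<delta>n attachments. The
    bound 2D/\<epsilon> ensures that the new pendant embeddings, at most D per copy, use up only
    half of the margin \<epsilon>n.\<close>
  obtain L :: nat where L0: "real L > max (1 / \<delta>) (2 * real D / \<epsilon>)" using reals_Archimedean2 by blast
  then have L: "1 / \<delta> < real L" "2 * real D / \<epsilon> < real L" by auto
  moreover have "1 / \<delta> > 0" using \<delta> by simp
  ultimately have Lpos: "L > 0" by (metis of_nat_0_less_iff order_less_trans)
  \<comment> \<open>The maximum with 1/2 keeps \<open>q\<close> positive when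
    \<open>\<epsilon>\<close> is large.\<close>
  define q where "q = max (1 - \<gamma> ^ hh * \<epsilon> / 2) (1 / 2)"
  have q: "0 < q" "q < 1" using \<epsilon> gamma_pos by (auto simp: q_def)
  \<comment> \<open>One factor of uncertainty is paid per vertex: about L for the base vertices
    allotted to a copy, and h for the copy itself.\<close>
  obtain \<eta> where \<eta>: "0 < \<eta>" "\<eta> < 1" "((1 + \<eta>) / (1 - \<eta>)) ^ (L + hh) * q < 1"
    using exists_ratio_power_less_one[OF q(2)] by blast
  define y where "y = (1 + \<eta>) / (1 - \<eta>)"
  have y: "y \<ge> 1 + \<eta>" "y \<ge> 1"
  proof -
    have "(1 + \<eta>) * (1 - \<eta>) \<le> 1 + \<eta>" using \<eta> by (simp add: algebra_simps)
    then show "y \<ge> 1 + \<eta>" using \<eta> by (simp add: y_def pos_le_divide_eq)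
    then show "y \<ge> 1" using \<eta> by simp
  qed
  have bound: "real (card (?X n)) / an n \<le> y ^ L * (y ^ (L + hh) * q) ^ (n div L)"
    if n: "n > 0" and attn: "\<forall>G\<in>graphs_on \<A> n. \<forall>k G'. real k \<le> \<delta> * real n \<and> attach_pendant H r G k G' \<longrightarrow> G' \<in> \<B>"
      and lo: "(\<gamma> * (1 - \<eta>)) ^ n \<le> an n / fact n"
      and up: "\<forall>N\<ge>n. real (card (graphs_on \<B> N)) / fact N \<le> (\<gamma> * (1 + \<eta>)) ^ N" for n
  proof (cases "?X n = {}")
    case True
    then show ?thesis using y q by (simp only: True) simp
  next
    case False
    define k where "k = n div L"
    define N where "N = n + k * hh"
    have kL: "real k * real L \<le> real n" using div_times_less_eq_dividend[of n L] unfolding k_def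
      by (metis of_nat_le_iff of_nat_mult)
    have k\<delta>: "real k \<le> \<delta> * real n"
    proof -
      have "1 \<le> \<delta> * real L" using L(1) \<delta> by (simp add: field_simps)
      then have "real k \<le> real k * (\<delta> * real L)" by (simp add: mult_le_cancel_left1)
      also have "\<dots> \<le> \<delta> * real n" using kL \<delta> by (simp add: mult.left_commute)
      finally show ?thesis .
    qed
    have kD: "real k * real D \<le> \<epsilon> / 2 * real n"
    proof -
      have "2 * real D \<le> \<epsilon> * real L" using L(2) \<epsilon> by (simp add: field_simps)
      then have "real k * (2 * real D) \<le> real k * (\<epsilon> * real L)" by (rule mult_left_mono) simp
      also have "\<dots> \<le> \<epsilon> * real n" using kL \<epsilon> by (simp add: mult.left_commute)
      finally show ?thesis by simp
    qed
    define m where "m = nat \<lfloor>(\<rho> ^ hh - \<epsilon> / 2) * n\<rfloor>"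
    have mG: "card (pend H r G) + k * (hh + 1) * pend_mult H \<le> m" if "G \<in> ?X n" for G
    proof -
      have "real (card (pend H r G) + k * (hh + 1) * pend_mult H) = real (card (pend H r G)) + real k * real D"
        by (simp add: D_def algebra_simps)
      also have "\<dots> \<le> (\<rho> ^ hh - \<epsilon> / 2) * n" using that kD by (simp add: algebra_simps)
      finally show ?thesis unfolding m_def by (simp add: le_nat_floor)
    qed
    \<comment> \<open>A member has a nonnegative count below the threshold, so the threshold is
      positive and \<rho>^h exceeds \<epsilon>.\<close>
    obtain G0 where "G0 \<in> ?X n" using False by blast
    then have "0 < (\<rho> ^ hh - \<epsilon>) * n" by (metis (mono_tags, lifting) mem_Collect_eq of_nat_0_le_iff order_le_less_trans)
    then have pos: "0 < \<rho> ^ hh - \<epsilon> / 2" using n \<epsilon> by (simp add: zero_less_mult_iff)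
    have mle: "real m \<le> (\<rho> ^ hh - \<epsilon> / 2) * n" using pos n unfolding m_def by simp
    have Xfin: "finite (?X n)" using finite_graphs_on[OF A] by simp
    have Xwf: "\<And>G. G \<in> ?X n \<Longrightarrow> wf_graph G \<and> verts G = {1..n}"
      using graph_class_wf[OF A] by (auto simp: graphs_on_def)
    have "card (?X n) * n ^ k * fact N \<le> card (graphs_on \<B> N) * (m ^ k * fact n)"
      unfolding N_def using attn k\<delta> by (intro attach_count[OF wfH r B(1) conn Xfin Xwf _ mG]) auto
    then have "real (card (?X n) * n ^ k * fact N) \<le> real (card (graphs_on \<B> N) * (m ^ k * fact n))"
      by (rule of_nat_mono)
    then have "real (card (?X n)) * real n ^ k * fact N \<le> real (card (graphs_on \<B> N)) * (real m ^ k * fact n)"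
      by simp
    then have "real (card (?X n)) / fact n * real n ^ k \<le> real (card (graphs_on \<B> N)) / fact N * real m ^ k"
      by (simp add: field_simps)
    also have "\<dots> \<le> (\<gamma> * (1 + \<eta>)) ^ N * ((\<rho> ^ hh - \<epsilon> / 2) * n) ^ k"
      using up mle gamma_pos \<eta> by (intro mult_mono power_mono) (auto simp: N_def)
    also have "\<dots> = ((\<gamma> * (1 + \<eta>)) ^ N * (\<rho> ^ hh - \<epsilon> / 2) ^ k) * real n ^ k" by (simp add: power_mult_distrib)
    finally have "real (card (?X n)) / fact n \<le> (\<gamma> * (1 + \<eta>)) ^ N * (\<rho> ^ hh - \<epsilon> / 2) ^ k"
      by (rule mult_right_le_imp_le) (use n in simp)
    also have "\<dots> = (\<gamma> * (1 + \<eta>)) ^ n * ((1 + \<eta>) ^ hh * (\<gamma> ^ hh * (\<rho> ^ hh - \<epsilon> / 2))) ^ k"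
      by (simp add: N_def power_add power_mult_distrib power_mult[symmetric] mult_ac)
    also have "\<gamma> ^ hh * (\<rho> ^ hh - \<epsilon> / 2) = 1 - \<gamma> ^ hh * \<epsilon> / 2"
      using gamma_pos by (simp add: \<rho>_def right_diff_distrib power_mult_distrib[symmetric])
    also have "(\<gamma> * (1 + \<eta>)) ^ n * ((1 + \<eta>) ^ hh * (1 - \<gamma> ^ hh * \<epsilon> / 2)) ^ k \<le> (\<gamma> * (1 + \<eta>)) ^ n * (y ^ hh * q) ^ k"
    proof -
      have "0 < \<gamma> ^ hh * (\<rho> ^ hh - \<epsilon> / 2)" using pos gamma_pos by simp
      also have "\<gamma> ^ hh * (\<rho> ^ hh - \<epsilon> / 2) = 1 - \<gamma> ^ hh * \<epsilon> / 2"
        using gamma_pos by (simp add: \<rho>_def right_diff_distrib power_mult_distrib[symmetric])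
      finally show ?thesis using y \<eta> gamma_pos q
        by (intro mult_left_mono power_mono mult_mono) (auto simp: q_def)
    qed
    finally have 1: "real (card (?X n)) / fact n \<le> (\<gamma> * (1 + \<eta>)) ^ n * (y ^ hh * q) ^ k" .
    have lopos: "(\<gamma> * (1 - \<eta>)) ^ n > 0" using gamma_pos \<eta> by simp
    have "real (card (?X n)) / an n = (real (card (?X n)) / fact n) / (an n / fact n)" by simp
    also have "\<dots> \<le> (\<gamma> * (1 + \<eta>)) ^ n * (y ^ hh * q) ^ k / (\<gamma> * (1 - \<eta>)) ^ n"
      using 1 lo lopos y q gamma_pos \<eta> by (intro frac_le) auto
    also have "\<dots> = y ^ n * (y ^ hh * q) ^ k"
      using gamma_pos \<eta> by (simp add: y_def power_mult_distrib power_divide)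
    also have "\<dots> \<le> y ^ (L * Suc k) * (y ^ hh * q) ^ k"
    proof -
      have "n \<le> L * Suc k" using dividend_less_times_div[OF Lpos, of n] by (simp add: k_def)
      then show ?thesis using y q by (intro mult_right_mono power_increasing) auto
    qed
    also have "\<dots> = y ^ L * (y ^ (L + hh) * q) ^ k"
      by (simp add: power_add power_mult power_mult_distrib mult_ac)
    finally show ?thesis by (simp add: k_def)
  qed
  obtain N0 where N0: "\<forall>N\<ge>N0. real (card (graphs_on \<B> N)) / fact N \<le> (\<gamma> * (1 + \<eta>)) ^ N"
    using growth_upper[OF B \<eta>(1)] unfolding eventually_sequentially by blast
  have "\<forall>\<^sub>F n in sequentially. 0 \<le> real (card (?X n)) / an n \<and>
      real (card (?X n)) / an n \<le> y ^ L * (y ^ (L + hh) * q) ^ (n div L)"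
    using eventually_gt_at_top[of 0] att growth_lower[OF \<eta>(1,2)] eventually_ge_at_top[of N0]
  proof eventually_elim
    case (elim n)
    then have "\<forall>N\<ge>n. real (card (graphs_on \<B> N)) / fact N \<le> (\<gamma> * (1 + \<eta>)) ^ N" using N0 by auto
    then show ?case using bound[OF elim(1,2,3)] by simp
  qed
  then show ?thesis
    by (rule exponential_beats_power) (use Lpos y q \<eta> in \<open>auto simp: y_def\<close>)
qed

text \<open>Now copies are detached. A graph with too many pendant embeddings offers at least
  (\<rho>^h + \<epsilon>/2) n choices for each copy, while its neighbour, one of n labels, suffices
  to restore it. Each copy thus costs the set a factor \<rho>^h / (\<rho>^h + \<epsilon>/2).\<close>

lemma upper_tail:
  assumes \<delta>: "\<delta> > 0" and B: "graph_class \<B>" "rho_class \<B> = rho_class \<A>"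
    and det: "\<forall>\<^sub>F n in sequentially. \<forall>G\<in>graphs_on \<A> n. \<forall>k G'.
          real k \<le> \<delta> * real n \<and> detach_pendant H r G k G' \<longrightarrow> G' \<in> \<B>"
    and \<epsilon>: "\<epsilon> > 0"
  shows "(\<lambda>n. real (card {G \<in> graphs_on \<A> n. real (card (pend H r G)) > (\<rho> ^ hh + \<epsilon>) * n}) / an n
      * real n ^ p) \<longlonglongrightarrow> 0"
proof -
  let ?X = "\<lambda>n. {G \<in> graphs_on \<A> n. real (card (pend H r G)) > (\<rho> ^ hh + \<epsilon>) * n}"
  define D where "D = hh * pend_mult H"
  \<comment> \<open>The bound 1/\<delta> keeps the number of copies within \<delta>n. The bound
    4D/\<epsilon> limits the embeddings spoilt by disjointness to \<epsilon>n/4; another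
    \<epsilon>n/4 pays for rounding \<open>m\<close> down. With 2h < L at least half of the vertices
    survive, so the growth bound applies to the remainder.\<close>
  obtain L :: nat where L0: "real L > max (max (1 / \<delta>) (4 * real D / \<epsilon>)) (2 * real hh)" using reals_Archimedean2 by blast
  then have L: "1 / \<delta> < real L" "4 * real D / \<epsilon> < real L" "2 * hh < L" by auto
  then have Lpos: "L > 0" by simp
  define q where "q = \<rho> ^ hh / (\<rho> ^ hh + \<epsilon> / 2)"
  have rp: "\<rho> ^ hh > 0" using rho_pos by simp
  have q: "0 < q" "q < 1" using \<epsilon> rp by (auto simp: q_def add_pos_pos)
  obtain \<eta> where \<eta>: "0 < \<eta>" "\<eta> < 1" "((1 + \<eta>) / (1 - \<eta>)) ^ L * q < 1"
    using exists_ratio_power_less_one[OF q(2)] by blast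
  define y where "y = (1 + \<eta>) / (1 - \<eta>)"
  have y: "y \<ge> 1" using \<eta> by (simp add: y_def)
  obtain N0 where N0: "\<forall>N\<ge>N0. real (card (graphs_on \<B> N)) / fact N \<le> (\<gamma> * (1 + \<eta>)) ^ N"
    using growth_upper[OF B \<eta>(1)] unfolding eventually_sequentially by blast
  have bound: "real (card (?X n)) / an n \<le> y ^ L * (y ^ L * q) ^ (n div L)"
    if n: "n > 0" and detn: "\<forall>G\<in>graphs_on \<A> n. \<forall>k G'. real k \<le> \<delta> * real n \<and> detach_pendant H r G k G' \<longrightarrow> G' \<in> \<B>"
      and lo: "(\<gamma> * (1 - \<eta>)) ^ n \<le> an n / fact n"
      and nN: "n \<ge> 2 * N0" and n\<epsilon>: "real n * \<epsilon> \<ge> 4" for n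
  proof -
    define k where "k = n div L"
    have kLn: "k * L \<le> n" using div_times_less_eq_dividend[of n L] by (simp add: k_def)
    then have kL: "real k * real L \<le> real n" by (metis of_nat_le_iff of_nat_mult)
    have "k * (2 * hh) \<le> k * L" using L(3) by (intro mult_left_mono) auto
    then have kh: "2 * (k * hh) \<le> n" using kLn by (metis mult.left_commute order_trans)
    define n0 where "n0 = n - k * hh"
    have n0: "n = n0 + k * hh" "n0 \<ge> N0" using kh nN by (auto simp: n0_def)
    have k\<delta>: "real k \<le> \<delta> * real n"
    proof -
      have "1 \<le> \<delta> * real L" using L(1) \<delta> by (simp add: field_simps)
      then have "real k \<le> real k * (\<delta> * real L)" by (simp add: mult_le_cancel_left1)
      also have "\<dots> \<le> \<delta> * real n" using kL \<delta> by (simp add: mult.left_commute)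
      finally show ?thesis .
    qed
    have kD: "real k * real D \<le> \<epsilon> / 4 * real n"
    proof -
      have "4 * real D \<le> \<epsilon> * real L" using L(2) \<epsilon> by (simp add: field_simps)
      then have "real k * (4 * real D) \<le> real k * (\<epsilon> * real L)" by (rule mult_left_mono) simp
      also have "\<dots> \<le> \<epsilon> * real n" using kL \<epsilon> by (simp add: mult.left_commute)
      finally show ?thesis by simp
    qed
    define m where "m = nat \<lfloor>(\<rho> ^ hh + \<epsilon>) * n\<rfloor>"
    have mG: "m \<le> card (pend H r G)" if "G \<in> ?X n" for G
      using that unfolding m_def by (simp add: nat_le_iff floor_le_iff)
    have "real m \<ge> (\<rho> ^ hh + \<epsilon>) * n - 1" unfolding m_def by linarith
    then have mm: "real (m - k * hh * pend_mult H) \<ge> (\<rho> ^ hh + \<epsilon> / 2) * n"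
    proof -
      assume a: "real m \<ge> (\<rho> ^ hh + \<epsilon>) * n - 1"
      have "real (m - b) \<ge> real m - real b" for b by (cases "b \<le> m") auto
      then have "real (m - k * hh * pend_mult H) \<ge> real m - real (k * hh * pend_mult H)" .
      moreover have "real (k * hh * pend_mult H) = real k * real D" by (simp add: D_def)
      moreover have "(\<rho> ^ hh + \<epsilon>) * n = (\<rho> ^ hh + \<epsilon> / 2) * n + real n * \<epsilon> / 4 + \<epsilon> / 4 * real n" by (simp add: algebra_simps)
      ultimately show ?thesis using a kD n\<epsilon> by linarith
    qed
    have Xfin: "finite (?X n)" using finite_graphs_on[OF A] by simp
    have Xwf: "\<And>G. G \<in> ?X n \<Longrightarrow> wf_graph G \<and> verts G = {1..n0 + k * hh}"
      using graph_class_wf[OF A] n0(1) by (auto simp: graphs_on_def)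
    have "card (?X n) * ((m - k * hh * pend_mult H) ^ k * fact n0) \<le> fact (n0 + k * hh) * card (graphs_on \<B> n0) * (n0 + k * hh) ^ k"
      using detn k\<delta> by (intro detach_count[OF wfH r B(1) conn Xfin Xwf _ mG]) auto
    then have "card (?X n) * ((m - k * hh * pend_mult H) ^ k * fact n0) \<le> fact n * card (graphs_on \<B> n0) * n ^ k"
      unfolding n0(1)[symmetric] .
    then have "real (card (?X n) * ((m - k * hh * pend_mult H) ^ k * fact n0)) \<le> real (fact n * card (graphs_on \<B> n0) * n ^ k)"
      by (rule of_nat_mono)
    then have "real (card (?X n)) * (real (m - k * hh * pend_mult H) ^ k * fact n0) \<le> fact n * real (card (graphs_on \<B> n0)) * real n ^ k"
      by simp
    then have "real (card (?X n)) / fact n * real (m - k * hh * pend_mult H) ^ k \<le> real (card (graphs_on \<B> n0)) / fact n0 * real n ^ k"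
      by (simp add: field_simps)
    also have "\<dots> \<le> (\<gamma> * (1 + \<eta>)) ^ n0 * real n ^ k"
      using N0 n0(2) by (intro mult_right_mono) auto
    finally have "real (card (?X n)) / fact n * real (m - k * hh * pend_mult H) ^ k \<le> (\<gamma> * (1 + \<eta>)) ^ n0 * real n ^ k" .
    moreover have "real (card (?X n)) / fact n * ((\<rho> ^ hh + \<epsilon> / 2) * n) ^ k \<le> real (card (?X n)) / fact n * real (m - k * hh * pend_mult H) ^ k"
      using mm rp \<epsilon> by (intro mult_left_mono power_mono) auto
    ultimately have "real (card (?X n)) / fact n * ((\<rho> ^ hh + \<epsilon> / 2) * n) ^ k \<le> (\<gamma> * (1 + \<eta>)) ^ n0 * real n ^ k" by linarith
    then have "real (card (?X n)) / fact n * (\<rho> ^ hh + \<epsilon> / 2) ^ k * real n ^ k \<le> (\<gamma> * (1 + \<eta>)) ^ n0 * real n ^ k"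
      by (simp only: power_mult_distrib mult.assoc)
    then have "real (card (?X n)) / fact n * (\<rho> ^ hh + \<epsilon> / 2) ^ k \<le> (\<gamma> * (1 + \<eta>)) ^ n0"
      by (rule mult_right_le_imp_le) (use n in simp)
    then have "real (card (?X n)) / fact n \<le> (\<gamma> * (1 + \<eta>)) ^ n0 / (\<rho> ^ hh + \<epsilon> / 2) ^ k"
      using rp \<epsilon> by (subst pos_le_divide_eq) (auto intro!: zero_less_power add_pos_pos)
    also have "\<dots> \<le> (\<gamma> * (1 + \<eta>)) ^ n * q ^ k"
    proof -
      have "(\<gamma> * (1 + \<eta>)) ^ n * q ^ k = (\<gamma> * (1 + \<eta>)) ^ n0 * (1 + \<eta>) ^ (k * hh) * (\<gamma> ^ (k * hh) * \<rho> ^ (hh * k)) / (\<rho> ^ hh + \<epsilon> / 2) ^ k"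
        by (simp add: n0(1) q_def power_divide power_mult_distrib power_add power_mult[symmetric])
      also have "\<gamma> ^ (k * hh) * \<rho> ^ (hh * k) = 1"
        using gamma_pos by (simp add: \<rho>_def mult.commute power_mult_distrib[symmetric])
      finally have eq: "(\<gamma> * (1 + \<eta>)) ^ n * q ^ k = ((\<gamma> * (1 + \<eta>)) ^ n0 * (1 + \<eta>) ^ (k * hh)) / (\<rho> ^ hh + \<epsilon> / 2) ^ k" by simp
      have "(\<gamma> * (1 + \<eta>)) ^ n0 \<le> (\<gamma> * (1 + \<eta>)) ^ n0 * (1 + \<eta>) ^ (k * hh)"
        using gamma_pos \<eta> mult_left_mono[of 1 "(1 + \<eta>) ^ (k * hh)" "(\<gamma> * (1 + \<eta>)) ^ n0"] by (simp add: one_le_power)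
      then show ?thesis unfolding eq using rp \<epsilon> by (intro divide_right_mono zero_le_power) auto
    qed
    finally have 1: "real (card (?X n)) / fact n \<le> (\<gamma> * (1 + \<eta>)) ^ n * q ^ k" .
    have lopos: "(\<gamma> * (1 - \<eta>)) ^ n > 0" using gamma_pos \<eta> by simp
    have "real (card (?X n)) / an n = (real (card (?X n)) / fact n) / (an n / fact n)" by simp
    also have "\<dots> \<le> (\<gamma> * (1 + \<eta>)) ^ n * q ^ k / (\<gamma> * (1 - \<eta>)) ^ n"
      using 1 lo lopos y q gamma_pos \<eta> by (intro frac_le) auto
    also have "\<dots> = y ^ n * q ^ k"
      using gamma_pos \<eta> by (simp add: y_def power_mult_distrib power_divide)
    also have "\<dots> \<le> y ^ (L * Suc k) * q ^ k"
    proof -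
      have "n \<le> L * Suc k" using dividend_less_times_div[OF Lpos, of n] by (simp add: k_def)
      then show ?thesis using y q by (intro mult_right_mono power_increasing) auto
    qed
    also have "\<dots> = y ^ L * (y ^ L * q) ^ k"
      by (simp add: power_add power_mult power_mult_distrib mult_ac)
    finally show ?thesis by (simp add: k_def)
  qed
  obtain n1 :: nat where n1: "4 / \<epsilon> < real n1" using reals_Archimedean2 by blast
  have "\<forall>\<^sub>F n in sequentially. 0 \<le> real (card (?X n)) / an n \<and>
      real (card (?X n)) / an n \<le> y ^ L * (y ^ L * q) ^ (n div L)"
    using eventually_gt_at_top[of 0] det growth_lower[OF \<eta>(1,2)] eventually_ge_at_top[of "2 * N0"]
      eventually_ge_at_top[of n1]
  proof eventually_elim
    case (elim n)
    have "4 / \<epsilon> \<le> real n" using n1 elim(5) by linarith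
    then have "real n * \<epsilon> \<ge> 4" using \<epsilon> by (simp add: field_simps)
    then show ?case using bound[OF elim(1,2,3,4)] by simp
  qed
  then show ?thesis
    by (rule exponential_beats_power) (use Lpos y q \<eta> in \<open>auto simp: y_def\<close>)
qed

lemma pend_concentration:
  fixes \<epsilon> :: real
  assumes "weakly_attachable H \<A>" "weakly_detachable H \<A>" "\<epsilon> > 0"
  shows "(\<lambda>n. real (card {G \<in> graphs_on \<A> n. \<bar>real (card (pend H r G)) - \<rho> ^ hh * n\<bar> > \<epsilon> * n}) / an n
      * real n ^ p) \<longlonglongrightarrow> 0"
proof -
  let ?Y = "\<lambda>n. {G \<in> graphs_on \<A> n. \<bar>real (card (pend H r G)) - \<rho> ^ hh * n\<bar> > \<epsilon> * n}"
  let ?lo = "\<lambda>n. {G \<in> graphs_on \<A> n. real (card (pend H r G)) < (\<rho> ^ hh - \<epsilon>) * n}"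
  let ?hi = "\<lambda>n. {G \<in> graphs_on \<A> n. real (card (pend H r G)) > (\<rho> ^ hh + \<epsilon>) * n}"
  have lo: "(\<lambda>n. real (card (?lo n)) / an n * real n ^ p) \<longlonglongrightarrow> 0"
  proof -
    obtain \<delta> \<B> where "\<delta> > 0" "graph_class \<B>" "rho_class \<B> = rho_class \<A>"
      "\<forall>\<^sub>F n in sequentially. \<forall>G\<in>graphs_on \<A> n. \<forall>k G'.
          real k \<le> \<delta> * real n \<and> attach_pendant H r G k G' \<longrightarrow> G' \<in> \<B>"
      using assms(1) r unfolding weakly_attachable_def by blast
    then show ?thesis using assms(3) by (rule lower_tail)
  qed
  have hi: "(\<lambda>n. real (card (?hi n)) / an n * real n ^ p) \<longlonglongrightarrow> 0"
  proof -
    obtain \<delta> \<B> where "\<delta> > 0" "graph_class \<B>" "rho_class \<B> = rho_class \<A>"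
      "\<forall>\<^sub>F n in sequentially. \<forall>G\<in>graphs_on \<A> n. \<forall>k G'.
          real k \<le> \<delta> * real n \<and> detach_pendant H r G k G' \<longrightarrow> G' \<in> \<B>"
      using assms(2) r unfolding weakly_detachable_def by blast
    then show ?thesis using assms(3) by (rule upper_tail)
  qed
  have sum: "(\<lambda>n. real (card (?lo n)) / an n * real n ^ p + real (card (?hi n)) / an n * real n ^ p) \<longlonglongrightarrow> 0"
    using tendsto_add[OF lo hi] by simp
  show ?thesis
  proof (rule tendsto_sandwich[OF _ _ tendsto_const sum]; intro always_eventually allI)
    fix n
    show "0 \<le> real (card (?Y n)) / an n * real n ^ p" by simp
    have "?Y n \<subseteq> ?lo n \<union> ?hi n" by (auto simp: algebra_simps abs_if split: if_splits)
    then have "card (?Y n) \<le> card (?lo n \<union> ?hi n)" using finite_graphs_on[OF A] by (intro card_mono) auto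
    also have "\<dots> \<le> card (?lo n) + card (?hi n)" by (rule card_Un_le)
    finally have "real (card (?Y n)) \<le> real (card (?lo n)) + real (card (?hi n))" by linarith
    then have "real (card (?Y n)) * (real n ^ p / an n) \<le> (real (card (?lo n)) + real (card (?hi n))) * (real n ^ p / an n)"
      by (rule mult_right_mono) simp
    then show "real (card (?Y n)) / an n * real n ^ p \<le> real (card (?lo n)) / an n * real n ^ p + real (card (?hi n)) / an n * real n ^ p"
      by (simp only: times_divide_eq_left times_divide_eq_right distrib_right add_divide_distrib)
  qed
qed

end

text \<open>All roots are summed because a bridge may leave a copy of \<open>H\<close> from any of
  its vertices. The concentration value is h \<rho>^h n with h = v(H).\<close>

definition pend_total :: "graph \<Rightarrow> graph \<Rightarrow> real" where
  "pend_total H G = (\<Sum>r\<in>verts H. real (card (pend H r G)))"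

definition pend_bad :: "graph \<Rightarrow> real \<Rightarrow> nat \<Rightarrow> graph set" where
  "pend_bad H \<epsilon> n = {G \<in> graphs_on \<A> n. \<bar>pend_total H G - card (verts H) * \<rho> ^ card (verts H) * n\<bar> > \<epsilon> * n}"

lemma pend_total_concentration:
  assumes "wf_graph H" "connected_graph H" "weakly_attachable H \<A>" "weakly_detachable H \<A>" "\<epsilon> > 0"
  shows "(\<lambda>n. real (card (pend_bad H \<epsilon> n)) / an n * real n ^ p) \<longlonglongrightarrow> 0"
proof -
  let ?h = "card (verts H)"
  let ?Y = "\<lambda>r n. {G \<in> graphs_on \<A> n. \<bar>real (card (pend H r G)) - \<rho> ^ ?h * n\<bar> > \<epsilon> / ?h * n}"
  have fin: "finite (verts H)" using assms wf_finite by blast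
  have h: "?h > 0" using assms fin by (auto simp: connected_graph_def card_gt_0_iff)
  have "(\<lambda>n. real (card (?Y r n)) / an n * real n ^ p) \<longlonglongrightarrow> 0" if "r \<in> verts H" for r
    using pend_concentration[OF assms(1) that assms(2,3,4), of "\<epsilon> / ?h"] assms(5) h by simp
  then have sum: "(\<lambda>n. \<Sum>r\<in>verts H. real (card (?Y r n)) / an n * real n ^ p) \<longlonglongrightarrow> 0"
    by (rule tendsto_null_sum)
  show ?thesis
  proof (rule tendsto_sandwich[OF _ _ tendsto_const sum]; intro always_eventually allI)
    fix n
    show "0 \<le> real (card (pend_bad H \<epsilon> n)) / an n * real n ^ p" by simp
    have "pend_bad H \<epsilon> n \<subseteq> (\<Union>r\<in>verts H. ?Y r n)"
    proof
      fix G assume G: "G \<in> pend_bad H \<epsilon> n"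
      show "G \<in> (\<Union>r\<in>verts H. ?Y r n)"
      proof (rule ccontr)
        assume "G \<notin> (\<Union>r\<in>verts H. ?Y r n)"
        moreover have "G \<in> graphs_on \<A> n" using G by (simp add: pend_bad_def)
        ultimately have small: "\<bar>real (card (pend H r G)) - \<rho> ^ ?h * n\<bar> \<le> \<epsilon> / ?h * n" if "r \<in> verts H" for r
          using that by (auto simp: not_less)
        have "pend_total H G - ?h * \<rho> ^ ?h * n = (\<Sum>r\<in>verts H. real (card (pend H r G)) - \<rho> ^ ?h * n)"
          by (simp add: pend_total_def sum_subtractf)
        then have "\<bar>pend_total H G - ?h * \<rho> ^ ?h * n\<bar> \<le> (\<Sum>r\<in>verts H. \<bar>real (card (pend H r G)) - \<rho> ^ ?h * n\<bar>)"
          by (simp only:) (rule sum_abs)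
        also have "\<dots> \<le> (\<Sum>r\<in>verts H. \<epsilon> / ?h * n)" by (intro sum_mono small)
        also have "\<dots> = \<epsilon> * n" using h by simp
        finally show False using G by (simp add: pend_bad_def)
      qed
    qed
    then have "card (pend_bad H \<epsilon> n) \<le> card (\<Union>r\<in>verts H. ?Y r n)"
      using finite_graphs_on[OF A] fin by (intro card_mono) auto
    also have "\<dots> \<le> (\<Sum>r\<in>verts H. card (?Y r n))" by (rule card_UN_le[OF fin])
    finally have "real (card (pend_bad H \<epsilon> n)) \<le> real (\<Sum>r\<in>verts H. card (?Y r n))" by (rule of_nat_mono)
    then have "real (card (pend_bad H \<epsilon> n)) \<le> (\<Sum>r\<in>verts H. real (card (?Y r n)))" by (simp only: of_nat_sum)
    then have "real (card (pend_bad H \<epsilon> n)) * (real n ^ p / an n) \<le> (\<Sum>r\<in>verts H. real (card (?Y r n))) * (real n ^ p / an n)"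
      by (rule mult_right_mono) simp
    then show "real (card (pend_bad H \<epsilon> n)) / an n * real n ^ p \<le> (\<Sum>r\<in>verts H. real (card (?Y r n)) / an n * real n ^ p)"
      by (simp only: times_divide_eq_left times_divide_eq_right sum_distrib_right sum_divide_distrib)
  qed
qed

end

section \<open>Embeddings onto unions of components\<close>

definition gunion :: "graph \<Rightarrow> graph \<Rightarrow> graph" where
  "gunion F H = (verts F \<union> verts H, edges F \<union> edges H)"

lemma verts_gunion [simp]: "verts (gunion F H) = verts F \<union> verts H" by (simp add: gunion_def)
lemma edges_gunion [simp]: "edges (gunion F H) = edges F \<union> edges H" by (simp add: gunion_def)

lemma wf_gunion: "wf_graph F \<Longrightarrow> wf_graph H \<Longrightarrow> wf_graph (gunion F H)"
  unfolding wf_graph_def verts_gunion edges_gunion by blast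

text \<open>Closedness forces the image to be a union of components, so these are the ways in which
  \<open>F\<close> occurs in \<open>G\<close> with no edge to the rest.\<close>

definition emb :: "graph \<Rightarrow> graph \<Rightarrow> (nat \<Rightarrow> nat) set" where
  "emb F G = {\<phi> \<in> extensional (verts F). inj_on \<phi> (verts F) \<and> closed_set G (\<phi> ` verts F) \<and>
     induced G (\<phi> ` verts F) = relabel \<phi> F}"

lemma emb_subset: "emb F G \<subseteq> verts F \<rightarrow>\<^sub>E verts G"
  by (auto simp: emb_def closed_set_def PiE_def)

lemma finite_emb: "wf_graph F \<Longrightarrow> wf_graph G \<Longrightarrow> finite (emb F G)"
  by (rule finite_subset[OF emb_subset finite_PiE]) (auto simp: wf_finite)

text \<open>This bound, polynomial in the order of \<open>G\<close>, is the reason why the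
  concentration results carry a factor n^p.\<close>

lemma card_emb_le:
  assumes "wf_graph F" "wf_graph G" shows "card (emb F G) \<le> card (verts G) ^ card (verts F)"
proof -
  have "card (emb F G) \<le> card (verts F \<rightarrow>\<^sub>E verts G)"
    using assms by (intro card_mono emb_subset finite_PiE) (auto simp: wf_finite)
  then show ?thesis using assms by (simp add: card_funcsetE wf_finite)
qed

definition join_fun :: "nat set \<Rightarrow> (nat \<Rightarrow> nat) \<Rightarrow> (nat \<Rightarrow> nat) \<Rightarrow> nat \<Rightarrow> nat" where
  "join_fun V \<phi> \<psi> v = (if v \<in> V then \<phi> v else \<psi> v)"

lemma join_fun_extensional:
  "\<psi> \<in> extensional W \<Longrightarrow> join_fun V \<phi> \<psi> \<in> extensional (V \<union> W)"
  by (auto simp: join_fun_def extensional_def)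

lemma join_fun_image: "V \<inter> W = {} \<Longrightarrow> join_fun V \<phi> \<psi> ` (V \<union> W) = \<phi> ` V \<union> \<psi> ` W"
  by (auto simp: join_fun_def image_iff)

lemma restrict_join_fun:
  assumes "V \<inter> W = {}" "\<phi> \<in> extensional V" "\<psi> \<in> extensional W"
  shows "restrict (join_fun V \<phi> \<psi>) V = \<phi>" "restrict (join_fun V \<phi> \<psi>) W = \<psi>"
  using assms by (auto simp: join_fun_def extensional_def fun_eq_iff restrict_def)

lemma join_fun_restrict:
  assumes "V \<inter> W = {}" "\<phi> \<in> extensional (V \<union> W)"
  shows "join_fun V (restrict \<phi> V) (restrict \<phi> W) = \<phi>"
  using assms by (auto simp: join_fun_def extensional_def fun_eq_iff restrict_def)

lemma join_fun_inj:
  assumes "V \<inter> W = {}" "inj_on \<phi> V" "inj_on \<psi> W" "\<phi> ` V \<inter> \<psi> ` W = {}"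
  shows "inj_on (join_fun V \<phi> \<psi>) (V \<union> W)"
proof (rule inj_onI)
  fix x y assume a: "x \<in> V \<union> W" "y \<in> V \<union> W" "join_fun V \<phi> \<psi> x = join_fun V \<phi> \<psi> y"
  show "x = y"
  proof (cases "x \<in> V"; cases "y \<in> V")
    assume "x \<in> V" "y \<in> V" then show ?thesis using a assms(2) by (auto simp: join_fun_def inj_on_eq_iff)
  next
    assume "x \<in> V" "y \<notin> V" then show ?thesis using a assms(4) by (auto simp: join_fun_def)
  next
    assume "x \<notin> V" "y \<in> V" then show ?thesis using a assms(4) by (auto simp: join_fun_def)
  next
    assume "x \<notin> V" "y \<notin> V" then show ?thesis using a assms(3) by (auto simp: join_fun_def inj_on_eq_iff)
  qed
qed

lemma relabel_gunion: "relabel f (gunion F H) = gunion (relabel f F) (relabel f H)"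
  by (rule graph_eqI) (auto simp: image_Un)

lemma relabel_join_fun:
  assumes "wf_graph F" "wf_graph H" "verts F \<inter> verts H = {}"
  shows "relabel (join_fun (verts F) \<phi> \<psi>) (gunion F H) = gunion (relabel \<phi> F) (relabel \<psi> H)"
proof -
  have "relabel (join_fun (verts F) \<phi> \<psi>) F = relabel \<phi> F"
    by (rule relabel_cong[OF assms(1)]) (simp add: join_fun_def)
  moreover have "relabel (join_fun (verts F) \<phi> \<psi>) H = relabel \<psi> H"
    by (rule relabel_cong[OF assms(2)]) (use assms(3) in \<open>auto simp: join_fun_def\<close>)
  ultimately show ?thesis by (simp add: relabel_gunion)
qed

lemma induced_Un_closed:
  assumes "wf_graph G" "closed_set G A" "closed_set G B"
  shows "induced G (A \<union> B) = gunion (induced G A) (induced G B)"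
proof (rule graph_eqI)
  have "e \<subseteq> A \<or> e \<subseteq> B" if "e \<in> edges G" "e \<subseteq> A \<union> B" for e
  proof -
    have "e \<noteq> {}" using wf_edge_nonempty[OF assms(1) that(1)] .
    then have "e \<inter> A \<noteq> {} \<or> e \<inter> B \<noteq> {}" using that(2) by blast
    then show ?thesis using assms(2,3) that(1) unfolding closed_set_def by blast
  qed
  then show "edges (induced G (A \<union> B)) = edges (gunion (induced G A) (induced G B))"
    unfolding edges_induced edges_gunion by blast
qed simp

section \<open>Removing and adding a pendant bridge\<close>

text \<open>Once its only boundary edge is gone, the image of \<open>H\<close> is closed, and it is
  connected because \<open>H\<close> is.\<close>

lemma delete_pendant_bridge:
  assumes wf: "wf_graph H" "wf_graph G'" and conn: "connected_graph H" and r: "r \<in> verts H"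
    and p: "\<psi> \<in> pend H r G'"
  defines "x \<equiv> pend_nbr H r G' \<psi>"
  defines "G \<equiv> delete_edge G' {\<psi> r, x}"
  shows "\<psi> ` verts H \<in> components G" "induced G (\<psi> ` verts H) = relabel \<psi> H"
    "x \<in> verts G - \<psi> ` verts H" "{\<psi> r, x} \<in> edges G'" "add_edge G (\<psi> r) x = G'" "{\<psi> r, x} \<notin> edges G"
    "\<psi> \<in> emb H G"
proof -
  note P = pendD[OF p] and N = pend_nbr[OF p, folded x_def]
  let ?W = "\<psi> ` verts H"
  have wfG: "wf_graph G" using wf_delete_edge[OF wf(2)] by (simp add: G_def)
  have "{\<psi> r, x} \<in> boundary G' ?W" using N(2) by simp
  then show e: "{\<psi> r, x} \<in> edges G'" by (simp add: boundary_def)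
  show xv: "x \<in> verts G - ?W" using N(1) by (simp add: G_def)
  show "add_edge G (\<psi> r) x = G'" using add_edge_delete_edge[OF e] by (simp add: G_def)
  show "{\<psi> r, x} \<notin> edges G" by (simp add: G_def)
  have "induced G ?W = induced G' ?W"
  proof (rule graph_eqI)
    have "\<not> {\<psi> r, x} \<subseteq> ?W" using N(1) by blast
    then show "edges (induced G ?W) = edges (induced G' ?W)"
      unfolding G_def edges_induced edges_delete_edge by blast
  qed simp
  then show ind: "induced G ?W = relabel \<psi> H" using P(4) by simp
  have cl: "closed_set G ?W"
    unfolding closed_set_def
  proof (intro conjI ballI impI)
    show "?W \<subseteq> verts G" using P(3) by (simp add: G_def)
    fix e assume e: "e \<in> edges G" "e \<inter> ?W \<noteq> {}"
    have "e \<in> edges G'" "e \<noteq> {\<psi> r, x}" using e(1) unfolding G_def edges_delete_edge by blast+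
    then have "e \<notin> boundary G' ?W" unfolding N(2) by blast
    then show "e \<subseteq> ?W" using e(2) \<open>e \<in> edges G'\<close> unfolding boundary_def by blast
  qed
  have "connected_graph (induced G ?W)" using connected_relabel[OF conn] by (simp only: ind)
  then show "?W \<in> components G"
    using components_iff[OF wfG] cl connected_induced_conn_set by blast
  show "\<psi> \<in> emb H G" using P cl ind by (simp add: emb_def)
qed

lemma add_pendant_bridge:
  assumes wf: "wf_graph H" "wf_graph G" and r: "r \<in> verts H" and \<phi>: "\<phi> \<in> emb H G"
    and x: "x \<in> verts G - \<phi> ` verts H"
  shows "\<phi> \<in> pend H r (add_edge G (\<phi> r) x)" "pend_nbr H r (add_edge G (\<phi> r) x) \<phi> = x"
proof -
  let ?G = "add_edge G (\<phi> r) x" and ?W = "\<phi> ` verts H"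
  have E: "\<phi> \<in> extensional (verts H)" "inj_on \<phi> (verts H)" "closed_set G ?W" "induced G ?W = relabel \<phi> H"
    using \<phi> by (auto simp: emb_def)
  have "induced ?G ?W = induced G ?W"
  proof (rule graph_eqI)
    have "\<not> {\<phi> r, x} \<subseteq> ?W" using x by blast
    then show "edges (induced ?G ?W) = edges (induced G ?W)" unfolding edges_induced edges_add_edge by blast
  qed simp
  moreover have b: "boundary ?G ?W = {{\<phi> r, x}}"
  proof -
    have "e = {\<phi> r, x}" if "e \<in> boundary ?G ?W" for e
      using that E(3) unfolding boundary_def closed_set_def edges_add_edge by blast
    moreover have "{\<phi> r, x} \<in> boundary ?G ?W" using x r unfolding boundary_def edges_add_edge by blast
    ultimately show ?thesis by blast
  qed
  moreover have "?W \<subseteq> verts G" using E(3) by (simp add: closed_set_def)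
  ultimately show p: "\<phi> \<in> pend H r ?G" unfolding pend_def mem_Collect_eq verts_add_edge using E x by metis
  show "pend_nbr H r ?G \<phi> = x" using pend_nbr_eqI[OF p b] .
qed

section \<open>Averages over a bridge-addable class\<close>

definition nonreach :: "graph \<Rightarrow> (nat \<times> nat) set" where
  "nonreach G = {(u, v). u \<in> verts G \<and> v \<in> verts G \<and> \<not> reach G u v}"

lemma finite_nonreach: "wf_graph G \<Longrightarrow> finite (nonreach G)"
  by (rule finite_subset[of _ "verts G \<times> verts G"]) (auto simp: nonreach_def wf_finite)

lemma card_nonreach:
  assumes "wf_graph G"
  shows "card (nonreach G) = (\<Sum>u\<in>verts G. card (verts G) - card (component_of G u))"
proof -
  have "nonreach G = Sigma (verts G) (\<lambda>u. verts G - component_of G u)"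
    by (auto simp: nonreach_def component_of_def)
  then have "card (nonreach G) = (\<Sum>u\<in>verts G. card (verts G - component_of G u))"
    using wf_finite[OF assms] by simp
  moreover have "card (verts G - component_of G u) = card (verts G) - card (component_of G u)" for u
    by (rule card_Diff_subset[OF finite_subset[OF component_of_subset wf_finite[OF assms]] component_of_subset])
  ultimately show ?thesis by simp
qed

lemma card_oriented_edges_le:
  assumes "finite S" shows "finite {(u, v). {u, v} \<in> S}" "card {(u, v). {u, v} \<in> S} \<le> 2 * card S"
proof -
  have 1: "finite {(u, v). {u, v} = e} \<and> card {(u, v). {u, v} = e} \<le> 2" for e :: "'a set"
  proof (cases "\<exists>a b. e = {a, b}")
    case True
    then obtain a b where e: "e = {a, b}" by blast
    have sub: "{(u, v). {u, v} = e} \<subseteq> {(a, b), (b, a)}" unfolding e by (auto simp: doubleton_eq_iff)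
    have c: "card {(u, v). {u, v} = e} \<le> card {(a, b), (b, a)}" by (rule card_mono[OF _ sub]) simp
    have d: "card {(a, b), (b, a)} \<le> 2" by (rule order_trans[OF card_insert_le_m1]) auto
    have "finite {(u, v). {u, v} = e}" by (rule finite_subset[OF sub]) simp
    then show ?thesis using order_trans[OF c d] by (rule conjI)
  next
    case False
    then have 0: "{(u, v). {u, v} = e} = {}" by blast
    show ?thesis unfolding 0 by simp
  qed
  have eq: "{(u, v). {u, v} \<in> S} = (\<Union>e\<in>S. {(u, v). {u, v} = e})" by blast
  show "finite {(u, v). {u, v} \<in> S}" unfolding eq by (rule finite_UN_I[OF assms]) (use 1 in blast)
  have "card {(u, v). {u, v} \<in> S} \<le> (\<Sum>e\<in>S. card {(u, v). {u, v} = e})" unfolding eq by (rule card_UN_le[OF assms])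
  moreover have "(\<Sum>e\<in>S. card {(u, v). {u, v} = e}) \<le> (\<Sum>e\<in>S. 2)"
    by (rule sum_mono) (use 1 in blast)
  ultimately have "card {(u, v). {u, v} \<in> S} \<le> (\<Sum>e\<in>S. 2)" by (rule order_trans)
  then show "card {(u, v). {u, v} \<in> S} \<le> 2 * card S" by simp
qed

lemma add_edge_bridge:
  assumes "\<not> reach G u v" shows "{u, v} \<in> bridges (add_edge G u v)" "{u, v} \<notin> edges G"
proof -
  show e: "{u, v} \<notin> edges G" using assms reach_edge by blast
  show "{u, v} \<in> bridges (add_edge G u v)"
    unfolding bridges_def mem_Collect_eq
  proof (intro conjI exI)
    show "\<not> reach (delete_edge (add_edge G u v) {u, v}) u v" using assms by (simp only: delete_edge_add_edge[OF e]) simp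
  qed (simp_all only: edges_add_edge insertI1)
qed

locale bridge_class = growth_class +
  assumes addable: "bridge_addable \<A>"
begin

lemma A_wf: "G \<in> graphs_on \<A> n \<Longrightarrow> wf_graph G" "G \<in> graphs_on \<A> n \<Longrightarrow> verts G = {1..n}"
  "G \<in> graphs_on \<A> n \<Longrightarrow> G \<in> \<A>"
  using graph_class_wf[OF A] by (auto simp: graphs_on_def)

lemma A_fin: "finite (graphs_on \<A> n)" using finite_graphs_on[OF A] .

lemma A_add_edge:
  "G \<in> graphs_on \<A> n \<Longrightarrow> u \<in> {1..n} \<Longrightarrow> v \<in> {1..n} \<Longrightarrow> \<not> reach G u v \<Longrightarrow> add_edge G u v \<in> graphs_on \<A> n"
  using addable unfolding bridge_addable_def graphs_on_def add_edge_def by auto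

text \<open>The expectation over a uniform graph on \<open>{1..n}\<close>; it is 0 when the class
  has no such graph.\<close>

definition avg :: "nat \<Rightarrow> (graph \<Rightarrow> real) \<Rightarrow> real" where
  "avg n f = (\<Sum>G\<in>graphs_on \<A> n. f G) / an n"

lemma avg_mono: "(\<And>G. G \<in> graphs_on \<A> n \<Longrightarrow> f G \<le> g G) \<Longrightarrow> avg n f \<le> avg n g"
  unfolding avg_def by (intro divide_right_mono sum_mono) auto

lemma avg_add: "avg n (\<lambda>G. f G + g G) = avg n f + avg n g"
  by (simp add: avg_def sum.distrib add_divide_distrib)

lemma avg_diff: "avg n (\<lambda>G. f G - g G) = avg n f - avg n g"
  by (simp add: avg_def sum_subtractf diff_divide_distrib)

lemma avg_cmult: "avg n (\<lambda>G. c * f G) = c * avg n f"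
  by (simp add: avg_def sum_distrib_left[symmetric])

lemma avg_sum: "avg n (\<lambda>G. \<Sum>i\<in>I. f i G) = (\<Sum>i\<in>I. avg n (f i))"
  unfolding avg_def by (subst sum.swap) (simp add: sum_divide_distrib)

lemma avg_const: "an n > 0 \<Longrightarrow> avg n (\<lambda>_. c) = c" by (simp add: avg_def)

lemma avg_const_le: "c \<ge> 0 \<Longrightarrow> avg n (\<lambda>_. c) \<le> c" by (simp add: avg_def)

lemma avg_le: "c \<ge> 0 \<Longrightarrow> (\<And>G. G \<in> graphs_on \<A> n \<Longrightarrow> f G \<le> c) \<Longrightarrow> avg n f \<le> c"
  using avg_mono[of n f "\<lambda>_. c"] avg_const_le[of c n] by force

lemma avg_abs: "\<bar>avg n f\<bar> \<le> avg n (\<lambda>G. \<bar>f G\<bar>)"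
  using divide_right_mono[OF sum_abs[of f "graphs_on \<A> n"], of "an n"] by (simp add: avg_def)

text \<open>A pair in different components becomes an oriented bridge of G + uv, which stays in the
  class. The oriented edge identifies \<open>G\<close>, and a graph on n vertices has fewer than n
  bridges, hence fewer than 2n oriented ones.\<close>

lemma avg_nonreach: "n > 0 \<Longrightarrow> avg n (\<lambda>G. real (card (nonreach G))) \<le> 2 * n"
proof -
  assume n: "n > 0"
  let ?S = "Sigma (graphs_on \<A> n) nonreach" and ?T = "Sigma (graphs_on \<A> n) (\<lambda>G. {(u, v). {u, v} \<in> bridges G})"
  have finb: "finite (bridges G)" if "G \<in> graphs_on \<A> n" for G
    using wf_finite_edges[OF A_wf(1)[OF that]] by (auto simp: bridges_def)
  have "card ?S \<le> card ?T"
  proof (rule card_inj_on_le[of "\<lambda>(G, u, v). (add_edge G u v, u, v)"])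
    show "finite ?T" using A_fin finb card_oriented_edges_le(1) by (intro finite_SigmaI) blast+
    show "inj_on (\<lambda>(G, u, v). (add_edge G u v, u, v)) ?S"
    proof (rule inj_onI)
      fix a b assume ab: "a \<in> ?S" "b \<in> ?S" "(\<lambda>(G, u, v). (add_edge G u v, u, v)) a = (\<lambda>(G, u, v). (add_edge G u v, u, v)) b"
      obtain G u v G' u' v' where e: "a = (G, u, v)" "b = (G', u', v')" by (cases a, cases b) blast
      have eq: "u' = u" "v' = v" "add_edge G u v = add_edge G' u v" using ab e by auto
      have "\<not> reach G u v" "\<not> reach G' u v" using ab e eq by (auto simp: nonreach_def)
      then have "G = G'" using eq(3) add_edge_bridge(2) delete_edge_add_edge by metis
      then show "a = b" using e eq by simp
    qed
    show "(\<lambda>(G, u, v). (add_edge G u v, u, v)) ` ?S \<subseteq> ?T"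
    proof (rule image_subsetI)
      fix a assume "a \<in> ?S"
      then obtain G u v where a: "a = (G, u, v)" "G \<in> graphs_on \<A> n" "(u, v) \<in> nonreach G" by (cases a) blast
      then have "add_edge G u v \<in> graphs_on \<A> n" "{u, v} \<in> bridges (add_edge G u v)"
        using A_add_edge[OF a(2)] A_wf(2)[OF a(2)] add_edge_bridge by (auto simp: nonreach_def)
      then show "(\<lambda>(G, u, v). (add_edge G u v, u, v)) a \<in> ?T" unfolding a(1) by simp
    qed
  qed
  also have "card ?T = (\<Sum>G\<in>graphs_on \<A> n. card {(u, v). {u, v} \<in> bridges G})"
    using A_fin finb card_oriented_edges_le(1) by (intro card_SigmaI) blast+
  also have "\<dots> \<le> (\<Sum>G\<in>graphs_on \<A> n. 2 * n)"
  proof (rule sum_mono)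
    fix G assume G: "G \<in> graphs_on \<A> n"
    have "card (bridges G) < n" using card_bridges[OF A_wf(1)[OF G]] A_wf(2)[OF G] n by simp
    then show "card {(u, v). {u, v} \<in> bridges G} \<le> 2 * n"
      using card_oriented_edges_le(2)[OF finb[OF G]] by linarith
  qed
  also have "card ?S = (\<Sum>G\<in>graphs_on \<A> n. card (nonreach G))"
    using A_fin finite_nonreach A_wf(1) by (intro card_SigmaI) blast+
  finally have "(\<Sum>G\<in>graphs_on \<A> n. card (nonreach G)) \<le> card (graphs_on \<A> n) * (2 * n)" by simp
  then have "real (\<Sum>G\<in>graphs_on \<A> n. card (nonreach G)) \<le> real (card (graphs_on \<A> n) * (2 * n))" by (rule of_nat_mono)
  then have "(\<Sum>G\<in>graphs_on \<A> n. real (card (nonreach G))) \<le> 2 * n * an n" by (simp add: mult_ac)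
  then show ?thesis unfolding avg_def
  proof (cases "an n = 0")
    case False
    then have "an n > 0" by simp
    then show "(\<Sum>G\<in>graphs_on \<A> n. real (card (nonreach G))) / an n \<le> 2 * n"
      using \<open>_ \<le> 2 * n * an n\<close> by (simp only: pos_divide_le_eq)
  next
    \<comment> \<open>Without graphs on n vertices the quotient is 0.\<close>
    case True
    show "(\<Sum>G\<in>graphs_on \<A> n. real (card (nonreach G))) / an n \<le> 2 * n" unfolding True by simp
  qed
qed

text \<open>A vertex in a component of size at most M \<le> n/2 fails to reach at least n/2
  vertices, so \<open>avg_nonreach\<close> allows on average at most 2n / (n/2) = 4 of them.\<close>

lemma avg_small_components:
  assumes "n > 0" "2 * M \<le> n"
  shows "avg n (\<lambda>G. real (card {u \<in> verts G. card (component_of G u) \<le> M})) \<le> 4"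
proof -
  let ?V = "\<lambda>G. {u \<in> verts G. card (component_of G u) \<le> M}"
  have "real n / 2 * card (?V G) \<le> card (nonreach G)" if "G \<in> graphs_on \<A> n" for G
  proof -
    note wf = A_wf[OF that]
    have "real (card (?V G)) * real (n - M) \<le> (\<Sum>u\<in>?V G. real (card (verts G) - card (component_of G u)))"
      by (rule sum_bounded_below) (use wf(2) in auto)
    also have "\<dots> \<le> (\<Sum>u\<in>verts G. real (card (verts G) - card (component_of G u)))"
      using wf_finite[OF wf(1)] by (intro sum_mono2) auto
    also have "\<dots> = real (card (nonreach G))" unfolding card_nonreach[OF wf(1)] of_nat_sum ..
    finally have "real (card (?V G)) * real (n - M) \<le> real (card (nonreach G))" .
    moreover have "real n / 2 \<le> real (n - M)" using assms(2) by simp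
    then have "real n / 2 * card (?V G) \<le> real (card (?V G)) * real (n - M)"
      using mult_left_mono[of "real n / 2" "real (n - M)" "real (card (?V G))"] by (simp add: mult.commute)
    ultimately show ?thesis by simp
  qed
  then have "avg n (\<lambda>G. real n / 2 * card (?V G)) \<le> avg n (\<lambda>G. real (card (nonreach G)))" by (rule avg_mono)
  also have "\<dots> \<le> 2 * n" using avg_nonreach[OF assms(1)] .
  finally have "real n / 2 * avg n (\<lambda>G. real (card (?V G))) \<le> real n / 2 * 4" unfolding avg_cmult by simp
  then show ?thesis using assms(1) by simp
qed

end

section \<open>Forests of graphs from the class\<close>

lemma closed_set_Un: "closed_set G A \<Longrightarrow> closed_set G B \<Longrightarrow> closed_set G (A \<union> B)"
  unfolding closed_set_def by blast

lemma gunion_parts: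
  assumes "wf_graph F" "wf_graph H" "verts F \<inter> verts H = {}"
  shows "closed_set (gunion F H) (verts F)" "closed_set (gunion F H) (verts H)"
    "induced (gunion F H) (verts F) = F" "induced (gunion F H) (verts H) = H"
proof -
  have eF: "e \<subseteq> verts F \<and> e \<noteq> {}" if "e \<in> edges F" for e
    using wf_edge_subset[OF assms(1) that] wf_edge_nonempty[OF assms(1) that] by blast
  have eH: "e \<subseteq> verts H \<and> e \<noteq> {}" if "e \<in> edges H" for e
    using wf_edge_subset[OF assms(2) that] wf_edge_nonempty[OF assms(2) that] by blast
  show "closed_set (gunion F H) (verts F)" "closed_set (gunion F H) (verts H)"
    unfolding closed_set_def verts_gunion edges_gunion using eF eH assms(3) by blast+
  show "induced (gunion F H) (verts F) = F"
  proof (rule graph_eqI)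
    show "edges (induced (gunion F H) (verts F)) = edges F"
      unfolding edges_induced edges_gunion using eF eH assms(3) by blast
  qed simp
  show "induced (gunion F H) (verts H) = H"
  proof (rule graph_eqI)
    show "edges (induced (gunion F H) (verts H)) = edges H"
      unfolding edges_induced edges_gunion using eF eH assms(3) by blast
  qed simp
qed

lemma components_gunion:
  assumes "wf_graph F" "wf_graph H" "verts F \<inter> verts H = {}"
  shows "components (gunion F H) = components F \<union> components H"
proof (rule components_eqI)
  note R = gunion_parts[OF assms]
  show "wf_graph (gunion F H)" using wf_gunion assms by blast
  show "verts (gunion F H) \<subseteq> \<Union> (components F \<union> components H)"
    using Union_components[of F] Union_components[of H] by (simp add: Union_Un_distrib)
  fix K assume "K \<in> components F \<union> components H"
  then have "K \<in> components (gunion F H)"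
    using components_induced[OF R(1)] components_induced[OF R(2)] R(3,4) by auto
  then show "closed_set (gunion F H) K \<and> conn_set (gunion F H) K"
    using components_iff[OF wf_gunion[OF assms(1,2)]] by blast
qed

lemma gunion_component:
  assumes "wf_graph F" "K \<in> components F"
  shows "F = gunion (induced F (verts F - K)) (induced F K)"
proof -
  have cl: "closed_set F K" using assms components_iff by blast
  have "F = induced F ((verts F - K) \<union> K)"
    using induced_verts[OF assms(1)] components_subset[OF assms(2)] by (simp add: Un_absorb2)
  also have "\<dots> = gunion (induced F (verts F - K)) (induced F K)"
    by (rule induced_Un_closed[OF assms(1) closed_set_Diff[OF assms(1) cl] cl])
  finally show ?thesis .
qed

definition forest :: "graph set \<Rightarrow> graph set" where
  "forest \<C> = {F. wf_graph F \<and> (\<forall>K\<in>components F. induced F K \<in> \<C>)}"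

lemma forest_wf: "F \<in> forest \<C> \<Longrightarrow> wf_graph F" by (simp add: forest_def)

lemma empty_in_forest: "({}, {}) \<in> forest \<C>"
  by (simp add: forest_def wf_graph_def components_def)

lemma forest_remove_component:
  assumes "F \<in> forest \<C>" "K \<in> components F"
  shows "induced F (verts F - K) \<in> forest \<C>" "induced F K \<in> \<C>"
proof -
  have wf: "wf_graph F" using assms forest_wf by blast
  have cl: "closed_set F (verts F - K)" using closed_set_Diff components_iff wf assms by blast
  have "induced (induced F (verts F - K)) L \<in> \<C>" if "L \<in> components (induced F (verts F - K))" for L
  proof -
    have L: "L \<in> components F" "L \<subseteq> verts F - K" using that components_induced[OF cl] by auto
    then show ?thesis using assms(1) induced_induced[OF L(2)] by (simp add: forest_def)
  qed
  then show "induced F (verts F - K) \<in> forest \<C>"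
    unfolding forest_def using wf_induced[OF wf] wf_finite[OF wf] by blast
  show "induced F K \<in> \<C>" using assms by (simp add: forest_def)
qed

lemma gunion_in_forest:
  assumes "F \<in> forest \<C>" "H \<in> forest \<C>" "verts F \<inter> verts H = {}"
  shows "gunion F H \<in> forest \<C>"
proof -
  have wf: "wf_graph F" "wf_graph H" using assms forest_wf by auto
  note R = gunion_parts[OF wf assms(3)]
  have "induced (gunion F H) K \<in> \<C>" if "K \<in> components (gunion F H)" for K
  proof -
    have "K \<in> components F \<or> K \<in> components H" using that components_gunion[OF wf assms(3)] by blast
    then show ?thesis
    proof
      assume K: "K \<in> components F"
      have "induced (gunion F H) K = induced F K"
        using induced_induced[OF components_subset[OF K], of "gunion F H"] R(3) by simp
      then show ?thesis using assms(1) K by (simp add: forest_def)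
    next
      assume K: "K \<in> components H"
      have "induced (gunion F H) K = induced H K"
        using induced_induced[OF components_subset[OF K], of "gunion F H"] R(4) by simp
      then show ?thesis using assms(2) K by (simp add: forest_def)
    qed
  qed
  then show ?thesis unfolding forest_def using wf_gunion[OF wf] by blast
qed

lemma relabel_in_forest:
  assumes "graph_class \<C>" "F \<in> forest \<C>" "inj_on f (verts F)"
  shows "relabel f F \<in> forest \<C>"
proof -
  have wf: "wf_graph F" using assms forest_wf by blast
  have "induced (relabel f F) K \<in> \<C>" if K: "K \<in> components (relabel f F)" for K
  proof -
    obtain L where L: "K = f ` L" "L \<in> components F" using K components_relabel[OF wf assms(3)] by blast
    have "induced F L \<in> \<C>" using assms(2) L by (simp add: forest_def)
    then show ?thesis using induced_relabel[OF wf assms(3) components_subset[OF L(2)]] L(1)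
      graph_class_relabel[OF assms(1), of "induced F L" f] inj_on_subset[OF assms(3) components_subset[OF L(2)]] by simp
  qed
  then show ?thesis unfolding forest_def using wf_relabel[OF wf assms(3)] by blast
qed

text \<open>Splitting off one component at a time reduces statements on forests to adding one
  disjoint member of \<open>\<C>\<close>.\<close>

lemma forest_induct:
  assumes F: "F \<in> forest \<C>" and P0: "P ({}, {})"
    and step: "\<And>F H. F \<in> forest \<C> \<Longrightarrow> P F \<Longrightarrow> H \<in> \<C> \<Longrightarrow> verts F \<inter> verts H = {} \<Longrightarrow> P (gunion F H)"
  shows "P F"
  using F
proof (induction "card (verts F)" arbitrary: F rule: less_induct)
  case less
  have wf: "wf_graph F" using less.prems forest_wf by blast
  show ?case
  proof (cases "verts F = {}")
    case True
    then have "edges F = {}" using wf wf_edge_subset wf_edge_nonempty by blast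
    then have "F = ({}, {})" using True by (intro graph_eqI) auto
    then show ?thesis using P0 by simp
  next
    case False
    then obtain K where K: "K \<in> components F" using Union_components[of F] by blast
    let ?F = "induced F (verts F - K)"
    note R = forest_remove_component[OF less.prems K]
    have "verts F - K \<subset> verts F" using components_subset[OF K] components_nonempty[OF K] by blast
    then have "card (verts ?F) < card (verts F)" using wf_finite[OF wf] by (simp add: psubset_card_mono)
    then have "P ?F" using less.hyps R(1) by blast
    then have "P (gunion ?F (induced F K))" by (rule step[OF R(1) _ R(2)]) auto
    then show ?thesis using gunion_component[OF wf K] by simp
  qed
qed

locale comp_class = bridge_class +
  fixes \<C> :: "graph set"
  assumes C: "graph_class \<C>" and C_conn: "\<forall>H\<in>\<C>. connected_graph H"
    and C_del: "\<forall>H\<in>\<C>. bridge_deletable H \<A>"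
    and C_att: "\<forall>H\<in>\<C>. weakly_attachable H \<A>"
    and C_det: "\<forall>H\<in>\<C>. weakly_detachable H \<A>"
begin

lemma C_wf: "H \<in> \<C> \<Longrightarrow> wf_graph H" using graph_class_wf[OF C] .

lemma C_card_pos: "H \<in> \<C> \<Longrightarrow> card (verts H) > 0"
  using C_conn C_wf wf_finite by (auto simp: connected_graph_def card_gt_0_iff)

lemma C_in_forest: "H \<in> \<C> \<Longrightarrow> H \<in> forest \<C>"
  unfolding forest_def using C_wf C_conn connected_graph_components induced_verts by auto

lemma pend_total_nonneg: "pend_total H G \<ge> 0" by (simp add: pend_total_def sum_nonneg)

lemma pend_total_le:
  assumes "H \<in> \<C>" "G \<in> graphs_on \<A> n"
  shows "pend_total H G \<le> real (card (verts H)) * (n * pend_mult H)"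
proof -
  have "real (card (pend H r G)) \<le> real (n * pend_mult H)" for r
    using card_pend_le[OF C_wf[OF assms(1)] A_wf(1)[OF assms(2)], of r] C_conn assms A_wf(2)[OF assms(2)]
    by (intro of_nat_mono) simp
  then have "pend_total H G \<le> (\<Sum>r\<in>verts H. real (n * pend_mult H))"
    unfolding pend_total_def by (rule sum_mono)
  then show ?thesis by simp
qed

text \<open>The image of \<open>H\<close> becomes the component on one side of the bridge, so
  bridge-deletability of \<open>H\<close> applies.\<close>

lemma A_delete_pendant:
  assumes H: "H \<in> \<C>" and G: "G \<in> graphs_on \<A> n" and r: "r \<in> verts H" and p: "\<psi> \<in> pend H r G"
  shows "delete_edge G {\<psi> r, pend_nbr H r G \<psi>} \<in> graphs_on \<A> n"
proof -
  let ?x = "pend_nbr H r G \<psi>"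
  let ?G = "delete_edge G {\<psi> r, ?x}"
  have conn: "connected_graph H" using H C_conn by blast
  note D = delete_pendant_bridge[OF C_wf[OF H] A_wf(1)[OF G] conn r p]
  have wfG: "wf_graph ?G" using wf_delete_edge[OF A_wf(1)[OF G]] .
  have comp: "component_of ?G (\<psi> r) = \<psi> ` verts H"
    using component_eq_component_of[OF D(1), of "\<psi> r"] r by blast
  have "\<not> reach ?G (\<psi> r) ?x" using comp D(3) unfolding component_of_def by blast
  moreover have "isomorphic (induced ?G (component_of ?G (\<psi> r))) H"
    unfolding comp D(2) using pendD(2)[OF p] C_wf[OF H]
    by (rule_tac isomorphic_sym[OF _ _ isomorphic_relabel]) (auto intro: wf_relabel)
  moreover have "bridge_deletable H \<A>" "G \<in> \<A>" using C_del H A_wf(3)[OF G] by auto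
  ultimately have "?G \<in> \<A>" using D(4) unfolding bridge_deletable_def Let_def by blast
  then show ?thesis using A_wf(2)[OF G] by (simp add: graphs_on_def)
qed

text \<open>Outside \<open>pend_bad\<close> the pendant total is h \<rho>^h n up to \<epsilon>n, and
  the exceptional graphs are so rare that even with weight n^p their share stays below
  \<epsilon>.\<close>

lemma avg_pend_total:
  assumes H: "H \<in> \<C>" and \<epsilon>: "\<epsilon> > 0"
    and w: "\<forall>\<^sub>F n in sequentially. \<forall>G\<in>graphs_on \<A> n. 0 \<le> w G \<and> w G \<le> real n ^ p"
  shows "\<forall>\<^sub>F n in sequentially. \<bar>avg n (\<lambda>G. w G * pend_total H G) / n
      - card (verts H) * \<rho> ^ card (verts H) * avg n w\<bar> \<le> \<epsilon> * avg n w + \<epsilon>"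
proof -
  let ?h = "card (verts H)"
  let ?a = "?h * \<rho> ^ ?h"
  \<comment> \<open>\<open>K * n\<close> bounds the deviation of the pendant total for every graph,
    exceptional or not.\<close>
  define K where "K = real ?h * real (pend_mult H) + ?a"
  have a0: "?a \<ge> 0" using rho_pos by simp
  have K0: "K \<ge> 0" unfolding K_def by (rule add_nonneg_nonneg[OF _ a0]) simp
  have "(\<lambda>n. K * (real (card (pend_bad H \<epsilon> n)) / an n * real n ^ p)) \<longlonglongrightarrow> K * 0"
    using C_att C_det C_conn H by (intro tendsto_intros pend_total_concentration C_wf \<epsilon>) auto
  then have "(\<lambda>n. K * (real (card (pend_bad H \<epsilon> n)) / an n * real n ^ p)) \<longlonglongrightarrow> 0" by simp
  then have "\<forall>\<^sub>F n in sequentially. K * (real (card (pend_bad H \<epsilon> n)) / an n * real n ^ p) < \<epsilon>"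
    using \<epsilon> by (rule order_tendstoD)
  then show ?thesis using w eventually_gt_at_top[of 0]
  proof eventually_elim
    case (elim n)
    let ?ind = "\<lambda>G. if G \<in> pend_bad H \<epsilon> n then 1 else 0 :: real"
    have pt: "\<bar>w G * pend_total H G - ?a * n * w G\<bar> \<le> \<epsilon> * n * w G + real n ^ p * K * n * ?ind G"
      if G: "G \<in> graphs_on \<A> n" for G
    proof -
      have w0: "0 \<le> w G" "w G \<le> real n ^ p" using elim(2) G by auto
      have eq: "\<bar>w G * pend_total H G - ?a * n * w G\<bar> = w G * \<bar>pend_total H G - ?a * n\<bar>"
        using w0(1) abs_mult[of "w G" "pend_total H G - ?a * n"] by (simp add: algebra_simps)
      show ?thesis
      proof (cases "G \<in> pend_bad H \<epsilon> n")
        case True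
        have "\<bar>pend_total H G - ?a * n\<bar> \<le> \<bar>pend_total H G\<bar> + \<bar>?a * n\<bar>" by (rule abs_triangle_ineq4)
        also have "\<dots> = pend_total H G + ?a * n" using pend_total_nonneg a0 by simp
        also have "\<dots> \<le> K * n" unfolding K_def using pend_total_le[OF H G] by (simp add: algebra_simps)
        finally have "w G * \<bar>pend_total H G - ?a * n\<bar> \<le> real n ^ p * (K * n)"
          using w0 K0 by (intro mult_mono) auto
        moreover have "0 \<le> \<epsilon> * n * w G" using \<epsilon> w0 by simp
        ultimately show ?thesis unfolding eq using True by (simp add: mult.assoc)
      next
        case False
        then have "\<bar>pend_total H G - ?a * n\<bar> \<le> \<epsilon> * n" using G by (auto simp: pend_bad_def not_less)
        then have "w G * \<bar>pend_total H G - ?a * n\<bar> \<le> w G * (\<epsilon> * n)" using w0 by (intro mult_left_mono)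
        then show ?thesis unfolding eq using False by (simp add: mult_ac)
      qed
    qed
    have ind: "avg n ?ind = real (card (pend_bad H \<epsilon> n)) / an n"
    proof -
      have "pend_bad H \<epsilon> n \<subseteq> graphs_on \<A> n" by (auto simp: pend_bad_def)
      then show ?thesis unfolding avg_def using A_fin by (simp add: sum.If_cases Int_absorb1)
    qed
    have "avg n (\<lambda>G. w G * pend_total H G) - ?a * n * avg n w = avg n (\<lambda>G. w G * pend_total H G - ?a * n * w G)"
      by (simp only: avg_diff avg_cmult)
    also have "\<bar>\<dots>\<bar> \<le> avg n (\<lambda>G. \<bar>w G * pend_total H G - ?a * n * w G\<bar>)" by (rule avg_abs)
    also have "\<dots> \<le> avg n (\<lambda>G. \<epsilon> * n * w G + real n ^ p * K * n * ?ind G)" by (rule avg_mono) (rule pt)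
    also have "\<dots> = \<epsilon> * n * avg n w + real n ^ p * K * n * avg n ?ind" by (simp only: avg_add avg_cmult)
    also have "\<dots> = (\<epsilon> * avg n w + K * (real (card (pend_bad H \<epsilon> n)) / an n * real n ^ p)) * n"
      unfolding ind by (simp add: algebra_simps)
    also have "\<dots> \<le> (\<epsilon> * avg n w + \<epsilon>) * n" using elim(1) by (intro mult_right_mono) auto
    finally have main: "\<bar>avg n (\<lambda>G. w G * pend_total H G) - ?a * n * avg n w\<bar> \<le> (\<epsilon> * avg n w + \<epsilon>) * n" .
    have "avg n (\<lambda>G. w G * pend_total H G) / n - ?a * avg n w = (avg n (\<lambda>G. w G * pend_total H G) - ?a * n * avg n w) / n"
      using elim(3) by (simp add: diff_divide_distrib)
    also have "\<bar>\<dots>\<bar> = \<bar>avg n (\<lambda>G. w G * pend_total H G) - ?a * n * avg n w\<bar> / n" by (simp add: abs_divide)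
    also have "\<dots> \<le> \<epsilon> * avg n w + \<epsilon>" using main elim(3) by (simp add: pos_divide_le_eq)
    finally show ?case .
  qed
qed

section \<open>Expected numbers of embeddings onto unions of components\<close>

text \<open>The inequality "lower limit at least \<rho>^v(F)" for the expected number of embeddings,
  spelled out with constants \<open>c\<close>.\<close>

definition low :: "graph \<Rightarrow> bool" where
  "low F \<longleftrightarrow> (\<forall>c<\<rho> ^ card (verts F). \<forall>\<^sub>F n in sequentially. c \<le> avg n (\<lambda>G. real (card (emb F G))))"

text \<open>Every graph has exactly one embedding of the empty graph, and \<rho>^0 = 1.\<close>

lemma low_empty: "low ({}, {})"
proof -
  have "edges (induced G {}) = {}" if "wf_graph G" for G
    unfolding edges_induced using wf_edge_nonempty[OF that] by blast
  then have "induced G {} = ({}, {})" if "wf_graph G" for G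
    using that by (intro graph_eqI) auto
  then have "emb ({}, {}) G = {\<lambda>_. undefined}" if "wf_graph G" for G
    using that by (auto simp: emb_def closed_set_def relabel_def)
  then have "avg n (\<lambda>G. real (card (emb ({}, {}) G))) = avg n (\<lambda>_. 1)" for n
    unfolding avg_def using A_wf(1) by (intro arg_cong2[where f = "(/)"] sum.cong) auto
  then show ?thesis unfolding low_def using an_pos by (auto elim!: eventually_mono simp: avg_const)
qed

text \<open>From an embedding of \<open>F\<close> and a disjoint pendant embedding of
  \<open>H\<close>, deleting the bridge produces an embedding of the union. Root and outer end of
  the bridge are recorded, at most h n possibilities, so the map is injective; dividing by h n,
  concentration gives the factor \<rho>^h.\<close>

lemma low_gunion:
  assumes F: "wf_graph F" "low F" and H: "H \<in> \<C>" and disj: "verts F \<inter> verts H = {}"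
  shows "low (gunion F H)"
proof -
  let ?h = "card (verts H)" and ?v = "card (verts F)" and ?U = "gunion F H"
  let ?w = "\<lambda>G. real (card (emb F G))"
  have wfH: "wf_graph H" and connH: "connected_graph H" using H C_wf C_conn by auto
  have h: "?h > 0" using C_card_pos[OF H] .
  \<comment> \<open>Bounds the pendant embeddings, over all roots of \<open>H\<close>, that meet the
    image of one embedding of \<open>F\<close>.\<close>
  define c0 where "c0 = real (?h * (?v * pend_mult H))"
  have inj: "avg n (\<lambda>G. ?w G * (pend_total H G - c0)) \<le> avg n (\<lambda>G. real ?h * n * card (emb ?U G))" for n
  proof -
    let ?P = "\<lambda>G \<phi> r. {\<psi> \<in> pend H r G. \<psi> ` verts H \<inter> \<phi> ` verts F = {}}"
    let ?S = "Sigma (graphs_on \<A> n) (\<lambda>G. Sigma (emb F G) (\<lambda>\<phi>. Sigma (verts H) (\<lambda>r. ?P G \<phi> r)))"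
    let ?T = "Sigma (graphs_on \<A> n) (\<lambda>G. emb ?U G \<times> verts H \<times> {1..n})"
    let ?g = "\<lambda>(G, \<phi>, r, \<psi>). (delete_edge G {\<psi> r, pend_nbr H r G \<psi>}, join_fun (verts F) \<phi> \<psi>, r, pend_nbr H r G \<psi>)"
    have finP: "finite (?P G \<phi> r)" if "G \<in> graphs_on \<A> n" for G \<phi> r
      using finite_pend[OF wfH A_wf(1)[OF that]] by simp
    have "card ?S \<le> card ?T"
    proof (rule card_inj_on_le[of ?g])
      show "finite ?T"
        using A_fin finite_emb[OF wf_gunion[OF F(1) wfH]] A_wf(1) wf_finite[OF wfH]
        by (intro finite_SigmaI finite_cartesian_product) auto
      show "inj_on ?g ?S"
      proof (rule inj_onI)
        fix a b assume a: "a \<in> ?S" and b: "b \<in> ?S" and eq: "?g a = ?g b"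
        obtain G \<phi> r \<psi> where a': "a = (G, \<phi>, r, \<psi>)" by (cases a) blast
        obtain G' \<phi>' r' \<psi>' where b': "b = (G', \<phi>', r', \<psi>')" by (cases b) blast
        have A1: "G \<in> graphs_on \<A> n" "\<phi> \<in> emb F G" "r \<in> verts H" "\<psi> \<in> pend H r G" using a a' by auto
        have B1: "G' \<in> graphs_on \<A> n" "\<phi>' \<in> emb F G'" "r' \<in> verts H" "\<psi>' \<in> pend H r' G'" using b b' by auto
        have e: "delete_edge G {\<psi> r, pend_nbr H r G \<psi>} = delete_edge G' {\<psi>' r', pend_nbr H r' G' \<psi>'}"
          "join_fun (verts F) \<phi> \<psi> = join_fun (verts F) \<phi>' \<psi>'" "r = r'" "pend_nbr H r G \<psi> = pend_nbr H r' G' \<psi>'"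
          using eq a' b' by auto
        have ext: "\<phi> \<in> extensional (verts F)" "\<phi>' \<in> extensional (verts F)" "\<psi> \<in> extensional (verts H)" "\<psi>' \<in> extensional (verts H)"
          using A1 B1 pendD(1) by (auto simp: emb_def)
        have f: "\<phi> = \<phi>'" "\<psi> = \<psi>'"
          using restrict_join_fun[OF disj ext(1,3)] restrict_join_fun[OF disj ext(2,4)] e(2) by auto
        have "G = G'"
          using delete_pendant_bridge(5)[OF wfH A_wf(1)[OF A1(1)] connH A1(3,4)]
            delete_pendant_bridge(5)[OF wfH A_wf(1)[OF B1(1)] connH B1(3,4)] e f by metis
        then show "a = b" using a' b' e f by simp
      qed
      show "?g ` ?S \<subseteq> ?T"
      proof (rule image_subsetI)
        fix a assume "a \<in> ?S"
        then obtain G \<phi> r \<psi> where a: "a = (G, \<phi>, r, \<psi>)" "G \<in> graphs_on \<A> n" "\<phi> \<in> emb F G" "r \<in> verts H"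
          "\<psi> \<in> pend H r G" "\<psi> ` verts H \<inter> \<phi> ` verts F = {}" by (cases a) blast
        let ?x = "pend_nbr H r G \<psi>"
        let ?G = "delete_edge G {\<psi> r, ?x}"
        note D = delete_pendant_bridge[OF wfH A_wf(1)[OF a(2)] connH a(4,5)]
        have E: "\<phi> \<in> extensional (verts F)" "inj_on \<phi> (verts F)" "closed_set G (\<phi> ` verts F)" "induced G (\<phi> ` verts F) = relabel \<phi> F"
          using a(3) by (auto simp: emb_def)
        have E2: "\<psi> \<in> extensional (verts H)" "inj_on \<psi> (verts H)" "closed_set ?G (\<psi> ` verts H)" "induced ?G (\<psi> ` verts H) = relabel \<psi> H"
          using D(7) by (auto simp: emb_def)
        have cl: "closed_set ?G (\<phi> ` verts F)" using E(3) by (auto simp: closed_set_def)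
        have nsub: "\<not> {\<psi> r, ?x} \<subseteq> \<phi> ` verts F" using a(4,6) by blast
        have "induced ?G (\<phi> ` verts F) = induced G (\<phi> ` verts F)"
        proof (rule graph_eqI)
          show "edges (induced ?G (\<phi> ` verts F)) = edges (induced G (\<phi> ` verts F))"
            unfolding edges_induced edges_delete_edge using nsub by blast
        qed simp
        then have ind: "induced ?G (\<phi> ` verts F) = relabel \<phi> F" using E(4) by simp
        have im: "join_fun (verts F) \<phi> \<psi> ` (verts F \<union> verts H) = \<phi> ` verts F \<union> \<psi> ` verts H" by (rule join_fun_image[OF disj])
        have wfG: "wf_graph ?G" using wf_delete_edge[OF A_wf(1)[OF a(2)]] .
        have "join_fun (verts F) \<phi> \<psi> \<in> emb ?U ?G"
          unfolding emb_def mem_Collect_eq verts_gunion im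
        proof (intro conjI)
          show "join_fun (verts F) \<phi> \<psi> \<in> extensional (verts F \<union> verts H)" by (rule join_fun_extensional[OF E2(1)])
          show "inj_on (join_fun (verts F) \<phi> \<psi>) (verts F \<union> verts H)"
            by (rule join_fun_inj[OF disj E(2) E2(2)]) (use a(6) in blast)
          show "closed_set ?G (\<phi> ` verts F \<union> \<psi> ` verts H)" using closed_set_Un[OF cl E2(3)] .
          show "induced ?G (\<phi> ` verts F \<union> \<psi> ` verts H) = relabel (join_fun (verts F) \<phi> \<psi>) ?U"
            using induced_Un_closed[OF wfG cl E2(3)] ind E2(4) relabel_join_fun[OF F(1) wfH disj] by simp
        qed
        moreover have "?G \<in> graphs_on \<A> n" using A_delete_pendant[OF H a(2,4,5)] .
        moreover have "?x \<in> {1..n}" using pend_nbr(1)[OF a(5)] A_wf(2)[OF a(2)] by blast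
        ultimately show "?g a \<in> ?T" unfolding a(1) using a(4) by simp
      qed
    qed
    also have "card ?T = (\<Sum>G\<in>graphs_on \<A> n. card (emb ?U G) * (?h * n))"
      using A_fin finite_emb[OF wf_gunion[OF F(1) wfH]] A_wf(1) wf_finite[OF wfH]
      by (subst card_SigmaI) (auto simp: card_cartesian_product)
    finally have 1: "card ?S \<le> (\<Sum>G\<in>graphs_on \<A> n. card (emb ?U G) * (?h * n))" .
    have "(\<Sum>G\<in>graphs_on \<A> n. ?w G * (pend_total H G - c0)) \<le> real (card ?S)"
    proof -
      have inner: "?w G * (pend_total H G - c0) \<le> real (card (Sigma (emb F G) (\<lambda>\<phi>. Sigma (verts H) (\<lambda>r. ?P G \<phi> r))))"
        if G: "G \<in> graphs_on \<A> n" for G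
      proof -
        have one: "pend_total H G - c0 \<le> real (card (Sigma (verts H) (\<lambda>r. ?P G \<phi> r)))" for \<phi>
        proof -
          have "real (card (pend H r G)) - real (?v * pend_mult H) \<le> real (card (?P G \<phi> r))" for r
          proof -
            have im: "finite (\<phi> ` verts F)" "card (\<phi> ` verts F) \<le> ?v" using wf_finite[OF F(1)] card_image_le by auto
            have u: "pend H r G = ?P G \<phi> r \<union> {\<psi> \<in> pend H r G. \<psi> ` verts H \<inter> \<phi> ` verts F \<noteq> {}}" by blast
            have "card (pend H r G) \<le> card (?P G \<phi> r) + card {\<psi> \<in> pend H r G. \<psi> ` verts H \<inter> \<phi> ` verts F \<noteq> {}}"
              by (subst u) (rule card_Un_le)
            also have "card {\<psi> \<in> pend H r G. \<psi> ` verts H \<inter> \<phi> ` verts F \<noteq> {}} \<le> card (\<phi> ` verts F) * pend_mult H"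
              by (rule card_pend_meeting[OF wfH A_wf(1)[OF G] connH im(1)])
            also have "\<dots> \<le> ?v * pend_mult H" using im(2) by (rule mult_right_mono) simp
            finally have "card (pend H r G) \<le> card (?P G \<phi> r) + ?v * pend_mult H" by simp
            then show ?thesis using of_nat_mono[of "card (pend H r G)" "card (?P G \<phi> r) + ?v * pend_mult H", where 'a = real] by simp
          qed
          then have "(\<Sum>r\<in>verts H. real (card (pend H r G)) - real (?v * pend_mult H)) \<le> (\<Sum>r\<in>verts H. real (card (?P G \<phi> r)))"
            by (rule sum_mono)
          moreover have "(\<Sum>r\<in>verts H. real (card (pend H r G)) - real (?v * pend_mult H)) = pend_total H G - c0"
            by (simp add: pend_total_def sum_subtractf c0_def)
          moreover have "real (card (Sigma (verts H) (\<lambda>r. ?P G \<phi> r))) = (\<Sum>r\<in>verts H. real (card (?P G \<phi> r)))"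
            using wf_finite[OF wfH] finP[OF G] by (subst card_SigmaI) auto
          ultimately show ?thesis by simp
        qed
        have "?w G * (pend_total H G - c0) = (\<Sum>\<phi>\<in>emb F G. pend_total H G - c0)" by simp
        also have "\<dots> \<le> (\<Sum>\<phi>\<in>emb F G. real (card (Sigma (verts H) (\<lambda>r. ?P G \<phi> r))))" by (rule sum_mono) (rule one)
        also have "\<dots> = real (card (Sigma (emb F G) (\<lambda>\<phi>. Sigma (verts H) (\<lambda>r. ?P G \<phi> r))))"
          using finite_emb[OF F(1) A_wf(1)[OF G]] wf_finite[OF wfH] finP[OF G] by (subst card_SigmaI) auto
        finally show ?thesis .
      qed
      have "(\<Sum>G\<in>graphs_on \<A> n. ?w G * (pend_total H G - c0)) \<le> (\<Sum>G\<in>graphs_on \<A> n. real (card (Sigma (emb F G) (\<lambda>\<phi>. Sigma (verts H) (\<lambda>r. ?P G \<phi> r)))))"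
        by (rule sum_mono) (rule inner)
      also have "\<dots> = real (card ?S)"
        using A_fin finite_emb[OF F(1)] A_wf(1) wf_finite[OF wfH] finP by (subst card_SigmaI) (auto intro!: finite_SigmaI)
      finally show ?thesis .
    qed
    also have "\<dots> \<le> real (\<Sum>G\<in>graphs_on \<A> n. card (emb ?U G) * (?h * n))" using 1 by (rule of_nat_mono)
    also have "\<dots> = (\<Sum>G\<in>graphs_on \<A> n. real ?h * n * card (emb ?U G))" by (simp add: mult_ac)
    finally show ?thesis unfolding avg_def by (rule divide_right_mono) simp
  qed
  show ?thesis unfolding low_def
  proof (intro allI impI)
    fix c assume "c < \<rho> ^ card (verts ?U)"
    moreover have "card (verts ?U) = ?v + ?h" using disj wf_finite F wfH by (simp add: card_Un_disjoint)
    ultimately have c: "c < \<rho> ^ ?v * \<rho> ^ ?h" by (simp add: power_add)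
    have rp: "\<rho> ^ ?h > 0" "\<rho> ^ ?v > 0" using rho_pos by auto
    define x where "x = c / \<rho> ^ ?h"
    \<comment> \<open>A positive number strictly between c / \<rho>^h and \<rho>^v(F), which leaves
      a gap for the errors.\<close>
    define c1 where "c1 = (max x 0 + \<rho> ^ ?v) / 2"
    have "x < \<rho> ^ ?v" using c rp by (simp add: pos_divide_less_eq x_def)
    then have c1: "0 < c1" "c1 < \<rho> ^ ?v" "x < c1" using rp by (auto simp: c1_def max_def)
    have "\<rho> ^ ?h \<noteq> 0" using rp by linarith
    then have "c = \<rho> ^ ?h * x" unfolding x_def by (metis nonzero_mult_div_cancel_left times_divide_eq_right)
    then have c1': "c < \<rho> ^ ?h * c1" using c1(3) rp by simp
    \<comment> \<open>The first term spends at most half of the gap on the error \<epsilon> (c1 +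
      1); the second keeps the coefficient of \<open>avg n ?w\<close> positive.\<close>
    define \<epsilon> where "\<epsilon> = min (?h * (\<rho> ^ ?h * c1 - c) / (2 * (c1 + 1))) (?h * \<rho> ^ ?h / 2)"
    have \<epsilon>: "\<epsilon> > 0" using c1' c1 h rp by (simp add: \<epsilon>_def)
    have \<epsilon>1: "\<epsilon> * (c1 + 1) \<le> ?h * (\<rho> ^ ?h * c1 - c) / 2" 
    proof -
      have "\<epsilon> \<le> ?h * (\<rho> ^ ?h * c1 - c) / (2 * (c1 + 1))" by (simp add: \<epsilon>_def)
      then have "\<epsilon> * (2 * (c1 + 1)) \<le> ?h * (\<rho> ^ ?h * c1 - c)" using c1 by (subst (asm) pos_le_divide_eq) auto
      then have "2 * (\<epsilon> * (c1 + 1)) \<le> ?h * (\<rho> ^ ?h * c1 - c)" by (simp only: mult.left_commute)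
      then show ?thesis by linarith
    qed
    have lim: "(\<lambda>n. (?h * \<rho> ^ ?h - \<epsilon> - c0 / n) * c1 - \<epsilon>) \<longlonglongrightarrow> (?h * \<rho> ^ ?h - \<epsilon> - 0) * c1 - \<epsilon>"
      by (intro tendsto_intros lim_const_over_n)
    have "?h * c < (?h * \<rho> ^ ?h - \<epsilon> - 0) * c1 - \<epsilon>"
    proof -
      have "?h * (\<rho> ^ ?h * c1 - c) > 0" using c1' h by simp
      then show ?thesis using \<epsilon>1 by (simp add: algebra_simps)
    qed
    from order_tendstoD(1)[OF lim this]
    have ev1: "\<forall>\<^sub>F n in sequentially. ?h * c < (?h * \<rho> ^ ?h - \<epsilon> - c0 / n) * c1 - \<epsilon>" .
    have lim2: "(\<lambda>n. ?h * \<rho> ^ ?h - \<epsilon> - c0 / n) \<longlonglongrightarrow> ?h * \<rho> ^ ?h - \<epsilon> - 0"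
      by (intro tendsto_intros lim_const_over_n)
    have "0 < ?h * \<rho> ^ ?h - \<epsilon> - 0"
    proof -
      have "\<epsilon> \<le> ?h * \<rho> ^ ?h / 2" unfolding \<epsilon>_def by (rule min.cobounded2)
      moreover have "?h * \<rho> ^ ?h > 0" using h rp by simp
      ultimately show ?thesis by linarith
    qed
    from order_tendstoD(1)[OF lim2 this]
    have ev2: "\<forall>\<^sub>F n in sequentially. 0 < ?h * \<rho> ^ ?h - \<epsilon> - c0 / n" .
    have ev3: "\<forall>\<^sub>F n in sequentially. \<forall>G\<in>graphs_on \<A> n. 0 \<le> ?w G \<and> ?w G \<le> real n ^ ?v"
    proof (intro always_eventually allI ballI conjI)
      fix n G assume G: "G \<in> graphs_on \<A> n"
      have "card (emb F G) \<le> n ^ ?v" using card_emb_le[OF F(1) A_wf(1)[OF G]] A_wf(2)[OF G] by simp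
      then show "?w G \<le> real n ^ ?v" by (metis of_nat_le_iff of_nat_power)
    qed simp
    have "\<forall>\<^sub>F n in sequentially. c1 \<le> avg n ?w" using F(2) c1(2) by (simp add: low_def)
    then show "\<forall>\<^sub>F n in sequentially. c \<le> avg n (\<lambda>G. real (card (emb ?U G)))"
      using ev1 ev2 avg_pend_total[OF H \<epsilon> ev3] eventually_gt_at_top[of 0]
    proof eventually_elim
      case (elim n)
      have "avg n (\<lambda>G. ?w G * (pend_total H G - c0)) = avg n (\<lambda>G. ?w G * pend_total H G) - c0 * avg n ?w"
        by (simp add: right_diff_distrib avg_diff mult.commute[of _ c0] avg_cmult)
      then have "avg n (\<lambda>G. ?w G * pend_total H G) - c0 * avg n ?w \<le> real ?h * real n * avg n (\<lambda>G. real (card (emb ?U G)))"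
        using inj[of n] by (simp only: avg_cmult)
      then have "(avg n (\<lambda>G. ?w G * pend_total H G) - c0 * avg n ?w) / n \<le> ?h * avg n (\<lambda>G. real (card (emb ?U G)))"
        using elim(5) by (simp add: pos_divide_le_eq mult_ac)
      then have 1: "avg n (\<lambda>G. ?w G * pend_total H G) / n - c0 / n * avg n ?w \<le> ?h * avg n (\<lambda>G. real (card (emb ?U G)))"
        by (simp add: diff_divide_distrib)
      have "?h * c \<le> (?h * \<rho> ^ ?h - \<epsilon> - c0 / n) * c1 - \<epsilon>" using elim(2) by simp
      also have "\<dots> \<le> (?h * \<rho> ^ ?h - \<epsilon> - c0 / n) * avg n ?w - \<epsilon>" using elim(1,3) by (simp add: mult_left_mono)
      also have "\<dots> = ?h * \<rho> ^ ?h * avg n ?w - (\<epsilon> * avg n ?w + \<epsilon>) - c0 / n * avg n ?w" by (simp add: algebra_simps)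
      also have "\<dots> \<le> avg n (\<lambda>G. ?w G * pend_total H G) / n - c0 / n * avg n ?w" using elim(4) by linarith
      also have "\<dots> \<le> ?h * avg n (\<lambda>G. real (card (emb ?U G)))" by (rule 1)
      finally show ?case using h by simp
    qed
  qed
qed

lemma low_forest: "F \<in> forest \<C> \<Longrightarrow> low F"
  by (erule forest_induct) (auto intro: low_empty low_gunion forest_wf)

end

section \<open>The closure under bridges and the bound one half\<close>

lemma card_class_verts:
  assumes X: "graph_class X" and V: "finite V"
  shows "card {G \<in> X. verts G = V} = card (graphs_on X (card V))"
proof -
  obtain f where f: "bij_betw f V {1..card V}"
    using V by (metis card_atLeastAtMost diff_Suc_1 finite_atLeastAtMost finite_same_card_bij)
  have inj: "inj_on f V" "f ` V = {1..card V}" using f by (auto simp: bij_betw_def)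
  let ?g = "inv_into V f"
  have g: "inj_on ?g {1..card V}" "?g ` {1..card V} = V" "\<And>v. v \<in> V \<Longrightarrow> ?g (f v) = v" "\<And>v. v \<in> {1..card V} \<Longrightarrow> f (?g v) = v"
    using bij_betw_inv_into[OF f] inj f_inv_into_f[of _ f V] by (auto simp: bij_betw_def)
  have "bij_betw (relabel f) {G \<in> X. verts G = V} (graphs_on X (card V))"
  proof (rule bij_betw_byWitness[where f' = "relabel ?g"])
    show "\<forall>G\<in>{G \<in> X. verts G = V}. relabel ?g (relabel f G) = G"
    proof
      fix G assume G: "G \<in> {G \<in> X. verts G = V}"
      have "wf_graph G" "inj_on f (verts G)" "\<And>v. v \<in> verts G \<Longrightarrow> ?g (f v) = v"
        using G graph_class_wf[OF X] inj(1) g(3) by auto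
      then show "relabel ?g (relabel f G) = G" by (rule relabel_inv)
    qed
    show "\<forall>G\<in>graphs_on X (card V). relabel f (relabel ?g G) = G"
    proof
      fix G assume G: "G \<in> graphs_on X (card V)"
      have "wf_graph G" "inj_on ?g (verts G)" "\<And>v. v \<in> verts G \<Longrightarrow> f (?g v) = v"
        using G graph_class_wf[OF X] g(1,4) by (auto simp: graphs_on_def)
      then show "relabel f (relabel ?g G) = G" by (rule relabel_inv)
    qed
    show "relabel f ` {G \<in> X. verts G = V} \<subseteq> graphs_on X (card V)"
      using graph_class_relabel[OF X] inj by (auto simp: graphs_on_def)
    show "relabel ?g ` graphs_on X (card V) \<subseteq> {G \<in> X. verts G = V}"
      using graph_class_relabel[OF X] g by (auto simp: graphs_on_def)
  qed
  then show ?thesis by (rule bij_betw_same_card)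
qed

lemma sum_over_subsets:
  fixes f :: "nat \<Rightarrow> real"
  assumes "finite S"
  shows "(\<Sum>A\<in>Pow S. f (card A)) = (\<Sum>i\<le>card S. real (card S choose i) * f i)"
proof -
  have "(\<Sum>A\<in>Pow S. f (card A)) = (\<Sum>i\<le>card S. \<Sum>A\<in>{A \<in> Pow S. card A = i}. f (card A))"
    by (rule sum.group[symmetric]) (use assms card_mono in auto)
  also have "\<dots> = (\<Sum>i\<le>card S. real (card S choose i) * f i)"
  proof (rule sum.cong)
    fix i
    have "(\<Sum>A\<in>{A \<in> Pow S. card A = i}. f (card A)) = (\<Sum>A\<in>{A \<in> Pow S. card A = i}. f i)"
      by (rule sum.cong) auto
    moreover have "card {A \<in> Pow S. card A = i} = (card S choose i)"
      using n_subsets[OF assms, of i] by simp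
    ultimately show "(\<Sum>A\<in>{A \<in> Pow S. card A = i}. f (card A)) = real (card S choose i) * f i" by simp
  qed simp
  finally show ?thesis .
qed

lemma emb_component:
  assumes "wf_graph H" "wf_graph G" "connected_graph H" "\<phi> \<in> emb H G"
  shows "\<phi> ` verts H \<in> components G" "induced G (\<phi> ` verts H) = relabel \<phi> H"
proof -
  have E: "closed_set G (\<phi> ` verts H)" and I: "induced G (\<phi> ` verts H) = relabel \<phi> H"
    using assms(4) by (auto simp: emb_def)
  show "induced G (\<phi> ` verts H) = relabel \<phi> H" by (rule I)
  have "connected_graph (induced G (\<phi> ` verts H))" unfolding I using connected_relabel[OF assms(3)] .
  then show "\<phi> ` verts H \<in> components G"
    using E components_iff[OF assms(2)] connected_induced_conn_set by blast
qed

text \<open>A component of size \<open>n\<close> is the image of exactly \<open>n!\<close> labelled graphs on \<open>{1..n}\<close>.\<close>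
lemma sum_card_emb_le:
  assumes X: "graph_class X" and conn: "\<forall>H\<in>X. connected_graph H" and wf: "wf_graph G"
  shows "(\<Sum>H\<in>graphs_on X n. card (emb H G)) \<le> fact n * card {K \<in> components G. card K = n \<and> induced G K \<in> X}"
proof -
  let ?K = "{K \<in> components G. card K = n \<and> induced G K \<in> X}"
  let ?B = "\<lambda>K. {\<phi> \<in> {1..n} \<rightarrow>\<^sub>E K. inj_on \<phi> {1..n}}"
  have finK: "finite ?K" using finite_components[OF wf] by simp
  have K: "finite K" "card K = n" if "K \<in> ?K" for K
    using that components_subset[of K G] wf_finite[OF wf] by (auto intro: finite_subset)
  have finB: "finite (?B K)" if "K \<in> ?K" for K
    using finite_PiE[of "{1..n}" "\<lambda>_. K"] K[OF that] by simp
  have Hwf: "wf_graph H" "connected_graph H" "verts H = {1..n}" "H \<in> X" if "H \<in> graphs_on X n" for H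
    using that graph_class_wf[OF X] conn by (auto simp: graphs_on_def)
  have "(\<Sum>H\<in>graphs_on X n. card (emb H G)) = card (Sigma (graphs_on X n) (\<lambda>H. emb H G))"
    using finite_graphs_on[OF X] finite_emb[OF _ wf] Hwf by (subst card_SigmaI) auto
  also have "\<dots> \<le> card (Sigma ?K ?B)"
  proof (rule card_inj_on_le[of "\<lambda>(H, \<phi>). (\<phi> ` {1..n}, \<phi>)"])
    show "finite (Sigma ?K ?B)" using finK finB by (intro finite_SigmaI) auto
    show "(\<lambda>(H, \<phi>). (\<phi> ` {1..n}, \<phi>)) ` Sigma (graphs_on X n) (\<lambda>H. emb H G) \<subseteq> Sigma ?K ?B"
    proof (rule image_subsetI)
      fix a assume "a \<in> Sigma (graphs_on X n) (\<lambda>H. emb H G)"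
      then obtain H \<phi> where a: "a = (H, \<phi>)" "H \<in> graphs_on X n" "\<phi> \<in> emb H G" by (cases a) blast
      note W = Hwf[OF a(2)] and E = emb_component[OF Hwf(1)[OF a(2)] wf Hwf(2)[OF a(2)] a(3)]
      have i: "inj_on \<phi> {1..n}" "\<phi> \<in> extensional {1..n}" using a(3) W(3) by (auto simp: emb_def)
      have "induced G (\<phi> ` {1..n}) \<in> X" using E(2) W(3,4) graph_class_relabel[OF X] i by simp
      moreover have "card (\<phi> ` {1..n}) = n" using card_image[OF i(1)] by simp
      moreover have "\<phi> ` {1..n} \<in> components G" using E(1) W(3) by simp
      moreover have "\<phi> \<in> {1..n} \<rightarrow>\<^sub>E \<phi> ` {1..n}" using i(2) by (auto simp: PiE_def)
      ultimately show "(\<lambda>(H, \<phi>). (\<phi> ` {1..n}, \<phi>)) a \<in> Sigma ?K ?B" unfolding a(1) using i(1) by simp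
    qed
    show "inj_on (\<lambda>(H, \<phi>). (\<phi> ` {1..n}, \<phi>)) (Sigma (graphs_on X n) (\<lambda>H. emb H G))"
    proof (rule inj_onI)
      fix a b assume ab: "a \<in> Sigma (graphs_on X n) (\<lambda>H. emb H G)" "b \<in> Sigma (graphs_on X n) (\<lambda>H. emb H G)"
        "(\<lambda>(H, \<phi>). (\<phi> ` {1..n}, \<phi>)) a = (\<lambda>(H, \<phi>). (\<phi> ` {1..n}, \<phi>)) b"
      obtain H \<phi> H' \<phi>' where e: "a = (H, \<phi>)" "b = (H', \<phi>')" by (cases a, cases b) blast
      have p: "\<phi>' = \<phi>" using ab(3) e by simp
      have HH: "H \<in> graphs_on X n" "H' \<in> graphs_on X n" "\<phi> \<in> emb H G" "\<phi> \<in> emb H' G" using ab(1,2) e p by auto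
      have "relabel \<phi> H = relabel \<phi> H'"
        using emb_component(2)[OF Hwf(1)[OF HH(1)] wf Hwf(2)[OF HH(1)] HH(3)]
          emb_component(2)[OF Hwf(1)[OF HH(2)] wf Hwf(2)[OF HH(2)] HH(4)] Hwf(3)[OF HH(1)] Hwf(3)[OF HH(2)] by simp
      moreover have i: "inj_on \<phi> (verts H)" "inj_on \<phi> (verts H')" using HH by (auto simp: emb_def)
      moreover have "relabel (inv_into {1..n} \<phi>) (relabel \<phi> H) = H" "relabel (inv_into {1..n} \<phi>) (relabel \<phi> H') = H'"
        using relabel_inv[OF Hwf(1)[OF HH(1)] i(1)] relabel_inv[OF Hwf(1)[OF HH(2)] i(2)] i Hwf(3)[OF HH(1)] Hwf(3)[OF HH(2)] by auto
      ultimately have "H = H'" by metis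
      then show "a = b" using e p by simp
    qed
  qed
  also have "\<dots> = (\<Sum>K\<in>?K. card (?B K))" using finK finB by (subst card_SigmaI) auto
  also have "\<dots> = (\<Sum>K\<in>?K. fact n)"
  proof (rule sum.cong)
    fix K assume K': "K \<in> ?K"
    have "card (?B K) = prod ((-) (card K)) {0..<card {1..n}}"
      using card_inj_on_subset_funcset[of "{1..n}" K "{1..n}"] K[OF K'] by simp
    then show "card (?B K) = fact n" using K[OF K'] by (simp add: fact_prod_rev)
  qed simp
  finally show ?thesis by (simp add: mult.commute)
qed

context comp_class
begin

section \<open>Closing the forests under bridges\<close>

text \<open>Starting from forests rather than connected graphs lets each rule add a single edge,
  which is one use of bridge-addability. Joining two members of \<open>\<C>\<close> is a forest with
  two components followed by one bridge.\<close>

inductive_set TT :: "graph set" where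
  forest: "F \<in> forest \<C> \<Longrightarrow> F \<in> TT"
| bridge: "F \<in> TT \<Longrightarrow> u \<in> verts F \<Longrightarrow> v \<in> verts F \<Longrightarrow> \<not> reach F u v \<Longrightarrow> add_edge F u v \<in> TT"

lemma TT_wf: "F \<in> TT \<Longrightarrow> wf_graph F"
proof (induction rule: TT.induct)
  case (bridge F u v)
  have "u \<noteq> v" using bridge by auto
  then show ?case using bridge wf_add_edge by blast
qed (rule forest_wf)

lemma TT_relabel: "F \<in> TT \<Longrightarrow> inj_on f (verts F) \<Longrightarrow> relabel f F \<in> TT"
proof (induction rule: TT.induct)
  case (forest F)
  then show ?case using relabel_in_forest[OF C] TT.forest by blast
next
  case (bridge F u v)
  have wf: "wf_graph F" using TT_wf[OF bridge.hyps(1)] .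
  have inj: "inj_on f (verts F)" using bridge.prems by simp
  have eq: "relabel f (add_edge F u v) = add_edge (relabel f F) (f u) (f v)" by (rule graph_eqI) auto
  have "\<not> reach (relabel f F) (f u) (f v)"
    using reach_relabel_iff[OF wf inj bridge.hyps(2,3)] bridge.hyps(4) by simp
  then show ?case unfolding eq using bridge.IH[OF inj] bridge.hyps(2,3) by (intro TT.bridge) auto
qed

lemma add_edge_gunion: "gunion (add_edge F u v) H = add_edge (gunion F H) u v"
  by (rule graph_eqI) auto

lemma gunion_commute: "gunion F H = gunion H F"
  by (rule graph_eqI) auto

lemma reach_gunion_iff:
  assumes "wf_graph F" "wf_graph H" "verts F \<inter> verts H = {}" "u \<in> verts F"
  shows "reach (gunion F H) u v \<longleftrightarrow> reach F u v"
  using reach_induced[OF gunion_parts(1)[OF assms(1-3)] assms(4), of v] gunion_parts(3)[OF assms(1-3)] by simp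

lemma TT_gunion_forest:
  "F \<in> TT \<Longrightarrow> H \<in> forest \<C> \<Longrightarrow> verts F \<inter> verts H = {} \<Longrightarrow> gunion F H \<in> TT"
proof (induction rule: TT.induct)
  case (forest F)
  then show ?case using gunion_in_forest TT.forest by blast
next
  case (bridge F u v)
  have disj: "verts F \<inter> verts H = {}" using bridge.prems by simp
  have "\<not> reach (gunion F H) u v"
    using reach_gunion_iff[OF TT_wf[OF bridge.hyps(1)] forest_wf[OF bridge.prems(1)] disj bridge.hyps(2)] bridge.hyps(4) by simp
  then show ?case unfolding add_edge_gunion
    using bridge.IH[OF bridge.prems(1) disj] bridge.hyps(2,3) by (intro TT.bridge) auto
qed

text \<open>Induction on one operand, with \<open>TT_gunion_forest\<close> as the base case; an
  added edge still joins different components because the other operand is disjoint.\<close>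

lemma TT_gunion:
  "H \<in> TT \<Longrightarrow> F \<in> TT \<Longrightarrow> verts F \<inter> verts H = {} \<Longrightarrow> gunion F H \<in> TT"
proof (induction rule: TT.induct)
  case (forest H)
  then show ?case using TT_gunion_forest by blast
next
  case (bridge H u v)
  have disj: "verts H \<inter> verts F = {}" using bridge.prems by auto
  have wf: "wf_graph H" "wf_graph F" using TT_wf bridge by auto
  have "\<not> reach (gunion H F) u v"
    using reach_gunion_iff[OF wf disj bridge.hyps(2)] bridge.hyps(4) by simp
  moreover have "gunion H F \<in> TT" using bridge.IH[OF bridge.prems(1)] disj gunion_commute[of H F] by auto
  ultimately have "add_edge (gunion H F) u v \<in> TT" using bridge.hyps(2,3) by (intro TT.bridge) auto
  then show ?case using gunion_commute[of F] add_edge_gunion by simp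
qed

text \<open>Adding the image of the new edge to \<open>G\<close> stays in the class and turns an
  embedding of \<open>F\<close> into one of F + uv. The embedding itself tells which edge to remove
  again, so nothing is counted twice.\<close>

lemma low_add_edge:
  assumes wf: "wf_graph F" and low: "low F" and uv: "u \<in> verts F" "v \<in> verts F" "\<not> reach F u v"
  shows "low (add_edge F u v)"
proof -
  let ?F = "add_edge F u v"
  have wf': "wf_graph ?F" using wf_add_edge[OF wf uv(1,2)] uv(3) reach_refl by metis
  have "avg n (\<lambda>G. real (card (emb F G))) \<le> avg n (\<lambda>G. real (card (emb ?F G)))" for n
  proof -
    let ?S = "Sigma (graphs_on \<A> n) (emb F)" and ?T = "Sigma (graphs_on \<A> n) (emb ?F)"
    have nr: "\<not> reach G (\<phi> u) (\<phi> v)" if "G \<in> graphs_on \<A> n" "\<phi> \<in> emb F G" for G \<phi>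
    proof -
      have E: "inj_on \<phi> (verts F)" "closed_set G (\<phi> ` verts F)" "induced G (\<phi> ` verts F) = relabel \<phi> F"
        using that by (auto simp: emb_def)
      have "reach G (\<phi> u) (\<phi> v) \<longleftrightarrow> reach (relabel \<phi> F) (\<phi> u) (\<phi> v)"
        using reach_induced[OF E(2), of "\<phi> u" "\<phi> v"] E(3) uv(1) by simp
      then show ?thesis using reach_relabel_iff[OF wf E(1) uv(1,2)] uv(3) by simp
    qed
    have "card ?S \<le> card ?T"
    proof (rule card_inj_on_le[of "\<lambda>(G, \<phi>). (add_edge G (\<phi> u) (\<phi> v), \<phi>)"])
      show "finite ?T" using A_fin finite_emb[OF wf' A_wf(1)] by (intro finite_SigmaI) auto
      show "inj_on (\<lambda>(G, \<phi>). (add_edge G (\<phi> u) (\<phi> v), \<phi>)) ?S"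
      proof (rule inj_onI)
        fix a b assume ab: "a \<in> ?S" "b \<in> ?S" "(\<lambda>(G, \<phi>). (add_edge G (\<phi> u) (\<phi> v), \<phi>)) a = (\<lambda>(G, \<phi>). (add_edge G (\<phi> u) (\<phi> v), \<phi>)) b"
        obtain G \<phi> G' \<phi>' where e: "a = (G, \<phi>)" "b = (G', \<phi>')" by (cases a, cases b) blast
        have eq: "\<phi>' = \<phi>" "add_edge G (\<phi> u) (\<phi> v) = add_edge G' (\<phi> u) (\<phi> v)" using ab e by auto
        have "\<not> reach G (\<phi> u) (\<phi> v)" "\<not> reach G' (\<phi> u) (\<phi> v)" using ab e eq(1) nr by auto
        then have "G = G'" using eq(2) add_edge_bridge(2) delete_edge_add_edge by metis
        then show "a = b" using e eq by simp
      qed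
      show "(\<lambda>(G, \<phi>). (add_edge G (\<phi> u) (\<phi> v), \<phi>)) ` ?S \<subseteq> ?T"
      proof (rule image_subsetI)
        fix a assume "a \<in> ?S"
        then obtain G \<phi> where a: "a = (G, \<phi>)" "G \<in> graphs_on \<A> n" "\<phi> \<in> emb F G" by (cases a) blast
        have E: "\<phi> \<in> extensional (verts F)" "inj_on \<phi> (verts F)" "closed_set G (\<phi> ` verts F)" "induced G (\<phi> ` verts F) = relabel \<phi> F"
          using a(3) by (auto simp: emb_def)
        let ?G = "add_edge G (\<phi> u) (\<phi> v)" and ?W = "\<phi> ` verts F"
        have uvW: "{\<phi> u, \<phi> v} \<subseteq> ?W" using uv by blast
        have "closed_set ?G ?W" using E(3) uvW unfolding closed_set_def verts_add_edge edges_add_edge by blast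
        moreover have "induced ?G ?W = relabel \<phi> ?F"
        proof (rule graph_eqI)
          have "edges (induced ?G ?W) = insert {\<phi> u, \<phi> v} (edges (induced G ?W))"
            unfolding edges_induced edges_add_edge using uvW by blast
          also have "\<dots> = edges (relabel \<phi> ?F)" unfolding E(4) by simp
          finally show "edges (induced ?G ?W) = edges (relabel \<phi> ?F)" .
        qed simp
        ultimately have "\<phi> \<in> emb ?F ?G" using E by (simp add: emb_def)
        moreover have "?W \<subseteq> {1..n}" using E(3) A_wf(2)[OF a(2)] by (simp add: closed_set_def)
        then have "?G \<in> graphs_on \<A> n" using A_add_edge[OF a(2) _ _ nr[OF a(2,3)]] uvW by blast
        ultimately show "(\<lambda>(G, \<phi>). (add_edge G (\<phi> u) (\<phi> v), \<phi>)) a \<in> ?T" unfolding a(1) by simp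
      qed
    qed
    also have "card ?S = (\<Sum>G\<in>graphs_on \<A> n. card (emb F G))"
      using A_fin finite_emb[OF wf A_wf(1)] by (subst card_SigmaI) auto
    also have "card ?T = (\<Sum>G\<in>graphs_on \<A> n. card (emb ?F G))"
      using A_fin finite_emb[OF wf' A_wf(1)] by (subst card_SigmaI) auto
    finally have "real (\<Sum>G\<in>graphs_on \<A> n. card (emb F G)) \<le> real (\<Sum>G\<in>graphs_on \<A> n. card (emb ?F G))" by (rule of_nat_mono)
    then show ?thesis unfolding avg_def by (intro divide_right_mono) (simp_all only: of_nat_sum of_nat_0_le_iff)
  qed
  note le = this
  show ?thesis unfolding low_def verts_add_edge
  proof (intro allI impI)
    fix c assume "c < \<rho> ^ card (verts F)"
    then have "\<forall>\<^sub>F n in sequentially. c \<le> avg n (\<lambda>G. real (card (emb F G)))" using low unfolding low_def by blast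
    then show "\<forall>\<^sub>F n in sequentially. c \<le> avg n (\<lambda>G. real (card (emb ?F G)))"
      by (rule eventually_mono) (rule order_trans[OF _ le])
  qed
qed

lemma low_TT: "F \<in> TT \<Longrightarrow> low F"
  by (induction rule: TT.induct) (auto intro: low_forest low_add_edge TT_wf)

definition T :: "graph set" where "T = {H \<in> TT. connected_graph H}"

lemma T_class: "graph_class T"
  unfolding graph_class_def
proof (intro conjI ballI allI impI)
  show "wf_graph G" if "G \<in> T" for G using that TT_wf by (simp add: T_def)
  fix G H assume a: "G \<in> T \<and> wf_graph H \<and> isomorphic G H"
  then obtain f where "inj_on f (verts G)" "H = relabel f G" using TT_wf[of G] isomorphic_iff[of G H] by (auto simp: T_def)
  then show "H \<in> T" using a TT_relabel connected_relabel by (auto simp: T_def)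
qed

lemma T_conn: "\<forall>H\<in>T. connected_graph H" by (simp add: T_def)

lemma T_wf: "H \<in> T \<Longrightarrow> wf_graph H" using TT_wf by (simp add: T_def)

lemma C_subset_T: "\<C> \<subseteq> T"
  using C_in_forest TT.forest C_conn by (auto simp: T_def)

lemma T_join:
  assumes H: "H1 \<in> T" "H2 \<in> T" "verts H1 \<inter> verts H2 = {}" and u: "u \<in> verts H1" and v: "v \<in> verts H2"
  shows "add_edge (gunion H1 H2) u v \<in> T" "component_of (gunion H1 H2) u = verts H1"
    "\<not> reach (gunion H1 H2) u v"
proof -
  have wf: "wf_graph H1" "wf_graph H2" using T_wf H by auto
  have c: "components H1 = {verts H1}" "components H2 = {verts H2}"
    using connected_graph_components wf T_conn H by auto
  let ?G = "gunion H1 H2"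
  have wfG: "wf_graph ?G" using wf_gunion wf by blast
  have comps: "components ?G = {verts H1, verts H2}" using components_gunion[OF wf H(3)] c by auto
  show co: "component_of ?G u = verts H1" using component_eq_component_of[of "verts H1" ?G u] comps u by simp
  have ne: "verts H1 \<noteq> verts H2" using u H(3) by blast
  show nr: "\<not> reach ?G u v" using components_not_reach[of "verts H1" ?G "verts H2" u v] comps u v ne by simp
  have "?G \<in> TT" using TT_gunion[of H2 H1] H by (simp add: T_def)
  then have tt: "add_edge ?G u v \<in> TT" using u v nr by (intro TT.bridge) auto
  have "components (add_edge ?G u v) = {verts H1 \<union> verts H2}"
    using components_add_edge[OF wfG, of "verts H1" "verts H2" u v] comps u v ne by auto
  then have "connected_graph (induced (add_edge ?G u v) (verts H1 \<union> verts H2))"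
    using connected_induced_component[OF TT_wf[OF tt]] by simp
  then have "connected_graph (add_edge ?G u v)" using induced_verts[OF TT_wf[OF tt]] by simp
  then show "add_edge ?G u v \<in> T" using tt by (simp add: T_def)
qed

section \<open>Counting bridges for the closure\<close>

definition t :: "nat \<Rightarrow> real" where "t m = real (card (graphs_on T m)) * \<rho> ^ m / fact m"

definition cT :: "nat \<Rightarrow> graph \<Rightarrow> real" where
  "cT m G = real (card {K \<in> components G. card K = m \<and> induced G K \<in> T})"

lemma t_nonneg: "t m \<ge> 0" using rho_pos by (simp add: t_def)

text \<open>Sum the bounds \<open>low\<close> over the labelled members of \<open>T\<close> with m
  vertices. Each component of order m is hit by at most m! embeddings in total, which turns the
  number of labelled graphs into the term \<open>t m\<close>.\<close>

lemma avg_cT_lower: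
  assumes \<epsilon>: "\<epsilon> > 0"
  shows "\<forall>\<^sub>F n in sequentially. t m - \<epsilon> \<le> avg n (cT m)"
proof -
  let ?Tm = "graphs_on T m"
  define q where "q = real (card ?Tm)"
  \<comment> \<open>Chosen so that \<open>q\<close> errors of this size sum to at most \<epsilon>
    m!; the +1 covers q = 0.\<close>
  define \<epsilon>' where "\<epsilon>' = \<epsilon> * fact m / (q + 1)"
  have q: "q \<ge> 0" by (simp add: q_def)
  have \<epsilon>': "\<epsilon>' > 0" using \<epsilon> q by (simp add: \<epsilon>'_def)
  have "\<forall>H\<in>?Tm. \<forall>\<^sub>F n in sequentially. \<rho> ^ m - \<epsilon>' \<le> avg n (\<lambda>G. real (card (emb H G)))"
  proof
    fix H assume "H \<in> ?Tm"
    then have "low H" "card (verts H) = m" using low_TT by (auto simp: graphs_on_def T_def)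
    then show "\<forall>\<^sub>F n in sequentially. \<rho> ^ m - \<epsilon>' \<le> avg n (\<lambda>G. real (card (emb H G)))"
      using \<epsilon>' by (simp add: low_def)
  qed
  then have "\<forall>\<^sub>F n in sequentially. \<forall>H\<in>?Tm. \<rho> ^ m - \<epsilon>' \<le> avg n (\<lambda>G. real (card (emb H G)))"
    by (rule eventually_ball_finite[OF finite_graphs_on[OF T_class]])
  then show ?thesis
  proof eventually_elim
    case (elim n)
    have "q * (\<rho> ^ m - \<epsilon>') = (\<Sum>H\<in>?Tm. \<rho> ^ m - \<epsilon>')" by (simp add: q_def)
    also have "\<dots> \<le> (\<Sum>H\<in>?Tm. avg n (\<lambda>G. real (card (emb H G))))" using elim by (intro sum_mono) blast
    also have "\<dots> = avg n (\<lambda>G. \<Sum>H\<in>?Tm. real (card (emb H G)))" by (simp add: avg_sum)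
    also have "\<dots> \<le> avg n (\<lambda>G. fact m * cT m G)"
    proof (rule avg_mono)
      fix G assume "G \<in> graphs_on \<A> n"
      then have "real (\<Sum>H\<in>?Tm. card (emb H G)) \<le> real (fact m * card {K \<in> components G. card K = m \<and> induced G K \<in> T})"
        by (intro of_nat_mono sum_card_emb_le T_class T_conn A_wf(1))
      then show "(\<Sum>H\<in>?Tm. real (card (emb H G))) \<le> fact m * cT m G" by (simp add: cT_def)
    qed
    also have "\<dots> = fact m * avg n (cT m)" by (rule avg_cmult)
    finally have "q * (\<rho> ^ m - \<epsilon>') / fact m \<le> avg n (cT m)" by (simp add: pos_divide_le_eq mult.commute)
    moreover have "q * (\<rho> ^ m - \<epsilon>') / fact m = t m - \<epsilon> * (q / (q + 1))"
      by (simp add: t_def q_def \<epsilon>'_def right_diff_distrib diff_divide_distrib)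
    moreover have "q / (q + 1) \<le> 1" using q by simp
    then have "\<epsilon> * (q / (q + 1)) \<le> \<epsilon>" using \<epsilon> by (intro mult_left_le) auto
    ultimately show ?case by linarith
  qed
qed

lemma components_delete_bridge:
  assumes wf: "wf_graph G" and e: "{u, v} \<in> edges G" and nr: "\<not> reach (delete_edge G {u, v}) u v"
  shows "component_of G u = component_of (delete_edge G {u, v}) u \<union> component_of (delete_edge G {u, v}) v"
proof -
  let ?D = "delete_edge G {u, v}"
  have uv: "u \<in> verts G" "v \<in> verts G" using wf_edgeD[OF wf e] by auto
  have wfD: "wf_graph ?D" using wf_delete_edge[OF wf] .
  have "v \<in> component_of ?D v" "v \<notin> component_of ?D u" using uv nr by (simp_all add: component_of_def)
  then have ne: "component_of ?D u \<noteq> component_of ?D v" by blast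
  have "components G = insert (component_of ?D u \<union> component_of ?D v) (components ?D - {component_of ?D u, component_of ?D v})"
    using components_add_edge[OF wfD, of "component_of ?D u" "component_of ?D v" u v] add_edge_delete_edge[OF e] uv ne
    by (simp add: component_of_in_components component_of_self)
  then have "component_of ?D u \<union> component_of ?D v \<in> components G" by simp
  moreover have "u \<in> component_of ?D u \<union> component_of ?D v" using uv by (simp add: component_of_self)
  ultimately show ?thesis using component_eq_component_of by metis
qed

text \<open>Both orientations of a bridge of \<open>G\<close> are counted only if the bridge lies in a component of
  size at most \<open>2M\<close>.\<close>
lemma card_small_side_bridges:
  assumes wf: "wf_graph G" and ne: "verts G \<noteq> {}"
  shows "card {(u, v). {u, v} \<in> edges G \<and> \<not> reach (delete_edge G {u, v}) u v \<and>
      card (component_of (delete_edge G {u, v}) u) \<le> M}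
    \<le> card (verts G) + 2 * M * card {u \<in> verts G. card (component_of G u) \<le> 2 * M}" (is "card ?P \<le> _")
    and "finite {(u, v). {u, v} \<in> edges G \<and> \<not> reach (delete_edge G {u, v}) u v \<and>
      card (component_of (delete_edge G {u, v}) u) \<le> M}"
proof -
  let ?S = "{u \<in> verts G. card (component_of G u) \<le> 2 * M}"
  let ?P1 = "{(u, v) \<in> ?P. card (component_of (delete_edge G {u, v}) v) > M}"
  have finS: "finite ?S" using wf_finite[OF wf] by simp
  have finc: "finite (component_of G u)" for u using finite_subset[OF component_of_subset wf_finite[OF wf]] .
  have "?P \<subseteq> verts G \<times> verts G" using wf_edgeD[OF wf] by blast
  then show finP: "finite ?P" using wf_finite[OF wf] by (meson finite_SigmaI finite_subset)
  have "card ?P1 \<le> card (bridges G)"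
  proof (rule card_inj_on_le[of "\<lambda>(u, v). {u, v}"])
    show "inj_on (\<lambda>(u, v). {u, v}) ?P1"
    proof (rule inj_onI)
      fix a b assume ab: "a \<in> ?P1" "b \<in> ?P1" "(\<lambda>(u, v). {u, v}) a = (\<lambda>(u, v). {u, v}) b"
      obtain u v x y where e: "a = (u, v)" "b = (x, y)" by (cases a, cases b) blast
      then have "{u, v} = {x, y}" using ab(3) by simp
      then consider "u = x" "v = y" | "u = y" "v = x" by (auto simp: doubleton_eq_iff)
      then show "a = b"
      proof cases
        case 2
        then have "card (component_of (delete_edge G {u, v}) v) \<le> M" using ab(2) e by (simp add: insert_commute)
        then show ?thesis using ab(1) e by simp
      qed (use e in simp)
    qed
    show "(\<lambda>(u, v). {u, v}) ` ?P1 \<subseteq> bridges G"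
    proof (rule image_subsetI)
      fix a assume a: "a \<in> ?P1"
      obtain u v where "a = (u, v)" by (cases a) blast
      then show "(\<lambda>(u, v). {u, v}) a \<in> bridges G" using a unfolding bridges_def by auto
    qed
    show "finite (bridges G)" using wf_finite_edges[OF wf] by (simp add: bridges_def)
  qed
  also have "\<dots> \<le> card (verts G)" using card_bridges[OF wf ne] by simp
  finally have 1: "card ?P1 \<le> card (verts G)" .
  have sub: "?P - ?P1 \<subseteq> Sigma ?S (component_of G)"
  proof
    fix a assume a: "a \<in> ?P - ?P1"
    obtain u v where e: "a = (u, v)" by (cases a) blast
    let ?D = "delete_edge G {u, v}"
    have p: "{u, v} \<in> edges G" "\<not> reach ?D u v" "card (component_of ?D u) \<le> M" "card (component_of ?D v) \<le> M"
      using a e by auto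
    have uv: "u \<in> verts G" "v \<in> verts G" using wf_edgeD[OF wf p(1)] by auto
    note c = components_delete_bridge[OF wf p(1,2)]
    have "card (component_of G u) \<le> 2 * M"
      unfolding c using card_Un_le[of "component_of ?D u" "component_of ?D v"] p(3,4) by linarith
    moreover have "v \<in> component_of G u" unfolding c using uv by (simp add: component_of_self)
    ultimately show "a \<in> Sigma ?S (component_of G)" using e uv by simp
  qed
  have "card (?P - ?P1) \<le> card (Sigma ?S (component_of G))"
    using finS finc by (intro card_mono[OF _ sub] finite_SigmaI) auto
  also have "\<dots> = (\<Sum>u\<in>?S. card (component_of G u))" using finS finc by (subst card_SigmaI) auto
  also have "\<dots> \<le> (\<Sum>u\<in>?S. 2 * M)" by (rule sum_mono) simp
  also have "\<dots> = 2 * M * card ?S" by simp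
  finally have 2: "card (?P - ?P1) \<le> 2 * M * card ?S" .
  have "?P1 \<subseteq> ?P" by blast
  moreover have "card A = card B + card (A - B)" if "finite A" "B \<subseteq> A" for A B :: "(nat \<times> nat) set"
    using that by (simp add: card_Diff_subset finite_subset card_mono)
  ultimately have "card ?P = card ?P1 + card (?P - ?P1)" using finP by blast
  then show "card ?P \<le> card (verts G) + 2 * M * card ?S" using 1 2 by linarith
qed

text \<open>Join a vertex of a small \<open>T\<close>-component to any vertex outside it and orient
  the bridge away from the small side. Counting only orientations whose tail side is small halves
  the leading term of \<open>avg_nonreach\<close>, since few vertices lie in components where both
  orientations count. The leading constant 1 obtained in this way is the bound S \<le> 1.\<close>

lemma avg_cT_upper:
  assumes n: "n > 0" "4 * M \<le> n"
  shows "real (n - M) * (\<Sum>m\<le>M. real m * avg n (cT m)) \<le> real n + 8 * M"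
proof -
  let ?good = "\<lambda>G. {u \<in> verts G. card (component_of G u) \<le> M \<and> induced G (component_of G u) \<in> T}"
  let ?V = "\<lambda>G. {u \<in> verts G. card (component_of G u) \<le> 2 * M}"
  let ?S = "Sigma (graphs_on \<A> n) (\<lambda>G. Sigma (?good G) (\<lambda>u. verts G - component_of G u))"
  let ?P = "\<lambda>G. {(u, v). {u, v} \<in> edges G \<and> \<not> reach (delete_edge G {u, v}) u v \<and>
      card (component_of (delete_edge G {u, v}) u) \<le> M}"
  have ne: "verts G \<noteq> {}" if "G \<in> graphs_on \<A> n" for G using A_wf(2)[OF that] n by simp
  have fing: "finite (?good G)" if "G \<in> graphs_on \<A> n" for G using wf_finite[OF A_wf(1)[OF that]] by simp
  have good_count: "(\<Sum>m\<le>M. real m * cT m G) = real (card (?good G))" if G: "G \<in> graphs_on \<A> n" for G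
  proof -
    let ?K = "\<lambda>m. {K \<in> components G. card K = m \<and> induced G K \<in> T}"
    note wf = A_wf(1)[OF G]
    have finK: "finite (?K m)" for m using finite_components[OF wf] by simp
    have finc: "finite K" if "K \<in> components G" for K using finite_subset[OF components_subset[OF that] wf_finite[OF wf]] .
    have one: "card (\<Union>(?K m)) = m * card (?K m)" for m
    proof -
      have "card (\<Union>(?K m)) = (\<Sum>K\<in>?K m. card K)"
        using finc components_disjoint[of _ G] by (intro card_Union_disjoint) (auto simp: pairwise_def disjnt_def)
      also have "\<dots> = (\<Sum>K\<in>?K m. m)" by (rule sum.cong) auto
      finally show ?thesis by (simp add: mult.commute)
    qed
    have "?good G = (\<Union>m\<in>{..M}. \<Union>(?K m))"
    proof (intro equalityI subsetI)
      fix u assume "u \<in> ?good G"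
      then have u: "u \<in> verts G" "card (component_of G u) \<le> M" "induced G (component_of G u) \<in> T" by auto
      then have "component_of G u \<in> ?K (card (component_of G u))" by (simp add: component_of_in_components)
      then show "u \<in> (\<Union>m\<in>{..M}. \<Union>(?K m))" using u component_of_self[OF u(1)] by blast
    next
      fix u assume "u \<in> (\<Union>m\<in>{..M}. \<Union>(?K m))"
      then obtain K where K: "K \<in> components G" "card K \<le> M" "induced G K \<in> T" "u \<in> K" by auto
      then have "K = component_of G u" using component_eq_component_of by blast
      then show "u \<in> ?good G" using K components_subset[OF K(1)] by auto
    qed
    then have "card (?good G) = card (\<Union>m\<in>{..M}. \<Union>(?K m))" by simp
    also have "\<dots> = (\<Sum>m\<le>M. card (\<Union>(?K m)))"
    proof (rule card_UN_disjoint)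
      show "\<forall>m\<in>{..M}. finite (\<Union>(?K m))" using finK finc by auto
      show "\<forall>i\<in>{..M}. \<forall>j\<in>{..M}. i \<noteq> j \<longrightarrow> \<Union>(?K i) \<inter> \<Union>(?K j) = {}"
      proof (intro ballI impI, rule ccontr)
        fix i j assume ij: "i \<noteq> j" "\<Union>(?K i) \<inter> \<Union>(?K j) \<noteq> {}"
        then obtain A B where AB: "A \<in> ?K i" "B \<in> ?K j" "A \<inter> B \<noteq> {}" by blast
        then have "A = B" using components_disjoint[of A G B] by blast
        then show False using AB ij by simp
      qed
    qed simp
    also have "\<dots> = (\<Sum>m\<le>M. m * card (?K m))" by (simp add: one)
    finally show ?thesis by (simp add: cT_def)
  qed
  have "card ?S \<le> card (Sigma (graphs_on \<A> n) ?P)"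
  proof (rule card_inj_on_le[of "\<lambda>(G, u, v). (add_edge G u v, u, v)"])
    show "finite (Sigma (graphs_on \<A> n) ?P)"
      using A_fin card_small_side_bridges(2)[OF A_wf(1) ne] by (intro finite_SigmaI) auto
    have nr: "\<not> reach G u v" "u \<in> {1..n}" "v \<in> {1..n}" if "(G, u, v) \<in> ?S" for G u v
      using that A_wf(2)[of G n] unfolding component_of_def by auto
    show "inj_on (\<lambda>(G, u, v). (add_edge G u v, u, v)) ?S"
    proof (rule inj_onI)
      fix a b assume ab: "a \<in> ?S" "b \<in> ?S" "(\<lambda>(G, u, v). (add_edge G u v, u, v)) a = (\<lambda>(G, u, v). (add_edge G u v, u, v)) b"
      obtain G u v G' u' v' where e: "a = (G, u, v)" "b = (G', u', v')" by (cases a, cases b) blast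
      have eq: "u' = u" "v' = v" "add_edge G u v = add_edge G' u v" using ab e by auto
      have "\<not> reach G u v" "\<not> reach G' u v" using nr(1)[of G u v] nr(1)[of G' u v] ab(1,2) e eq by auto
      then have "G = G'" using eq(3) add_edge_bridge(2) delete_edge_add_edge by metis
      then show "a = b" using e eq by simp
    qed
    show "(\<lambda>(G, u, v). (add_edge G u v, u, v)) ` ?S \<subseteq> Sigma (graphs_on \<A> n) ?P"
    proof (rule image_subsetI)
      fix a assume aS: "a \<in> ?S"
      obtain G u v where a: "a = (G, u, v)" by (cases a) blast
      have G: "G \<in> graphs_on \<A> n" "card (component_of G u) \<le> M" using aS a by auto
      note N = nr[OF aS[unfolded a]]
      have d: "delete_edge (add_edge G u v) {u, v} = G" using delete_edge_add_edge[OF add_edge_bridge(2)[OF N(1)]] .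
      have "(u, v) \<in> ?P (add_edge G u v)" using d N(1) G(2) by simp
      then show "(\<lambda>(G, u, v). (add_edge G u v, u, v)) a \<in> Sigma (graphs_on \<A> n) ?P"
        unfolding a using A_add_edge[OF G(1) N(2,3,1)] by simp
    qed
  qed
  also have "\<dots> = (\<Sum>G\<in>graphs_on \<A> n. card (?P G))"
    using A_fin card_small_side_bridges(2)[OF A_wf(1) ne] by (subst card_SigmaI) auto
  also have "\<dots> \<le> (\<Sum>G\<in>graphs_on \<A> n. n + 2 * M * card (?V G))"
  proof (rule sum_mono)
    fix G assume G: "G \<in> graphs_on \<A> n"
    show "card (?P G) \<le> n + 2 * M * card (?V G)"
      using card_small_side_bridges(1)[OF A_wf(1)[OF G] ne[OF G], of M] A_wf(2)[OF G] by simp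
  qed
  finally have S1: "real (card ?S) \<le> (\<Sum>G\<in>graphs_on \<A> n. real n + 2 * M * real (card (?V G)))"
    using of_nat_mono[of "card ?S" "\<Sum>G\<in>graphs_on \<A> n. n + 2 * M * card (?V G)", where 'a = real] by simp
  have "real (n - M) * (\<Sum>m\<le>M. real m * avg n (cT m)) = avg n (\<lambda>G. real (n - M) * (\<Sum>m\<le>M. real m * cT m G))"
    by (simp only: avg_cmult avg_sum)
  also have "\<dots> = (\<Sum>G\<in>graphs_on \<A> n. real (n - M) * real (card (?good G))) / an n"
    unfolding avg_def by (intro arg_cong2[where f = "(/)"] sum.cong) (auto simp only: good_count)
  also have "\<dots> \<le> real (card ?S) / an n"
  proof (rule divide_right_mono)
    have "(\<Sum>G\<in>graphs_on \<A> n. real (n - M) * real (card (?good G))) \<le> (\<Sum>G\<in>graphs_on \<A> n. \<Sum>u\<in>?good G. real (card (verts G - component_of G u)))"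
    proof (rule sum_mono)
      fix G assume G: "G \<in> graphs_on \<A> n"
      have "real (card (?good G)) * real (n - M) \<le> (\<Sum>u\<in>?good G. real (card (verts G - component_of G u)))"
      proof (rule sum_bounded_below)
        fix u assume u: "u \<in> ?good G"
        have "card (verts G - component_of G u) = card (verts G) - card (component_of G u)"
          by (rule card_Diff_subset[OF finite_subset[OF component_of_subset wf_finite[OF A_wf(1)[OF G]]] component_of_subset])
        moreover have "card (component_of G u) \<le> M" using u by blast
        moreover have "card (verts G) = n" using A_wf(2)[OF G] by simp
        ultimately have "n - M \<le> card (verts G - component_of G u)" by linarith
        then show "real (n - M) \<le> real (card (verts G - component_of G u))" by (rule of_nat_mono)
      qed
      then show "real (n - M) * real (card (?good G)) \<le> (\<Sum>u\<in>?good G. real (card (verts G - component_of G u)))" by (simp only: mult.commute)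
    qed
    also have "\<dots> = real (\<Sum>G\<in>graphs_on \<A> n. \<Sum>u\<in>?good G. card (verts G - component_of G u))" by simp
    also have "(\<Sum>G\<in>graphs_on \<A> n. \<Sum>u\<in>?good G. card (verts G - component_of G u)) = (\<Sum>G\<in>graphs_on \<A> n. card (Sigma (?good G) (\<lambda>u. verts G - component_of G u)))"
      using fing wf_finite[OF A_wf(1)] by (intro sum.cong refl card_SigmaI[symmetric]) auto
    also have "\<dots> = card ?S" using A_fin fing wf_finite[OF A_wf(1)] by (intro card_SigmaI[symmetric]) (auto intro!: finite_SigmaI)
    finally show "(\<Sum>G\<in>graphs_on \<A> n. real (n - M) * real (card (?good G))) \<le> real (card ?S)" .
  qed simp
  also have "\<dots> \<le> avg n (\<lambda>G. real n + 2 * M * real (card (?V G)))"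
    unfolding avg_def using S1 by (rule divide_right_mono) simp
  also have "\<dots> = avg n (\<lambda>_. real n) + 2 * M * avg n (\<lambda>G. real (card (?V G)))" by (simp only: avg_add avg_cmult)
  \<comment> \<open>The 4 is \<open>avg_small_components\<close> at size 2M, which requires 4M \<le>
    n.\<close>
  also have "\<dots> \<le> real n + real (2 * M) * 4"
    using avg_const_le[of "real n" n] avg_small_components[of n "2 * M"] n by (intro add_mono mult_left_mono) auto
  finally show ?thesis by simp
qed

lemma t_partial_sums: "(\<Sum>m\<le>M. real m * t m) \<le> 1"
proof (rule field_le_epsilon)
  fix e :: real assume e: "e > 0"
  \<comment> \<open>There are M + 1 terms with factors at most M + 1, so the errors add up to at
    most e.\<close>
  define \<epsilon> where "\<epsilon> = e / (real (Suc M) * real (Suc M))"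
  have \<epsilon>: "\<epsilon> > 0" using e by (simp add: \<epsilon>_def)
  have "\<forall>\<^sub>F n in sequentially. \<forall>m\<in>{..M}. t m - \<epsilon> \<le> avg n (cT m)"
    using avg_cT_lower[OF \<epsilon>] by (intro eventually_ball_finite) auto
  then have "\<forall>\<^sub>F n in sequentially. (\<Sum>m\<le>M. real m * (t m - \<epsilon>)) \<le> (real n + 8 * M) / real (n - M)"
    using eventually_gt_at_top[of 0] eventually_ge_at_top[of "4 * M + 1"]
  proof eventually_elim
    case (elim n)
    have "(\<Sum>m\<le>M. real m * (t m - \<epsilon>)) \<le> (\<Sum>m\<le>M. real m * avg n (cT m))"
      using elim(1) by (intro sum_mono mult_left_mono) auto
    also have "\<dots> \<le> (real n + 8 * M) / real (n - M)"
      using avg_cT_upper[of n M] elim by (simp add: pos_le_divide_eq mult.commute)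
    finally show ?case .
  qed
  moreover have "(\<lambda>n. (real n + 8 * M) / real (n - M)) \<longlonglongrightarrow> 1"
  proof -
    \<comment> \<open>Shifting the index by M removes the truncated subtraction n - M.\<close>
    have "(\<lambda>n. (real (n + M) + 8 * M) / real n) \<longlonglongrightarrow> 1"
    proof -
      have "(\<lambda>n. 1 + (9 * real M) / real n) \<longlonglongrightarrow> 1 + 0" by (intro tendsto_intros lim_const_over_n)
      moreover have "\<forall>\<^sub>F n in sequentially. 1 + (9 * real M) / real n = (real (n + M) + 8 * M) / real n"
        using eventually_gt_at_top[of 0] by eventually_elim (simp add: field_simps)
      ultimately show ?thesis using Lim_transform_eventually by force
    qed
    then have "(\<lambda>n. (real (n + M) + 8 * M) / real (n + M - M)) \<longlonglongrightarrow> 1" by simp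
    then show ?thesis by (rule LIMSEQ_offset)
  qed
  ultimately have "(\<Sum>m\<le>M. real m * (t m - \<epsilon>)) \<le> 1" by (intro tendsto_lowerbound) auto
  moreover have "(\<Sum>m\<le>M. real m * (t m - \<epsilon>)) = (\<Sum>m\<le>M. real m * t m) - (\<Sum>m\<le>M. real m * \<epsilon>)"
    by (simp add: right_diff_distrib sum_subtractf)
  moreover have "(\<Sum>m\<le>M. real m * \<epsilon>) \<le> e"
  proof -
    have "(\<Sum>m\<le>M. real m * \<epsilon>) \<le> (\<Sum>m\<le>M. real (Suc M) * \<epsilon>)" using \<epsilon> by (intro sum_mono mult_right_mono) auto
    also have "\<dots> = e" by (simp add: \<epsilon>_def)
    finally show ?thesis .
  qed
  ultimately show "(\<Sum>m\<le>M. real m * t m) \<le> 1 + e" by linarith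
qed

text \<open>Join two members of \<open>T\<close> on complementary vertex sets by an edge from a
  chosen vertex of the first to one of the second: the result lies in \<open>T\<close> and carries
  an oriented bridge. Deleting the bridge recovers the parts, the first being the component of
  \<open>u\<close>. A graph has at most 2 (n - 1) oriented bridges, and multiplication by \<rho>^n /
  n! turns the binomial sum into a convolution.\<close>

lemma t_convolution:
  assumes n: "n > 0"
  shows "(\<Sum>i\<le>n. (real i * t i) * (real (n - i) * t (n - i))) \<le> 2 * (real n - 1) * t n"
proof -
  let ?X = "\<lambda>A. {G \<in> T. verts G = A}"
  let ?S = "Sigma (Pow {1..n}) (\<lambda>A. (?X A \<times> A) \<times> (?X ({1..n} - A) \<times> ({1..n} - A)))"
  let ?P = "Sigma (graphs_on T n) (\<lambda>G. {(u, v). {u, v} \<in> bridges G})"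
  let ?f = "\<lambda>(A, (G1, u), (G2, v)). (add_edge (gunion G1 G2) u v, (u, v))"
  have finX: "finite (?X A)" if "finite A" for A
    by (rule finite_subset[OF _ finite_graphs_with_verts[OF that]]) (auto dest: T_wf)
  have finb: "finite (bridges G)" if "G \<in> graphs_on T n" for G
    using wf_finite_edges[OF T_wf] that by (auto simp: bridges_def graphs_on_def)
  have "card ?S \<le> card ?P"
  proof (rule card_inj_on_le[of ?f])
    show "finite ?P" using finite_graphs_on[OF T_class] finb card_oriented_edges_le(1) by (intro finite_SigmaI) blast+
    have dest: "G1 \<in> T" "G2 \<in> T" "verts G1 = A" "verts G2 = {1..n} - A" "u \<in> A" "v \<in> {1..n} - A" "A \<subseteq> {1..n}"
      if "(A, (G1, u), (G2, v)) \<in> ?S" for A G1 u G2 v using that by auto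
    show "inj_on ?f ?S"
    proof (rule inj_onI)
      fix a b assume ab: "a \<in> ?S" "b \<in> ?S" "?f a = ?f b"
      obtain A G1 u G2 v where a: "a = (A, (G1, u), (G2, v))" by (cases a) auto
      obtain A' G1' u' G2' v' where b: "b = (A', (G1', u'), (G2', v'))" by (cases b) auto
      note D = dest[OF ab(1)[unfolded a]] and D' = dest[OF ab(2)[unfolded b]]
      have eq: "u' = u" "v' = v" "add_edge (gunion G1 G2) u v = add_edge (gunion G1' G2') u v" using ab(3) a b by auto
      have dj: "verts G1 \<inter> verts G2 = {}" "verts G1' \<inter> verts G2' = {}" using D D' by auto
      have uv: "u \<in> verts G1" "v \<in> verts G2" "u \<in> verts G1'" "v \<in> verts G2'" using D D' eq by auto
      note J = T_join[OF D(1,2) dj(1) uv(1,2)] and J' = T_join[OF D'(1,2) dj(2) uv(3,4)]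
      have g: "gunion G1 G2 = gunion G1' G2'"
        using eq(3) delete_edge_add_edge[OF add_edge_bridge(2)[OF J(3)]] delete_edge_add_edge[OF add_edge_bridge(2)[OF J'(3)]] by metis
      have v1: "verts G1 = verts G1'" using J(2) J'(2) g by simp
      then have v2: "verts G2 = verts G2'" using D D' by simp
      have "G1 = G1'" "G2 = G2'"
        using gunion_parts(3,4)[OF T_wf[OF D(1)] T_wf[OF D(2)] dj(1)] gunion_parts(3,4)[OF T_wf[OF D'(1)] T_wf[OF D'(2)] dj(2)] g v1 v2
        by metis+
      then show "a = b" using a b eq v1 D D' by simp
    qed
    show "?f ` ?S \<subseteq> ?P"
    proof (rule image_subsetI)
      fix a assume aS: "a \<in> ?S"
      obtain A G1 u G2 v where a: "a = (A, (G1, u), (G2, v))" by (cases a) auto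
      note D = dest[OF aS[unfolded a]]
      have dj: "verts G1 \<inter> verts G2 = {}" and uv: "u \<in> verts G1" "v \<in> verts G2" using D by auto
      note J = T_join[OF D(1,2) dj uv]
      have "verts (add_edge (gunion G1 G2) u v) = {1..n}" using D by auto
      then show "?f a \<in> ?P" unfolding a using J(1) add_edge_bridge(1)[OF J(3)] by (simp add: graphs_on_def)
    qed
  qed
  also have "\<dots> = (\<Sum>G\<in>graphs_on T n. card {(u, v). {u, v} \<in> bridges G})"
    using finite_graphs_on[OF T_class] finb card_oriented_edges_le(1) by (intro card_SigmaI) blast+
  also have "\<dots> \<le> (\<Sum>G\<in>graphs_on T n. 2 * (n - 1))"
  proof (rule sum_mono)
    fix G assume G: "G \<in> graphs_on T n"
    have "card (bridges G) < n" using card_bridges[OF T_wf, of G] G n by (auto simp: graphs_on_def)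
    then show "card {(u, v). {u, v} \<in> bridges G} \<le> 2 * (n - 1)"
      using card_oriented_edges_le(2)[OF finb[OF G]] by linarith
  qed
  also have "\<dots> = card (graphs_on T n) * (2 * (n - 1))" by simp
  finally have "real (card ?S) \<le> real (card (graphs_on T n) * (2 * (n - 1)))" by (rule of_nat_mono)
  also have "\<dots> = 2 * (real n - 1) * real (card (graphs_on T n))" using n by (simp add: of_nat_diff)
  finally have 1: "real (card ?S) \<le> 2 * (real n - 1) * real (card (graphs_on T n))" .
  define g where "g i = real (card (graphs_on T i)) * i * (real (card (graphs_on T (n - i))) * real (n - i))" for i
  have "card ?S = (\<Sum>A\<in>Pow {1..n}. card ((?X A \<times> A) \<times> (?X ({1..n} - A) \<times> ({1..n} - A))))"
    using finX finite_subset[of _ "{1..n}"] by (intro card_SigmaI) auto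
  then have "real (card ?S) = (\<Sum>A\<in>Pow {1..n}. g (card A))"
  proof -
    assume a: "card ?S = (\<Sum>A\<in>Pow {1..n}. card ((?X A \<times> A) \<times> (?X ({1..n} - A) \<times> ({1..n} - A))))"
    have "real (card ((?X A \<times> A) \<times> (?X ({1..n} - A) \<times> ({1..n} - A)))) = g (card A)" if "A \<in> Pow {1..n}" for A
    proof -
      have f: "finite A" using that finite_subset[of A "{1..n}"] by auto
      have "card ({1..n} - A) = n - card A" using that f by (simp add: card_Diff_subset)
      then show ?thesis
        using card_class_verts[OF T_class f] card_class_verts[OF T_class, of "{1..n} - A"] by (simp add: g_def card_cartesian_product)
    qed
    then show ?thesis unfolding a of_nat_sum by (rule sum.cong[OF refl])
  qed
  also have "\<dots> = (\<Sum>i\<le>n. real (n choose i) * g i)" using sum_over_subsets[of "{1..n}" g] by simp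
  finally have 2: "(\<Sum>i\<le>n. real (n choose i) * g i) \<le> 2 * (real n - 1) * real (card (graphs_on T n))" using 1 by simp
  have "(\<Sum>i\<le>n. (real i * t i) * (real (n - i) * t (n - i))) = (\<Sum>i\<le>n. real (n choose i) * g i) * (\<rho> ^ n / fact n)"
  proof -
    have "(real i * t i) * (real (n - i) * t (n - i)) = real (n choose i) * g i * (\<rho> ^ n / fact n)" if "i \<in> {..n}" for i
    proof -
      have i: "i \<le> n" using that by simp
      have p: "\<rho> ^ i * \<rho> ^ (n - i) = \<rho> ^ n" using i by (simp add: power_add[symmetric])
      have b: "real (n choose i) = fact n / (fact i * fact (n - i))" using binomial_fact[OF i] .
      show ?thesis unfolding t_def g_def b p[symmetric] by simp
    qed
    then show ?thesis unfolding sum_distrib_right by (rule sum.cong[OF refl])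
  qed
  also have "\<dots> \<le> 2 * (real n - 1) * real (card (graphs_on T n)) * (\<rho> ^ n / fact n)"
    using 2 rho_pos by (intro mult_right_mono) auto
  finally show ?thesis by (simp add: t_def)
qed

lemma t_0: "t 0 = 0"
proof -
  have "graphs_on T 0 = {}" using T_conn by (auto simp: graphs_on_def connected_graph_def)
  then show ?thesis by (simp add: t_def)
qed

lemma t_sum_half: "summable t" "suminf t \<le> 1 / 2"
proof -
  define s where "s n = real n * t n" for n
  have s0: "s n \<ge> 0" for n using t_nonneg by (simp add: s_def)
  have bnd: "(\<Sum>m<n. s m) \<le> 1" for n
  proof -
    have "(\<Sum>m<n. s m) \<le> (\<Sum>m\<le>n. s m)" using s0 by (intro sum_mono2) auto
    then show ?thesis using t_partial_sums[of n] by (simp add: s_def)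
  qed
  have ss: "summable s" using s0 bnd by (intro summableI_nonneg_bounded[of s 1]) auto
  have S1: "suminf s \<le> 1" using suminf_le_const[OF ss] bnd by blast
  have ts: "t n \<le> s n" for n
    using t_0 t_nonneg mult_right_mono[of 1 "real n" "t n"] by (cases "n = 0") (auto simp: s_def)
  show st: "summable t" by (rule summable_comparison_test'[OF ss, of 0]) (use ts t_nonneg in auto)
  have conv: "(\<lambda>n. \<Sum>i\<le>n. s i * s (n - i)) sums (suminf s * suminf s)"
    using ss s0 by (intro Cauchy_product_sums) auto
  have le: "(\<Sum>i\<le>n. s i * s (n - i)) \<le> 2 * (s n - t n)" for n
  proof (cases "n = 0")
    case False
    then show ?thesis using t_convolution[of n] by (simp add: s_def algebra_simps)
  qed (simp add: s_def t_0)
  have "suminf s * suminf s \<le> 2 * (suminf s - suminf t)"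
  proof (rule sums_le[OF le conv])
    show "(\<lambda>n. 2 * (s n - t n)) sums (2 * (suminf s - suminf t))"
      by (intro sums_mult sums_diff summable_sums ss st)
  qed
  \<comment> \<open>S - S^2 / 2 \<le> 1/2 is a rearrangement of (S - 1)^2 \<ge> 0.\<close>
  moreover have "0 \<le> (suminf s - 1) ^ 2" by simp
  ultimately show "suminf t \<le> 1 / 2" by (simp add: power2_eq_square algebra_simps)
qed

lemma egf_real:
  "egf \<C> \<rho> \<le> 1 / 2" "summable (\<lambda>n. real (card (graphs_on \<C> n)) * \<rho> ^ n / fact n)"
  "enn2real (egf \<C> \<rho>) = (\<Sum>n. real (card (graphs_on \<C> n)) * \<rho> ^ n / fact n)"
proof -
  define c where "c n = real (card (graphs_on \<C> n)) * \<rho> ^ n / fact n" for n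
  have c0: "c n \<ge> 0" for n using rho_pos by (simp add: c_def)
  have ct: "c n \<le> t n" for n
  proof -
    have "graphs_on \<C> n \<subseteq> graphs_on T n" using C_subset_T by (auto simp: graphs_on_def)
    then have "card (graphs_on \<C> n) \<le> card (graphs_on T n)" using card_mono finite_graphs_on[OF T_class] by blast
    then show ?thesis unfolding c_def t_def using rho_pos by (intro divide_right_mono mult_right_mono) auto
  qed
  have sc: "summable c" by (rule summable_comparison_test'[OF t_sum_half(1), of 0]) (use c0 ct in auto)
  then show "summable (\<lambda>n. real (card (graphs_on \<C> n)) * \<rho> ^ n / fact n)" by (simp add: c_def[abs_def])
  have half: "suminf c \<le> 1 / 2" using suminf_le[OF ct sc t_sum_half(1)] t_sum_half(2) by linarith
  \<comment> \<open>Connected graphs are nonempty, so starting \<open>egf\<close> at order 1 loses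
    nothing.\<close>
  have z: "c 0 = 0"
  proof -
    have "graphs_on \<C> 0 = {}" using C_conn by (auto simp: graphs_on_def connected_graph_def)
    then show ?thesis by (simp add: c_def)
  qed
  have sS: "summable (\<lambda>n. c (Suc n))" using sc summable_Suc_iff by blast
  have "egf \<C> \<rho> = (\<Sum>n. ennreal (c (Suc n)))" by (simp add: egf_def c_def)
  also have "\<dots> = ennreal (\<Sum>n. c (Suc n))" using c0 sS by (intro suminf_ennreal2) auto
  also have "(\<Sum>n. c (Suc n)) = suminf c" using suminf_split_head[OF sc] z by simp
  finally have e: "egf \<C> \<rho> = ennreal (suminf c)" .
  show "enn2real (egf \<C> \<rho>) = (\<Sum>n. real (card (graphs_on \<C> n)) * \<rho> ^ n / fact n)"
    unfolding e using suminf_nonneg[OF sc] c0 by (simp add: c_def[abs_def])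
  have "ennreal (suminf c) \<le> ennreal (1 / 2)" using half by (rule ennreal_leI)
  also have "ennreal (1 / 2) = 1 / 2" by (subst ennreal_divide_numeral[symmetric]) auto
  finally show "egf \<C> \<rho> \<le> 1 / 2" unfolding e .
qed

end

section \<open>Switching a pendant copy with a fragment component\<close>

locale frag_class = comp_class +
  fixes lc :: "graph \<Rightarrow> nat set"
  assumes lc: "is_largest_component_choice lc"
begin

section \<open>The fragment and the largest component\<close>

definition FragV :: "graph \<Rightarrow> nat set" where
  "FragV G = \<Union>{K \<in> components G. K \<noteq> lc G \<and> induced G K \<in> \<C>}"

lemma frag_C_FragV: "frag_C lc \<C> G = iso_class (induced G (FragV G))"
  by (simp add: frag_C_def FragV_def)

lemma lc_component: "wf_graph G \<Longrightarrow> verts G \<noteq> {} \<Longrightarrow> lc G \<in> components G"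
  and lc_largest: "wf_graph G \<Longrightarrow> K \<in> components G \<Longrightarrow> card K \<le> card (lc G)"
proof -
  show "wf_graph G \<Longrightarrow> verts G \<noteq> {} \<Longrightarrow> lc G \<in> components G"
    using lc unfolding is_largest_component_choice_def by blast
  assume wf: "wf_graph G" and K: "K \<in> components G"
  have "verts G \<noteq> {}" using components_subset[OF K] components_nonempty[OF K] by blast
  then show "card K \<le> card (lc G)" using lc wf K unfolding is_largest_component_choice_def by blast
qed

text \<open>A component with more than half of the vertices leaves no room for another one at least
  as large. Hence the switching does not depend on how ties are broken.\<close>

lemma lc_giant:
  assumes wf: "wf_graph G" and K: "K \<in> components G" "2 * card K > card (verts G)"
  shows "lc G = K"
proof (rule ccontr)
  assume ne: "lc G \<noteq> K"
  have v: "verts G \<noteq> {}" using components_subset[OF K(1)] components_nonempty[OF K(1)] by blast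
  have l: "lc G \<in> components G" using lc_component[OF wf v] .
  have fin: "finite K" "finite (lc G)"
    using finite_subset[OF components_subset wf_finite[OF wf]] K l by auto
  have "card (lc G \<union> K) = card (lc G) + card K"
    using components_disjoint[OF l K(1) ne] fin by (intro card_Un_disjoint) auto
  moreover have "card (lc G \<union> K) \<le> card (verts G)"
    using components_subset[OF l] components_subset[OF K(1)] wf_finite[OF wf] by (intro card_mono) auto
  ultimately show False using lc_largest[OF wf K(1)] K(2) by linarith
qed

lemma FragV_closed: "wf_graph G \<Longrightarrow> closed_set G (FragV G)"
  unfolding FragV_def using components_iff by (intro closed_set_Union) auto

lemma FragV_subset: "FragV G \<subseteq> verts G"
  unfolding FragV_def using components_subset by blast

lemma FragV_lc_disjoint: "wf_graph G \<Longrightarrow> verts G \<noteq> {} \<Longrightarrow> FragV G \<inter> lc G = {}"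
  unfolding FragV_def using components_disjoint[OF _ lc_component] by blast

lemma wf_frag: "wf_graph G \<Longrightarrow> wf_graph (induced G (FragV G))"
  using wf_induced finite_subset[OF FragV_subset wf_finite] by blast

lemma frag_components:
  "wf_graph G \<Longrightarrow> components (induced G (FragV G)) = {K \<in> components G. K \<noteq> lc G \<and> induced G K \<in> \<C>}"
proof -
  assume wf: "wf_graph G"
  have "K \<noteq> lc G \<and> induced G K \<in> \<C>" if K: "K \<in> components G" "K \<subseteq> FragV G" for K
  proof -
    obtain v where v: "v \<in> K" using components_nonempty[OF K(1)] by blast
    then obtain L where L: "L \<in> components G" "L \<noteq> lc G" "induced G L \<in> \<C>" "v \<in> L" using K(2) unfolding FragV_def by blast
    then show ?thesis using components_disjoint[OF K(1) L(1)] v by blast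
  qed
  moreover have "K \<subseteq> FragV G" if "K \<in> components G" "K \<noteq> lc G" "induced G K \<in> \<C>" for K
    using that unfolding FragV_def by blast
  ultimately show ?thesis unfolding components_induced[OF FragV_closed[OF wf]] by blast
qed

lemma frag_in_forest: "wf_graph G \<Longrightarrow> induced G (FragV G) \<in> forest \<C>"
proof -
  assume wf: "wf_graph G"
  have "induced (induced G (FragV G)) K \<in> \<C>" if "K \<in> components (induced G (FragV G))" for K
  proof -
    have "K \<in> components G" "K \<noteq> lc G" "induced G K \<in> \<C>" using that frag_components[OF wf] by auto
    moreover from this have "K \<subseteq> FragV G" unfolding FragV_def by blast
    ultimately show ?thesis using induced_induced[of K "FragV G" G] by simp
  qed
  then show ?thesis unfolding forest_def using wf_frag[OF wf] by blast
qed

text \<open>Each vertex fails to reach at least n - |lc G| others, so n times this deficit is at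
  most the number of unreachable pairs, whose average is at most 2n.\<close>

lemma avg_deficit: "n > 0 \<Longrightarrow> avg n (\<lambda>G. real n - real (card (lc G))) \<le> 2"
proof -
  assume n: "n > 0"
  have "real n * (real n - real (card (lc G))) \<le> real (card (nonreach G))" if G: "G \<in> graphs_on \<A> n" for G
  proof -
    note wf = A_wf[OF G]
    have "real (card (verts G)) * (real n - real (card (lc G))) \<le> (\<Sum>u\<in>verts G. real (card (verts G) - card (component_of G u)))"
    proof (rule sum_bounded_below)
      fix u assume u: "u \<in> verts G"
      have "card (component_of G u) \<le> card (lc G)" using lc_largest[OF wf(1) component_of_in_components[OF u]] .
      moreover have "card (verts G) = n" using wf(2) by simp
      ultimately show "real n - real (card (lc G)) \<le> real (card (verts G) - card (component_of G u))" by linarith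
    qed
    also have "\<dots> = real (card (nonreach G))" unfolding card_nonreach[OF wf(1)] of_nat_sum ..
    finally show ?thesis using wf(2) by simp
  qed
  then have "avg n (\<lambda>G. real n * (real n - real (card (lc G)))) \<le> avg n (\<lambda>G. real (card (nonreach G)))" by (rule avg_mono)
  also have "\<dots> \<le> 2 * n" by (rule avg_nonreach[OF n])
  finally have "real n * avg n (\<lambda>G. real n - real (card (lc G))) \<le> real n * 2" unfolding avg_cmult by simp
  then show ?thesis using n by simp
qed

lemma lc_card_le: "G \<in> graphs_on \<A> n \<Longrightarrow> n > 0 \<Longrightarrow> card (lc G) \<le> n"
proof -
  assume G: "G \<in> graphs_on \<A> n" and n: "n > 0"
  have "verts G \<noteq> {}" using A_wf(2)[OF G] n by simp
  then have "lc G \<subseteq> verts G" by (rule components_subset[OF lc_component[OF A_wf(1)[OF G]]])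
  then have "card (lc G) \<le> card (verts G)" using wf_finite[OF A_wf(1)[OF G]] by (rule card_mono[rotated])
  then show ?thesis using A_wf(2)[OF G] by simp
qed

text \<open>Since \<open>K\<close> has more than half of the vertices, it is the largest component
  before the edge is added, and \<open>W \<union> K\<close> is the largest afterwards. No other
  component changes, so the fragment loses exactly \<open>W\<close>.\<close>

lemma switch_frag:
  assumes wf: "wf_graph G" and W: "W \<in> components G" and K: "K \<in> components G" and WK: "W \<noteq> K"
    and w: "w \<in> W" and x: "x \<in> K" and big: "2 * card K > card (verts G)" and C': "induced G W \<in> \<C>"
  defines "G' \<equiv> add_edge G w x"
  shows "lc G = K" "lc G' = W \<union> K" "FragV G = FragV G' \<union> W" "FragV G' \<inter> W = {}"
    "induced G' (FragV G') = induced G (FragV G')" "closed_set G (FragV G')" "wf_graph G'"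
proof -
  have vs: "w \<in> verts G" "x \<in> verts G" "w \<noteq> x"
    using components_subset[OF W] components_subset[OF K] w x components_disjoint[OF W K WK] by blast+
  show wf': "wf_graph G'" unfolding G'_def using wf_add_edge[OF wf vs] .
  have comps: "components G' = insert (W \<union> K) (components G - {W, K})"
    unfolding G'_def by (rule components_add_edge[OF wf W K WK w x])
  show l: "lc G = K" by (rule lc_giant[OF wf K big])
  have "finite (W \<union> K)" using finite_subset[OF components_subset wf_finite[OF wf]] W K by blast
  then have "card K \<le> card (W \<union> K)" by (intro card_mono) auto
  moreover have "verts G' = verts G" by (simp add: G'_def)
  ultimately have "2 * card (W \<union> K) > card (verts G')" using big by simp
  then show l': "lc G' = W \<union> K" using lc_giant[OF wf', of "W \<union> K"] comps by simp
  have ind: "induced G' L = induced G L" if "L \<in> components G - {W, K}" for L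
  proof (rule graph_eqI)
    have "w \<notin> L" using that w components_disjoint[OF W, of L] by blast
    then show "edges (induced G' L) = edges (induced G L)"
      unfolding G'_def edges_induced edges_add_edge by blast
  qed simp
  have ne: "L \<noteq> W \<union> K" if "L \<in> components G - {W, K}" for L
    using that w components_disjoint[OF W, of L] by blast
  have eq: "{L \<in> components G'. L \<noteq> lc G' \<and> induced G' L \<in> \<C>} = {L \<in> components G - {W, K}. induced G L \<in> \<C>}"
  proof (intro equalityI subsetI)
    fix L assume "L \<in> {L \<in> components G'. L \<noteq> lc G' \<and> induced G' L \<in> \<C>}"
    then have L: "L \<in> components G - {W, K}" "induced G' L \<in> \<C>" unfolding comps l' by auto
    then show "L \<in> {L \<in> components G - {W, K}. induced G L \<in> \<C>}" using ind[OF L(1)] by simp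
  next
    fix L assume "L \<in> {L \<in> components G - {W, K}. induced G L \<in> \<C>}"
    then have L: "L \<in> components G - {W, K}" "induced G L \<in> \<C>" by auto
    then show "L \<in> {L \<in> components G'. L \<noteq> lc G' \<and> induced G' L \<in> \<C>}"
      unfolding comps l' using ind[OF L(1)] ne[OF L(1)] by simp
  qed
  have F': "FragV G' = \<Union>{L \<in> components G - {W, K}. induced G L \<in> \<C>}" unfolding FragV_def eq ..
  have eqG: "{L \<in> components G. L \<noteq> lc G \<and> induced G L \<in> \<C>} = insert W {L \<in> components G - {W, K}. induced G L \<in> \<C>}"
    unfolding l using W WK C' by blast
  show "FragV G = FragV G' \<union> W" unfolding F' FragV_def[of G] eqG by blast
  show d: "FragV G' \<inter> W = {}" unfolding F' using components_disjoint[OF W] by blast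
  show "closed_set G (FragV G')" unfolding F' using components_iff[OF wf] by (intro closed_set_Union) auto
  show "induced G' (FragV G') = induced G (FragV G')"
  proof (rule graph_eqI)
    have "w \<notin> FragV G'" using d w by blast
    then show "edges (induced G' (FragV G')) = edges (induced G (FragV G'))"
      unfolding G'_def edges_induced edges_add_edge by blast
  qed simp
qed

section \<open>The bijection between the two sides of the switching\<close>

context
  fixes F H :: graph
  assumes wfF: "wf_graph F" and H: "H \<in> \<C>" and disj: "verts F \<inter> verts H = {}"
begin

lemma wfH: "wf_graph H" using C_wf[OF H] .
lemma connH: "connected_graph H" using C_conn H by blast
lemma wfU: "wf_graph (gunion F H)" using wf_gunion[OF wfF wfH] .

text \<open>Data for adding a bridge: the third coordinate selects its end in the copy of
  \<open>H\<close>, the last one its end in the largest component.\<close>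

definition side1 :: "nat \<Rightarrow> (graph \<times> (nat \<Rightarrow> nat) \<times> nat \<times> nat) set" where
  "side1 n = Sigma {G \<in> graphs_on \<A> n. 2 * card (lc G) > n}
     (\<lambda>G. isos (gunion F H) (induced G (FragV G)) \<times> verts H \<times> lc G)"

text \<open>Data for deleting a bridge. The larger threshold reflects that the largest component
  loses the vertices of the copy and must still be a majority.\<close>

definition side2 :: "nat \<Rightarrow> (graph \<times> (nat \<Rightarrow> nat) \<times> nat \<times> (nat \<Rightarrow> nat)) set" where
  "side2 n = Sigma {G \<in> graphs_on \<A> n. 2 * card (lc G) > n + 2 * card (verts H)}
     (\<lambda>G. isos F (induced G (FragV G)) \<times> Sigma (verts H) (\<lambda>r. {\<psi> \<in> pend H r G. \<psi> ` verts H \<subseteq> lc G}))"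

definition fwd :: "graph \<times> (nat \<Rightarrow> nat) \<times> nat \<times> nat \<Rightarrow> graph \<times> (nat \<Rightarrow> nat) \<times> nat \<times> (nat \<Rightarrow> nat)" where
  "fwd = (\<lambda>(G, \<phi>, r, x). (add_edge G (\<phi> r) x, restrict \<phi> (verts F), r, restrict \<phi> (verts H)))"

definition bwd :: "graph \<times> (nat \<Rightarrow> nat) \<times> nat \<times> (nat \<Rightarrow> nat) \<Rightarrow> graph \<times> (nat \<Rightarrow> nat) \<times> nat \<times> nat" where
  "bwd = (\<lambda>(G, \<phi>, r, \<psi>). (delete_edge G {\<psi> r, pend_nbr H r G \<psi>}, join_fun (verts F) \<phi> \<psi>, r, pend_nbr H r G \<psi>))"

lemma fwd_side2:
  assumes n: "n > 0" and a: "(G, \<phi>, r, x) \<in> side1 n"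
  shows "fwd (G, \<phi>, r, x) \<in> side2 n" "bwd (fwd (G, \<phi>, r, x)) = (G, \<phi>, r, x)"
proof -
  let ?U = "gunion F H" and ?D = "induced G (FragV G)"
  have A1: "G \<in> graphs_on \<A> n" "2 * card (lc G) > n" "\<phi> \<in> isos ?U ?D" "r \<in> verts H" "x \<in> lc G"
    using a by (auto simp: side1_def)
  note wfG = A_wf(1)[OF A1(1)] and vG = A_wf(2)[OF A1(1)]
  have vne: "verts G \<noteq> {}" using vG n by simp
  have iso: "\<phi> \<in> extensional (verts F \<union> verts H)" "inj_on \<phi> (verts F \<union> verts H)" "?D = relabel \<phi> ?U"
    using A1(3) isos_iff[OF wfU wf_frag[OF wfG]] by auto
  have injF: "inj_on \<phi> (verts F)" and injH: "inj_on \<phi> (verts H)"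
    using inj_on_subset[OF iso(2)] by blast+
  have im: "\<phi> ` (verts F \<union> verts H) = FragV G" using arg_cong[OF iso(3), of verts] by simp
  let ?W = "\<phi> ` verts H"
  note R = gunion_parts[OF wfF wfH disj]
  have "verts H \<in> components ?U"
    using components_gunion[OF wfF wfH disj] connected_graph_components[OF wfH connH] by simp
  then have "?W \<in> components ?D"
    unfolding iso(3) using components_relabel[OF wfU] iso(2) by simp
  then have W: "?W \<in> components G" "?W \<noteq> lc G" "induced G ?W \<in> \<C>" using frag_components[OF wfG] by auto
  have indW: "induced G ?W = relabel \<phi> H"
  proof -
    have "?W \<subseteq> FragV G" using im by blast
    then have "induced G ?W = induced ?D ?W" by (rule induced_induced[symmetric])
    also have "\<dots> = relabel \<phi> (induced ?U (verts H))" unfolding iso(3)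
      using induced_relabel[OF wfU, of \<phi> "verts H"] iso(2) by simp
    finally show ?thesis using R(4) by simp
  qed
  have K: "lc G \<in> components G" using lc_component[OF wfG vne] .
  have rW: "\<phi> r \<in> ?W" using A1(4) by blast
  have big: "2 * card (lc G) > card (verts G)" using A1(2) vG by simp
  note S = switch_frag[OF wfG W(1) K W(2) rW A1(5) big W(3)]
  let ?G = "add_edge G (\<phi> r) x"
  have nr: "\<not> reach G (\<phi> r) x" using components_not_reach[OF W(1) K W(2) rW A1(5)] .
  have vs: "\<phi> r \<in> {1..n}" "x \<in> {1..n}"
    using components_subset[OF W(1)] components_subset[OF K] rW A1(5) vG by blast+
  have G': "?G \<in> graphs_on \<A> n" using A_add_edge[OF A1(1) vs nr] .
  have embW: "restrict \<phi> (verts H) \<in> emb H G"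
  proof -
    have "relabel (restrict \<phi> (verts H)) H = relabel \<phi> H" by (rule relabel_cong[OF wfH]) simp
    then show ?thesis using indW injH W(1) components_iff[OF wfG]
      by (simp add: emb_def inj_on_restrict_eq)
  qed
  have xW: "x \<in> verts G - restrict \<phi> (verts H) ` verts H"
    using A1(5) components_disjoint[OF W(1) K W(2)] components_subset[OF K] by auto
  have rr: "restrict \<phi> (verts H) r = \<phi> r" using A1(4) by simp
  note P = add_pendant_bridge[OF wfH wfG A1(4) embW xW, unfolded rr]
  have dUF: "\<phi> ` verts F \<inter> ?W = {}" using iso(2) disj by (auto simp: inj_on_def)
  have "FragV G = \<phi> ` verts F \<union> ?W" using im by (simp add: image_Un)
  then have F': "FragV ?G = \<phi> ` verts F" using S(3,4) dUF by blast
  have "induced ?G (FragV ?G) = relabel \<phi> F"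
  proof -
    have "induced ?G (FragV ?G) = induced G (\<phi> ` verts F)" using S(5) F' by simp
    also have "\<dots> = induced ?D (\<phi> ` verts F)" by (rule induced_induced[symmetric]) (use im in blast)
    also have "\<dots> = relabel \<phi> (induced ?U (verts F))" unfolding iso(3)
      using induced_relabel[OF wfU, of \<phi> "verts F"] iso(2) by simp
    finally show ?thesis using R(3) by simp
  qed
  moreover have "relabel (restrict \<phi> (verts F)) F = relabel \<phi> F" by (rule relabel_cong[OF wfF]) simp
  ultimately have "induced ?G (FragV ?G) = relabel (restrict \<phi> (verts F)) F" by simp
  then have isoF: "restrict \<phi> (verts F) \<in> isos F (induced ?G (FragV ?G))"
    using isos_iff[OF wfF wf_frag[OF S(7)]] injF by (simp add: inj_on_restrict_eq)
  have "card (lc ?G) = card ?W + card (lc G)"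
    unfolding S(2) using components_disjoint[OF W(1) K W(2)] finite_subset[OF components_subset wf_finite[OF wfG]] W(1) K
    by (intro card_Un_disjoint) auto
  then have "2 * card (lc ?G) > n + 2 * card (verts H)" using A1(2) card_image[OF injH] by simp
  moreover have "restrict \<phi> (verts H) ` verts H \<subseteq> lc ?G" unfolding S(2) by auto
  ultimately show "fwd (G, \<phi>, r, x) \<in> side2 n"
    unfolding fwd_def side2_def using G' isoF A1(4) P(1) by simp
  show "bwd (fwd (G, \<phi>, r, x)) = (G, \<phi>, r, x)"
    unfolding fwd_def bwd_def prod.case rr P(2)
    using delete_edge_add_edge[OF add_edge_bridge(2)[OF nr]] join_fun_restrict[OF disj iso(1)] by simp
qed

lemma bwd_side1:
  assumes n: "n > 0" and b: "(G', \<phi>, r, \<psi>) \<in> side2 n"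
  shows "bwd (G', \<phi>, r, \<psi>) \<in> side1 n" "fwd (bwd (G', \<phi>, r, \<psi>)) = (G', \<phi>, r, \<psi>)"
proof -
  let ?U = "gunion F H" and ?D = "induced G' (FragV G')"
  have B1: "G' \<in> graphs_on \<A> n" "2 * card (lc G') > n + 2 * card (verts H)" "\<phi> \<in> isos F ?D" "r \<in> verts H"
    "\<psi> \<in> pend H r G'" "\<psi> ` verts H \<subseteq> lc G'"
    using b by (auto simp: side2_def)
  note wfG' = A_wf(1)[OF B1(1)] and vG' = A_wf(2)[OF B1(1)]
  define x where "x = pend_nbr H r G' \<psi>"
  define G where "G = delete_edge G' {\<psi> r, x}"
  note D = delete_pendant_bridge[OF wfH wfG' connH B1(4,5), folded x_def, folded G_def]
  have GA: "G \<in> graphs_on \<A> n" using A_delete_pendant[OF H B1(1,4,5)] unfolding G_def x_def .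
  note wfG = A_wf(1)[OF GA] and vG = A_wf(2)[OF GA]
  let ?W = "\<psi> ` verts H" and ?K = "component_of G x"
  have injH: "inj_on \<psi> (verts H)" "\<psi> \<in> extensional (verts H)" using pendD[OF B1(5)] by auto
  have xv: "x \<in> verts G" "x \<notin> ?W" using D(3) by auto
  have K: "?K \<in> components G" and xK: "x \<in> ?K"
    using component_of_in_components[OF xv(1)] component_of_self[OF xv(1)] by auto
  have WK: "?W \<noteq> ?K" using xK xv by blast
  have rW: "\<psi> r \<in> ?W" using B1(4) by blast
  have comps: "components G' = insert (?W \<union> ?K) (components G - {?W, ?K})"
    using components_add_edge[OF wfG D(1) K WK rW xK] D(5) by simp
  have vne: "verts G' \<noteq> {}" using vG' n by simp
  have lcG': "lc G' = ?W \<union> ?K"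
  proof -
    have "?W \<union> ?K \<in> components G'" using comps by blast
    moreover have "\<psi> r \<in> lc G'" using rW B1(6) by blast
    ultimately show ?thesis using components_disjoint[OF lc_component[OF wfG' vne], of "?W \<union> ?K"] rW by blast
  qed
  have "card (lc G') = card ?W + card ?K"
    unfolding lcG' using components_disjoint[OF D(1) K WK] finite_subset[OF components_subset wf_finite[OF wfG]] D(1) K
    by (intro card_Un_disjoint) auto
  \<comment> \<open>The threshold of \<open>side2\<close> is used here: without the vertices of the
    copy a majority remains.\<close>
  then have big: "2 * card ?K > card (verts G)" using B1(2) vG card_image[OF injH(1)] by simp
  have CW: "induced G ?W \<in> \<C>" unfolding D(2) using graph_class_relabel[OF C H injH(1)] .
  note S = switch_frag[OF wfG D(1) K WK rW xK big CW, unfolded D(5)]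
  have iso: "\<phi> \<in> extensional (verts F)" "inj_on \<phi> (verts F)" "?D = relabel \<phi> F"
    using B1(3) isos_iff[OF wfF wf_frag[OF wfG']] by auto
  have imF: "\<phi> ` verts F = FragV G'" using arg_cong[OF iso(3), of verts] by simp
  have clW: "closed_set G ?W" using D(1) components_iff[OF wfG] by blast
  have "induced G (FragV G) = gunion (induced G (FragV G')) (induced G ?W)"
    unfolding S(3) by (rule induced_Un_closed[OF wfG S(6) clW])
  also have "\<dots> = gunion (relabel \<phi> F) (relabel \<psi> H)" using S(5) iso(3) D(2) by simp
  also have "\<dots> = relabel (join_fun (verts F) \<phi> \<psi>) ?U" using relabel_join_fun[OF wfF wfH disj] by simp
  finally have ind: "induced G (FragV G) = relabel (join_fun (verts F) \<phi> \<psi>) ?U" .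
  have "join_fun (verts F) \<phi> \<psi> \<in> isos ?U (induced G (FragV G))"
    unfolding isos_iff[OF wfU wf_frag[OF wfG]] verts_gunion
    using ind join_fun_extensional[OF injH(2)] join_fun_inj[OF disj iso(2) injH(1)] S(4) imF by blast
  moreover have "2 * card (lc G) > n" using big S(1) vG by simp
  moreover have "x \<in> lc G" using xK S(1) by simp
  ultimately show "bwd (G', \<phi>, r, \<psi>) \<in> side1 n"
    unfolding bwd_def side1_def prod.case x_def[symmetric] G_def[symmetric] using GA B1(4) by simp
  have jr: "join_fun (verts F) \<phi> \<psi> r = \<psi> r" using B1(4) disj by (auto simp: join_fun_def)
  show "fwd (bwd (G', \<phi>, r, \<psi>)) = (G', \<phi>, r, \<psi>)"
    unfolding bwd_def fwd_def prod.case x_def[symmetric] G_def[symmetric] jr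
    using D(5) restrict_join_fun[OF disj iso(1) injH(2)] by simp
qed

lemma card_sides: "n > 0 \<Longrightarrow> card (side1 n) = card (side2 n)"
proof (rule bij_betw_same_card[of fwd], rule bij_betw_byWitness[where f' = bwd])
  assume n: "n > 0"
  show "\<forall>a\<in>side1 n. bwd (fwd a) = a"
  proof
    fix a assume a: "a \<in> side1 n"
    obtain G \<phi> r x where e: "a = (G, \<phi>, r, x)" by (cases a) blast
    show "bwd (fwd a) = a" using fwd_side2(2)[OF n a[unfolded e]] e by simp
  qed
  show "fwd ` side1 n \<subseteq> side2 n"
  proof (rule image_subsetI)
    fix a assume a: "a \<in> side1 n"
    obtain G \<phi> r x where e: "a = (G, \<phi>, r, x)" by (cases a) blast
    show "fwd a \<in> side2 n" using fwd_side2(1)[OF n a[unfolded e]] e by simp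
  qed
  show "\<forall>a\<in>side2 n. fwd (bwd a) = a"
  proof
    fix a assume a: "a \<in> side2 n"
    obtain G \<phi> r \<psi> where e: "a = (G, \<phi>, r, \<psi>)" by (cases a) blast
    show "fwd (bwd a) = a" using bwd_side1(2)[OF n a[unfolded e]] e by simp
  qed
  show "bwd ` side2 n \<subseteq> side1 n"
  proof (rule image_subsetI)
    fix a assume a: "a \<in> side2 n"
    obtain G \<phi> r \<psi> where e: "a = (G, \<phi>, r, \<psi>)" by (cases a) blast
    show "bwd a \<in> side1 n" using bwd_side1(1)[OF n a[unfolded e]] e by simp
  qed
qed

end

text \<open>The average of \<open>fw F\<close> is the automorphism count of \<open>F\<close> times the probability that the fragment
  is a copy of \<open>F\<close>.\<close>
definition fw :: "graph \<Rightarrow> graph \<Rightarrow> real" where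
  "fw F G = real (card (isos F (induced G (FragV G))))"

text \<open>An isomorphism forces the fragment to have v(F) vertices, so the bound does not depend
  on the order of \<open>G\<close>.\<close>

lemma fw_le:
  assumes "wf_graph F" "wf_graph G" shows "fw F G \<le> real (card (verts F) ^ card (verts F))"
proof (cases "isos F (induced G (FragV G)) = {}")
  case False
  let ?D = "induced G (FragV G)"
  have wfD: "wf_graph ?D" using wf_frag[OF assms(2)] .
  have c: "card (verts ?D) = card (verts F)"
    using False isos_empty_iff[OF assms(1) wfD] isomorphic_card by metis
  have "card (isos F ?D) \<le> card (verts F \<rightarrow>\<^sub>E verts ?D)"
  proof (rule card_mono)
    show "finite (verts F \<rightarrow>\<^sub>E verts ?D)" using wf_finite[OF assms(1)] wf_finite[OF wfD] by (intro finite_PiE)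
    show "isos F ?D \<subseteq> verts F \<rightarrow>\<^sub>E verts ?D" unfolding isos_def by blast
  qed
  also have "\<dots> = card (verts F) ^ card (verts F)" using c assms(1) by (simp add: card_funcsetE wf_finite)
  finally show ?thesis unfolding fw_def by (rule of_nat_mono)
qed (simp add: fw_def)

lemma fw_nonneg: "fw F G \<ge> 0" by (simp add: fw_def)

section \<open>Asymptotics of the switching\<close>

text \<open>The ideal count has n in place of |lc G| and admits every graph. The shortfall is the
  deficit n - |lc G| when there is a majority component and n otherwise, at most twice the deficit
  in either case. The deficit averages at most 2, hence the constant 2 * 2 = 4.\<close>

lemma side1_estimate:
  assumes F: "wf_graph F" and H: "H \<in> \<C>" and disj: "verts F \<inter> verts H = {}" and n: "n > 0"
  defines "U \<equiv> gunion F H"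
  shows "\<bar>real (card (verts H)) * n * avg n (fw U) - real (card (side1 F H n)) / an n\<bar>
     \<le> 4 * real (card (verts H)) * real (card (verts U) ^ card (verts U))"
proof -
  let ?h = "card (verts H)" and ?K = "real (card (verts U) ^ card (verts U))"
  have wfU: "wf_graph U" unfolding U_def using wf_gunion[OF F C_wf[OF H]] .
  let ?A = "{G \<in> graphs_on \<A> n. 2 * card (lc G) > n}"
  let ?g = "\<lambda>G. if 2 * card (lc G) > n then fw U G * (?h * card (lc G)) else 0"
  have finlc: "finite (lc G)" if "G \<in> graphs_on \<A> n" for G
  proof -
    have "verts G \<noteq> {}" using A_wf(2)[OF that] n by simp
    then show ?thesis using finite_subset[OF components_subset[OF lc_component] wf_finite] A_wf(1)[OF that] by blast
  qed
  have "card (side1 F H n) = (\<Sum>G\<in>?A. card (isos U (induced G (FragV G)) \<times> verts H \<times> lc G))"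
    unfolding side1_def[OF F H disj] U_def[symmetric]
    using A_fin finite_isos[OF wfU wf_frag[OF A_wf(1)]] wf_finite[OF C_wf[OF H]] finlc by (intro card_SigmaI) auto
  then have "real (card (side1 F H n)) = (\<Sum>G\<in>?A. fw U G * (?h * card (lc G)))"
    by (simp add: card_cartesian_product fw_def)
  also have "\<dots> = (\<Sum>G\<in>graphs_on \<A> n. ?g G)" using A_fin by (rule sum.inter_filter)
  finally have 1: "real (card (side1 F H n)) / an n = avg n ?g" by (simp add: avg_def)
  have "real ?h * n * avg n (fw U) - avg n ?g = avg n (\<lambda>G. real ?h * n * fw U G - ?g G)" by (simp only: avg_diff avg_cmult)
  also have "\<bar>\<dots>\<bar> \<le> avg n (\<lambda>G. \<bar>real ?h * n * fw U G - ?g G\<bar>)" by (rule avg_abs)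
  also have "\<dots> \<le> avg n (\<lambda>G. (2 * real ?h * ?K) * (real n - real (card (lc G))))"
  proof (rule avg_mono)
    fix G assume G: "G \<in> graphs_on \<A> n"
    define d where "d = (if 2 * card (lc G) > n then real n - card (lc G) else real n)"
    have l: "card (lc G) \<le> n" using lc_card_le[OF G n] .
    have d: "0 \<le> d" "d \<le> 2 * (real n - card (lc G))" using l by (auto simp: d_def)
    have "real ?h * n * fw U G - ?g G = real ?h * fw U G * d" by (simp add: d_def algebra_simps)
    then have "\<bar>real ?h * n * fw U G - ?g G\<bar> = real ?h * fw U G * d" using d fw_nonneg by simp
    also have "\<dots> \<le> real ?h * ?K * (2 * (real n - card (lc G)))"
      using fw_le[OF wfU A_wf(1)[OF G]] d fw_nonneg by (intro mult_mono mult_left_mono) auto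
    also have "\<dots> = (2 * real ?h * ?K) * (real n - real (card (lc G)))" by (simp only: mult_ac)
    finally show "\<bar>real ?h * n * fw U G - ?g G\<bar> \<le> (2 * real ?h * ?K) * (real n - real (card (lc G)))" .
  qed
  also have "\<dots> = (2 * real ?h * ?K) * avg n (\<lambda>G. real n - real (card (lc G)))" by (rule avg_cmult)
  also have "\<dots> \<le> (2 * real ?h * ?K) * 2" by (rule mult_left_mono[OF avg_deficit[OF n]]) simp
  finally show ?thesis unfolding 1 by simp
qed

text \<open>A pendant embedding not inside the largest component meets one of the n - |lc G|
  vertices outside it. Graphs below the threshold satisfy n \<le> 2 (n - |lc G|) + 2h, so in both
  cases the error is linear in the deficit; its average, at most 2, gives the factor 4 + 2h.\<close>

lemma side2_estimate:
  assumes F: "wf_graph F" and H: "H \<in> \<C>" and disj: "verts F \<inter> verts H = {}" and n: "n > 0"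
  shows "\<bar>avg n (\<lambda>G. fw F G * pend_total H G) - real (card (side2 F H n)) / an n\<bar>
     \<le> real (card (verts F) ^ card (verts F)) * (real (card (verts H) * pend_mult H) * (4 + 2 * real (card (verts H))))"
proof -
  let ?h = "card (verts H)" and ?K = "real (card (verts F) ^ card (verts F))" and ?D = "real (card (verts H) * pend_mult H)"
  note wfH = C_wf[OF H]
  have connH: "connected_graph H" using C_conn H by blast
  let ?A = "{G \<in> graphs_on \<A> n. 2 * card (lc G) > n + 2 * ?h}"
  let ?P = "\<lambda>G r. {\<psi> \<in> pend H r G. \<psi> ` verts H \<subseteq> lc G}"
  let ?p = "\<lambda>G. \<Sum>r\<in>verts H. real (card (?P G r))"
  let ?g = "\<lambda>G. if 2 * card (lc G) > n + 2 * ?h then fw F G * ?p G else 0"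
  have finP: "finite (?P G r)" if "G \<in> graphs_on \<A> n" for G r using finite_pend[OF wfH A_wf(1)[OF that]] by simp
  have "card (side2 F H n) = (\<Sum>G\<in>?A. card (isos F (induced G (FragV G)) \<times> Sigma (verts H) (?P G)))"
    unfolding side2_def[OF F H disj]
    using A_fin finite_isos[OF F wf_frag[OF A_wf(1)]] wf_finite[OF wfH] finP by (intro card_SigmaI) (auto intro!: finite_SigmaI)
  also have "\<dots> = (\<Sum>G\<in>?A. card (isos F (induced G (FragV G))) * (\<Sum>r\<in>verts H. card (?P G r)))"
    using wf_finite[OF wfH] finP by (intro sum.cong refl) (simp add: card_cartesian_product)
  finally have "real (card (side2 F H n)) = (\<Sum>G\<in>?A. fw F G * ?p G)" by (simp add: fw_def)
  also have "\<dots> = (\<Sum>G\<in>graphs_on \<A> n. ?g G)" using A_fin by (rule sum.inter_filter)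
  finally have "real (card (side2 F H n)) / an n = avg n ?g" by (simp add: avg_def)
  moreover define g where "g = ?g"
  ultimately have 1: "real (card (side2 F H n)) / an n = avg n g" by simp
  have 2: "\<bar>avg n (\<lambda>G. fw F G * pend_total H G) - avg n g\<bar> \<le> avg n (\<lambda>G. \<bar>fw F G * pend_total H G - g G\<bar>)"
    unfolding avg_diff[symmetric] by (rule avg_abs)
  have 3: "avg n (\<lambda>G. \<bar>fw F G * pend_total H G - g G\<bar>) \<le> avg n (\<lambda>G. (?K * ?D * 2) * (real n - real (card (lc G))) + ?K * (?D * (2 * ?h)))"
  proof (rule avg_mono)
    fix G assume G: "G \<in> graphs_on \<A> n"
    note wfG = A_wf(1)[OF G]
    define f where "f = real n - real (card (lc G))"
    have f0: "f \<ge> 0" using lc_card_le[OF G n] by (simp add: f_def)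
    define d where "d = pend_total H G - (if 2 * card (lc G) > n + 2 * ?h then ?p G else 0)"
    have vne: "verts G \<noteq> {}" using A_wf(2)[OF G] n by simp
    have lcs: "lc G \<subseteq> verts G" using components_subset[OF lc_component[OF wfG vne]] .
    have dec: "real (card (pend H r G)) - real (card (?P G r)) \<le> f * pend_mult H" "card (?P G r) \<le> card (pend H r G)" for r
    proof -
      let ?M = "{\<psi> \<in> pend H r G. \<psi> ` verts H \<inter> (verts G - lc G) \<noteq> {}}"
      have fp: "finite (pend H r G)" using finite_pend[OF wfH wfG] .
      show "card (?P G r) \<le> card (pend H r G)" using fp by (intro card_mono) auto
      have "pend H r G \<subseteq> ?P G r \<union> ?M" using pendD(3) by blast
      then have "card (pend H r G) \<le> card (?P G r \<union> ?M)" using fp by (intro card_mono) auto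
      also have "\<dots> \<le> card (?P G r) + card ?M" by (rule card_Un_le)
      also have "card ?M \<le> card (verts G - lc G) * pend_mult H"
        using card_pend_meeting[OF wfH wfG connH] wf_finite[OF wfG] by blast
      finally have "card (pend H r G) \<le> card (?P G r) + card (verts G - lc G) * pend_mult H" by simp
      then have "real (card (pend H r G)) \<le> real (card (?P G r) + card (verts G - lc G) * pend_mult H)" by (rule of_nat_mono)
      moreover have "real (card (verts G - lc G)) = f"
        using card_Diff_subset[OF finite_subset[OF lcs wf_finite[OF wfG]] lcs] lc_card_le[OF G n] A_wf(2)[OF G] by (simp add: f_def of_nat_diff)
      ultimately show "real (card (pend H r G)) - real (card (?P G r)) \<le> f * pend_mult H" by simp
    qed
    have d: "0 \<le> d \<and> d \<le> ?D * (2 * f + 2 * ?h)"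
    proof (cases "2 * card (lc G) > n + 2 * ?h")
      case True
      have "d = (\<Sum>r\<in>verts H. real (card (pend H r G)) - real (card (?P G r)))"
        using True by (simp add: d_def pend_total_def sum_subtractf)
      moreover have "(\<Sum>r\<in>verts H. real (card (pend H r G)) - real (card (?P G r))) \<ge> 0"
        using dec(2) by (intro sum_nonneg) simp
      moreover have "(\<Sum>r\<in>verts H. real (card (pend H r G)) - real (card (?P G r))) \<le> (\<Sum>r\<in>verts H. f * pend_mult H)"
        by (rule sum_mono) (rule dec(1))
      moreover have "(\<Sum>r\<in>verts H. f * pend_mult H) = ?D * f" by simp
      moreover have "?D * f \<le> ?D * (2 * f + 2 * ?h)" using f0 by (intro mult_left_mono) auto
      ultimately show ?thesis by linarith
    next
      case False
      have "real n \<le> 2 * f + 2 * ?h" using False by (simp add: f_def)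
      then have "?D * real n \<le> ?D * (2 * f + 2 * ?h)" by (rule mult_left_mono) simp
      moreover have "pend_total H G \<le> ?D * real n" using pend_total_le[OF H G] by (simp add: mult_ac)
      ultimately show ?thesis using False pend_total_nonneg[of H G] by (simp add: d_def)
    qed
    have "fw F G * pend_total H G - g G = fw F G * d" by (simp add: d_def g_def right_diff_distrib)
    then have "\<bar>fw F G * pend_total H G - g G\<bar> = fw F G * d" using d fw_nonneg[of F G] by simp
    also have "\<dots> \<le> ?K * (?D * (2 * f + 2 * ?h))"
      using fw_le[OF F wfG] d fw_nonneg by (intro mult_mono) auto
    finally show "\<bar>fw F G * pend_total H G - g G\<bar> \<le> (?K * ?D * 2) * (real n - real (card (lc G))) + ?K * (?D * (2 * ?h))"
      unfolding f_def by (simp add: algebra_simps)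
  qed
  have "avg n (\<lambda>G. (?K * ?D * 2) * (real n - real (card (lc G))) + ?K * (?D * (2 * ?h))) = (?K * ?D * 2) * avg n (\<lambda>G. real n - real (card (lc G))) + avg n (\<lambda>_. ?K * (?D * (2 * ?h)))"
    by (simp only: avg_add avg_cmult)
  also have "\<dots> \<le> (?K * ?D * 2) * 2 + ?K * (?D * (2 * ?h))"
    by (intro add_mono mult_left_mono avg_deficit[OF n] avg_const_le) auto
  also have "\<dots> = ?K * (?D * (4 + 2 * real ?h))" by (simp add: algebra_simps)
  finally show ?thesis unfolding 1 using 2 3 by linarith
qed

text \<open>\<open>card_sides\<close> equates two counts of order n whose estimates have bounded
  errors. Division by n removes these errors, and concentration replaces the pendant total by h
  \<rho>^h n.\<close>

lemma fw_step:
  assumes F: "wf_graph F" and H: "H \<in> \<C>" and disj: "verts F \<inter> verts H = {}"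
  shows "(\<lambda>n. avg n (fw (gunion F H)) - \<rho> ^ card (verts H) * avg n (fw F)) \<longlonglongrightarrow> 0"
proof -
  let ?h = "card (verts H)" and ?U = "gunion F H"
  define K where "K = real (card (verts F) ^ card (verts F))"
  define C0 where "C0 = 4 * real ?h * real (card (verts ?U) ^ card (verts ?U)) + K * (real (?h * pend_mult H) * (4 + 2 * real ?h))"
  have h: "real ?h > 0" using C_card_pos[OF H] by simp
  have K0: "K \<ge> 0" by (simp add: K_def)
  show ?thesis
  proof (rule LIMSEQ_I)
    fix e :: real assume e: "e > 0"
    \<comment> \<open>The weight is at most \<open>K\<close>, so the concentration error is at most
      \<epsilon> (K + 1) = e h / 2, half of the tolerance. The other half is for C0 / n.\<close>
    define \<epsilon> where "\<epsilon> = e * ?h / (2 * (K + 1))"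
    have \<epsilon>: "\<epsilon> > 0" using e h K0 by (simp add: \<epsilon>_def)
    have \<epsilon>K: "\<epsilon> * (K + 1) = e / 2 * ?h" using K0 by (simp add: \<epsilon>_def field_simps)
    obtain m :: nat where m: "K \<le> real m" using real_arch_simple by blast
    \<comment> \<open>The weight is bounded, so the exponent 1 in \<open>avg_pend_total\<close>
      suffices once n \<ge> K.\<close>
    have w: "\<forall>\<^sub>F n in sequentially. \<forall>G\<in>graphs_on \<A> n. 0 \<le> fw F G \<and> fw F G \<le> real n ^ 1"
      using eventually_ge_at_top[of m]
    proof eventually_elim
      case (elim n)
      show ?case
      proof
        fix G assume G: "G \<in> graphs_on \<A> n"
        have "fw F G \<le> K" unfolding K_def by (rule fw_le[OF F A_wf(1)[OF G]])
        then show "0 \<le> fw F G \<and> fw F G \<le> real n ^ 1" using m elim fw_nonneg[of F G] by simp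
      qed
    qed
    have "(\<lambda>n. C0 / n) \<longlonglongrightarrow> 0" by (rule lim_const_over_n)
    moreover have "e / 2 * ?h > 0" using e h by simp
    ultimately have "\<forall>\<^sub>F n in sequentially. C0 / n < e / 2 * ?h" by (rule order_tendstoD)
    then have "\<forall>\<^sub>F n in sequentially. norm (avg n (fw ?U) - \<rho> ^ ?h * avg n (fw F) - 0) < e"
      using avg_pend_total[OF H \<epsilon> w] eventually_gt_at_top[of 0]
    proof eventually_elim
      case (elim n)
      have n: "n > 0" using elim(3) .
      have "\<bar>real ?h * n * avg n (fw ?U) - avg n (\<lambda>G. fw F G * pend_total H G)\<bar> \<le> C0"
        using side1_estimate[OF F H disj n] side2_estimate[OF F H disj n]
        unfolding C0_def K_def card_sides[OF F H disj n] by linarith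
      then have "\<bar>(real ?h * n * avg n (fw ?U) - avg n (\<lambda>G. fw F G * pend_total H G)) / n\<bar> \<le> C0 / n"
        unfolding abs_divide using n by (intro frac_le) auto
      moreover have "(real ?h * n * avg n (fw ?U) - avg n (\<lambda>G. fw F G * pend_total H G)) / n
          = real ?h * avg n (fw ?U) - avg n (\<lambda>G. fw F G * pend_total H G) / n"
        using n by (simp add: diff_divide_distrib)
      moreover have "avg n (fw F) \<le> K"
        using K0 fw_le[OF F A_wf(1)] by (intro avg_le) (auto simp: K_def)
      then have "\<epsilon> * avg n (fw F) + \<epsilon> \<le> \<epsilon> * K + \<epsilon>" using \<epsilon> by (simp add: mult_left_mono)
      moreover have "\<epsilon> * K + \<epsilon> = e / 2 * ?h" using \<epsilon>K by (simp add: algebra_simps)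
      ultimately have "\<bar>real ?h * avg n (fw ?U) - ?h * \<rho> ^ ?h * avg n (fw F)\<bar> < e / 2 * ?h + e / 2 * ?h"
        using elim(1,2) by linarith
      moreover have "real ?h * avg n (fw ?U) - ?h * \<rho> ^ ?h * avg n (fw F) = real ?h * (avg n (fw ?U) - \<rho> ^ ?h * avg n (fw F))"
        by (simp add: right_diff_distrib)
      ultimately have "real ?h * \<bar>avg n (fw ?U) - \<rho> ^ ?h * avg n (fw F)\<bar> < real ?h * e" using h by (simp add: abs_mult mult.commute)
      then show ?case using h by simp
    qed
    then show "\<exists>n0. \<forall>n\<ge>n0. norm (avg n (fw ?U) - \<rho> ^ ?h * avg n (fw F) - 0) < e"
      by (simp add: eventually_sequentially)
  qed
qed

text \<open>The reference is the probability of an empty fragment. It is pinned down only in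
  \<open>total_variation\<close>; until then differences take the place of limits.\<close>

lemma fw_limit:
  assumes "F \<in> forest \<C>"
  shows "(\<lambda>n. avg n (fw F) - \<rho> ^ card (verts F) * avg n (fw ({}, {}))) \<longlonglongrightarrow> 0"
  using assms
proof (induction rule: forest_induct[consumes 1, case_names empty step])
  case empty
  then show ?case by simp
next
  case (step F H)
  have wf: "wf_graph F" "wf_graph H" using forest_wf[OF step(1)] C_wf[OF step(2)] .
  have "(\<lambda>n. (avg n (fw (gunion F H)) - \<rho> ^ card (verts H) * avg n (fw F)) +
      \<rho> ^ card (verts H) * (avg n (fw F) - \<rho> ^ card (verts F) * avg n (fw ({}, {})))) \<longlonglongrightarrow> 0 + \<rho> ^ card (verts H) * 0"
    by (intro tendsto_intros fw_step[OF wf(1) step(2,3)] step(4))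
  moreover have "card (verts (gunion F H)) = card (verts F) + card (verts H)"
    using step(3) wf by (simp add: card_Un_disjoint wf_finite)
  ultimately show ?case by (simp add: algebra_simps power_add)
qed

end

section \<open>The exponential formula\<close>

lemma card_bijections:
  assumes "finite V" "card V = n"
  shows "card {f \<in> V \<rightarrow>\<^sub>E {1..n}. inj_on f V} = fact n"
  using card_inj_on_subset_funcset[OF assms(1), of "{1..n}" V] assms by (simp add: fact_prod_rev)

definition forest_k :: "graph set \<Rightarrow> nat \<Rightarrow> graph set" where
  "forest_k \<C> k = {F \<in> forest \<C>. card (components F) = k}"

lemma forest_kD:
  assumes "F \<in> forest_k \<C> k"
  shows "F \<in> forest \<C>" "wf_graph F" "card (components F) = k"
  using assms forest_wf[of F \<C>] by (simp_all add: forest_k_def)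

lemma graphs_onD: "G \<in> graphs_on X n \<Longrightarrow> G \<in> X" "G \<in> graphs_on X n \<Longrightarrow> verts G = {1..n}"
  by (simp_all add: graphs_on_def)

lemma finite_class_verts: "graph_class X \<Longrightarrow> finite V \<Longrightarrow> finite {G \<in> X. verts G = V}"
  by (rule finite_subset[OF _ finite_graphs_with_verts[of V]]) (use graph_class_wf in blast)

lemma forest_class: "graph_class \<C> \<Longrightarrow> graph_class (forest \<C>)"
  unfolding graph_class_def[of "forest \<C>"]
proof (intro conjI ballI allI impI)
  assume C: "graph_class \<C>"
  show "wf_graph G" if "G \<in> forest \<C>" for G using that forest_wf by blast
  fix G H assume a: "G \<in> forest \<C> \<and> wf_graph H \<and> isomorphic G H"
  then obtain f where "inj_on f (verts G)" "H = relabel f G" using isomorphic_iff[of G H] forest_wf by blast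
  then show "H \<in> forest \<C>" using a relabel_in_forest[OF C] by blast
qed

lemma forest_k_class: "graph_class \<C> \<Longrightarrow> graph_class (forest_k \<C> k)"
  unfolding graph_class_def[of "forest_k \<C> k"]
proof (intro conjI ballI allI impI)
  assume C: "graph_class \<C>"
  show "wf_graph G" if "G \<in> forest_k \<C> k" for G using forest_kD(2)[OF that] .
  fix G H assume a: "G \<in> forest_k \<C> k \<and> wf_graph H \<and> isomorphic G H"
  then have "G \<in> forest_k \<C> k" by blast
  note G = forest_kD[OF this]
  obtain f where f: "inj_on f (verts G)" "H = relabel f G" using a isomorphic_iff[OF G(2), of H] by blast
  have "inj_on ((`) f) (components G)"
    by (rule inj_on_subset[OF inj_on_image_Pow[OF f(1)]]) (use components_subset in blast)
  then have "card (components H) = k" unfolding f(2) components_relabel[OF G(2) f(1)] using G(3) by (simp add: card_image)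
  moreover have "H \<in> forest \<C>" unfolding f(2) using relabel_in_forest[OF C G(1) f(1)] .
  ultimately show "H \<in> forest_k \<C> k" unfolding forest_k_def by blast
qed

text \<open>Mark one of the k + 1 components: the marked component sits on a vertex set
  \<open>A\<close>, the remaining forest on its complement.\<close>

lemma forest_k_count:
  assumes C: "graph_class \<C>" and conn: "\<forall>H\<in>\<C>. connected_graph H"
  shows "real (Suc k) * card (graphs_on (forest_k \<C> (Suc k)) n) =
    (\<Sum>i\<le>n. real (n choose i) * (real (card (graphs_on \<C> i)) * card (graphs_on (forest_k \<C> k) (n - i))))"
proof -
  let ?X = "\<lambda>A. {G \<in> \<C>. verts G = A}" and ?Y = "\<lambda>A. {G \<in> forest_k \<C> k. verts G = A}"
  let ?S = "Sigma (graphs_on (forest_k \<C> (Suc k)) n) components"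
  let ?R = "Sigma (Pow {1..n}) (\<lambda>A. ?X A \<times> ?Y ({1..n} - A))"
  have S: "wf_graph G" "verts G = {1..n}" "G \<in> forest \<C>" "card (components G) = Suc k"
    if "G \<in> graphs_on (forest_k \<C> (Suc k)) n" for G
    using forest_kD[OF graphs_onD(1)[OF that]] graphs_onD(2)[OF that] by auto
  have finX: "finite (?X A)" "finite (?Y A)" if "finite A" for A
    using finite_class_verts[OF C that] finite_class_verts[OF forest_k_class[OF C] that] by auto
  have bij: "bij_betw (\<lambda>(G, K). (K, induced G K, induced G ({1..n} - K))) ?S ?R"
  proof (rule bij_betw_byWitness[where f' = "\<lambda>(K, H, F). (gunion F H, K)"])
    show "\<forall>a\<in>?S. (\<lambda>(K, H, F). (gunion F H, K)) ((\<lambda>(G, K). (K, induced G K, induced G ({1..n} - K))) a) = a"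
    proof
      fix a assume a: "a \<in> ?S"
      obtain G K where e: "a = (G, K)" by (cases a) blast
      have G: "G \<in> graphs_on (forest_k \<C> (Suc k)) n" and K: "K \<in> components G" using a e by auto
      have "gunion (induced G ({1..n} - K)) (induced G K) = G"
        using gunion_component[OF S(1)[OF G] K] S(2)[OF G] by simp
      then show "(\<lambda>(K, H, F). (gunion F H, K)) ((\<lambda>(G, K). (K, induced G K, induced G ({1..n} - K))) a) = a"
        unfolding e by simp
    qed
    have R: "K \<subseteq> {1..n}" "H \<in> \<C>" "verts H = K" "F \<in> forest_k \<C> k" "verts F = {1..n} - K" "wf_graph H" "wf_graph F"
      "verts F \<inter> verts H = {}" "connected_graph H"
      if "(K, H, F) \<in> ?R" for K H F
    proof -
      show b: "K \<subseteq> {1..n}" "H \<in> \<C>" "verts H = K" "F \<in> forest_k \<C> k" "verts F = {1..n} - K" using that by auto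
      show "wf_graph H" "wf_graph F" using graph_class_wf[OF C b(2)] forest_kD(2)[OF b(4)] .
      show "connected_graph H" using conn b(2) by blast
      show "verts F \<inter> verts H = {}" unfolding b(3,5) by blast
    qed
    show "\<forall>a\<in>?R. (\<lambda>(G, K). (K, induced G K, induced G ({1..n} - K))) ((\<lambda>(K, H, F). (gunion F H, K)) a) = a"
    proof
      fix a assume a: "a \<in> ?R"
      obtain K H F where e: "a = (K, H, F)" by (cases a) blast
      note r = R[OF a[unfolded e]]
      have "induced (gunion F H) K = H" "induced (gunion F H) ({1..n} - K) = F"
        using gunion_parts(3,4)[OF r(7,6,8)] r(3,5) by auto
      then show "(\<lambda>(G, K). (K, induced G K, induced G ({1..n} - K))) ((\<lambda>(K, H, F). (gunion F H, K)) a) = a"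
        unfolding e by simp
    qed
    show "(\<lambda>(G, K). (K, induced G K, induced G ({1..n} - K))) ` ?S \<subseteq> ?R"
    proof (rule image_subsetI)
      fix a assume a: "a \<in> ?S"
      obtain G K where e: "a = (G, K)" by (cases a) blast
      have G: "G \<in> graphs_on (forest_k \<C> (Suc k)) n" and K: "K \<in> components G" using a e by auto
      note s = S[OF G] and f = forest_remove_component[OF S(3)[OF G] K]
      have cl: "closed_set G (verts G - K)" using closed_set_Diff[OF s(1)] components_iff[OF s(1)] K by blast
      have "components (induced G (verts G - K)) = components G - {K}"
        unfolding components_induced[OF cl]
      proof (intro equalityI subsetI)
        fix L assume "L \<in> {L \<in> components G. L \<subseteq> verts G - K}"
        then show "L \<in> components G - {K}" using components_nonempty[OF K] by blast
      next
        fix L assume L: "L \<in> components G - {K}"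
        then have "K \<inter> L = {}" "L \<subseteq> verts G" using components_disjoint[OF K, of L] components_subset[of L G] by auto
        then show "L \<in> {L \<in> components G. L \<subseteq> verts G - K}" using L by blast
      qed
      then have "card (components (induced G (verts G - K))) = k"
        using s(4) K finite_components[OF s(1)] by simp
      then have "induced G ({1..n} - K) \<in> forest_k \<C> k" using f(1) s(2) by (simp add: forest_k_def)
      moreover have "K \<subseteq> {1..n}" using components_subset[OF K] s(2) by simp
      ultimately show "(\<lambda>(G, K). (K, induced G K, induced G ({1..n} - K))) a \<in> ?R"
        unfolding e using f(2) by simp
    qed
    show "(\<lambda>(K, H, F). (gunion F H, K)) ` ?R \<subseteq> ?S"
    proof (rule image_subsetI)
      fix a assume a: "a \<in> ?R"
      obtain K H F where e: "a = (K, H, F)" by (cases a) blast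
      note r = R[OF a[unfolded e]]
      have Ff: "F \<in> forest \<C>" "card (components F) = k" using r(4) by (auto simp: forest_k_def)
      have cH: "components H = {K}" using connected_graph_components[OF r(6,9)] r(3) by simp
      have "H \<in> forest \<C>" unfolding forest_def using r(2,3,6) cH induced_verts[OF r(6)] by simp
      then have gf: "gunion F H \<in> forest \<C>" using gunion_in_forest[OF Ff(1) _ r(8)] by blast
      have cg: "components (gunion F H) = insert K (components F)" using components_gunion[OF r(7,6,8)] cH by simp
      have "K \<notin> components F" using components_subset[of K F] components_nonempty[of K H] cH r(3,8) by auto
      then have "card (components (gunion F H)) = Suc k" unfolding cg using Ff(2) finite_components[OF r(7)] by simp
      moreover have "verts (gunion F H) = {1..n}" using r(1,3,5) by auto
      ultimately show "(\<lambda>(K, H, F). (gunion F H, K)) a \<in> ?S"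
        unfolding e using gf cg by (simp add: graphs_on_def forest_k_def)
    qed
  qed
  have "card ?S = (\<Sum>G\<in>graphs_on (forest_k \<C> (Suc k)) n. card (components G))"
    using finite_graphs_on[OF forest_k_class[OF C]] finite_components S(1) by (intro card_SigmaI) auto
  also have "\<dots> = (\<Sum>G\<in>graphs_on (forest_k \<C> (Suc k)) n. Suc k)" using S(4) by (intro sum.cong) auto
  finally have 1: "card ?S = card (graphs_on (forest_k \<C> (Suc k)) n) * Suc k" by simp
  define g where "g i = real (card (graphs_on \<C> i)) * card (graphs_on (forest_k \<C> k) (n - i))" for i
  have "card ?R = (\<Sum>A\<in>Pow {1..n}. card (?X A \<times> ?Y ({1..n} - A)))"
    using finX finite_subset[of _ "{1..n}"] by (intro card_SigmaI) auto
  then have "real (card ?R) = (\<Sum>A\<in>Pow {1..n}. real (card (?X A \<times> ?Y ({1..n} - A))))" by (simp only: of_nat_sum)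
  also have "\<dots> = (\<Sum>A\<in>Pow {1..n}. g (card A))"
  proof (rule sum.cong[OF refl])
    fix A assume A: "A \<in> Pow {1..n}"
    have f: "finite A" using A finite_subset[of A "{1..n}"] by auto
    have "card ({1..n} - A) = n - card A" using A f by (simp add: card_Diff_subset)
    then show "real (card (?X A \<times> ?Y ({1..n} - A))) = g (card A)"
      using card_class_verts[OF C f] card_class_verts[OF forest_k_class[OF C], of "{1..n} - A"]
      by (simp add: g_def card_cartesian_product)
  qed
  also have "\<dots> = (\<Sum>i\<le>n. real (n choose i) * g i)" using sum_over_subsets[of "{1..n}" g] by simp
  finally have "real (card ?S) = (\<Sum>i\<le>n. real (n choose i) * g i)" using bij_betw_same_card[OF bij] by simp
  then show ?thesis unfolding 1 g_def of_nat_mult by (simp only: mult.commute)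
qed

context comp_class
begin

section \<open>Generating functions of labelled forests\<close>

definition cc :: "nat \<Rightarrow> real" where "cc n = real (card (graphs_on \<C> n)) * \<rho> ^ n / fact n"

definition zk :: "nat \<Rightarrow> nat \<Rightarrow> real" where
  "zk k n = real (card (graphs_on (forest_k \<C> k) n)) * \<rho> ^ n / fact n"

definition zz :: "nat \<Rightarrow> real" where
  "zz n = real (card (graphs_on (forest \<C>) n)) * \<rho> ^ n / fact n"

lemma cc_nonneg: "cc n \<ge> 0" and zk_nonneg: "zk k n \<ge> 0" and zz_nonneg: "zz n \<ge> 0"
  using rho_pos by (auto simp: cc_def zk_def zz_def)

lemma cc_summable: "summable cc" using egf_real(2) by (simp add: cc_def[abs_def])

lemma egf_cc: "enn2real (egf \<C> \<rho>) = suminf cc" using egf_real(3) by (simp add: cc_def[abs_def])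

lemma zk_rec: "real (Suc k) * zk (Suc k) n = (\<Sum>i\<le>n. cc i * zk k (n - i))"
proof -
  have "real (Suc k) * zk (Suc k) n = (real (Suc k) * card (graphs_on (forest_k \<C> (Suc k)) n)) * (\<rho> ^ n / fact n)"
    by (simp add: zk_def)
  also have "\<dots> = (\<Sum>i\<le>n. real (n choose i) * (real (card (graphs_on \<C> i)) * card (graphs_on (forest_k \<C> k) (n - i))) * (\<rho> ^ n / fact n))"
    unfolding forest_k_count[OF C C_conn] sum_distrib_right ..
  also have "\<dots> = (\<Sum>i\<le>n. cc i * zk k (n - i))"
  proof (rule sum.cong[OF refl])
    fix i assume "i \<in> {..n}"
    then have i: "i \<le> n" by simp
    have p: "\<rho> ^ n = \<rho> ^ i * \<rho> ^ (n - i)" using i by (simp add: power_add[symmetric])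
    have b: "real (n choose i) = fact n / (fact i * fact (n - i))" using binomial_fact[OF i] .
    show "real (n choose i) * (real (card (graphs_on \<C> i)) * card (graphs_on (forest_k \<C> k) (n - i))) * (\<rho> ^ n / fact n) = cc i * zk k (n - i)"
      unfolding cc_def zk_def b p by simp
  qed
  finally show ?thesis .
qed

lemma zk_0: "zk 0 n = (if n = 0 then 1 else 0)"
proof -
  have e: "verts F = {} \<longleftrightarrow> card (components F) = 0" if "wf_graph F" for F
    using finite_components[OF that] Union_components[of F] components_nonempty[of _ F] by auto
  show ?thesis
  proof (cases "n = 0")
    case True
    have "graphs_on (forest_k \<C> 0) 0 = {({}, {})}"
    proof (intro equalityI subsetI)
      fix F assume "F \<in> graphs_on (forest_k \<C> 0) 0"
      then have F: "wf_graph F" "verts F = {}" using forest_kD(2)[OF graphs_onD(1)] graphs_onD(2)[of F _ 0] by auto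
      then have "edges F = {}" using wf_edge_subset wf_edge_nonempty by blast
      then show "F \<in> {({}, {})}" using F(2) by (simp add: graph_eqI)
    next
      fix F :: graph assume "F \<in> {({}, {})}"
      then show "F \<in> graphs_on (forest_k \<C> 0) 0" using empty_in_forest by (simp add: graphs_on_def forest_k_def components_def)
    qed
    then show ?thesis using True by (simp add: zk_def)
  next
    case False
    have "graphs_on (forest_k \<C> 0) n = {}"
    proof (rule ccontr)
      assume "graphs_on (forest_k \<C> 0) n \<noteq> {}"
      then obtain F where "F \<in> graphs_on (forest_k \<C> 0) n" by blast
      then have "wf_graph F" "verts F = {1..n}" "card (components F) = 0"
        using forest_kD[OF graphs_onD(1)] graphs_onD(2)[of F _ n] by blast+
      then show False using e[of F] False by simp
    qed
    then show ?thesis using False by (simp add: zk_def)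
  qed
qed

text \<open>By the Cauchy product, summing \<open>zk_rec\<close> over n multiplies the sum for k by
  C(\<rho>) / (k + 1).\<close>

lemma zk_sums: "zk k sums (suminf cc ^ k / fact k)"
proof (induction k)
  case 0
  have "(\<lambda>n. if n = 0 then 1 else 0 :: real) sums 1" using sums_single[of 0 "\<lambda>_. 1 :: real"] by simp
  then show ?case using zk_0 by (simp add: zk_0[abs_def])
next
  case (Suc k)
  have "(\<lambda>n. \<Sum>i\<le>n. cc i * zk k (n - i)) sums (suminf cc * suminf (zk k))"
    using cc_summable Suc sums_summable cc_nonneg zk_nonneg by (intro Cauchy_product_sums) auto
  then have "(\<lambda>n. real (Suc k) * zk (Suc k) n) sums (suminf cc * (suminf cc ^ k / fact k))"
    using sums_unique[OF Suc] zk_rec by simp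
  then have "(\<lambda>n. (1 / real (Suc k)) * (real (Suc k) * zk (Suc k) n)) sums ((1 / real (Suc k)) * (suminf cc * (suminf cc ^ k / fact k)))"
    by (rule sums_mult)
  then show ?case by (simp add: field_simps del: of_nat_Suc)
qed

lemma card_components_le: "wf_graph F \<Longrightarrow> card (components F) \<le> card (verts F)"
  unfolding components_def using card_image_le wf_finite by blast

lemma zz_eq: "n \<le> N \<Longrightarrow> zz n = (\<Sum>k\<le>N. zk k n)"
proof -
  assume n: "n \<le> N"
  have "graphs_on (forest \<C>) n = (\<Union>k\<in>{..N}. graphs_on (forest_k \<C> k) n)"
  proof (intro equalityI subsetI)
    fix F assume F: "F \<in> graphs_on (forest \<C>) n"
    then have "card (components F) \<le> N"
      using card_components_le[OF forest_wf[OF graphs_onD(1)[OF F]]] graphs_onD(2)[OF F] n by simp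
    then show "F \<in> (\<Union>k\<in>{..N}. graphs_on (forest_k \<C> k) n)" using F by (simp add: graphs_on_def forest_k_def)
  qed (auto simp: graphs_on_def forest_k_def)
  then have "card (graphs_on (forest \<C>) n) = card (\<Union>k\<in>{..N}. graphs_on (forest_k \<C> k) n)" by simp
  also have "\<dots> = (\<Sum>k\<le>N. card (graphs_on (forest_k \<C> k) n))"
    using finite_graphs_on[OF forest_k_class[OF C]] by (intro card_UN_disjoint) (auto simp: graphs_on_def forest_k_def)
  finally show ?thesis by (simp add: zz_def zk_def sum_distrib_right sum_divide_distrib)
qed

text \<open>All terms are nonnegative, so finite parts of the array \<open>zk k n\<close> bound each
  order of summation by the other. A forest on n vertices has at most n components, so for fixed n
  only finitely many k contribute.\<close>

lemma zz_sums: "zz sums exp (suminf cc)"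
proof -
  let ?c = "suminf cc"
  have c0: "?c \<ge> 0" using suminf_nonneg[OF cc_summable] cc_nonneg by blast
  have e: "(\<lambda>k. ?c ^ k / fact k) sums exp ?c" using exp_converges[of ?c] by (simp add: divide_inverse mult.commute)
  have zks: "summable (zk k)" "suminf (zk k) = ?c ^ k / fact k" for k
    using zk_sums[of k] sums_summable sums_unique by (auto simp: sums_iff)
  have bnd: "(\<Sum>n<N. zz n) \<le> exp ?c" for N
  proof -
    have "(\<Sum>n<N. zz n) = (\<Sum>n<N. \<Sum>k\<le>N. zk k n)" using zz_eq by (intro sum.cong) auto
    also have "\<dots> = (\<Sum>k\<le>N. \<Sum>n<N. zk k n)" by (rule sum.swap)
    also have "\<dots> \<le> (\<Sum>k\<le>N. ?c ^ k / fact k)"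
      using sum_le_suminf[OF zks(1)] zk_nonneg zks(2) by (intro sum_mono) (metis finite_lessThan)
    also have "\<dots> \<le> exp ?c"
      using sum_le_suminf[OF sums_summable[OF e], of "{..N}"] c0 sums_unique[OF e] by simp
    finally show ?thesis .
  qed
  have s: "summable zz" using zz_nonneg bnd by (intro summableI_nonneg_bounded[of zz "exp ?c"]) auto
  have "suminf zz \<le> exp ?c" using suminf_le_const[OF s] bnd by blast
  moreover have "exp ?c \<le> suminf zz"
  proof -
    have "(\<Sum>k<K. ?c ^ k / fact k) \<le> suminf zz" for K
    proof -
      have "(\<lambda>n. \<Sum>k<K. zk k n) sums (\<Sum>k<K. ?c ^ k / fact k)" by (rule sums_sum) (rule zk_sums)
      moreover have "(\<Sum>k<K. zk k n) \<le> zz n" for n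
      proof -
        have "(\<Sum>k<K. zk k n) \<le> (\<Sum>k\<le>max K n. zk k n)" using zk_nonneg by (intro sum_mono2) auto
        then show ?thesis using zz_eq[of n "max K n"] by simp
      qed
      ultimately show ?thesis using sums_le[OF _ _ summable_sums[OF s], of "\<lambda>n. \<Sum>k<K. zk k n"] by blast
    qed
    then show ?thesis using suminf_le_const[OF sums_summable[OF e]] sums_unique[OF e] by metis
  qed
  ultimately show ?thesis using summable_sums[OF s] by simp
qed

section \<open>Unlabelled forests and their Boltzmann weights\<close>

abbreviation UF :: "graph set set" where "UF \<equiv> unlabelled_F \<C>"

definition usize :: "graph set \<Rightarrow> nat" where "usize U = card (verts (rep U))"

lemma UF_eq: "UF = iso_class ` forest \<C>"
  unfolding unlabelled_F_def forest_def by blast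

lemma UF_rep:
  assumes "U \<in> UF" shows "rep U \<in> forest \<C>" "wf_graph (rep U)" "iso_class (rep U) = U"
proof -
  obtain G where G: "G \<in> forest \<C>" "U = iso_class G" using assms UF_eq by blast
  have wf: "wf_graph G" using forest_wf[OF G(1)] .
  note R = rep_iso_class[OF wf, folded G(2)]
  show "wf_graph (rep U)" by (rule R(1))
  show "rep U \<in> forest \<C>" using forest_class[OF C] G(1) R unfolding graph_class_def by blast
  show "iso_class (rep U) = U" using iso_class_eq_iff[OF wf R(1)] R(2) G(2) by simp
qed

lemma usize_iso_class: "wf_graph G \<Longrightarrow> usize (iso_class G) = card (verts G)"
  using isomorphic_card[OF rep_iso_class(2)] by (simp add: usize_def)

definition UFn :: "nat \<Rightarrow> graph set set" where "UFn n = {U \<in> UF. usize U = n}"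

lemma UFn_image: "UFn n = iso_class ` graphs_on (forest \<C>) n"
proof (intro equalityI subsetI)
  fix U assume "U \<in> UFn n"
  then have U: "U \<in> UF" "card (verts (rep U)) = n" by (auto simp: UFn_def usize_def)
  note R = UF_rep[OF U(1)]
  obtain f where f: "bij_betw f (verts (rep U)) {1..n}"
    using wf_finite[OF R(2)] U(2) by (metis card_atLeastAtMost diff_Suc_1 finite_atLeastAtMost finite_same_card_bij)
  then have inj: "inj_on f (verts (rep U))" "f ` verts (rep U) = {1..n}" by (auto simp: bij_betw_def)
  have "relabel f (rep U) \<in> graphs_on (forest \<C>) n"
    using relabel_in_forest[OF C R(1) inj(1)] inj(2) by (simp add: graphs_on_def)
  moreover have "iso_class (relabel f (rep U)) = U"
    using iso_class_eq_iff[OF R(2) wf_relabel[OF R(2) inj(1)]] isomorphic_relabel[OF R(2) inj(1)] R(3) by simp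
  ultimately show "U \<in> iso_class ` graphs_on (forest \<C>) n" by blast
next
  fix U assume "U \<in> iso_class ` graphs_on (forest \<C>) n"
  then obtain G where "G \<in> forest \<C>" "verts G = {1..n}" "U = iso_class G" by (auto simp: graphs_on_def)
  then show "U \<in> UFn n" using usize_iso_class[OF forest_wf] UF_eq by (auto simp: UFn_def)
qed

lemma finite_UFn: "finite (UFn n)"
  unfolding UFn_image using finite_graphs_on[OF forest_class[OF C]] by blast

lemma mu_nonneg: "mu \<rho> U \<ge> 0" using rho_pos by (simp add: mu_def)

text \<open>Every bijection from the representative onto \<open>{1..n}\<close> yields one labelled
  copy, and each copy comes from as many bijections as there are automorphisms.\<close>

lemma labelled_count:
  assumes "U \<in> UFn n"
  shows "card {G \<in> graphs_on (forest \<C>) n. iso_class G = U} * aut_count (rep U) = fact n"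
proof -
  let ?L = "{G \<in> graphs_on (forest \<C>) n. iso_class G = U}" and ?F = "rep U"
  have U: "U \<in> UF" "card (verts ?F) = n" using assms by (auto simp: UFn_def usize_def)
  note R = UF_rep[OF U(1)]
  have L: "wf_graph G" "verts G = {1..n}" "isomorphic ?F G" if "G \<in> ?L" for G
  proof -
    have "G \<in> graphs_on (forest \<C>) n" using that by blast
    then show wf: "wf_graph G" "verts G = {1..n}" using forest_wf[OF graphs_onD(1)] graphs_onD(2)[of G _ n] by blast+
    show "isomorphic ?F G" using that R(3) iso_class_eq_iff[OF R(2) wf(1)] by simp
  qed
  have finL: "finite ?L" using finite_graphs_on[OF forest_class[OF C]] by simp
  have "{f \<in> verts ?F \<rightarrow>\<^sub>E {1..n}. inj_on f (verts ?F)} = (\<Union>G\<in>?L. isos ?F G)"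
  proof (intro equalityI subsetI)
    fix f assume f: "f \<in> {f \<in> verts ?F \<rightarrow>\<^sub>E {1..n}. inj_on f (verts ?F)}"
    then have inj: "inj_on f (verts ?F)" and ext: "f \<in> extensional (verts ?F)" and sub: "f ` verts ?F \<subseteq> {1..n}"
      by (auto simp: PiE_def)
    have "f ` verts ?F = {1..n}" using card_image[OF inj] U(2) sub by (intro card_subset_eq) auto
    then have "relabel f ?F \<in> ?L"
      using relabel_in_forest[OF C R(1) inj] R(3) iso_class_eq_iff[OF R(2) wf_relabel[OF R(2) inj]] isomorphic_relabel[OF R(2) inj]
      by (simp add: graphs_on_def)
    moreover have "f \<in> isos ?F (relabel f ?F)" using isos_iff[OF R(2) wf_relabel[OF R(2) inj]] inj ext by simp
    ultimately show "f \<in> (\<Union>G\<in>?L. isos ?F G)" by blast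
  next
    fix f assume "f \<in> (\<Union>G\<in>?L. isos ?F G)"
    then obtain G where G: "G \<in> ?L" "f \<in> isos ?F G" by blast
    have "f \<in> verts ?F \<rightarrow>\<^sub>E {1..n}" using G(2) L(2)[OF G(1)] by (simp add: isos_def)
    moreover have "inj_on f (verts ?F)" using G(2) isos_iff[OF R(2) L(1)[OF G(1)]] by blast
    ultimately show "f \<in> {f \<in> verts ?F \<rightarrow>\<^sub>E {1..n}. inj_on f (verts ?F)}" by blast
  qed
  then have "fact n = card (\<Union>G\<in>?L. isos ?F G)" using card_bijections[OF wf_finite[OF R(2)] U(2)] by simp
  also have "\<dots> = (\<Sum>G\<in>?L. card (isos ?F G))"
  proof (rule card_UN_disjoint[OF finL])
    show "\<forall>G\<in>?L. finite (isos ?F G)" using finite_isos[OF R(2) L(1)] by blast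
    show "\<forall>G\<in>?L. \<forall>G'\<in>?L. G \<noteq> G' \<longrightarrow> isos ?F G \<inter> isos ?F G' = {}"
    proof (intro ballI impI, rule ccontr)
      fix G G' assume a: "G \<in> ?L" "G' \<in> ?L" "G \<noteq> G'" "isos ?F G \<inter> isos ?F G' \<noteq> {}"
      then obtain f where "f \<in> isos ?F G" "f \<in> isos ?F G'" by blast
      then have "G = relabel f ?F" "G' = relabel f ?F" using isos_iff[OF R(2) L(1)[OF a(1)]] isos_iff[OF R(2) L(1)[OF a(2)]] by blast+
      then show False using a(3) by simp
    qed
  qed
  also have "\<dots> = (\<Sum>G\<in>?L. aut_count ?F)" using card_isos[OF R(2) L(1) L(3)] by (intro sum.cong) auto
  finally show ?thesis by simp
qed

text \<open>By \<open>labelled_count\<close> the weight of an unlabelled graph is \<rho>^n / n!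
  times its number of labellings. This links \<mu> to the exponential formula.\<close>

lemma sum_mu_UFn: "(\<Sum>U\<in>UFn n. mu \<rho> U) = zz n"
proof -
  let ?L = "\<lambda>U. {G \<in> graphs_on (forest \<C>) n. iso_class G = U}"
  have "mu \<rho> U = real (card (?L U)) * (\<rho> ^ n / fact n)" if U: "U \<in> UFn n" for U
  proof -
    have s: "card (verts (rep U)) = n" "U \<in> UF" using U by (auto simp: UFn_def usize_def)
    have a: "real (aut_count (rep U)) > 0" using aut_count_pos[OF UF_rep(2)[OF s(2)]] by simp
    have "real (card (?L U)) * real (aut_count (rep U)) = fact n"
      unfolding of_nat_mult[symmetric] labelled_count[OF U] by (rule of_nat_fact)
    then have "real (card (?L U)) = fact n / real (aut_count (rep U))" using a by (simp add: eq_divide_eq)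
    then show ?thesis unfolding mu_def s(1) using a by simp
  qed
  then have "(\<Sum>U\<in>UFn n. mu \<rho> U) = (\<Sum>U\<in>UFn n. real (card (?L U))) * (\<rho> ^ n / fact n)"
    unfolding sum_distrib_right by (rule sum.cong[OF refl])
  also have "(\<Sum>U\<in>UFn n. real (card (?L U))) = real (card (graphs_on (forest \<C>) n))"
  proof -
    have "card (graphs_on (forest \<C>) n) = (\<Sum>U\<in>UFn n. card (?L U))"
    proof -
      have "graphs_on (forest \<C>) n = (\<Union>U\<in>UFn n. ?L U)" unfolding UFn_image by blast
      then have "card (graphs_on (forest \<C>) n) = card (\<Union>U\<in>UFn n. ?L U)" by simp
      also have "\<dots> = (\<Sum>U\<in>UFn n. card (?L U))"
        using finite_UFn finite_graphs_on[OF forest_class[OF C]] by (intro card_UN_disjoint) auto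
      finally show ?thesis .
    qed
    then show ?thesis by simp
  qed
  finally show ?thesis by (simp add: zz_def)
qed

text \<open>Finite truncations by order, to which sums over arbitrary sets of unlabelled graphs are
  reduced.\<close>

definition UM :: "nat \<Rightarrow> graph set set" where "UM M = {U \<in> UF. usize U \<le> M}"

lemma UM_eq: "UM M = (\<Union>m\<in>{..M}. UFn m)" by (auto simp: UM_def UFn_def)

lemma finite_UM: "finite (UM M)" unfolding UM_eq using finite_UFn by blast

lemma UM_subset: "UM M \<subseteq> UF" by (auto simp: UM_def)

lemma sum_mu_UM: "(\<Sum>U\<in>UM M. mu \<rho> U) = (\<Sum>m\<le>M. zz m)"
proof -
  have "(\<Sum>U\<in>UM M. mu \<rho> U) = (\<Sum>m\<le>M. \<Sum>U\<in>UFn m. mu \<rho> U)"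
    unfolding UM_eq using finite_UFn by (intro sum.UNION_disjoint) (auto simp: UFn_def)
  then show ?thesis using sum_mu_UFn by simp
qed

abbreviation Z :: real where "Z \<equiv> exp (suminf cc)"

lemma sum_mu_le:
  assumes "finite B" "B \<subseteq> UF" shows "(\<Sum>U\<in>B. mu \<rho> U) \<le> Z"
proof -
  define M where "M = Max (insert 0 (usize ` B))"
  have "B \<subseteq> UM M" using assms by (auto simp: UM_def M_def)
  then have "(\<Sum>U\<in>B. mu \<rho> U) \<le> (\<Sum>U\<in>UM M. mu \<rho> U)" using finite_UM mu_nonneg by (intro sum_mono2) auto
  also have "\<dots> = (\<Sum>m\<le>M. zz m)" by (rule sum_mu_UM)
  also have "\<dots> \<le> suminf zz" using zz_sums sums_summable zz_nonneg by (intro sum_le_suminf) auto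
  also have "\<dots> = Z" using zz_sums sums_unique by metis
  finally show ?thesis .
qed

lemma mu_summable: "X \<subseteq> UF \<Longrightarrow> mu \<rho> summable_on X"
  using sum_mu_le mu_nonneg
  by (intro nonneg_bdd_above_summable_on) (auto intro!: bdd_aboveI[of _ Z])

text \<open>What lies beyond the truncation weighs at most Z minus the truncated weight, whatever
  \<open>X\<close> is.\<close>

lemma infsum_mu_split:
  assumes "X \<subseteq> UF"
  shows "\<bar>infsum (mu \<rho>) X - (\<Sum>U\<in>X \<inter> UM M. mu \<rho> U)\<bar> \<le> Z - (\<Sum>U\<in>UM M. mu \<rho> U)"
proof -
  have X: "X = (X \<inter> UM M) \<union> (X - UM M)" by blast
  have s: "mu \<rho> summable_on (X - UM M)" "mu \<rho> summable_on (X \<inter> UM M)" using mu_summable assms by blast+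
  have "infsum (mu \<rho>) X = infsum (mu \<rho>) (X \<inter> UM M) + infsum (mu \<rho>) (X - UM M)"
    by (subst X) (rule infsum_Un_disjoint[OF s(2,1)], blast)
  moreover have "infsum (mu \<rho>) (X \<inter> UM M) = (\<Sum>U\<in>X \<inter> UM M. mu \<rho> U)" using finite_UM by (intro infsum_finite) auto
  moreover have "infsum (mu \<rho>) (X - UM M) \<ge> 0" by (rule infsum_nonneg) (rule mu_nonneg)
  moreover have "infsum (mu \<rho>) (X - UM M) \<le> Z - (\<Sum>U\<in>UM M. mu \<rho> U)"
  proof (rule infsum_le_finite_sums[OF s(1)])
    fix B assume B: "finite B" "B \<subseteq> X - UM M"
    have "(\<Sum>U\<in>B. mu \<rho> U) + (\<Sum>U\<in>UM M. mu \<rho> U) = (\<Sum>U\<in>B \<union> UM M. mu \<rho> U)"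
      using B finite_UM by (intro sum.union_disjoint[symmetric]) auto
    also have "\<dots> \<le> Z" using B assms finite_UM UM_subset by (intro sum_mu_le) auto
    finally show "sum (mu \<rho>) B \<le> Z - (\<Sum>U\<in>UM M. mu \<rho> U)" by linarith
  qed
  ultimately show ?thesis by linarith
qed

end

section \<open>Convergence in total variation\<close>

context frag_class
begin

lemma frag_in_UF: "G \<in> graphs_on \<A> n \<Longrightarrow> frag_C lc \<C> G \<in> UF"
  unfolding frag_C_FragV UF_eq using frag_in_forest[OF A_wf(1)] by blast

lemma frag_usize: "G \<in> graphs_on \<A> n \<Longrightarrow> usize (frag_C lc \<C> G) = card (FragV G)"
  unfolding frag_C_FragV using usize_iso_class[OF wf_frag[OF A_wf(1)]] by simp

lemma fw_rep:
  assumes U: "U \<in> UF" and G: "G \<in> graphs_on \<A> n"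
  shows "fw (rep U) G = (if frag_C lc \<C> G = U then real (aut_count (rep U)) else 0)"
proof -
  note R = UF_rep[OF U] and wfD = wf_frag[OF A_wf(1)[OF G]]
  have "frag_C lc \<C> G = U \<longleftrightarrow> isomorphic (rep U) (induced G (FragV G))"
    unfolding frag_C_FragV using iso_class_eq_iff[OF R(2) wfD] R(3) by auto
  then show ?thesis unfolding fw_def using card_isos[OF R(2) wfD] isos_empty_iff[OF R(2) wfD] by auto
qed

lemma frag_prob_avg: "frag_prob \<A> lc \<C> n S = avg n (\<lambda>G. if frag_C lc \<C> G \<in> S then 1 else 0)"
  unfolding frag_prob_def avg_def using A_fin by (simp add: sum.If_cases Int_def)

lemma pointwise:
  assumes U: "U \<in> UF"
  shows "(\<lambda>n. frag_prob \<A> lc \<C> n {U} - mu \<rho> U * avg n (fw ({}, {}))) \<longlonglongrightarrow> 0"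
proof -
  let ?a = "real (aut_count (rep U))"
  have a: "?a > 0" using aut_count_pos[OF UF_rep(2)[OF U]] by simp
  have e: "avg n (fw (rep U)) = ?a * frag_prob \<A> lc \<C> n {U}" for n
    unfolding frag_prob_avg avg_cmult[symmetric] unfolding avg_def
    using fw_rep[OF U] by (intro arg_cong2[where f = "(/)"] sum.cong) auto
  have "(\<lambda>n. (1 / ?a) * (avg n (fw (rep U)) - \<rho> ^ card (verts (rep U)) * avg n (fw ({}, {})))) \<longlonglongrightarrow> (1 / ?a) * 0"
    by (intro tendsto_intros fw_limit UF_rep(1)[OF U])
  moreover have "(1 / ?a) * (avg n (fw (rep U)) - \<rho> ^ card (verts (rep U)) * avg n (fw ({}, {}))) =
      frag_prob \<A> lc \<C> n {U} - mu \<rho> U * avg n (fw ({}, {}))" for n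
    unfolding e mu_def using a by (simp add: right_diff_distrib)
  ultimately show ?thesis by simp
qed

lemma frag_prob_finite:
  assumes "finite B" shows "frag_prob \<A> lc \<C> n B = (\<Sum>U\<in>B. frag_prob \<A> lc \<C> n {U})"
proof -
  have "(if frag_C lc \<C> G \<in> B then 1 else 0) = (\<Sum>U\<in>B. if frag_C lc \<C> G \<in> {U} then 1 else 0 :: real)" for G
    using assms by simp
  then show ?thesis unfolding frag_prob_avg avg_sum[symmetric] by simp
qed

text \<open>Markov's inequality: a fragment with more than M vertices forces n - |lc G| above M,
  while its average is at most 2.\<close>

lemma frag_tail:
  assumes n: "n > 0" and M: "M > 0"
  shows "\<bar>frag_prob \<A> lc \<C> n S - frag_prob \<A> lc \<C> n (S \<inter> UM M)\<bar> \<le> 2 / M"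
proof -
  have "frag_prob \<A> lc \<C> n S - frag_prob \<A> lc \<C> n (S \<inter> UM M) =
      avg n (\<lambda>G. (if frag_C lc \<C> G \<in> S then 1 else 0) - (if frag_C lc \<C> G \<in> S \<inter> UM M then 1 else 0))"
    unfolding frag_prob_avg avg_diff ..
  from arg_cong[OF this, of abs] have "\<bar>frag_prob \<A> lc \<C> n S - frag_prob \<A> lc \<C> n (S \<inter> UM M)\<bar> \<le>
      avg n (\<lambda>G. \<bar>(if frag_C lc \<C> G \<in> S then 1 else 0) - (if frag_C lc \<C> G \<in> S \<inter> UM M then 1 else 0)\<bar>)"
    by (simp only: avg_abs)
  also have "\<dots> \<le> avg n (\<lambda>G. (1 / M) * (real n - real (card (lc G))))"
  proof (rule avg_mono)
    fix G assume G: "G \<in> graphs_on \<A> n"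
    have l: "card (lc G) \<le> n" using lc_card_le[OF G n] .
    have vne: "verts G \<noteq> {}" using A_wf(2)[OF G] n by simp
    have sub: "lc G \<subseteq> verts G" using components_subset[OF lc_component[OF A_wf(1)[OF G] vne]] .
    have "FragV G \<subseteq> verts G - lc G" using FragV_subset FragV_lc_disjoint[OF A_wf(1)[OF G] vne] by blast
    then have "card (FragV G) \<le> card (verts G - lc G)" using wf_finite[OF A_wf(1)[OF G]] by (intro card_mono) auto
    also have "\<dots> = n - card (lc G)"
      using card_Diff_subset[OF finite_subset[OF sub wf_finite[OF A_wf(1)[OF G]]] sub] A_wf(2)[OF G] by simp
    finally have c: "real (card (FragV G)) \<le> real n - real (card (lc G))" using l by linarith
    show "\<bar>(if frag_C lc \<C> G \<in> S then 1 else 0) - (if frag_C lc \<C> G \<in> S \<inter> UM M then 1 else 0 :: real)\<bar>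
        \<le> (1 / M) * (real n - real (card (lc G)))"
    proof (cases "frag_C lc \<C> G \<in> UM M")
      case True
      then show ?thesis using l by simp
    next
      case False
      then have "card (FragV G) > M" using frag_in_UF[OF G] frag_usize[OF G] by (simp add: UM_def)
      then have "real M \<le> real n - real (card (lc G))" using c by linarith
      then have "1 \<le> (1 / M) * (real n - real (card (lc G)))" using M by (simp add: pos_le_divide_eq)
      then show ?thesis using False by (auto split: if_splits)
    qed
  qed
  also have "\<dots> = (1 / M) * avg n (\<lambda>G. real n - real (card (lc G)))" by (rule avg_cmult)
  also have "\<dots> \<le> (1 / M) * 2" using avg_deficit[OF n] by (intro mult_left_mono) auto
  finally show ?thesis by simp
qed

lemma frag_prob_UF: "an n > 0 \<Longrightarrow> frag_prob \<A> lc \<C> n UF = 1"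
proof -
  assume a: "an n > 0"
  have "{G \<in> graphs_on \<A> n. frag_C lc \<C> G \<in> UF} = graphs_on \<A> n" using frag_in_UF by blast
  then show ?thesis unfolding frag_prob_def using a by simp
qed

text \<open>Up to small tails everything happens on the finite set \<open>UM M\<close>, where the
  probabilities are close to the multiple \<open>?\<pi> n\<close> of \<mu>. Both the fragment law
  and \<mu> / Z have total mass 1, so \<open>?\<pi> n\<close> must be close to 1 / Z. None of the
  error bounds involves \<open>S\<close>, which gives uniformity.\<close>

lemma total_variation:
  assumes \<epsilon>: "\<epsilon> > 0"
  shows "\<forall>\<^sub>F n in sequentially. \<forall>S. \<bar>frag_prob \<A> lc \<C> n S - bp_prob \<C> \<rho> S\<bar> \<le> \<epsilon>"
proof -
  \<comment> \<open>The four estimates at the end cost d + d + 3d + d = 6d.\<close>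
  define d where "d = \<epsilon> / 7"
  have d: "d > 0" using \<epsilon> by (simp add: d_def)
  have Z: "Z > 0" by simp
  define ZM where "ZM M = (\<Sum>U\<in>UM M. mu \<rho> U)" for M
  have "ZM \<longlonglongrightarrow> Z" unfolding ZM_def sum_mu_UM using zz_sums by (simp add: sums_def_le)
  then have "\<forall>\<^sub>F M in sequentially. ZM M > Z - d * Z" by (rule order_tendstoD) (use d Z in simp)
  moreover have "\<forall>\<^sub>F M in sequentially. 2 / real M < d"
    using lim_const_over_n[of 2] by (rule order_tendstoD) (rule d)
  ultimately have "\<forall>\<^sub>F M in sequentially. ZM M > Z - d * Z \<and> 2 / real M < d \<and> M > 0"
    using eventually_gt_at_top[of 0] by eventually_elim auto
  then obtain M where M: "ZM M > Z - d * Z" "2 / real M < d" "M > 0" using eventually_happens' sequentially_bot by blast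
  have ZMZ: "ZM M \<le> Z" unfolding ZM_def by (rule sum_mu_le[OF finite_UM UM_subset])
  let ?\<pi> = "\<lambda>n. avg n (fw ({}, {}))"
  have "(\<lambda>n. \<Sum>U\<in>UM M. \<bar>frag_prob \<A> lc \<C> n {U} - mu \<rho> U * ?\<pi> n\<bar>) \<longlonglongrightarrow> 0"
    using pointwise UM_subset by (intro tendsto_null_sum tendsto_rabs_zero) blast
  then have "\<forall>\<^sub>F n in sequentially. (\<Sum>U\<in>UM M. \<bar>frag_prob \<A> lc \<C> n {U} - mu \<rho> U * ?\<pi> n\<bar>) < d"
    using d by (rule order_tendstoD)
  then show ?thesis using an_pos eventually_gt_at_top[of 0]
  proof eventually_elim
    case (elim n)
    define err where "err = (\<Sum>U\<in>UM M. \<bar>frag_prob \<A> lc \<C> n {U} - mu \<rho> U * ?\<pi> n\<bar>)"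
    have err: "err < d" using elim(1) by (simp add: err_def)
    have part: "\<bar>frag_prob \<A> lc \<C> n B - ?\<pi> n * (\<Sum>U\<in>B. mu \<rho> U)\<bar> \<le> err" if B: "B \<subseteq> UM M" for B
    proof -
      have fB: "finite B" using finite_subset[OF B finite_UM] .
      have "frag_prob \<A> lc \<C> n B - ?\<pi> n * (\<Sum>U\<in>B. mu \<rho> U) = (\<Sum>U\<in>B. frag_prob \<A> lc \<C> n {U} - mu \<rho> U * ?\<pi> n)"
        unfolding frag_prob_finite[OF fB] sum_subtractf sum_distrib_left by (simp only: mult.commute)
      from arg_cong[OF this, of abs] have "\<bar>frag_prob \<A> lc \<C> n B - ?\<pi> n * (\<Sum>U\<in>B. mu \<rho> U)\<bar> \<le> (\<Sum>U\<in>B. \<bar>frag_prob \<A> lc \<C> n {U} - mu \<rho> U * ?\<pi> n\<bar>)"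
        by (simp only: sum_abs)
      also have "\<dots> \<le> err" unfolding err_def using B finite_UM by (intro sum_mono2) auto
      finally show ?thesis .
    qed
    have tot: "\<bar>1 - frag_prob \<A> lc \<C> n (UM M)\<bar> \<le> d"
      using frag_tail[OF elim(3) M(3), of UF] frag_prob_UF[OF elim(2)] M(2) UM_subset[of M] by (simp add: Int_absorb1)
    have pZ: "\<bar>?\<pi> n * ZM M - 1\<bar> \<le> 2 * d" using part[of "UM M"] tot err by (simp add: ZM_def)
    have zr: "\<bar>1 - ZM M / Z\<bar> \<le> d"
    proof -
      have "ZM M / Z \<le> 1" using ZMZ Z by simp
      moreover have "1 - d \<le> ZM M / Z" using M(1) Z by (simp add: pos_le_divide_eq left_diff_distrib)
      ultimately show ?thesis by linarith
    qed
    \<comment> \<open>Multiplied by \<open>ZM M\<close>, both \<open>?\<pi> n\<close> and 1 / Z are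
      near 1, with errors 2d and d. The product form is what is needed for sets of weight at most
      \<open>ZM M\<close>.\<close>
    have pi: "\<bar>?\<pi> n - 1 / Z\<bar> * ZM M \<le> 3 * d"
    proof -
      have "ZM M \<ge> 0" unfolding ZM_def by (rule sum_nonneg) (rule mu_nonneg)
      then have "\<bar>?\<pi> n - 1 / Z\<bar> * ZM M = \<bar>(?\<pi> n - 1 / Z) * ZM M\<bar>" by (simp add: abs_mult)
      also have "(?\<pi> n - 1 / Z) * ZM M = (?\<pi> n * ZM M - 1) + (1 - ZM M / Z)" by (simp add: left_diff_distrib)
      finally show ?thesis using pZ zr by linarith
    qed
    show ?case
    proof
      fix S
      let ?B = "S \<inter> UM M"
      define m where "m = (\<Sum>U\<in>?B. mu \<rho> U)"
      have m: "0 \<le> m" "m \<le> ZM M" unfolding m_def ZM_def using mu_nonneg finite_UM by (auto intro: sum_nonneg sum_mono2)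
      have 1: "\<bar>frag_prob \<A> lc \<C> n S - frag_prob \<A> lc \<C> n ?B\<bar> \<le> d" using frag_tail[OF elim(3) M(3), of S] M(2) by linarith
      have 2: "\<bar>frag_prob \<A> lc \<C> n ?B - ?\<pi> n * m\<bar> \<le> d" using part[of ?B] err by (simp add: m_def)
      have 3: "\<bar>?\<pi> n * m - m / Z\<bar> \<le> 3 * d"
      proof -
        have "?\<pi> n * m - m / Z = (?\<pi> n - 1 / Z) * m" by (simp add: left_diff_distrib)
        then have "\<bar>?\<pi> n * m - m / Z\<bar> = \<bar>?\<pi> n - 1 / Z\<bar> * m" using m by (simp add: abs_mult)
        also have "\<dots> \<le> \<bar>?\<pi> n - 1 / Z\<bar> * ZM M" using m by (intro mult_left_mono) auto
        finally show ?thesis using pi by linarith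
      qed
      have 4: "\<bar>bp_prob \<C> \<rho> S - m / Z\<bar> \<le> d"
      proof -
        have b: "bp_prob \<C> \<rho> S = infsum (mu \<rho>) (S \<inter> UF) / Z"
          unfolding bp_prob_def egf_cc exp_minus by (simp add: divide_inverse mult.commute)
        have i: "S \<inter> UF \<inter> UM M = ?B" using UM_subset by blast
        have "\<bar>infsum (mu \<rho>) (S \<inter> UF) - m\<bar> \<le> Z - ZM M"
          using infsum_mu_split[of "S \<inter> UF" M] unfolding i m_def ZM_def by simp
        then have "\<bar>infsum (mu \<rho>) (S \<inter> UF) - m\<bar> \<le> d * Z" using M(1) by linarith
        moreover have "\<bar>infsum (mu \<rho>) (S \<inter> UF) / Z - m / Z\<bar> = \<bar>infsum (mu \<rho>) (S \<inter> UF) - m\<bar> / Z"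
          by (simp add: diff_divide_distrib[symmetric] abs_divide)
        ultimately show ?thesis unfolding b using Z by (simp add: pos_divide_le_eq)
      qed
      show "\<bar>frag_prob \<A> lc \<C> n S - bp_prob \<C> \<rho> S\<bar> \<le> \<epsilon>"
        using 1 2 3 4 d unfolding d_def by linarith
    qed
  qed
qed

lemma egf_pos:
  assumes "\<C> \<noteq> {}" shows "0 < egf \<C> \<rho>"
proof -
  obtain H where H: "H \<in> \<C>" using assms by blast
  \<comment> \<open>The summand of \<open>egf\<close> with index n belongs to the graphs on n + 1
    vertices.\<close>
  define n where "n = card (verts H) - 1"
  have n: "card (verts H) = Suc n" using C_card_pos[OF H] by (simp add: n_def)
  have "H \<in> {G \<in> \<C>. verts G = verts H}" using H by simp
  moreover have "finite {G \<in> \<C>. verts G = verts H}"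
    by (rule finite_class_verts[OF C wf_finite[OF C_wf[OF H]]])
  ultimately have "card {G \<in> \<C>. verts G = verts H} > 0" unfolding card_gt_0_iff by blast
  then have "card (graphs_on \<C> (Suc n)) > 0" using card_class_verts[OF C wf_finite[OF C_wf[OF H]]] n by simp
  then have "real (card (graphs_on \<C> (Suc n))) * \<rho> ^ Suc n / fact (Suc n) > 0" using rho_pos by simp
  then have pos: "0 < ennreal (real (card (graphs_on \<C> (Suc n))) * \<rho> ^ Suc n / fact (Suc n))" by (simp only: ennreal_less_zero_iff)
  have "ennreal (real (card (graphs_on \<C> (Suc n))) * \<rho> ^ Suc n / fact (Suc n)) \<le> egf \<C> \<rho>"
    unfolding egf_def using sum_le_suminf[OF summableI, of "{n}" "\<lambda>n. ennreal (real (card (graphs_on \<C> (Suc n))) * \<rho> ^ Suc n / fact (Suc n))"] by simp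
  then show ?thesis using pos by (rule less_le_trans[rotated])
qed

end

theorem theorem1p4:
  fixes \<A> \<C> :: "graph set" and \<gamma> :: real and lc :: "graph \<Rightarrow> nat set"
  assumes "graph_class \<A>" and "bridge_addable \<A>" and "has_growth_constant \<A> \<gamma>"
    and "graph_class \<C>" and "\<C> \<noteq> {}" and "\<forall>H\<in>\<C>. connected_graph H"
    and "\<forall>H\<in>\<C>. bridge_deletable H \<A>"
    and "\<forall>H\<in>\<C>. weakly_attachable H \<A>"
    and "\<forall>H\<in>\<C>. weakly_detachable H \<A>"
    and "is_largest_component_choice lc"
  shows "0 < egf \<C> (1 / \<gamma>) \<and> egf \<C> (1 / \<gamma>) \<le> 1 / 2 \<and>
    (\<forall>\<epsilon>>0. \<forall>\<^sub>F n in sequentially. \<forall>S.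
        \<bar>frag_prob \<A> lc \<C> n S - bp_prob \<C> (1 / \<gamma>) S\<bar> \<le> \<epsilon>)"
proof -
  interpret frag_class \<A> \<gamma> \<C> lc by unfold_locales (use assms in auto)
  show ?thesis using egf_pos[OF assms(5)] egf_real(1) total_variation unfolding \<rho>_def by blast
qed

end
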